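(* Let $\mathcal{H}_A$ and $\mathcal{H}_B$ be finite-dimensional Hilbert spaces, $d_A=\dim\mathcal{H}_A$, and let $\mathcal{T}_{A\rightarrow B}$ be a completely positive trace-preserving map from operators on $\mathcal{H}_A$ to operators on $\mathcal{H}_B$. Let $A'$ be a copy of $A$, let $|\Psi\rangle_{A'A}=\frac{1}{\sqrt{d_A}}\sum_{i=1}^{d_A}|i\rangle_{A}\otimes|i\rangle_{A'}$, and let $\tau_{A'B}=(\mathcal{I}_{A'}\otimes\mathcal{T}_{A\rightarrow B})(|\Psi\rangle\langle\Psi|_{A'A})$ be the Choi–Jamiołkowski state of the channel. Let $\pi_A=\mathbb{I}_A/d_A$. Then for $\varepsilon>0$: (i) $\left\langle\left\|\mathcal{T}_{A\rightarrow B}(|\phi\rangle\langle\phi|_A)-\mathcal{T}_{A\rightarrow B}(\pi_A)\right\|_1\right\rangle_{|\phi\rangle_A} \leq 2^{-\frac{1}{2}{\rm H}_{\min}^{\varepsilon}(A'|B)_\tau}+O(\varepsilon)$, where $\langle\cdot\rangle_{|\phi\rangle_A}$ denotes the average over pure states $|\phi\rangle_A$ drawn from the uniform (Haar) measure on the unit sphere of $\mathcal{H}_A$; (ii) for every $\delta>0$, $\Pr_{|\phi\rangle_A}\left\{\left\|\mathcal{T}_{A\rightarrow B}(|\phi\rangle\langle\phi|_A)-\mathcal{T}_{A\rightarrow B}(\pi_A)\right\|_1\geq 2^{-\frac{1}{2}{\rm H}_{\min}^{\varepsilon}(A'|B)_\tau}+O(\varepsilon)+\delta\right\}\leq 2e^{-d_A\delta^2/16}$,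 where the probability is over $|\phi\rangle_A$ drawn from the Haar measure; (iii) conversely, for $\varepsilon,\delta>0$ with $\sqrt{2\delta}+4\varepsilon<1$, if ${\rm H}_{\max}^{\varepsilon}(A'B)_\tau+\log\frac{1}{1-(\sqrt{2\delta}+4\varepsilon)^2}+\log\frac{2}{\varepsilon^2}<{\rm H}_{\min}^{\varepsilon}(B)_\tau$, then there is no density operator $\omega_B$ on $\mathcal{H}_B$ such that $\left\langle\left\|\mathcal{T}_{A\rightarrow B}(|\phi\rangle\langle\phi|_A)-\omega_B\right\|_1\right\rangle_{|\phi\rangle_A}\leq\frac{\delta}{2}$.
   Context: $\log$ is the binary logarithm and $\|X\|_1=\mathrm{tr}\sqrt{X^\dagger X}$. The term $O(\varepsilon)$ denotes a quantity bounded by a universal constant times $\varepsilon$ (independent of the channel and the dimensions). For a (possibly subnormalized) positive operator $\rho_{AB}$ with trace at most 1: ${\rm H}_{\min}(A|B)_\rho=\sup_{\sigma_B}\sup\{\lambda\in\mathbb{R}: 2^{-\lambda}\mathbb{I}_A\otimes\sigma_B\geq\rho_{AB}\}$ and ${\rm H}_{\max}(A|B)_\rho=\sup_{\sigma_B}\log\left[F(\rho_{AB},\mathbb{I}_A\otimes\sigma_B)\right]^2$, where the suprema are over density operators $\sigma_B$ on $\mathcal{H}_B$ and $F(\rho,\sigma)=\|\sqrt{\rho}\sqrt{\sigma}\|_1$. Unconditional entropies ${\rm H}_{\min}(A)$, ${\rm H}_{\max}(A)$ are the conditional ones with trivial $B$. The purified distance between subnormalized states is $P(\rho,\sigma)=\sqrt{1-\bar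 F(\rho,\sigma)^2}$ with $\bar F(\rho,\sigma)=\|\sqrt\rho\sqrt\sigma\|_1+\sqrt{(1-\mathrm{tr}\rho)(1-\mathrm{tr}\sigma)}$. The smooth entropies are ${\rm H}_{\min}^{\varepsilon}(A|B)_\rho=\sup\{{\rm H}_{\min}(A|B)_\sigma: \sigma_{AB}\geq0,\ \mathrm{tr}\,\sigma_{AB}\leq1,\ P(\rho_{AB},\sigma_{AB})\leq\varepsilon\}$ and ${\rm H}_{\max}^{\varepsilon}(A|B)_\rho=\inf\{{\rm H}_{\max}(A|B)_\sigma: \sigma_{AB}\geq0,\ \mathrm{tr}\,\sigma_{AB}\leq1,\ P(\rho_{AB},\sigma_{AB})\leq\varepsilon\}$. Entropies of subsystems of $\tau_{A'B}$ are evaluated on the corresponding reduced states. *)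

theory Defs
  imports "HOL-Probability.Probability" "Jordan_Normal_Form.Matrix"
begin

definition adj :: "complex mat \<Rightarrow> complex mat" where
  "adj M = Matrix.mat (dim_col M) (dim_row M) (\<lambda>(i,j). cnj (M $$ (j,i)))"

definition tr :: "complex mat \<Rightarrow> complex" where
  "tr M = (\<Sum>i<dim_row M. M $$ (i,i))"

definition psd :: "nat \<Rightarrow> complex mat \<Rightarrow> bool" where
  "psd n M \<longleftrightarrow> M \<in> carrier_mat n n \<and>
     (\<forall>v :: nat \<Rightarrow> complex. let q = (\<Sum>i<n. \<Sum>j<n. cnj (v i) * M $$ (i,j) * v j)
                                 in Im q = 0 \<and> Re q \<ge> 0)"

definition loewner_ge :: "nat \<Rightarrow> complex mat \<Rightarrow> complex mat \<Rightarrow> bool" where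
  "loewner_ge n X Y \<longleftrightarrow> X \<in> carrier_mat n n \<and> Y \<in> carrier_mat n n \<and> psd n (X - Y)"

definition density :: "nat \<Rightarrow> complex mat \<Rightarrow> bool" where
  "density n \<rho> \<longleftrightarrow> psd n \<rho> \<and> tr \<rho> = 1"

definition subnormalized :: "nat \<Rightarrow> complex mat \<Rightarrow> bool" where
  "subnormalized n \<rho> \<longleftrightarrow> psd n \<rho> \<and> Re (tr \<rho>) \<le> 1"

definition msqrt :: "nat \<Rightarrow> complex mat \<Rightarrow> complex mat" where
  "msqrt n M = (THE S. psd n S \<and> S * S = M)"

definition tnorm :: "complex mat \<Rightarrow> real" where
  "tnorm X = Re (tr (msqrt (dim_col X) (adj X * X)))"

definition fid :: "complex mat \<Rightarrow> complex mat \<Rightarrow> real" where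
  "fid \<rho> \<sigma> = tnorm (msqrt (dim_row \<rho>) \<rho> * msqrt (dim_row \<sigma>) \<sigma>)"

definition gen_fid :: "complex mat \<Rightarrow> complex mat \<Rightarrow> real" where
  "gen_fid \<rho> \<sigma> = fid \<rho> \<sigma> + sqrt ((1 - Re (tr \<rho>)) * (1 - Re (tr \<sigma>)))"

definition pdist :: "complex mat \<Rightarrow> complex mat \<Rightarrow> real" where
  "pdist \<rho> \<sigma> = sqrt (1 - (gen_fid \<rho> \<sigma>)\<^sup>2)"

section \<open>Tensor products and partial traces (index (a,i) of A (x) B is a * dim B + i)\<close>

definition kron :: "complex mat \<Rightarrow> complex mat \<Rightarrow> complex mat" where
  "kron A B = Matrix.mat (dim_row A * dim_row B) (dim_col A * dim_col B)
     (\<lambda>(i,j). A $$ (i div dim_row B, j div dim_col B) * B $$ (i mod dim_row B, j mod dim_col B))"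

definition ptr1 :: "nat \<Rightarrow> nat \<Rightarrow> complex mat \<Rightarrow> complex mat" where
  "ptr1 dA dB M = Matrix.mat dB dB (\<lambda>(i,j). \<Sum>a<dA. M $$ (a*dB + i, a*dB + j))"

definition block :: "nat \<Rightarrow> complex mat \<Rightarrow> nat \<Rightarrow> nat \<Rightarrow> complex mat" where
  "block d M a b = Matrix.mat d d (\<lambda>(k,l). M $$ (a*d + k, b*d + l))"

definition id_tensor :: "nat \<Rightarrow> nat \<Rightarrow> nat \<Rightarrow> (complex mat \<Rightarrow> complex mat) \<Rightarrow> complex mat \<Rightarrow> complex mat" where
  "id_tensor n dA dB T M = Matrix.mat (n*dB) (n*dB)
     (\<lambda>(i,j). T (block dA M (i div dB) (j div dB)) $$ (i mod dB, j mod dB))"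

definition cptp :: "nat \<Rightarrow> nat \<Rightarrow> (complex mat \<Rightarrow> complex mat) \<Rightarrow> bool" where
  "cptp dA dB T \<longleftrightarrow>
     (\<forall>X \<in> carrier_mat dA dA. T X \<in> carrier_mat dB dB) \<and>
     (\<forall>X \<in> carrier_mat dA dA. \<forall>Y \<in> carrier_mat dA dA. \<forall>a b :: complex.
        T (a \<cdot>\<^sub>m X + b \<cdot>\<^sub>m Y) = a \<cdot>\<^sub>m T X + b \<cdot>\<^sub>m T Y) \<and>
     (\<forall>X \<in> carrier_mat dA dA. tr (T X) = tr X) \<and>
     (\<forall>n M. psd (n*dA) M \<longrightarrow> psd (n*dB) (id_tensor n dA dB T M))"

definition max_ent :: "nat \<Rightarrow> complex mat" where
  "max_ent dA = Matrix.mat (dA*dA) (dA*dA)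
     (\<lambda>(p,q). if p div dA = p mod dA \<and> q div dA = q mod dA then complex_of_real (1 / real dA) else 0)"

definition choi :: "nat \<Rightarrow> nat \<Rightarrow> (complex mat \<Rightarrow> complex mat) \<Rightarrow> complex mat" where
  "choi dA dB T = id_tensor dA dA dB T (max_ent dA)"

definition max_mixed :: "nat \<Rightarrow> complex mat" where
  "max_mixed d = complex_of_real (1 / real d) \<cdot>\<^sub>m 1\<^sub>m d"

definition Hmin_c :: "nat \<Rightarrow> nat \<Rightarrow> complex mat \<Rightarrow> ereal" where
  "Hmin_c dA dB \<rho> = (SUP \<sigma> \<in> {\<sigma>. density dB \<sigma>}.
      Sup {ereal l | l. loewner_ge (dA*dB) (complex_of_real (2 powr (-l)) \<cdot>\<^sub>m kron (1\<^sub>m dA) \<sigma>) \<rho>})"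

definition Hmax_c :: "nat \<Rightarrow> nat \<Rightarrow> complex mat \<Rightarrow> ereal" where
  "Hmax_c dA dB \<rho> = (SUP \<sigma> \<in> {\<sigma>. density dB \<sigma>}.
      (let F = fid \<rho> (kron (1\<^sub>m dA) \<sigma>) in if F = 0 then -\<infinity> else ereal (log 2 (F\<^sup>2))))"

definition Hmin_s :: "real \<Rightarrow> nat \<Rightarrow> nat \<Rightarrow> complex mat \<Rightarrow> ereal" where
  "Hmin_s \<epsilon> dA dB \<rho> = (SUP \<sigma> \<in> {\<sigma>. subnormalized (dA*dB) \<sigma> \<and> pdist \<rho> \<sigma> \<le> \<epsilon>}. Hmin_c dA dB \<sigma>)"

definition Hmax_s :: "real \<Rightarrow> nat \<Rightarrow> nat \<Rightarrow> complex mat \<Rightarrow> ereal" where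
  "Hmax_s \<epsilon> dA dB \<rho> = (INF \<sigma> \<in> {\<sigma>. subnormalized (dA*dB) \<sigma> \<and> pdist \<rho> \<sigma> \<le> \<epsilon>}. Hmax_c dA dB \<sigma>)"

text \<open>Unconditional smooth entropies: trivial conditioning system (dimension 1).\<close>
definition Hmin_s1 :: "real \<Rightarrow> nat \<Rightarrow> complex mat \<Rightarrow> ereal" where
  "Hmin_s1 \<epsilon> d \<rho> = Hmin_s \<epsilon> d 1 \<rho>"

definition Hmax_s1 :: "real \<Rightarrow> nat \<Rightarrow> complex mat \<Rightarrow> ereal" where
  "Hmax_s1 \<epsilon> d \<rho> = Hmax_s \<epsilon> d 1 \<rho>"

definition pow2_neg_half :: "ereal \<Rightarrow> ereal" where
  "pow2_neg_half x = (if x = \<infinity> then 0 else if x = -\<infinity> then \<infinity>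
                      else ereal (2 powr (- real_of_ereal x / 2)))"

text \<open>Vectors of C^d are represented as functions nat => complex vanishing from index d on.\<close>
definition unit_sphere_c :: "nat \<Rightarrow> (nat \<Rightarrow> complex) set" where
  "unit_sphere_c d = {v. (\<forall>i\<ge>d. v i = 0) \<and> (\<Sum>i<d. (cmod (v i))\<^sup>2) = 1}"

definition proj :: "nat \<Rightarrow> (nat \<Rightarrow> complex) \<Rightarrow> complex mat" where
  "proj d v = Matrix.mat d d (\<lambda>(i,j). v i * cnj (v j))"

definition unitary :: "nat \<Rightarrow> complex mat \<Rightarrow> bool" where
  "unitary d U \<longleftrightarrow> U \<in> carrier_mat d d \<and> adj U * U = 1\<^sub>m d"

definition apply_mat :: "complex mat \<Rightarrow> (nat \<Rightarrow> complex) \<Rightarrow> nat \<Rightarrow> complex" where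
  "apply_mat U v = (\<lambda>i. if i < dim_row U then (\<Sum>j<dim_col U. U $$ (i,j) * v j) else 0)"

definition haar_sphere :: "nat \<Rightarrow> (nat \<Rightarrow> complex) measure \<Rightarrow> bool" where
  "haar_sphere d \<mu> \<longleftrightarrow> prob_space \<mu> \<and> sets \<mu> = sets borel \<and>
     emeasure \<mu> (unit_sphere_c d) = 1 \<and>
     (\<forall>U. unitary d U \<longrightarrow> distr \<mu> borel (apply_mat U) = \<mu>)"

end

theory Submission
  imports Defs
begin

text \<open>
  The Choi state \<open>\<tau>\<close> of the channel is written as a Gram matrix \<open>A A*\<close>, so that the outputs are
  Gram matrices of vectors depending linearly on the input.

  Average: if \<open>\<tau> \<le> \<kappa> (I \<otimes> \<sigma>)\<close>, the duality of the trace norm and Cauchy-Schwarz with weight \<open>\<sigma>\<close> bound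
  the mean deviation by second moments, which are quadratic forms with explicit variance under the Haar
  measure. A nearby \<open>\<tau>'\<close> satisfying such a bound is replaced by a part \<open>B B* \<le> \<tau>'\<close> with \<open>B\<close> close to
  \<open>\<surd>\<tau>\<close> in Frobenius norm, at a cost linear in \<open>\<epsilon>\<close>.

  Concentration: the deviation is 2-Lipschitz and, after centring, bounded by 1, so that its homogeneous
  extension is \<open>\<surd>5\<close>-Lipschitz on the whole space. Maurey's property (tau) gives sub-Gaussian exponential
  moments for a Gaussian vector. They pass to an arbitrary unitarily invariant measure because, multiplied
  by an independent Gaussian radius, it has the exponential transform of the Gaussian vector.

  Converse: cutting off the small eigenvalues of a state near \<open>\<tau>\<close> leaves a Choi operator of low rank, so the
  output of some fixed input lives almost entirely on a low-dimensional subspace. The average output is close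
  to it, but its smooth min-entropy forbids so much weight on so few dimensions.
\<close>

section \<open>Spectral theory of positive matrices\<close>

text \<open>Three obstacles shape the development. \<open>haar_sphere\<close> fixes the measure only
  through its invariance and its mass on the sphere, so moments have to come from special unitaries
  (phases, Hadamard rotations, Householder reflections); concentration takes a Gaussian detour
  because exponential transforms are what invariance determines. The weight \<sigma> may be singular
  and the suprema in the entropies are never assumed attained, so estimates are proved for each
  admissible \<open>l\<close> and \<sigma> and then passed to the supremum. Products of norms are
  bounded by \<open>(c * a + b / c) / 2\<close>, which integrates termwise and leaves
  \<open>c\<close> to be chosen after averaging.

  On the constants: the factor 6 of \<epsilon> is 3 + 3, from replacing the state in the output and
  in its mean. The exponent 16 arises from \<open>5 = 1\<^sup>2 + 2\<^sup>2\<close>, the bound and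
  the Lipschitz constant of the centred deviation, against a mean Gaussian radius of square at least
  \<open>5 * d / 4\<close>. In the converse the errors total
  \<open>16 * \<epsilon>\<^sup>2 + 2 * \<delta>\<close>, just below the square of
  \<open>sqrt (2 * \<delta>) + 4 * \<epsilon>\<close>.\<close>

definition ip :: "nat \<Rightarrow> (nat \<Rightarrow> complex) \<Rightarrow> (nat \<Rightarrow> complex) \<Rightarrow> complex" where
  "ip n x y = (\<Sum>i<n. cnj (x i) * y i)"

definition nsq :: "nat \<Rightarrow> (nat \<Rightarrow> complex) \<Rightarrow> real" where
  "nsq n x = (\<Sum>i<n. (cmod (x i))\<^sup>2)"

text \<open>Matrices enter as functions of two indices, cut off at \<open>n\<close> by the sum, so
  that entries of a \<open>complex mat\<close>, explicit kernels and Gram expressions are treated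
  alike.\<close>

definition mv :: "nat \<Rightarrow> (nat \<Rightarrow> nat \<Rightarrow> complex) \<Rightarrow> (nat \<Rightarrow> complex) \<Rightarrow> nat \<Rightarrow> complex" where
  "mv n M x i = (\<Sum>j<n. M i j * x j)"

definition orthonormal :: "nat \<Rightarrow> nat \<Rightarrow> (nat \<Rightarrow> nat \<Rightarrow> complex) \<Rightarrow> bool" where
  "orthonormal n k v \<longleftrightarrow> (\<forall>a<k. \<forall>b<k. ip n (v a) (v b) = (if a = b then 1 else 0))"

lemma nsq_nonneg [simp]: "nsq n x \<ge> 0"
  by (simp add: nsq_def sum_nonneg)

lemma ip_self: "ip n x x = of_real (nsq n x)"
  by (simp add: ip_def nsq_def complex_norm_square mult.commute del: of_real_power)

lemma cnj_ip: "cnj (ip n x y) = ip n y x"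
  by (simp add: ip_def cnj_sum mult.commute)

lemma ip_add_right: "ip n x (\<lambda>i. y i + z i) = ip n x y + ip n x z"
  by (simp add: ip_def algebra_simps sum.distrib)

lemma ip_diff_right: "ip n x (\<lambda>i. y i - z i) = ip n x y - ip n x z"
  by (simp add: ip_def algebra_simps sum_subtractf)

lemma ip_scale_right: "ip n x (\<lambda>i. c * y i) = c * ip n x y"
  by (simp add: ip_def sum_distrib_left algebra_simps)

lemma ip_add_left: "ip n (\<lambda>i. y i + z i) x = ip n y x + ip n z x"
  by (simp add: ip_def algebra_simps sum.distrib)

lemma ip_diff_left: "ip n (\<lambda>i. y i - z i) x = ip n y x - ip n z x"
  by (simp add: ip_def algebra_simps sum_subtractf)

lemma ip_scale_left: "ip n (\<lambda>i. c * y i) x = cnj c * ip n y x"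
  by (simp add: ip_def sum_distrib_left algebra_simps)

lemma ip_sum_right: "ip n x (\<lambda>i. \<Sum>k\<in>A. f k i) = (\<Sum>k\<in>A. ip n x (f k))"
  unfolding ip_def by (simp add: sum_distrib_left) (rule sum.swap)

lemma ip_sum_left: "ip n (\<lambda>i. \<Sum>k\<in>A. f k i) x = (\<Sum>k\<in>A. ip n (f k) x)"
  unfolding ip_def by (simp add: sum_distrib_right) (rule sum.swap)

lemma nsq_eq_Re_ip: "nsq n x = Re (ip n x x)"
  by (simp add: ip_self)

lemma nsq_eq_0_iff: "nsq n x = 0 \<longleftrightarrow> (\<forall>i<n. x i = 0)"
  by (auto simp: nsq_def sum_nonneg_eq_0_iff)

lemma ip_unit_right: "j < n \<Longrightarrow> ip n x (\<lambda>i. if i = j then 1 else 0) = cnj (x j)"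
  by (simp add: ip_def if_distrib [where f = "\<lambda>t. _ * t"] cong: if_cong)

lemma nsq_unit: "j < n \<Longrightarrow> nsq n (\<lambda>i. if i = j then 1 else 0) = 1"
proof -
  assume "j < n"
  have "nsq n (\<lambda>i. if i = j then 1 else 0) = (\<Sum>i<n. if i = j then 1 else 0)"
    unfolding nsq_def by (intro sum.cong) auto
  then show ?thesis using \<open>j < n\<close> by simp
qed

text \<open>The condition is weaker than orthonormality: vectors orthogonal to \<open>x\<close> may
  have any length. This admits families with zero vectors, such as the normalised images in
  \<open>tnorm_attained\<close>.\<close>

lemma nsq_sub_proj_gen:
  fixes k :: nat
  assumes "\<And>a b. a < k \<Longrightarrow> b < k \<Longrightarrow> ip n (v b) x * ip n (v a) (v b) = (if a = b then ip n (v b) x else 0)"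
  shows "nsq n (\<lambda>i. x i - (\<Sum>a<k. ip n (v a) x * v a i)) = nsq n x - (\<Sum>a<k. (cmod (ip n (v a) x))\<^sup>2)"
proof -
  let ?p = "\<lambda>i. \<Sum>a<k. ip n (v a) x * v a i"
  have px: "ip n ?p x = (\<Sum>a<k. cnj (ip n (v a) x) * ip n (v a) x)"
    by (simp add: ip_sum_left ip_scale_left)
  then have px': "ip n ?p x = of_real (\<Sum>a<k. (cmod (ip n (v a) x))\<^sup>2)"
    by (simp add: complex_norm_square mult.commute del: of_real_power)
  have "ip n ?p ?p = (\<Sum>a<k. cnj (ip n (v a) x) * (\<Sum>b<k. ip n (v b) x * ip n (v a) (v b)))"
    by (simp add: ip_sum_left ip_scale_left ip_sum_right ip_scale_right)
  also have "\<dots> = (\<Sum>a<k. cnj (ip n (v a) x) * ip n (v a) x)"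
  proof (rule sum.cong[OF refl])
    fix a assume a: "a \<in> {..<k}"
    have "(\<Sum>b<k. ip n (v b) x * ip n (v a) (v b)) = (\<Sum>b<k. if b = a then ip n (v b) x else 0)"
      by (rule sum.cong) (use assms a in auto)
    also have "\<dots> = ip n (v a) x" using a by simp
    finally show "cnj (ip n (v a) x) * (\<Sum>b<k. ip n (v b) x * ip n (v a) (v b)) = cnj (ip n (v a) x) * ip n (v a) x"
      by simp
  qed
  finally have pp: "ip n ?p ?p = ip n ?p x" using px by simp
  have xp: "ip n x ?p = of_real (\<Sum>a<k. (cmod (ip n (v a) x))\<^sup>2)"
    using cnj_ip[of n ?p x] px' by simp
  have "ip n (\<lambda>i. x i - ?p i) (\<lambda>i. x i - ?p i) = ip n x x - of_real (\<Sum>a<k. (cmod (ip n (v a) x))\<^sup>2)"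
    by (simp only: ip_diff_left ip_diff_right pp xp px') simp
  then show ?thesis by (simp add: nsq_eq_Re_ip del: of_real_sum)
qed

lemma nsq_sub_proj:
  assumes "orthonormal n k v"
  shows "nsq n (\<lambda>i. x i - (\<Sum>a<k. ip n (v a) x * v a i)) = nsq n x - (\<Sum>a<k. (cmod (ip n (v a) x))\<^sup>2)"
  using assms by (intro nsq_sub_proj_gen) (simp add: orthonormal_def)

lemma bessel:
  assumes "orthonormal n k v"
  shows "(\<Sum>a<k. (cmod (ip n (v a) x))\<^sup>2) \<le> nsq n x"
  using nsq_sub_proj[OF assms, of x] nsq_nonneg[of n "\<lambda>i. x i - (\<Sum>a<k. ip n (v a) x * v a i)"] by linarith

lemma ip_sub_proj:
  assumes "orthonormal n k v" "b < k"
  shows "ip n (v b) (\<lambda>i. x i - (\<Sum>a<k. ip n (v a) x * v a i)) = 0"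
proof -
  have "ip n (v b) (\<lambda>i. \<Sum>a<k. ip n (v a) x * v a i) = (\<Sum>a<k. ip n (v a) x * ip n (v b) (v a))"
    by (simp add: ip_sum_right ip_scale_right)
  also have "\<dots> = (\<Sum>a<k. if b = a then ip n (v a) x else 0)"
    using assms unfolding orthonormal_def by (intro sum.cong) auto
  also have "\<dots> = ip n (v b) x" using assms by simp
  finally show ?thesis by (simp add: ip_diff_right)
qed

text \<open>Counting dimensions through the traces of the two sides of Bessel's inequality.\<close>
lemma sum_unit_bessel:
  assumes "orthonormal n k v"
  shows "(\<Sum>j<n. \<Sum>a<k. (cmod (v a j))\<^sup>2) = real k"
proof -
  have "(\<Sum>j<n. \<Sum>a<k. (cmod (v a j))\<^sup>2) = (\<Sum>a<k. nsq n (v a))"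
    unfolding nsq_def by (rule sum.swap)
  also have "\<dots> = (\<Sum>a<k. 1)"
    using assms unfolding orthonormal_def by (intro sum.cong) (auto simp: nsq_eq_Re_ip)
  finally show ?thesis by simp
qed

text \<open>The residuals of the \<open>n\<close> basis vectors have total squared norm
  \<open>n - n = 0\<close>, so Bessel's inequality is an equality for each of them.\<close>

lemma orthonormal_complete:
  assumes "orthonormal n n v" "i < n" "j < n"
  shows "(\<Sum>k<n. v k i * cnj (v k j)) = (if i = j then 1 else 0)"
proof -
  let ?r = "\<lambda>j i. (if i = j then 1 else 0) - (\<Sum>a<n. cnj (v a j) * v a i)"
  have r: "nsq n (?r j) = 1 - (\<Sum>a<n. (cmod (v a j))\<^sup>2)" if "j < n" for j
    using nsq_sub_proj[OF assms(1), of "\<lambda>i. if i = j then 1 else 0"] that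
    by (simp add: ip_unit_right nsq_unit)
  have "(\<Sum>j<n. nsq n (?r j)) = (\<Sum>j<n. 1 - (\<Sum>a<n. (cmod (v a j))\<^sup>2))"
    using r by simp
  also have "\<dots> = 0" using sum_unit_bessel[OF assms(1)] by (simp add: sum_subtractf)
  finally have "nsq n (?r j) = 0" using assms(3) by (simp add: sum_nonneg_eq_0_iff)
  then show ?thesis using assms(2) by (auto simp: nsq_eq_0_iff mult.commute split: if_splits)
qed

text \<open>Here the residuals total \<open>n - k > 0\<close>, so that of some basis vector is
  nonzero.\<close>

lemma exists_orthogonal:
  assumes "orthonormal n k v" "k < n"
  obtains x where "nsq n x > 0" "\<And>a. a < k \<Longrightarrow> ip n (v a) x = 0"
proof -
  let ?r = "\<lambda>j i. (if i = j then 1 else 0) - (\<Sum>a<k. cnj (v a j) * v a i)"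
  have r: "nsq n (?r j) = 1 - (\<Sum>a<k. (cmod (v a j))\<^sup>2)" if "j < n" for j
    using nsq_sub_proj[OF assms(1), of "\<lambda>i. if i = j then 1 else 0"] that
    by (simp add: ip_unit_right nsq_unit)
  have "(\<Sum>j<n. nsq n (?r j)) = (\<Sum>j<n. 1 - (\<Sum>a<k. (cmod (v a j))\<^sup>2))"
    using r by simp
  also have "\<dots> = real n - real k" using sum_unit_bessel[OF assms(1)] by (simp add: sum_subtractf)
  finally have "(\<Sum>j<n. nsq n (?r j)) > 0" using assms(2) by simp
  then have "\<exists>j\<in>{..<n}. nsq n (?r j) > 0"
    by (rule contrapos_pp) (auto simp: not_less intro!: sum_nonpos)
  then obtain j where j: "j < n" "nsq n (?r j) > 0" by blast
  have "ip n (v a) (?r j) = 0" if "a < k" for a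
    using ip_sub_proj[OF assms(1) that, of "\<lambda>i. if i = j then 1 else 0"] j
    by (simp add: ip_unit_right)
  with j that show ?thesis by blast
qed

section \<open>Topology of vectors with finitely many coordinates\<close>

lemma continuous_on_ip [continuous_intros]:
  fixes f :: "'a::topological_space \<Rightarrow> nat \<Rightarrow> complex"
  assumes "continuous_on S f" "continuous_on S g"
  shows "continuous_on S (\<lambda>x. ip n (f x) (g x))"
proof -
  have "continuous_on S (\<lambda>x. f x i)" "continuous_on S (\<lambda>x. g x i)" for i
    using assms by (auto intro: continuous_on_product_then_coordinatewise)
  then show ?thesis unfolding ip_def by (intro continuous_intros)
qed

lemma continuous_on_nsq [continuous_intros]:
  fixes f :: "'a::topological_space \<Rightarrow> nat \<Rightarrow> complex"
  assumes "continuous_on S f"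
  shows "continuous_on S (\<lambda>x. nsq n (f x))"
proof -
  have "continuous_on S (\<lambda>x. f x i)" for i
    using assms by (auto intro: continuous_on_product_then_coordinatewise)
  then show ?thesis unfolding nsq_def by (intro continuous_intros)
qed

lemma continuous_on_mv [continuous_intros]:
  fixes f :: "'a::topological_space \<Rightarrow> nat \<Rightarrow> complex"
  assumes "continuous_on S f"
  shows "continuous_on S (\<lambda>x. mv n M (f x))"
proof (rule continuous_on_coordinatewise_then_product)
  have "continuous_on S (\<lambda>x. f x i)" for i
    using assms by (auto intro: continuous_on_product_then_coordinatewise)
  then show "continuous_on S (\<lambda>x. mv n M (f x) i)" for i unfolding mv_def by (intro continuous_intros)
qed

lemma compact_box: "compact (PiE UNIV (\<lambda>i::nat. if i < n then cball (0::complex) 1 else {0}))"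
proof -
  have "compactin (product_topology (\<lambda>i. euclidean) UNIV)
     (PiE UNIV (\<lambda>i::nat. if i < n then cball (0::complex) 1 else {0}))"
    by (subst compactin_PiE) auto
  then show ?thesis by (simp add: euclidean_product_topology)
qed

text \<open>Vectors are functions on all of \<open>nat\<close> under the product topology, so
  compactness is Tychonoff's theorem for a box whose factors are \<open>{0}\<close> from
  \<open>n\<close> on, cut by closed conditions.\<close>

lemma compact_unit_orthogonal:
  "compact {x::nat\<Rightarrow>complex. (\<forall>i\<ge>n. x i = 0) \<and> nsq n x = 1 \<and> (\<forall>a<k. ip n (v a) x = 0)}" (is "compact ?C")
proof -
  let ?B = "PiE UNIV (\<lambda>i::nat. if i < n then cball (0::complex) 1 else {0})"
  let ?D = "{x::nat\<Rightarrow>complex. nsq n x = 1} \<inter> (\<Inter>a\<in>{..<k}. {x. ip n (v a) x = 0})"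
  have cl: "closed ?D"
    by (intro closed_Int closed_INT ballI closed_Collect_eq continuous_intros continuous_on_id)
  have "?C = ?B \<inter> ?D"
  proof (rule Set.set_eqI)
    fix x
    have "cmod (x i) \<le> 1" if "nsq n x = 1" "i < n" for i
    proof -
      have "(cmod (x i))\<^sup>2 \<le> nsq n x"
        unfolding nsq_def by (rule member_le_sum) (use that in auto)
      then show ?thesis using that by (simp add: power2_le_imp_le)
    qed
    then show "x \<in> ?C \<longleftrightarrow> x \<in> ?B \<inter> ?D"
      by (auto simp: PiE_def Pi_def extensional_def split: if_splits)
  qed
  then show ?thesis using compact_box cl by (simp add: compact_Int_closed)
qed

text \<open>The first-order condition at a maximum. At \<open>t = a / c\<close>, with
  \<open>c\<close> positive and at least \<open>b\<close>, the linear term wins unless it is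
  zero.\<close>

lemma nonneg_quadratic_zero:
  fixes a b :: real
  assumes "\<And>t. 0 \<le> - 2 * t * a + t\<^sup>2 * b" "a \<ge> 0"
  shows "a = 0"
proof (rule ccontr)
  assume "a \<noteq> 0"
  then have a: "a > 0" using assms by simp
  define c where "c = \<bar>b\<bar> + 1"
  have c: "c > 0" "b \<le> c" by (auto simp: c_def)
  have "0 \<le> - 2 * (a/c) * a + (a/c)\<^sup>2 * b" by (rule assms)
  also have "\<dots> \<le> - 2 * (a/c) * a + (a/c)\<^sup>2 * c"
    using c by (intro add_left_mono mult_left_mono) auto
  also have "\<dots> = - (a\<^sup>2 / c)"
  proof -
    have "(a/c)\<^sup>2 * c = a\<^sup>2 / c" using c by (simp add: power2_eq_square)
    moreover have "2 * (a/c) * a = 2 * (a\<^sup>2 / c)" by (simp add: power2_eq_square)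
    ultimately show ?thesis by linarith
  qed
  finally have "a\<^sup>2 / c \<le> 0" by simp
  moreover have "a\<^sup>2 / c > 0" using a c by (intro divide_pos_pos) auto
  ultimately show False by linarith
qed

section \<open>Eigenvectors of Hermitian matrices\<close>

lemma ip_mv_hermitian:
  assumes "\<And>i j. i < n \<Longrightarrow> j < n \<Longrightarrow> M j i = cnj (M i j)"
  shows "ip n x (mv n M y) = ip n (mv n M x) y"
proof -
  have "ip n x (mv n M y) = (\<Sum>i<n. \<Sum>j<n. cnj (x i) * (M i j * y j))"
    by (simp add: ip_def mv_def sum_distrib_left)
  also have "\<dots> = (\<Sum>j<n. \<Sum>i<n. cnj (x i) * (M i j * y j))" by (rule sum.swap)
  also have "\<dots> = (\<Sum>j<n. \<Sum>i<n. cnj (M j i * x i) * y j)"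
  proof (intro sum.cong refl)
    fix i j assume "j \<in> {..<n}" "i \<in> {..<n}"
    then have "M i j = cnj (M j i)" using assms[of j i] by simp
    then show "cnj (x i) * (M i j * y j) = cnj (M j i * x i) * y j"
      by (simp add: mult.commute mult.left_commute)
  qed
  also have "\<dots> = ip n (mv n M x) y"
    by (simp add: ip_def mv_def sum_distrib_right cnj_sum)
  finally show ?thesis .
qed

lemma ip_cong: "(\<And>i. i < n \<Longrightarrow> x i = x' i) \<Longrightarrow> (\<And>i. i < n \<Longrightarrow> y i = y' i) \<Longrightarrow> ip n x y = ip n x' y'"
  by (simp add: ip_def)

lemma mv_add: "mv n M (\<lambda>i. x i + y i) = (\<lambda>i. mv n M x i + mv n M y i)"
  by (rule ext) (simp add: mv_def algebra_simps sum.distrib)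

lemma mv_scale: "mv n M (\<lambda>i. c * x i) = (\<lambda>i. c * mv n M x i)"
  by (rule ext) (simp add: mv_def algebra_simps sum_distrib_left)

lemma nsq_scale: "nsq n (\<lambda>i. c * x i) = (cmod c)\<^sup>2 * nsq n x"
  by (simp add: nsq_def norm_mult power_mult_distrib sum_distrib_left)

lemma mv_unit: "j < n \<Longrightarrow> mv n M (\<lambda>i. if i = j then 1 else 0) = (\<lambda>i. M i j)"
  by (rule ext) (simp add: mv_def if_distrib [where f = "\<lambda>t. _ * t"] cong: if_cong)

lemma ip_unit_left: "j < n \<Longrightarrow> ip n (\<lambda>i. if i = j then 1 else 0) x = x j"
  using ip_unit_right[of j n x] cnj_ip[of n x "\<lambda>i. if i = j then 1 else 0"] by simp

lemma psd_form:
  assumes "psd n M"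
  shows "Im (ip n v (mv n (\<lambda>i j. M $$ (i,j)) v)) = 0" "Re (ip n v (mv n (\<lambda>i j. M $$ (i,j)) v)) \<ge> 0"
proof -
  have "ip n v (mv n (\<lambda>i j. M $$ (i,j)) v) = (\<Sum>i<n. \<Sum>j<n. cnj (v i) * M $$ (i,j) * v j)"
    by (simp add: ip_def mv_def sum_distrib_left mult.assoc)
  then show "Im (ip n v (mv n (\<lambda>i j. M $$ (i,j)) v)) = 0" "Re (ip n v (mv n (\<lambda>i j. M $$ (i,j)) v)) \<ge> 0"
    using assms unfolding psd_def Let_def by simp_all
qed

text \<open>\<open>psd\<close> only says that the form is real and nonnegative. Polarisation
  recovers the symmetry: on two basis vectors the coefficients \<open>1, 1\<close> settle the
  imaginary parts of the off-diagonal entries and \<open>1, \<i>\<close> the real parts.\<close>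

lemma psd_hermitian:
  assumes "psd n M" "i < n" "j < n"
  shows "M $$ (j,i) = cnj (M $$ (i,j))"
proof -
  let ?M = "\<lambda>i j. M $$ (i,j)" and ?u = "\<lambda>j i::nat. if i = j then 1 else (0::complex)"
  have e: "ip n (\<lambda>m. a * ?u i m + b * ?u j m) (mv n ?M (\<lambda>m. a * ?u i m + b * ?u j m))
     = cnj a * (a * ?M i i) + cnj a * (b * ?M i j) + cnj b * (a * ?M j i) + cnj b * (b * ?M j j)" for a b
    unfolding mv_add mv_scale ip_add_left ip_add_right ip_scale_left ip_scale_right
      mv_unit[OF assms(2)] mv_unit[OF assms(3)] ip_unit_left[OF assms(2)] ip_unit_left[OF assms(3)]
    by (simp only: distrib_left add.assoc)
  have qe: "Im (cnj a * (a * ?M i i) + cnj a * (b * ?M i j) + cnj b * (a * ?M j i) + cnj b * (b * ?M j j)) = 0" for a b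
    using psd_form(1)[OF assms(1)] unfolding e[symmetric] .
  have "Im (M$$(i,i)) = 0" using qe[of 1 0] by simp
  moreover have "Im (M$$(j,j)) = 0" using qe[of 0 1] by simp
  ultimately show ?thesis using qe[of 1 1] qe[of 1 \<i>] by (intro complex_eqI) auto
qed

text \<open>A maximiser of the Rayleigh quotient on the unit vectors orthogonal to the eigenvectors
  already found is an eigenvector: its residual stays in the same orthogonal complement and is
  therefore an admissible direction of variation.\<close>

lemma next_eigenvector:
  assumes herm: "\<And>i j. i < n \<Longrightarrow> j < n \<Longrightarrow> M j i = cnj (M i j)"
    and on: "orthonormal n k v" and k: "k < n"
    and ev: "\<And>a i. a < k \<Longrightarrow> i < n \<Longrightarrow> mv n M (v a) i = of_real (s a) * v a i"
  obtains x l where "nsq n x = 1" "\<And>a. a < k \<Longrightarrow> ip n (v a) x = 0"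
    "\<And>i. i < n \<Longrightarrow> mv n M x i = of_real l * x i"
proof -
  let ?C = "{x::nat\<Rightarrow>complex. (\<forall>i\<ge>n. x i = 0) \<and> nsq n x = 1 \<and> (\<forall>a<k. ip n (v a) x = 0)}"
  let ?q = "\<lambda>x. Re (ip n x (mv n M x))"
  have norm: "(\<lambda>i. if i < n then complex_of_real (1 / sqrt (nsq n y)) * y i else 0) \<in> ?C"
    if "nsq n y > 0" "\<And>a. a < k \<Longrightarrow> ip n (v a) y = 0" for y
  proof -
    have "nsq n (\<lambda>i. if i < n then complex_of_real (1 / sqrt (nsq n y)) * y i else 0)
       = nsq n (\<lambda>i. complex_of_real (1 / sqrt (nsq n y)) * y i)"
      by (simp add: nsq_def)
    also have "\<dots> = 1" using that by (simp add: nsq_scale norm_divide power_divide del: of_real_divide)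
    finally have 1: "nsq n (\<lambda>i. if i < n then complex_of_real (1 / sqrt (nsq n y)) * y i else 0) = 1" .
    have "ip n (v a) (\<lambda>i. if i < n then complex_of_real (1 / sqrt (nsq n y)) * y i else 0) = 0" if "a < k" for a
    proof -
      have "ip n (v a) (\<lambda>i. if i < n then complex_of_real (1 / sqrt (nsq n y)) * y i else 0)
        = ip n (v a) (\<lambda>i. complex_of_real (1 / sqrt (nsq n y)) * y i)" by (rule ip_cong) auto
      then show ?thesis using \<open>\<And>a. a < k \<Longrightarrow> ip n (v a) y = 0\<close>[OF that] by (simp only: ip_scale_right) simp
    qed
    with 1 show ?thesis by simp
  qed
  obtain y where y: "nsq n y > 0" "\<And>a. a < k \<Longrightarrow> ip n (v a) y = 0"
    using exists_orthogonal[OF on k] by blast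
  have ne: "?C \<noteq> {}" using norm[OF y] by (metis (no_types, lifting) empty_iff)
  have cont: "continuous_on ?C ?q" by (intro continuous_intros continuous_on_id)
  have "\<exists>x\<in>?C. \<forall>y\<in>?C. ?q y \<le> ?q x"
    by (rule continuous_attains_sup[OF compact_unit_orthogonal ne cont])
  then obtain x where x: "x \<in> ?C" and max: "\<And>y. y \<in> ?C \<Longrightarrow> ?q y \<le> ?q x" by (elim bexE) blast
  define l where "l = ?q x"
  \<comment> \<open>Homogeneity turns the maximum over unit vectors into an inequality for all
    admissible vectors, as the perturbed vector below is not normalised.\<close>
  have le: "?q y \<le> l * nsq n y" if o: "\<And>a. a < k \<Longrightarrow> ip n (v a) y = 0" for y
  proof (cases "nsq n y > 0")
    case True
    let ?c = "complex_of_real (1 / sqrt (nsq n y))"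
    let ?y = "\<lambda>i. if i < n then ?c * y i else 0"
    have "?q ?y \<le> l" unfolding l_def by (rule max, rule norm[OF True o])
    have m: "mv n M ?y = mv n M (\<lambda>i. ?c * y i)" by (rule ext) (simp add: mv_def)
    have "ip n ?y (mv n M ?y) = ip n (\<lambda>i. ?c * y i) (mv n M ?y)" by (rule ip_cong) auto
    also have "\<dots> = cnj ?c * (?c * ip n y (mv n M y))"
      by (simp only: m mv_scale ip_scale_left ip_scale_right)
    also have "\<dots> = complex_of_real (1 / nsq n y) * ip n y (mv n M y)"
    proof -
      have "cnj ?c * ?c = complex_of_real (1 / nsq n y)"
        using True by (metis complex_cnj_complex_of_real of_real_mult power2_eq_square power_one_over real_sqrt_pow2 less_imp_le)
      then show ?thesis by (metis mult.assoc)
    qed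
    finally have "?q ?y = ?q y / nsq n y" by simp
    with \<open>?q ?y \<le> l\<close> show ?thesis using True by (simp add: field_simps)
  next
    case False
    then have "nsq n y = 0" using nsq_nonneg[of n y] by linarith
    then have "\<And>i. i < n \<Longrightarrow> y i = 0" by (simp add: nsq_eq_0_iff)
    then have "ip n y (mv n M y) = 0" by (simp add: ip_def)
    then show ?thesis using \<open>nsq n y = 0\<close> by simp
  qed
  define w where "w = (\<lambda>i. mv n M x i - of_real l * x i)"
  have hm: "ip n x (mv n M y) = ip n (mv n M x) y" for x y
    by (rule ip_mv_hermitian) (rule herm)
  have xo: "ip n (v a) x = 0" if "a < k" for a using x that by simp
  have nx: "nsq n x = 1" using x by simp
  have wo: "ip n (v a) w = 0" if "a < k" for a
  proof -
    have "ip n (v a) (mv n M x) = ip n (mv n M (v a)) x" by (rule hm)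
    also have "\<dots> = ip n (\<lambda>i. of_real (s a) * v a i) x" using ev[OF that] by (intro ip_cong) auto
    also have "\<dots> = 0" using xo[OF that] by (simp only: ip_scale_left) simp
    finally show ?thesis unfolding w_def using xo[OF that] by (simp only: ip_diff_right ip_scale_right) simp
  qed
  \<comment> \<open>Perturbing \<open>x\<close> in the direction \<open>w\<close>: as the real part
    of their inner product vanishes, the coefficient linear in \<open>t\<close> is a multiple of
    \<open>nsq n w\<close>.\<close>
  have "nsq n w = 0"
  proof (rule nonneg_quadratic_zero)
    fix t :: real
    let ?y = "\<lambda>i. x i + of_real t * w i"
    have o: "ip n (v a) ?y = 0" if "a < k" for a
      using xo[OF that] wo[OF that] by (simp only: ip_add_right ip_scale_right) simp
    have q: "?q ?y \<le> l * nsq n ?y" by (rule le[OF o])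
    have mx: "mv n M x = (\<lambda>i. w i + of_real l * x i)" by (simp add: w_def)
    have xmw: "ip n x (mv n M w) = ip n (\<lambda>i. w i + of_real l * x i) w"
      using hm[of x w] unfolding mx .
    have "?q ?y = Re (ip n x (\<lambda>i. w i + of_real l * x i) + of_real t * ip n (\<lambda>i. w i + of_real l * x i) w
        + of_real t * (ip n w (\<lambda>i. w i + of_real l * x i) + of_real t * ip n w (mv n M w)))"
      by (simp only: mv_add mv_scale ip_add_right ip_add_left ip_scale_left ip_scale_right mx xmw
          complex_cnj_complex_of_real) (simp add: algebra_simps)
    also have "\<dots> = Re (ip n x w) + l + t * (nsq n w + l * Re (ip n x w)) + t * (nsq n w + l * Re (ip n w x)) + t\<^sup>2 * ?q w"
      unfolding ip_add_right ip_scale_right ip_add_left ip_scale_left ip_self nx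
      by (simp add: power2_eq_square distrib_left mult.assoc)
    finally have e1: "?q ?y = Re (ip n x w) + l + t * (nsq n w + l * Re (ip n x w)) + t * (nsq n w + l * Re (ip n w x)) + t\<^sup>2 * ?q w" .
    have "nsq n ?y = 1 + t * Re (ip n x w) + t * Re (ip n w x) + t\<^sup>2 * nsq n w"
      unfolding nsq_eq_Re_ip[of n ?y] using nx
      by (simp add: ip_add_right ip_scale_right ip_add_left ip_scale_left ip_self power2_eq_square algebra_simps)
    with q e1 have "Re (ip n x w) + l + t * (nsq n w + l * Re (ip n x w)) + t * (nsq n w + l * Re (ip n w x)) + t\<^sup>2 * ?q w
       \<le> l * (1 + t * Re (ip n x w) + t * Re (ip n w x) + t\<^sup>2 * nsq n w)" by simp
    moreover have "Re (ip n x w) = 0"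
    proof -
      have "ip n x w = ip n x (mv n M x) - of_real l * ip n x x"
        unfolding w_def by (simp only: ip_diff_right ip_scale_right)
      then show ?thesis using nx by (simp add: ip_self l_def)
    qed
    moreover have "Re (ip n w x) = Re (ip n x w)" using cnj_ip[of n x w] by (metis cnj.simps(1))
    ultimately show "0 \<le> - 2 * t * nsq n w + t\<^sup>2 * (l * nsq n w - ?q w)" by (simp add: algebra_simps)
  qed simp
  then have "\<And>i. i < n \<Longrightarrow> mv n M x i = of_real l * x i"
    by (simp add: nsq_eq_0_iff w_def)
  with nx xo that show ?thesis by blast
qed

lemma eigenvectors_upto:
  assumes herm: "\<And>i j. i < n \<Longrightarrow> j < n \<Longrightarrow> M j i = cnj (M i j)"
  shows "k \<le> n \<Longrightarrow> \<exists>v s. orthonormal n k v \<and> (\<forall>a<k. \<forall>i<n. mv n M (v a) i = of_real (s a) * v a i)"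
proof (induction k)
  case 0
  then show ?case by (simp add: orthonormal_def)
next
  case (Suc k)
  then obtain v s where on: "orthonormal n k v"
    and ev: "\<And>a i. a < k \<Longrightarrow> i < n \<Longrightarrow> mv n M (v a) i = complex_of_real (s a) * v a i" by auto
  obtain x l where x: "nsq n x = 1" "\<And>a. a < k \<Longrightarrow> ip n (v a) x = 0"
    "\<And>i. i < n \<Longrightarrow> mv n M x i = of_real l * x i"
    using next_eigenvector[OF herm on _ ev] Suc.prems by (metis Suc_le_lessD)
  have x': "ip n x (v a) = 0" if "a < k" for a
    using x(2)[OF that] cnj_ip[of n "v a" x] by simp
  have "orthonormal n (Suc k) (v(k := x))"
    using on x x' unfolding orthonormal_def by (auto simp: less_Suc_eq ip_self)
  moreover have "\<forall>a<Suc k. \<forall>i<n. mv n M ((v(k := x)) a) i = of_real ((s(k := l)) a) * (v(k := x)) a i"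
    using ev x(3) by (auto simp: less_Suc_eq)
  ultimately show ?case by blast
qed

lemma psd_spectral:
  assumes "psd n M"
  obtains s :: "nat \<Rightarrow> real" and v where "\<And>k. k < n \<Longrightarrow> s k \<ge> 0" "orthonormal n n v"
    "\<And>i j. i < n \<Longrightarrow> j < n \<Longrightarrow> M $$ (i,j) = (\<Sum>k<n. of_real (s k) * v k i * cnj (v k j))"
proof -
  let ?M = "\<lambda>i j. M $$ (i,j)"
  obtain v s where on: "orthonormal n n v"
    and ev: "\<And>a i. a < n \<Longrightarrow> i < n \<Longrightarrow> mv n ?M (v a) i = complex_of_real (s a) * v a i"
    using eigenvectors_upto[of n ?M n, OF psd_hermitian[OF assms]] by auto
  have "s k \<ge> 0" if "k < n" for k
  proof -
    have "0 \<le> Re (\<Sum>i<n. \<Sum>j<n. cnj (v k i) * M $$ (i,j) * v k j)"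
      using assms unfolding psd_def Let_def by blast
    also have "(\<Sum>i<n. \<Sum>j<n. cnj (v k i) * M $$ (i,j) * v k j) = ip n (v k) (mv n ?M (v k))"
      by (simp add: ip_def mv_def sum_distrib_left mult.assoc)
    also have "\<dots> = ip n (v k) (\<lambda>i. of_real (s k) * v k i)" using ev[OF that] by (intro ip_cong) auto
    also have "\<dots> = of_real (s k)" using on that unfolding ip_scale_right orthonormal_def by simp
    finally show ?thesis by simp
  qed
  moreover have "M $$ (i,j) = (\<Sum>k<n. of_real (s k) * v k i * cnj (v k j))" if "i < n" "j < n" for i j
  proof -
    have "(\<Sum>k<n. of_real (s k) * v k i * cnj (v k j)) = (\<Sum>k<n. \<Sum>m<n. M $$ (i,m) * v k m * cnj (v k j))"
      using ev that by (intro sum.cong refl) (simp add: mv_def sum_distrib_right flip: ev)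
    also have "\<dots> = (\<Sum>m<n. M $$ (i,m) * (\<Sum>k<n. v k m * cnj (v k j)))"
      by (subst sum.swap) (simp add: sum_distrib_left mult.assoc)
    also have "\<dots> = (\<Sum>m<n. if m = j then M $$ (i,m) else 0)"
      using orthonormal_complete[OF on _ that(2)] by (intro sum.cong) auto
    also have "\<dots> = M $$ (i,j)" using that by simp
    finally show ?thesis by simp
  qed
  ultimately show ?thesis using that on by blast
qed

section \<open>Spectral calculus and the positive square root\<close>

lemma mat_mult_entry:
  assumes "A \<in> carrier_mat n m" "B \<in> carrier_mat m p" "i < n" "j < p"
  shows "(A * B) $$ (i,j) = (\<Sum>k<m. A $$ (i,k) * B $$ (k,j))"
  using assms by (auto simp: scalar_prod_def atLeast0LessThan)

lemma adj_carrier [simp]: "A \<in> carrier_mat n m \<Longrightarrow> adj A \<in> carrier_mat m n"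
  by (auto simp: adj_def)

lemma adj_entry: "A \<in> carrier_mat n m \<Longrightarrow> i < m \<Longrightarrow> j < n \<Longrightarrow> adj A $$ (i,j) = cnj (A $$ (j,i))"
  by (auto simp: adj_def)

lemma psd_carrier: "psd n M \<Longrightarrow> M \<in> carrier_mat n n"
  by (simp add: psd_def)

lemma psdI:
  assumes "M \<in> carrier_mat n n"
    "\<And>x. ip n x (mv n (\<lambda>i j. M $$ (i,j)) x) = of_real (q x)" "\<And>x. q x \<ge> 0"
  shows "psd n M"
proof -
  have "(\<Sum>i<n. \<Sum>j<n. cnj (v i) * M $$ (i,j) * v j) = of_real (q v)" for v
    unfolding assms(2)[symmetric] by (simp add: ip_def mv_def sum_distrib_left mult.assoc)
  then show ?thesis using assms(1,3) unfolding psd_def Let_def by simp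
qed

lemma mv_cong: "(\<And>j. j < n \<Longrightarrow> M i j = M' i j) \<Longrightarrow> (\<And>j. j < n \<Longrightarrow> x j = x' j) \<Longrightarrow> mv n M x i = mv n M' x' i"
  by (simp add: mv_def)

lemma mv_mat_mult:
  assumes "A \<in> carrier_mat n n" "B \<in> carrier_mat n n" "i < n"
  shows "mv n (\<lambda>i j. (A * B) $$ (i,j)) x i = mv n (\<lambda>i j. A $$ (i,j)) (mv n (\<lambda>i j. B $$ (i,j)) x) i"
proof -
  have "mv n (\<lambda>i j. (A * B) $$ (i,j)) x i = (\<Sum>j<n. \<Sum>k<n. A $$ (i,k) * B $$ (k,j) * x j)"
    unfolding mv_def using mat_mult_entry[OF assms(1,2,3)] by (simp add: sum_distrib_right del: index_mult_mat)
  also have "\<dots> = (\<Sum>k<n. \<Sum>j<n. A $$ (i,k) * B $$ (k,j) * x j)" by (rule sum.swap)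
  finally show ?thesis by (simp add: mv_def sum_distrib_left mult.assoc)
qed

lemma eq_mat_of_basis:
  assumes "orthonormal n n v" "\<And>k i. k < n \<Longrightarrow> i < n \<Longrightarrow> mv n A (v k) i = mv n B (v k) i" "i < n" "j < n"
  shows "A i j = B i j"
proof -
  have e: "C i j = (\<Sum>k<n. mv n C (v k) i * cnj (v k j))" for C
  proof -
    have "(\<Sum>k<n. mv n C (v k) i * cnj (v k j)) = (\<Sum>k<n. \<Sum>m<n. C i m * (v k m * cnj (v k j)))"
      by (simp add: mv_def sum_distrib_right mult.assoc)
    also have "\<dots> = (\<Sum>m<n. C i m * (\<Sum>k<n. v k m * cnj (v k j)))"
      by (subst sum.swap) (simp add: sum_distrib_left)
    also have "\<dots> = (\<Sum>m<n. if m = j then C i m else 0)"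
      using orthonormal_complete[OF assms(1) _ assms(4)] by (intro sum.cong) auto
    finally show ?thesis using assms(4) by simp
  qed
  show ?thesis unfolding e[of A] e[of B] using assms by simp
qed

text \<open>For a fixed orthonormal \<open>v\<close>, products, roots and traces act on the
  eigenvalues \<open>s\<close> alone; this is the functional calculus used throughout.\<close>

definition specmat :: "nat \<Rightarrow> (nat \<Rightarrow> real) \<Rightarrow> (nat \<Rightarrow> nat \<Rightarrow> complex) \<Rightarrow> complex mat" where
  "specmat n s v = Matrix.mat n n (\<lambda>(i,j). \<Sum>k<n. of_real (s k) * v k i * cnj (v k j))"

lemma specmat_carrier [simp]: "specmat n s v \<in> carrier_mat n n"
  by (simp add: specmat_def)

lemma specmat_entry: "i < n \<Longrightarrow> j < n \<Longrightarrow> specmat n s v $$ (i,j) = (\<Sum>k<n. of_real (s k) * v k i * cnj (v k j))"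
  by (simp add: specmat_def)

lemma specmat_cong: "(\<And>k. k < n \<Longrightarrow> s k = t k) \<Longrightarrow> specmat n s v = specmat n t v"
  unfolding specmat_def by (intro cong_mat) (auto intro!: sum.cong)

lemma mv_specmat: "i < n \<Longrightarrow> mv n (\<lambda>i j. specmat n s v $$ (i,j)) x i = (\<Sum>k<n. of_real (s k) * ip n (v k) x * v k i)"
proof -
  assume i: "i < n"
  have "mv n (\<lambda>i j. specmat n s v $$ (i,j)) x i = (\<Sum>j<n. \<Sum>k<n. of_real (s k) * v k i * cnj (v k j) * x j)"
    using i by (simp add: mv_def specmat_entry sum_distrib_right)
  also have "\<dots> = (\<Sum>k<n. \<Sum>j<n. of_real (s k) * v k i * cnj (v k j) * x j)" by (rule sum.swap)
  finally show ?thesis by (simp add: ip_def sum_distrib_left sum_distrib_right ac_simps)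
qed

lemma mv_specmat_basis:
  assumes "orthonormal n n v" "i < n" "k < n"
  shows "mv n (\<lambda>i j. specmat n s v $$ (i,j)) (v k) i = of_real (s k) * v k i"
proof -
  have "(\<Sum>l<n. of_real (s l) * ip n (v l) (v k) * v l i) = (\<Sum>l<n. if l = k then of_real (s l) * v l i else 0)"
    using assms unfolding orthonormal_def by (intro sum.cong) auto
  then show ?thesis using assms by (simp add: mv_specmat)
qed

lemma psd_eq_specmat:
  assumes "psd n M"
  obtains s v where "\<And>k. k < n \<Longrightarrow> s k \<ge> 0" "orthonormal n n v" "M = specmat n s v"
proof -
  obtain s v where sv: "\<And>k. k < n \<Longrightarrow> s k \<ge> 0" "orthonormal n n v"
    "\<And>i j. i < n \<Longrightarrow> j < n \<Longrightarrow> M $$ (i,j) = (\<Sum>k<n. of_real (s k) * v k i * cnj (v k j))"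
    using psd_spectral[OF assms] by blast
  moreover have "M = specmat n s v"
    using sv(3) psd_carrier[OF assms] by (intro eq_matI) (auto simp: specmat_def)
  ultimately show ?thesis using that by blast
qed

lemma ip_specmat:
  "ip n x (mv n (\<lambda>i j. specmat n s v $$ (i,j)) x) = of_real (\<Sum>k<n. s k * (cmod (ip n (v k) x))\<^sup>2)"
proof -
  have "ip n x (mv n (\<lambda>i j. specmat n s v $$ (i,j)) x) = ip n x (\<lambda>i. \<Sum>k<n. of_real (s k) * ip n (v k) x * v k i)"
    by (intro ip_cong) (auto simp: mv_specmat)
  also have "\<dots> = (\<Sum>k<n. of_real (s k) * ip n (v k) x * cnj (ip n (v k) x))"
    by (simp add: ip_sum_right ip_scale_right cnj_ip)
  finally show ?thesis by (simp add: complex_norm_square mult.assoc del: of_real_power)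
qed

lemma psd_specmat: "(\<And>k. k < n \<Longrightarrow> s k \<ge> 0) \<Longrightarrow> psd n (specmat n s v)"
  by (rule psdI[OF specmat_carrier ip_specmat]) (auto intro!: sum_nonneg)

lemma specmat_mult:
  assumes "orthonormal n n v"
  shows "specmat n s v * specmat n t v = specmat n (\<lambda>k. s k * t k) v"
proof (rule eq_matI)
  fix i j assume "i < dim_row (specmat n (\<lambda>k. s k * t k) v)" "j < dim_col (specmat n (\<lambda>k. s k * t k) v)"
  then have ij: "i < n" "j < n" by (auto simp: specmat_def)
  show "(specmat n s v * specmat n t v) $$ (i,j) = specmat n (\<lambda>k. s k * t k) v $$ (i,j)"
  proof (rule eq_mat_of_basis[OF assms _ ij, where A = "\<lambda>i j. (specmat n s v * specmat n t v) $$ (i,j)"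
        and B = "\<lambda>i j. specmat n (\<lambda>k. s k * t k) v $$ (i,j)"])
    fix k i assume k: "k < n" "i < n"
    have "mv n (\<lambda>i j. (specmat n s v * specmat n t v) $$ (i,j)) (v k) i
      = mv n (\<lambda>i j. specmat n s v $$ (i,j)) (mv n (\<lambda>i j. specmat n t v $$ (i,j)) (v k)) i"
      by (rule mv_mat_mult) (use k in auto)
    also have "\<dots> = mv n (\<lambda>i j. specmat n s v $$ (i,j)) (\<lambda>i. of_real (t k) * v k i) i"
      by (rule mv_cong) (use k mv_specmat_basis[OF assms] in auto)
    also have "\<dots> = of_real (t k) * (of_real (s k) * v k i)"
      using mv_specmat_basis[OF assms k(2,1)] by (simp add: mv_scale)
    finally show "mv n (\<lambda>i j. (specmat n s v * specmat n t v) $$ (i,j)) (v k) i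
        = mv n (\<lambda>i j. specmat n (\<lambda>k. s k * t k) v $$ (i,j)) (v k) i"
      using mv_specmat_basis[OF assms k(2,1)] by simp
  qed
qed (auto simp: specmat_def)

text \<open>\<open>msqrt\<close> is a definite description and needs uniqueness. For an eigenvector
  \<open>v\<close> of \<open>S\<close> with eigenvalue \<open>s > 0\<close>, the vector
  \<open>w = R v - s v\<close> satisfies \<open>R w = - s w\<close>, which positivity of
  \<open>R\<close> allows only for \<open>w = 0\<close>; for \<open>s = 0\<close> one has
  \<open>|R v|\<^sup>2 = \<langle>v, R R v\<rangle> = 0\<close>.\<close>

lemma psd_sqrt_unique:
  assumes S: "psd n S" and R: "psd n R" and eq: "S * S = R * R"
  shows "S = R"
proof -
  obtain s v where sv: "\<And>k. k < n \<Longrightarrow> s k \<ge> 0" "orthonormal n n v" "S = specmat n s v"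
    using psd_eq_specmat[OF S] by blast
  let ?S = "\<lambda>i j. S $$ (i,j)" and ?R = "\<lambda>i j. R $$ (i,j)"
  have Rc: "R \<in> carrier_mat n n" and Sc: "S \<in> carrier_mat n n" using psd_carrier S R by auto
  have herm: "ip n x (mv n ?R y) = ip n (mv n ?R x) y" for x y
    by (rule ip_mv_hermitian) (rule psd_hermitian[OF R])
  have R_ev: "mv n ?R (v k) i = of_real (s k) * v k i" if k: "k < n" and i: "i < n" for k i
  proof -
    define w where "w = (\<lambda>i. mv n ?R (v k) i - of_real (s k) * v k i)"
    have RR: "mv n ?R (mv n ?R (v k)) i = of_real ((s k)\<^sup>2) * v k i" if "i < n" for i
    proof -
      have "mv n ?R (mv n ?R (v k)) i = mv n (\<lambda>i j. (S * S) $$ (i,j)) (v k) i"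
        unfolding eq using mv_mat_mult[OF Rc Rc that] by simp
      also have "\<dots> = of_real ((s k)\<^sup>2) * v k i"
        unfolding sv(3) specmat_mult[OF sv(2)] using mv_specmat_basis[OF sv(2) that k]
        by (simp add: power2_eq_square)
      finally show ?thesis .
    qed
    have "nsq n w = 0"
    proof (cases "s k = 0")
      case True
      have "ip n (mv n ?R (v k)) (mv n ?R (v k)) = ip n (v k) (mv n ?R (mv n ?R (v k)))" by (simp add: herm)
      also have "\<dots> = 0" using RR True by (simp add: ip_def)
      finally show ?thesis using True by (simp add: w_def ip_self)
    next
      case False
      then have pos: "s k > 0" using sv(1)[OF k] by simp
      have "mv n ?R w i = of_real (- s k) * w i" if "i < n" for i
      proof -
        have "w = (\<lambda>i. mv n ?R (v k) i + of_real (- s k) * v k i)" by (simp add: w_def)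
        then have "mv n ?R w i = mv n ?R (mv n ?R (v k)) i + of_real (- s k) * mv n ?R (v k) i"
          by (simp only: mv_add mv_scale)
        then show ?thesis using RR[OF that] by (simp add: w_def power2_eq_square algebra_simps)
      qed
      then have "ip n w (mv n ?R w) = ip n w (\<lambda>i. of_real (- s k) * w i)" by (intro ip_cong) auto
      also have "\<dots> = of_real (- s k * nsq n w)" by (simp only: ip_scale_right ip_self of_real_mult)
      finally have "0 \<le> - s k * nsq n w" using psd_form(2)[OF R, of w] by simp
      with pos show ?thesis using nsq_nonneg[of n w] by (simp add: mult_le_0_iff)
    qed
    then show ?thesis using i by (simp add: nsq_eq_0_iff w_def)
  qed
  have "S $$ (i,j) = R $$ (i,j)" if "i < n" "j < n" for i j
  proof (rule eq_mat_of_basis[OF sv(2) _ that, where A = ?S and B = ?R])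
    fix k i assume "k < n" "i < n"
    then show "mv n ?S (v k) i = mv n ?R (v k) i"
      using R_ev mv_specmat_basis[OF sv(2), of i k s] sv(3) by simp
  qed
  then show ?thesis using Rc Sc by (intro eq_matI) auto
qed

lemma msqrt_specmat:
  assumes "\<And>k. k < n \<Longrightarrow> s k \<ge> 0" "orthonormal n n v"
  shows "msqrt n (specmat n s v) = specmat n (\<lambda>k. sqrt (s k)) v"
  unfolding msqrt_def
proof (rule the_equality)
  have "specmat n (\<lambda>k. sqrt (s k) * sqrt (s k)) v = specmat n s v"
    by (rule specmat_cong) (simp add: assms)
  then show *: "psd n (specmat n (\<lambda>k. sqrt (s k)) v) \<and>
     specmat n (\<lambda>k. sqrt (s k)) v * specmat n (\<lambda>k. sqrt (s k)) v = specmat n s v"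
    using specmat_mult[OF assms(2)] psd_specmat[of n "\<lambda>k. sqrt (s k)" v] assms(1) by simp
  show "S = specmat n (\<lambda>k. sqrt (s k)) v" if "psd n S \<and> S * S = specmat n s v" for S
    using that * psd_sqrt_unique[of n S "specmat n (\<lambda>k. sqrt (s k)) v"] by simp
qed

lemma msqrt_psd: "psd n M \<Longrightarrow> psd n (msqrt n M)" and msqrt_square: "psd n M \<Longrightarrow> msqrt n M * msqrt n M = M"
proof -
  assume "psd n M"
  then obtain s v where sv: "\<And>k. k < n \<Longrightarrow> s k \<ge> 0" "orthonormal n n v" "M = specmat n s v"
    using psd_eq_specmat by blast
  have "specmat n (\<lambda>k. sqrt (s k) * sqrt (s k)) v = specmat n s v"
    by (rule specmat_cong) (simp add: sv(1))
  then have "psd n (msqrt n M) \<and> msqrt n M * msqrt n M = M"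
    using msqrt_specmat[OF sv(1,2)] psd_specmat[of n "\<lambda>k. sqrt (s k)" v] specmat_mult[OF sv(2)] sv(1,3)
    by simp
  then show "psd n (msqrt n M)" "msqrt n M * msqrt n M = M" by auto
qed

lemma tr_specmat: "orthonormal n n v \<Longrightarrow> tr (specmat n s v) = of_real (\<Sum>k<n. s k)"
proof -
  assume on: "orthonormal n n v"
  have "tr (specmat n s v) = (\<Sum>i<n. \<Sum>k<n. of_real (s k) * v k i * cnj (v k i))"
    unfolding tr_def by (intro sum.cong) (auto simp: specmat_entry, simp add: specmat_def)
  also have "\<dots> = (\<Sum>k<n. of_real (s k) * ip n (v k) (v k))"
    by (subst sum.swap) (simp add: ip_def sum_distrib_left mult.assoc mult.left_commute mult.commute)
  also have "\<dots> = (\<Sum>k<n. of_real (s k))" using on by (simp add: orthonormal_def)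
  finally show ?thesis by simp
qed

section \<open>The trace norm\<close>

lemma cauchy_schwarz_ip: "cmod (ip n x y) \<le> sqrt (nsq n x) * sqrt (nsq n y)"
proof (cases "nsq n x = 0")
  case True
  then have "ip n x y = 0" by (simp add: nsq_eq_0_iff ip_def)
  then show ?thesis by simp
next
  case False
  then have pos: "nsq n x > 0" using nsq_nonneg[of n x] by linarith
  let ?c = "complex_of_real (1 / sqrt (nsq n x))"
  let ?v = "\<lambda>i. ?c * x i"
  have "nsq n ?v = 1" unfolding nsq_scale using pos by (simp add: norm_divide power_divide)
  then have "orthonormal n 1 (\<lambda>_. ?v)" unfolding orthonormal_def using ip_self[of n ?v] by simp
  from bessel[OF this, of y] have "(cmod (ip n ?v y))\<^sup>2 \<le> nsq n y" by simp
  moreover have "cmod (ip n ?v y) = cmod (ip n x y) / sqrt (nsq n x)"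
    unfolding ip_scale_left using pos by (simp add: norm_mult norm_divide)
  ultimately have "(cmod (ip n x y) / sqrt (nsq n x))\<^sup>2 \<le> nsq n y" by (simp only:)
  then have "(cmod (ip n x y))\<^sup>2 \<le> nsq n y * nsq n x"
    using pos by (simp add: power_divide field_simps)
  then have "cmod (ip n x y) \<le> sqrt (nsq n y * nsq n x)" by (rule real_le_rsqrt)
  then show ?thesis by (simp add: real_sqrt_mult mult.commute)
qed

section \<open>Duality of the trace norm with contractions\<close>

lemma ip_mv_adjoint: "ip n x (mv n W y) = ip n (mv n (\<lambda>i j. cnj (W j i)) x) y"
proof -
  have "ip n x (mv n W y) = (\<Sum>i<n. \<Sum>j<n. cnj (x i) * (W i j * y j))"
    by (simp add: ip_def mv_def sum_distrib_left)
  also have "\<dots> = (\<Sum>j<n. \<Sum>i<n. cnj (x i) * (W i j * y j))" by (rule sum.swap)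
  finally show ?thesis by (simp add: ip_def mv_def sum_distrib_left sum_distrib_right cnj_sum ac_simps)
qed

text \<open>The operators of norm at most 1, the dual unit ball of the trace norm.\<close>

definition contraction :: "nat \<Rightarrow> (nat \<Rightarrow> nat \<Rightarrow> complex) \<Rightarrow> bool" where
  "contraction n W \<longleftrightarrow> (\<forall>x. nsq n (mv n W x) \<le> nsq n x)"

lemma contraction_adj:
  assumes "contraction n W"
  shows "contraction n (\<lambda>i j. cnj (W j i))"
  unfolding contraction_def
proof
  fix y
  let ?a = "mv n (\<lambda>i j. cnj (W j i)) y"
  have "nsq n ?a = cmod (ip n y (mv n W ?a))"
    using ip_mv_adjoint[of n y W ?a] by (simp add: ip_self)
  also have "\<dots> \<le> sqrt (nsq n y) * sqrt (nsq n (mv n W ?a))" by (rule cauchy_schwarz_ip)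
  also have "\<dots> \<le> sqrt (nsq n y) * sqrt (nsq n ?a)"
    using assms by (intro mult_left_mono) (auto simp: contraction_def)
  finally have le: "sqrt (nsq n ?a) * sqrt (nsq n ?a) \<le> sqrt (nsq n y) * sqrt (nsq n ?a)" by simp
  show "nsq n ?a \<le> nsq n y"
  proof (cases "nsq n ?a = 0")
    case True then show ?thesis by simp
  next
    case False
    then have "sqrt (nsq n ?a) > 0" by (metis real_sqrt_gt_zero nsq_nonneg order_le_less)
    then have "sqrt (nsq n ?a) \<le> sqrt (nsq n y)" using le by (rule mult_right_le_imp_le[rotated])
    then show ?thesis by simp
  qed
qed

lemma nsq_comb_orthonormal:
  assumes "orthonormal n k v"
  shows "nsq n (\<lambda>i. \<Sum>a<k. c a * v a i) = (\<Sum>a<k. (cmod (c a))\<^sup>2)"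
proof -
  have "ip n (\<lambda>i. \<Sum>a<k. c a * v a i) (\<lambda>i. \<Sum>a<k. c a * v a i) = (\<Sum>a<k. cnj (c a) * (\<Sum>b<k. c b * ip n (v a) (v b)))"
    by (simp add: ip_sum_left ip_scale_left ip_sum_right ip_scale_right)
  also have "\<dots> = (\<Sum>a<k. cnj (c a) * (\<Sum>b<k. if a = b then c b else 0))"
    using assms unfolding orthonormal_def by (intro sum.cong refl arg_cong2[where f="(*)"]) auto
  also have "\<dots> = (\<Sum>a<k. of_real ((cmod (c a))\<^sup>2))"
    by (intro sum.cong refl) (simp add: complex_norm_square mult.commute del: of_real_power)
  finally show ?thesis by (simp add: nsq_eq_Re_ip)
qed

text \<open>The \<open>v k\<close> are right singular vectors, an eigenbasis of
  \<open>adj X * X\<close>. Orthogonality of their images takes the place of a polar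
  decomposition.\<close>

lemma tnorm_singular_values:
  assumes X: "X \<in> carrier_mat n n"
  obtains s :: "nat \<Rightarrow> real" and v where "\<And>k. k < n \<Longrightarrow> s k \<ge> 0" "orthonormal n n v"
    "\<And>k l. k < n \<Longrightarrow> l < n \<Longrightarrow> ip n (mv n (\<lambda>i j. X $$ (i,j)) (v k)) (mv n (\<lambda>i j. X $$ (i,j)) (v l))
        = (if k = l then of_real ((s k)\<^sup>2) else 0)"
    "tnorm X = (\<Sum>k<n. s k)"
proof -
  let ?X = "\<lambda>i j. X $$ (i,j)"
  have c: "adj X * X \<in> carrier_mat n n" using X by (intro mult_carrier_mat[of _ n n]) auto
  have e: "ip n y (mv n (\<lambda>i j. (adj X * X) $$ (i,j)) x) = ip n (mv n ?X y) (mv n ?X x)" for x y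
  proof -
    have "ip n y (mv n (\<lambda>i j. (adj X * X) $$ (i,j)) x) = ip n y (mv n (\<lambda>i j. adj X $$ (i,j)) (mv n ?X x))"
      using X by (intro ip_cong mv_mat_mult) auto
    also have "\<dots> = ip n y (mv n (\<lambda>i j. cnj (X $$ (j,i))) (mv n ?X x))"
      by (intro ip_cong mv_cong refl) (use adj_entry[OF X] in auto)
    finally show ?thesis by (simp add: ip_mv_adjoint)
  qed
  have "psd n (adj X * X)"
    by (rule psdI[OF c, where q = "\<lambda>x. nsq n (mv n ?X x)"]) (simp_all add: e ip_self)
  then obtain t v where t: "\<And>k. k < n \<Longrightarrow> t k \<ge> 0" "orthonormal n n v" "adj X * X = specmat n t v"
    using psd_eq_specmat by blast
  have tn: "tnorm X = (\<Sum>k<n. sqrt (t k))"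
    using X unfolding tnorm_def t(3) by (simp add: msqrt_specmat[OF t(1,2)] tr_specmat[OF t(2)])
  have "ip n (mv n ?X (v k)) (mv n ?X (v l)) = (if k = l then of_real ((sqrt (t k))\<^sup>2) else 0)"
    if "k < n" "l < n" for k l
  proof -
    have "ip n (mv n ?X (v k)) (mv n ?X (v l)) = ip n (v k) (mv n (\<lambda>i j. specmat n t v $$ (i,j)) (v l))"
      unfolding e[symmetric] t(3) ..
    also have "\<dots> = ip n (v k) (\<lambda>i. of_real (t l) * v l i)"
      by (intro ip_cong refl mv_specmat_basis[OF t(2)]) (use that in auto)
    also have "\<dots> = of_real (t l) * ip n (v k) (v l)" by (rule ip_scale_right)
    finally show ?thesis using t(1,2) that by (simp add: orthonormal_def)
  qed
  then show ?thesis using that[of "\<lambda>k. sqrt (t k)" v] t tn by simp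
qed

lemma trace_basis:
  assumes "orthonormal n n v"
  shows "(\<Sum>k<n. ip n (v k) (mv n A (v k))) = (\<Sum>i<n. A i i)"
proof -
  have "(\<Sum>k<n. ip n (v k) (mv n A (v k))) = (\<Sum>k<n. \<Sum>i<n. \<Sum>j<n. A i j * (v k j * cnj (v k i)))"
    by (simp add: ip_def mv_def sum_distrib_left ac_simps)
  also have "\<dots> = (\<Sum>i<n. \<Sum>k<n. \<Sum>j<n. A i j * (v k j * cnj (v k i)))" by (rule sum.swap)
  also have "\<dots> = (\<Sum>i<n. \<Sum>j<n. \<Sum>k<n. A i j * (v k j * cnj (v k i)))"
    by (rule sum.cong[OF refl]) (rule sum.swap)
  also have "\<dots> = (\<Sum>i<n. \<Sum>j<n. A i j * (if j = i then 1 else 0))"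
    by (intro sum.cong refl) (simp add: orthonormal_complete[OF assms] flip: sum_distrib_left)
  also have "\<dots> = (\<Sum>i<n. \<Sum>j<n. if j = i then A i j else 0)" by (intro sum.cong) auto
  finally show ?thesis by simp
qed

lemma sum_prod_eq_trace:
  fixes X W :: "nat \<Rightarrow> nat \<Rightarrow> complex"
  shows "(\<Sum>i<n. \<Sum>j<n. X i j * W j i) = (\<Sum>i<n. (\<Sum>j<n. W i j * X j i))"
  by (subst sum.swap) (rule sum.cong[OF refl], rule sum.cong[OF refl], rule mult.commute)

lemma mv_compose: "mv n (\<lambda>i l. \<Sum>j<n. W i j * X j l) x = mv n W (mv n X x)"
proof
  fix i
  have "mv n (\<lambda>i l. \<Sum>j<n. W i j * X j l) x i = (\<Sum>l<n. \<Sum>j<n. W i j * X j l * x l)"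
    by (simp add: mv_def sum_distrib_right)
  also have "\<dots> = (\<Sum>j<n. \<Sum>l<n. W i j * X j l * x l)" by (rule sum.swap)
  finally show "mv n (\<lambda>i l. \<Sum>j<n. W i j * X j l) x i = mv n W (mv n X x) i"
    by (simp add: mv_def sum_distrib_left mult.assoc)
qed

text \<open>With the trace of \<open>W X\<close> taken in the basis of singular vectors,
  Cauchy-Schwarz bounds each diagonal term by its singular value. Together with
  \<open>tnorm_attained\<close> this characterises the trace norm; the later inequalities rest on
  the pair.\<close>

theorem tnorm_ge:
  assumes X: "X \<in> carrier_mat n n" and W: "contraction n W"
  shows "cmod (\<Sum>i<n. \<Sum>j<n. X $$ (i,j) * W j i) \<le> tnorm X"
proof -
  let ?X = "\<lambda>i j. X $$ (i,j)"
  obtain s v where sv: "\<And>k. k < n \<Longrightarrow> s k \<ge> 0" "orthonormal n n v"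
    "\<And>k l. k < n \<Longrightarrow> l < n \<Longrightarrow> ip n (mv n ?X (v k)) (mv n ?X (v l)) = (if k = l then complex_of_real ((s k)\<^sup>2) else 0)"
    "tnorm X = (\<Sum>k<n. s k)" using tnorm_singular_values[OF X] by blast
  have "(\<Sum>i<n. \<Sum>j<n. X $$ (i,j) * W j i) = (\<Sum>i<n. (\<Sum>j<n. W i j * X $$ (j,i)))"
    by (rule sum_prod_eq_trace)
  also have "\<dots> = (\<Sum>k<n. ip n (v k) (mv n (\<lambda>i l. \<Sum>j<n. W i j * ?X j l) (v k)))"
    by (rule trace_basis[OF sv(2), symmetric])
  also have "\<dots> = (\<Sum>k<n. ip n (v k) (mv n W (mv n ?X (v k))))" by (simp only: mv_compose)
  finally have "cmod (\<Sum>i<n. \<Sum>j<n. X $$ (i,j) * W j i) \<le> (\<Sum>k<n. cmod (ip n (v k) (mv n W (mv n ?X (v k)))))"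
    by (simp only: norm_sum)
  also have "\<dots> \<le> (\<Sum>k<n. s k)"
  proof (rule sum_mono)
    fix k assume "k \<in> {..<n}" then have k: "k < n" by simp
    have 1: "nsq n (v k) = 1" using sv(2) k by (simp add: orthonormal_def nsq_eq_Re_ip)
    have "nsq n (mv n W (mv n ?X (v k))) \<le> nsq n (mv n ?X (v k))" using W by (simp add: contraction_def)
    also have "\<dots> = (s k)\<^sup>2" using sv(3)[OF k k] by (simp add: nsq_eq_Re_ip)
    finally have "sqrt (nsq n (mv n W (mv n ?X (v k)))) \<le> s k" using sv(1)[OF k] by (rule real_le_lsqrt[rotated])
    then show "cmod (ip n (v k) (mv n W (mv n ?X (v k)))) \<le> s k"
      using cauchy_schwarz_ip[of n "v k" "mv n W (mv n ?X (v k))"] 1 by simp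
  qed
  finally show ?thesis using sv(4) by simp
qed

theorem tnorm_attained:
  assumes X: "X \<in> carrier_mat n n"
  obtains W where "contraction n W" "(\<Sum>i<n. \<Sum>j<n. X $$ (i,j) * W j i) = of_real (tnorm X)"
proof -
  let ?X = "\<lambda>i j. X $$ (i,j)"
  obtain s v where sv: "\<And>k. k < n \<Longrightarrow> s k \<ge> 0" "orthonormal n n v"
    "\<And>k l. k < n \<Longrightarrow> l < n \<Longrightarrow> ip n (mv n ?X (v k)) (mv n ?X (v l)) = (if k = l then complex_of_real ((s k)\<^sup>2) else 0)"
    "tnorm X = (\<Sum>k<n. s k)" using tnorm_singular_values[OF X] by blast
  \<comment> \<open>Normalised images of the singular vectors. Division by zero makes
    \<open>w k\<close> zero for a vanishing singular value, so \<open>W\<close> is a partial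
    isometry from left to right singular vectors.\<close>
  define w where "w k i = complex_of_real (1 / s k) * mv n ?X (v k) i" for k i
  define W where "W i j = (\<Sum>k<n. v k i * cnj (w k j))" for i j
  have w_ip: "ip n (w k) (w l) = (if k = l \<and> s k \<noteq> 0 then 1 else 0)" if "k < n" "l < n" for k l
  proof -
    have "ip n (w k) (w l) = cnj (complex_of_real (1 / s k)) * (complex_of_real (1 / s l) * (if k = l then complex_of_real ((s k)\<^sup>2) else 0))"
      unfolding w_def ip_scale_left ip_scale_right using sv(3)[OF that] by simp
    then show ?thesis by (auto simp: power2_eq_square)
  qed
  have mvW: "mv n W x i = (\<Sum>k<n. ip n (w k) x * v k i)" for x i
  proof -
    have "mv n W x i = (\<Sum>j<n. \<Sum>k<n. v k i * cnj (w k j) * x j)"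
      by (simp add: mv_def W_def sum_distrib_right)
    also have "\<dots> = (\<Sum>k<n. \<Sum>j<n. v k i * cnj (w k j) * x j)" by (rule sum.swap)
    finally show ?thesis by (simp add: ip_def sum_distrib_left sum_distrib_right ac_simps)
  qed
  have "contraction n W"
    unfolding contraction_def
  proof
    fix x
    have z: "ip n (w k) x = 0" if "k < n" "s k = 0" for k
    proof -
      have "w k i = 0" for i using that by (simp add: w_def)
      then show ?thesis by (simp add: ip_def)
    qed
    have "nsq n (\<lambda>i. x i - (\<Sum>a<n. ip n (w a) x * w a i)) = nsq n x - (\<Sum>a<n. (cmod (ip n (w a) x))\<^sup>2)"
      by (rule nsq_sub_proj_gen) (use w_ip z in auto)
    then have "(\<Sum>a<n. (cmod (ip n (w a) x))\<^sup>2) \<le> nsq n x"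
      using nsq_nonneg[of n "\<lambda>i. x i - (\<Sum>a<n. ip n (w a) x * w a i)"] by linarith
    moreover have "nsq n (mv n W x) = (\<Sum>a<n. (cmod (ip n (w a) x))\<^sup>2)"
      using nsq_comb_orthonormal[OF sv(2), of "\<lambda>k. ip n (w k) x"] by (simp add: mvW[abs_def])
    ultimately show "nsq n (mv n W x) \<le> nsq n x" by simp
  qed
  moreover have "(\<Sum>i<n. \<Sum>j<n. X $$ (i,j) * W j i) = of_real (tnorm X)"
  proof -
    have "(\<Sum>i<n. \<Sum>j<n. X $$ (i,j) * W j i) = (\<Sum>i<n. (\<Sum>j<n. W i j * X $$ (j,i)))"
    by (rule sum_prod_eq_trace)
  also have "\<dots> = (\<Sum>l<n. ip n (v l) (mv n (\<lambda>i l. \<Sum>j<n. W i j * ?X j l) (v l)))"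
    by (rule trace_basis[OF sv(2), symmetric])
  also have "\<dots> = (\<Sum>l<n. ip n (v l) (mv n W (mv n ?X (v l))))" by (simp only: mv_compose)
    also have "\<dots> = (\<Sum>l<n. of_real (s l))"
    proof (intro sum.cong refl)
      fix l assume "l \<in> {..<n}" then have l: "l < n" by simp
      have c: "ip n (w k) (mv n ?X (v l)) = (if k = l then of_real (s k) else 0)" if "k < n" for k
        unfolding w_def ip_scale_left using sv(3)[OF that l] by (simp add: power2_eq_square)
      have "ip n (v l) (mv n W (mv n ?X (v l))) = ip n (v l) (\<lambda>i. \<Sum>k<n. ip n (w k) (mv n ?X (v l)) * v k i)"
        by (simp add: mvW[abs_def])
      also have "\<dots> = (\<Sum>k<n. ip n (w k) (mv n ?X (v l)) * ip n (v l) (v k))"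
        by (simp add: ip_sum_right ip_scale_right)
      also have "\<dots> = (\<Sum>k<n. if k = l then of_real (s k) else 0)"
        using sv(2) l c by (intro sum.cong) (auto simp: orthonormal_def)
      finally show "ip n (v l) (mv n W (mv n ?X (v l))) = of_real (s l)" using l by simp
    qed
    finally show ?thesis using sv(4) by simp
  qed
  ultimately show ?thesis using that by blast
qed

lemma contraction_entry_le_1:
  assumes "contraction n W" "i < n" "j < n"
  shows "cmod (W i j) \<le> 1"
proof -
  have "(cmod (W i j))\<^sup>2 \<le> nsq n (mv n W (\<lambda>i. if i = j then 1 else 0))"
    unfolding mv_unit[OF assms(3)] nsq_def using assms(2)
    by (intro member_le_sum[where f = "\<lambda>i. (cmod (W i j))\<^sup>2"]) auto
  also have "\<dots> \<le> nsq n (\<lambda>i. if i = j then 1 else 0)" using assms(1) by (simp add: contraction_def)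
  also have "\<dots> = 1" by (rule nsq_unit[OF assms(3)])
  finally have "(cmod (W i j))\<^sup>2 \<le> 1\<^sup>2" by simp
  then show ?thesis by (rule power2_le_imp_le) simp
qed

lemma tnorm_nonneg:
  assumes "X \<in> carrier_mat n n" shows "tnorm X \<ge> 0"
proof -
  have "contraction n (\<lambda>_ _. 0)" by (simp add: contraction_def mv_def nsq_def sum_nonneg)
  from tnorm_ge[OF assms this] show ?thesis by simp
qed

text \<open>A crude bound, sufficient for continuity, integrability and vanishing.\<close>

lemma tnorm_le_sum_entries:
  assumes "X \<in> carrier_mat n n"
  shows "tnorm X \<le> (\<Sum>i<n. \<Sum>j<n. cmod (X $$ (i,j)))"
proof -
  obtain W where W: "contraction n W" "(\<Sum>i<n. \<Sum>j<n. X $$ (i,j) * W j i) = of_real (tnorm X)"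
    using tnorm_attained[OF assms] by blast
  have "tnorm X \<le> cmod (of_real (tnorm X))" by simp
  also have "\<dots> = cmod (\<Sum>i<n. \<Sum>j<n. X $$ (i,j) * W j i)" by (simp only: W(2))
  also have "\<dots> \<le> (\<Sum>i<n. \<Sum>j<n. cmod (X $$ (i,j) * W j i))"
    by (intro order_trans[OF norm_sum] sum_mono norm_sum)
  also have "\<dots> \<le> (\<Sum>i<n. \<Sum>j<n. cmod (X $$ (i,j)))"
    using contraction_entry_le_1[OF W(1)] by (intro sum_mono) (simp add: norm_mult mult_left_le)
  finally show ?thesis .
qed

lemma tnorm_diff_triangle:
  assumes "X \<in> carrier_mat n n" "Y \<in> carrier_mat n n" "Z \<in> carrier_mat n n"
  shows "tnorm (X - Z) \<le> tnorm (X - Y) + tnorm (Y - Z)"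
proof -
  have c: "X - Z \<in> carrier_mat n n" "X - Y \<in> carrier_mat n n" "Y - Z \<in> carrier_mat n n" using assms by auto
  obtain W where W: "contraction n W" "(\<Sum>i<n. \<Sum>j<n. (X - Z) $$ (i,j) * W j i) = of_real (tnorm (X - Z))"
    using tnorm_attained[OF c(1)] by blast
  have "(\<Sum>i<n. \<Sum>j<n. (X - Z) $$ (i,j) * W j i)
      = (\<Sum>i<n. \<Sum>j<n. (X - Y) $$ (i,j) * W j i) + (\<Sum>i<n. \<Sum>j<n. (Y - Z) $$ (i,j) * W j i)"
    using assms unfolding sum.distrib[symmetric] by (intro sum.cong refl) (auto simp: algebra_simps)
  then have "of_real (tnorm (X - Z)) = (\<Sum>i<n. \<Sum>j<n. (X - Y) $$ (i,j) * W j i) + (\<Sum>i<n. \<Sum>j<n. (Y - Z) $$ (i,j) * W j i)"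
    unfolding W(2) .
  then have "cmod (of_real (tnorm (X - Z))) \<le> cmod (\<Sum>i<n. \<Sum>j<n. (X - Y) $$ (i,j) * W j i) + cmod (\<Sum>i<n. \<Sum>j<n. (Y - Z) $$ (i,j) * W j i)"
    by (simp only: norm_triangle_ineq)
  then show ?thesis using tnorm_ge[OF c(2) W(1)] tnorm_ge[OF c(3) W(1)] by simp
qed

lemma tnorm_diff_commute:
  assumes "X \<in> carrier_mat n n" "Y \<in> carrier_mat n n"
  shows "tnorm (X - Y) = tnorm (Y - X)"
proof -
  have "tnorm (X - Y) \<le> tnorm (Y - X)" if "X \<in> carrier_mat n n" "Y \<in> carrier_mat n n" for X Y
  proof -
    have c: "X - Y \<in> carrier_mat n n" "Y - X \<in> carrier_mat n n" using that by auto
    obtain W where W: "contraction n W" "(\<Sum>i<n. \<Sum>j<n. (X - Y) $$ (i,j) * W j i) = of_real (tnorm (X - Y))"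
      using tnorm_attained[OF c(1)] by blast
    have "(\<Sum>i<n. \<Sum>j<n. (Y - X) $$ (i,j) * W j i) = - (\<Sum>i<n. \<Sum>j<n. (X - Y) $$ (i,j) * W j i)"
      using that unfolding sum_negf[symmetric] by (intro sum.cong refl) (auto simp: algebra_simps)
    then show ?thesis using tnorm_ge[OF c(2) W(1)] unfolding W(2) by simp
  qed
  then show ?thesis using assms by (intro antisym) auto
qed

lemma tnorm_triangle2:
  assumes "X \<in> carrier_mat n n" "Y \<in> carrier_mat n n"
  shows "tnorm (X - Y) \<le> tnorm X + tnorm Y"
proof -
  have 0: "X - 0\<^sub>m n n = X" "Y - 0\<^sub>m n n = Y" using assms by (auto intro!: eq_matI)
  have "tnorm (X - Y) \<le> tnorm (X - 0\<^sub>m n n) + tnorm (0\<^sub>m n n - Y)"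
    by (rule tnorm_diff_triangle) (use assms in auto)
  then show ?thesis using tnorm_diff_commute[of "0\<^sub>m n n" n Y] assms 0 by simp
qed

lemma tnorm_lipschitz:
  assumes "X \<in> carrier_mat n n" "Y \<in> carrier_mat n n"
  shows "\<bar>tnorm X - tnorm Y\<bar> \<le> tnorm (X - Y)"
proof -
  have 0: "X - 0\<^sub>m n n = X" "Y - 0\<^sub>m n n = Y" using assms by (auto intro!: eq_matI)
  show ?thesis
    using tnorm_diff_triangle[of X n Y "0\<^sub>m n n"] tnorm_diff_triangle[of Y n X "0\<^sub>m n n"] tnorm_diff_commute[OF assms] assms 0
    by simp
qed

text \<open>Cauchy-Schwarz in arithmetic-geometric form. Sums and integrals of the right side split
  into two separate terms, so \<open>c\<close> can be chosen after averaging.\<close>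

lemma cmod_ip_le_am_gm: "c > 0 \<Longrightarrow> cmod (ip n x y) \<le> (c * nsq n y + nsq n x / c) / 2"
proof -
  assume c: "c > 0"
  have am: "a * b \<le> (c * b\<^sup>2 + a\<^sup>2 / c) / 2" for a b :: real
  proof -
    have "0 \<le> (c * b - a)\<^sup>2 / c" using c by simp
    also have "\<dots> = c * b\<^sup>2 + a\<^sup>2 / c - 2 * (a * b)" using c by (simp add: power2_eq_square field_simps)
    finally show ?thesis by simp
  qed
  have "cmod (ip n x y) \<le> (\<Sum>i<n. cmod (x i) * cmod (y i))"
    unfolding ip_def by (rule order_trans[OF norm_sum]) (simp add: norm_mult)
  also have "\<dots> \<le> (\<Sum>i<n. (c * (cmod (y i))\<^sup>2 + (cmod (x i))\<^sup>2 / c) / 2)" by (intro sum_mono am)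
  also have "\<dots> = (c * nsq n y + nsq n x / c) / 2"
    by (simp add: nsq_def sum_distrib_left sum_divide_distrib sum.distrib add_divide_distrib)
  finally show ?thesis .
qed

text \<open>The squared Frobenius norm. \<open>K\<close> is read as a factor with \<open>n\<close>
  rows and \<open>N\<close> columns of the positive matrix formed by \<open>K\<close> and its
  adjoint.\<close>

definition fro :: "nat \<Rightarrow> nat \<Rightarrow> (nat \<Rightarrow> nat \<Rightarrow> complex) \<Rightarrow> real" where
  "fro n N K = (\<Sum>i<n. \<Sum>m<N. (cmod (K i m))\<^sup>2)"

lemma fro_nonneg [simp]: "fro n N K \<ge> 0" by (simp add: fro_def sum_nonneg)

lemma fro_columns: "fro n N K = (\<Sum>m<N. nsq n (\<lambda>i. K i m))"
  unfolding fro_def nsq_def by (rule sum.swap)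

lemma fro_rows: "fro n N K = (\<Sum>i<n. nsq N (K i))"
  unfolding fro_def nsq_def ..

lemma gram_trace:
  "(\<Sum>i<n. \<Sum>j<n. (\<Sum>m<N. K i m * cnj (L j m)) * W j i) = (\<Sum>m<N. ip n (\<lambda>i. L i m) (mv n W (\<lambda>i. K i m)))"
proof -
  have "(\<Sum>i<n. \<Sum>j<n. (\<Sum>m<N. K i m * cnj (L j m)) * W j i) = (\<Sum>j<n. \<Sum>i<n. \<Sum>m<N. K i m * cnj (L j m) * W j i)"
    by (subst sum.swap) (simp add: sum_distrib_right)
  also have "\<dots> = (\<Sum>j<n. \<Sum>m<N. \<Sum>i<n. K i m * cnj (L j m) * W j i)"
    by (rule sum.cong[OF refl]) (rule sum.swap)
  also have "\<dots> = (\<Sum>m<N. \<Sum>j<n. \<Sum>i<n. K i m * cnj (L j m) * W j i)" by (rule sum.swap)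
  finally show ?thesis by (simp add: ip_def mv_def sum_distrib_left sum_distrib_right ac_simps)
qed

text \<open>Hoelder's inequality between trace and Frobenius norms, with the product split by
  \<open>c\<close>.\<close>

lemma tnorm_gram_le:
  assumes X: "X \<in> carrier_mat n n" and c: "c > 0"
    and e: "\<And>i j. i < n \<Longrightarrow> j < n \<Longrightarrow> X $$ (i,j) = (\<Sum>m<N. K i m * cnj (L j m))"
  shows "tnorm X \<le> (c * fro n N K + fro n N L / c) / 2"
proof -
  obtain W where W: "contraction n W" "(\<Sum>i<n. \<Sum>j<n. X $$ (i,j) * W j i) = of_real (tnorm X)"
    using tnorm_attained[OF X] by blast
  have "(\<Sum>i<n. \<Sum>j<n. X $$ (i,j) * W j i) = (\<Sum>i<n. \<Sum>j<n. (\<Sum>m<N. K i m * cnj (L j m)) * W j i)"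
    by (intro sum.cong refl) (simp add: e)
  also note gram_trace
  finally have t: "complex_of_real (tnorm X) = (\<Sum>m<N. ip n (\<lambda>i. L i m) (mv n W (\<lambda>i. K i m)))"
    unfolding W(2) .
  have "tnorm X \<le> cmod (of_real (tnorm X))" by simp
  also have "\<dots> = cmod (\<Sum>m<N. ip n (\<lambda>i. L i m) (mv n W (\<lambda>i. K i m)))" by (simp only: t)
  also have "\<dots> \<le> (\<Sum>m<N. cmod (ip n (\<lambda>i. L i m) (mv n W (\<lambda>i. K i m))))" by (rule norm_sum)
  also have "\<dots> \<le> (\<Sum>m<N. (c * nsq n (\<lambda>i. K i m) + nsq n (\<lambda>i. L i m) / c) / 2)"
  proof (rule sum_mono)
    fix m
    have "cmod (ip n (\<lambda>i. L i m) (mv n W (\<lambda>i. K i m))) \<le> (c * nsq n (mv n W (\<lambda>i. K i m)) + nsq n (\<lambda>i. L i m) / c) / 2"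
      by (rule cmod_ip_le_am_gm[OF c])
    also have "\<dots> \<le> (c * nsq n (\<lambda>i. K i m) + nsq n (\<lambda>i. L i m) / c) / 2"
      using W(1) c by (intro divide_right_mono add_right_mono mult_left_mono) (auto simp: contraction_def)
    finally show "cmod (ip n (\<lambda>i. L i m) (mv n W (\<lambda>i. K i m))) \<le> (c * nsq n (\<lambda>i. K i m) + nsq n (\<lambda>i. L i m) / c) / 2" .
  qed
  also have "\<dots> = (c * fro n N K + fro n N L / c) / 2"
    by (simp add: fro_columns sum_distrib_left sum_divide_distrib sum.distrib add_divide_distrib)
  finally show ?thesis .
qed

text \<open>Polarisation: \<open>KK* - LL* = ((K-L)(K+L)* + (K+L)(K-L)*)/2\<close>.\<close>
lemma tnorm_gram_diff_le:
  assumes X: "X \<in> carrier_mat n n" and c: "c > 0"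
    and e: "\<And>i j. i < n \<Longrightarrow> j < n \<Longrightarrow> X $$ (i,j) = (\<Sum>m<N. K i m * cnj (K j m)) - (\<Sum>m<N. L i m * cnj (L j m))"
  shows "tnorm X \<le> (c * fro n N (\<lambda>i m. K i m - L i m) + fro n N (\<lambda>i m. K i m + L i m) / c) / 2"
proof -
  let ?D = "\<lambda>i m. K i m - L i m" and ?S = "\<lambda>i m. K i m + L i m"
  let ?Y = "Matrix.mat n n (\<lambda>(i,j). \<Sum>m<N. ?D i m * cnj (?S j m) / 2)"
  let ?Z = "Matrix.mat n n (\<lambda>(i,j). \<Sum>m<N. (- ?S i m / 2) * cnj (?D j m))"
  have XY: "X = ?Y - ?Z"
    using X by (intro eq_matI) (auto simp: e sum_subtractf[symmetric] field_simps intro!: sum.cong)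
  have 1: "tnorm ?Y \<le> (c * fro n N ?D + fro n N (\<lambda>i m. ?S i m / 2) / (c/4)) / 2 / 2"
  proof -
    have "tnorm ?Y \<le> ((c/2) * fro n N ?D + fro n N (\<lambda>i m. ?S i m / 2) / (c/2)) / 2"
      by (rule tnorm_gram_le) (use c in auto)
    then show ?thesis by (simp add: field_simps)
  qed
  have 2: "tnorm ?Z \<le> (4 * fro n N (\<lambda>i m. - ?S i m / 2) / c + c * fro n N ?D) / 2 / 2"
  proof -
    have "tnorm ?Z \<le> ((2/c) * fro n N (\<lambda>i m. - ?S i m / 2) + fro n N ?D / (2/c)) / 2"
      by (rule tnorm_gram_le) (use c in auto)
    then show ?thesis using c by (simp add: field_simps)
  qed
  have h: "fro n N (\<lambda>i m. ?S i m / 2) = fro n N ?S / 4" "fro n N (\<lambda>i m. - ?S i m / 2) = fro n N ?S / 4"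
    by (simp_all add: fro_def norm_divide power_divide sum_divide_distrib norm_minus_cancel del: minus_add_distrib)
  have "tnorm X \<le> tnorm ?Y + tnorm ?Z" unfolding XY by (rule tnorm_triangle2) auto
  then show ?thesis using 1 2 unfolding h by (simp add: field_simps)
qed

text \<open>The rows of the product are, up to conjugation, the images of the rows of
  \<open>S\<close> under the adjoint of \<open>W\<close>.\<close>

lemma fro_contraction_right:
  assumes "contraction N W"
  shows "fro n N (\<lambda>i m. \<Sum>k<N. S i k * W k m) \<le> fro n N S"
  unfolding fro_rows
proof (rule sum_mono)
  fix i
  have "nsq N (\<lambda>m. \<Sum>k<N. S i k * W k m) = nsq N (\<lambda>m. cnj (\<Sum>k<N. S i k * W k m))"
    by (simp only: nsq_def complex_mod_cnj)
  also have "(\<lambda>m. cnj (\<Sum>k<N. S i k * W k m)) = mv N (\<lambda>i j. cnj (W j i)) (\<lambda>k. cnj (S i k))"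
    by (rule ext) (simp add: mv_def cnj_sum mult.commute)
  also have "nsq N \<dots> \<le> nsq N (\<lambda>k. cnj (S i k))"
    using contraction_adj[OF assms] by (simp add: contraction_def)
  finally show "nsq N (\<lambda>m. \<Sum>k<N. S i k * W k m) \<le> nsq N (S i)" by (simp add: nsq_def)
qed

text \<open>Duality of the trace norm in the form of Uhlmann's theorem: \<open>W\<close> acts on the
  purifying index of the root of \<sigma> and makes its overlap with the root of \<rho> equal to the
  fidelity.\<close>

lemma fid_attained:
  assumes "psd n \<rho>" "psd n \<sigma>"
  obtains W where "contraction n W"
    "(\<Sum>i<n. \<Sum>m<n. cnj (msqrt n \<rho> $$ (i,m)) * (\<Sum>k<n. msqrt n \<sigma> $$ (i,k) * W k m)) = of_real (fid \<rho> \<sigma>)"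
proof -
  let ?R = "msqrt n \<rho>" and ?S = "msqrt n \<sigma>"
  have c: "?R \<in> carrier_mat n n" "?S \<in> carrier_mat n n"
    using msqrt_psd[OF assms(1)] msqrt_psd[OF assms(2)] psd_carrier by auto
  have d: "dim_row \<rho> = n" "dim_row \<sigma> = n" using assms psd_carrier by auto
  have c': "?R * ?S \<in> carrier_mat n n" using c by (intro mult_carrier_mat[of _ n n]) auto
  obtain W where W: "contraction n W" "(\<Sum>i<n. \<Sum>j<n. (?R * ?S) $$ (i,j) * W j i) = of_real (tnorm (?R * ?S))"
    using tnorm_attained[OF c'] by blast
  have h: "?R $$ (i,k) = cnj (?R $$ (k,i))" if "i < n" "k < n" for i k
    using psd_hermitian[OF msqrt_psd[OF assms(1)] that(2,1)] .
  have "(\<Sum>i<n. \<Sum>j<n. (?R * ?S) $$ (i,j) * W j i) = (\<Sum>i<n. \<Sum>j<n. \<Sum>k<n. cnj (?R $$ (k,i)) * ?S $$ (k,j) * W j i)"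
  proof (intro sum.cong refl)
    fix i j assume ij: "i \<in> {..<n}" "j \<in> {..<n}"
    have "(?R * ?S) $$ (i,j) = (\<Sum>k<n. ?R $$ (i,k) * ?S $$ (k,j))"
      by (rule mat_mult_entry[OF c]) (use ij in auto)
    also have "\<dots> = (\<Sum>k<n. cnj (?R $$ (k,i)) * ?S $$ (k,j))"
      by (rule sum.cong[OF refl], rule arg_cong2[where f="(*)"], rule h) (use ij in auto)
    finally show "(?R * ?S) $$ (i,j) * W j i = (\<Sum>k<n. cnj (?R $$ (k,i)) * ?S $$ (k,j) * W j i)"
      by (simp add: sum_distrib_right)
  qed
  also have "\<dots> = (\<Sum>i<n. \<Sum>k<n. \<Sum>j<n. cnj (?R $$ (k,i)) * ?S $$ (k,j) * W j i)"
    by (rule sum.cong[OF refl]) (rule sum.swap)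
  also have "\<dots> = (\<Sum>k<n. \<Sum>i<n. \<Sum>j<n. cnj (?R $$ (k,i)) * ?S $$ (k,j) * W j i)" by (rule sum.swap)
  also have "\<dots> = (\<Sum>i<n. \<Sum>m<n. cnj (?R $$ (i,m)) * (\<Sum>k<n. ?S $$ (i,k) * W k m))"
    by (simp add: sum_distrib_left mult.assoc)
  finally have "(\<Sum>i<n. \<Sum>m<n. cnj (?R $$ (i,m)) * (\<Sum>k<n. ?S $$ (i,k) * W k m)) = of_real (tnorm (?R * ?S))"
    unfolding W(2) ..
  then show ?thesis using that[OF W(1)] unfolding fid_def d by simp
qed

lemma msqrt_gram:
  assumes "psd n \<rho>" "i < n" "j < n"
  shows "\<rho> $$ (i,j) = (\<Sum>m<n. msqrt n \<rho> $$ (i,m) * cnj (msqrt n \<rho> $$ (j,m)))"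
proof -
  have c: "msqrt n \<rho> \<in> carrier_mat n n" using msqrt_psd[OF assms(1)] psd_carrier by auto
  have "\<rho> $$ (i,j) = (msqrt n \<rho> * msqrt n \<rho>) $$ (i,j)" using msqrt_square[OF assms(1)] by simp
  also have "\<dots> = (\<Sum>m<n. msqrt n \<rho> $$ (i,m) * msqrt n \<rho> $$ (m,j))" by (rule mat_mult_entry[OF c c assms(2,3)])
  also have "\<dots> = (\<Sum>m<n. msqrt n \<rho> $$ (i,m) * cnj (msqrt n \<rho> $$ (j,m)))"
    by (intro sum.cong refl arg_cong2[where f="(*)"] psd_hermitian[OF msqrt_psd[OF assms(1)]]) (use assms in auto)
  finally show ?thesis .
qed

lemma fro_msqrt:
  assumes "psd n \<rho>"
  shows "fro n n (\<lambda>i j. msqrt n \<rho> $$ (i,j)) = Re (tr \<rho>)"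
proof -
  have "Re (tr \<rho>) = (\<Sum>i<n. Re (\<Sum>m<n. msqrt n \<rho> $$ (i,m) * cnj (msqrt n \<rho> $$ (i,m))))"
    using psd_carrier[OF assms] msqrt_gram[OF assms] by (simp add: tr_def)
  then show ?thesis by (simp add: fro_def cmod_power2 flip: power2_eq_square)
qed

lemma gram_form:
  assumes "\<And>p q. p < n \<Longrightarrow> q < n \<Longrightarrow> M p q = (\<Sum>m<N. S p m * cnj (S q m))"
  shows "ip n x (mv n M x) = of_real (\<Sum>m<N. (cmod (\<Sum>p<n. cnj (S p m) * x p))\<^sup>2)"
proof -
  have "ip n x (mv n M x) = (\<Sum>p<n. \<Sum>q<n. (\<Sum>m<N. (cnj (x p) * S p m) * (cnj (S q m) * x q)))"
    unfolding ip_def mv_def sum_distrib_left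
    by (intro sum.cong refl) (simp add: assms sum_distrib_left sum_distrib_right mult.assoc)
  also have "\<dots> = (\<Sum>p<n. \<Sum>m<N. \<Sum>q<n. (cnj (x p) * S p m) * (cnj (S q m) * x q))"
    by (rule sum.cong[OF refl], rule sum.swap)
  also have "\<dots> = (\<Sum>m<N. \<Sum>p<n. \<Sum>q<n. (cnj (x p) * S p m) * (cnj (S q m) * x q))" by (rule sum.swap)
  also have "\<dots> = (\<Sum>m<N. cnj (\<Sum>q<n. cnj (S q m) * x q) * (\<Sum>q<n. cnj (S q m) * x q))"
    unfolding sum_product[symmetric] by (intro sum.cong refl arg_cong2[where f="(*)"]) (simp add: cnj_sum mult.commute)
  also have "\<dots> = of_real (\<Sum>m<N. (cmod (\<Sum>p<n. cnj (S p m) * x p))\<^sup>2)"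
    by (simp add: complex_norm_square mult.commute del: of_real_power)
  finally show ?thesis .
qed

section \<open>Moments of the Haar measure on the sphere\<close>

text \<open>Agrees with \<open>apply_mat\<close> for the matrix with entries \<open>u\<close>,
  including the value 0 from \<open>d\<close> on, so that explicit kernels can be used as
  unitaries.\<close>

definition umap :: "nat \<Rightarrow> (nat \<Rightarrow> nat \<Rightarrow> complex) \<Rightarrow> (nat \<Rightarrow> complex) \<Rightarrow> nat \<Rightarrow> complex" where
  "umap d u x = (\<lambda>i. if i < d then mv d u x i else 0)"

lemma measurable_borel_coordinate [measurable]: "(\<lambda>x::nat\<Rightarrow>complex. x i) \<in> borel_measurable borel"
  by (rule borel_measurable_continuous_onI) (rule continuous_on_product_coordinates)

lemma borel_measurable_cnj [measurable (raw)]: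
  "f \<in> borel_measurable M \<Longrightarrow> (\<lambda>x. cnj (f x)) \<in> borel_measurable M"
  by (rule measurable_compose[OF _ borel_measurable_continuous_onI]) (auto intro: continuous_intros)

lemma measurable_umap [measurable]: "umap d u \<in> borel_measurable borel"
  unfolding umap_def mv_def
  by (rule measurable_coordinatewise_then_product) measurable

text \<open>With no parametrisation of the sphere at hand, the integrals over it are computed from
  invariance under particular unitaries.\<close>

locale haar =
  fixes d :: nat and \<mu> :: "(nat \<Rightarrow> complex) measure"
  assumes haar: "haar_sphere d \<mu>"
begin

lemma prob: "prob_space \<mu>" and sets_mu [measurable_cong]: "sets \<mu> = sets borel"
  using haar by (auto simp: haar_sphere_def)

sublocale prob_space \<mu> by (rule prob)

lemma space_mu [simp]: "space \<mu> = UNIV"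
  using sets_eq_imp_space_eq[OF sets_mu] by simp

lemma prob_UNIV [simp]: "prob UNIV = 1"
  using prob_space by simp

lemma AE_unit_sphere: "AE x in \<mu>. x \<in> unit_sphere_c d"
proof -
  have e: "emeasure \<mu> (unit_sphere_c d) = 1" using haar by (simp add: haar_sphere_def)
  \<comment> \<open>A set outside the sigma-algebra would have measure 0, so the assumed mass 1
    makes the sphere measurable.\<close>
  then have "unit_sphere_c d \<in> sets \<mu>" by (metis emeasure_notin_sets zero_neq_one)
  then show ?thesis using e by (intro AE_prob_1) (simp add: measure_def)
qed

lemma AE_sphere: "AE x in \<mu>. nsq d x = 1"
  using AE_unit_sphere by eventually_elim (simp add: unit_sphere_c_def nsq_def)

lemma distr_umap:
  assumes "\<And>i j. i < d \<Longrightarrow> j < d \<Longrightarrow> (\<Sum>k<d. cnj (u k i) * u k j) = (if i = j then 1 else 0)"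
  shows "distr \<mu> borel (umap d u) = \<mu>"
proof -
  define U where "U = Matrix.mat d d (\<lambda>(i,j). u i j)"
  have U: "U \<in> carrier_mat d d" by (simp add: U_def)
  have "adj U * U = 1\<^sub>m d"
  proof (rule eq_matI)
    fix i j assume "i < dim_row (1\<^sub>m d)" "j < dim_col (1\<^sub>m d)"
    then have ij: "i < d" "j < d" by auto
    have "(adj U * U) $$ (i,j) = (\<Sum>k<d. adj U $$ (i,k) * U $$ (k,j))"
      by (rule mat_mult_entry[OF adj_carrier[OF U] U ij])
    also have "\<dots> = (\<Sum>k<d. cnj (u k i) * u k j)"
    proof (rule sum.cong[OF refl])
      fix k assume "k \<in> {..<d}"
      then have "adj U $$ (i,k) = cnj (U $$ (k,i))" "U $$ (k,i) = u k i" "U $$ (k,j) = u k j"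
        using ij by (auto simp: adj_entry[OF U]) (auto simp: U_def)
      then show "adj U $$ (i,k) * U $$ (k,j) = cnj (u k i) * u k j" by simp
    qed
    finally show "(adj U * U) $$ (i,j) = 1\<^sub>m d $$ (i,j)" using assms[OF ij] ij by simp
  qed (use U in \<open>auto simp: adj_def\<close>)
  then have "unitary d U" using U by (simp add: unitary_def)
  then have "distr \<mu> borel (apply_mat U) = \<mu>" using haar by (simp add: haar_sphere_def)
  moreover have "apply_mat U = umap d u"
    by (intro ext) (auto simp: apply_mat_def umap_def mv_def U_def intro!: sum.cong)
  ultimately show ?thesis by simp
qed

lemma umap_measurable_mu: "umap d u \<in> measurable \<mu> borel"
  by (subst measurable_cong_sets[OF sets_mu refl]) (rule measurable_umap)

lemma integral_umap:
  fixes g :: "_ \<Rightarrow> 'b::{banach,second_countable_topology}"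
  assumes "\<And>i j. i < d \<Longrightarrow> j < d \<Longrightarrow> (\<Sum>k<d. cnj (u k i) * u k j) = (if i = j then 1 else 0)"
    and "g \<in> borel_measurable borel"
  shows "(\<integral>x. g (umap d u x) \<partial>\<mu>) = (\<integral>x. g x \<partial>\<mu>)"
  using integral_distr[OF umap_measurable_mu assms(2), of u] distr_umap[OF assms(1)] by simp

lemma nn_integral_umap:
  assumes "\<And>i j. i < d \<Longrightarrow> j < d \<Longrightarrow> (\<Sum>k<d. cnj (u k i) * u k j) = (if i = j then 1 else 0)"
    and "g \<in> borel_measurable borel"
  shows "(\<integral>\<^sup>+x. g (umap d u x) \<partial>\<mu>) = (\<integral>\<^sup>+x. g x \<partial>\<mu>)"
  using nn_integral_distr[OF umap_measurable_mu, of g u] assms(2) distr_umap[OF assms(1)] by simp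

lemma integrable_bounded_sphere:
  fixes g :: "_ \<Rightarrow> 'b::{banach,second_countable_topology}"
  assumes "g \<in> borel_measurable borel" "\<And>x. nsq d x = 1 \<Longrightarrow> norm (g x) \<le> B"
  shows "integrable \<mu> g"
proof (rule integrable_const_bound[where B = B])
  show "AE x in \<mu>. norm (g x) \<le> B" using AE_sphere by eventually_elim (rule assms(2))
  show "g \<in> borel_measurable \<mu>" by (subst measurable_cong_sets[OF sets_mu refl]) (rule assms(1))
qed

end

section \<open>Second and fourth moments of the coordinates\<close>

lemma sphere_coord_le_1:
  assumes "nsq d x = 1" "i < d" shows "cmod (x i) \<le> 1"
proof -
  have "(cmod (x i))\<^sup>2 \<le> nsq d x" unfolding nsq_def by (rule member_le_sum) (use assms in auto)
  then have "(cmod (x i))\<^sup>2 \<le> 1\<^sup>2" using assms by simp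
  then show ?thesis by (rule power2_le_imp_le) simp
qed

definition monom4 :: "nat \<Rightarrow> nat \<Rightarrow> nat \<Rightarrow> nat \<Rightarrow> (nat \<Rightarrow> complex) \<Rightarrow> complex" where
  "monom4 i j k l x = x i * cnj (x j) * x k * cnj (x l)"

lemma measurable_monom4 [measurable]: "monom4 i j k l \<in> borel_measurable borel"
  unfolding monom4_def by measurable

text \<open>A quarter turn of one coordinate. The factor \<open>\<i>\<close>, rather than -1, also
  distinguishes \<open>x p * x p\<close> from \<open>x p * cnj (x p)\<close>.\<close>

definition phase_mat :: "nat \<Rightarrow> nat \<Rightarrow> nat \<Rightarrow> complex" where
  "phase_mat p i j = (if i = j then (if i = p then \<i> else 1) else 0)"

lemma phase_mat_unitary:
  "i < d \<Longrightarrow> j < d \<Longrightarrow> (\<Sum>k<d. cnj (phase_mat p k i) * phase_mat p k j) = (if i = j then 1 else 0)"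
proof -
  assume ij: "i < d" "j < d"
  have "(\<Sum>k<d. cnj (phase_mat p k i) * phase_mat p k j) = (\<Sum>k<d. if k = i then (if i = j then 1 else 0) else 0)"
    by (intro sum.cong) (auto simp: phase_mat_def)
  then show ?thesis using ij by simp
qed

lemma umap_phase: "i < d \<Longrightarrow> umap d (phase_mat p) x i = (if i = p then \<i> else 1) * x i"
proof -
  assume i: "i < d"
  have "mv d (phase_mat p) x i = (\<Sum>j<d. if j = i then (if i = p then \<i> else 1) * x i else 0)"
    unfolding mv_def by (intro sum.cong) (auto simp: phase_mat_def)
  then show ?thesis using i by (simp add: umap_def)
qed

definition hr :: complex where "hr = of_real (1 / sqrt 2)"

lemma hr_simps [simp]: "hr * hr = 1 / 2" "cnj hr = hr"
  by (simp_all add: hr_def flip: of_real_mult)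

definition hadamard_mat :: "nat \<Rightarrow> nat \<Rightarrow> nat \<Rightarrow> nat \<Rightarrow> complex" where
  "hadamard_mat p q i j =
    (if i = p then (if j = p \<or> j = q then hr else 0)
     else if i = q then (if j = p then hr else if j = q then - hr else 0)
     else if i = j then 1 else 0)"

lemma sum_two_points:
  fixes f :: "nat \<Rightarrow> 'a::comm_monoid_add"
  assumes "p < d" "q < d" "p \<noteq> q" "\<And>k. k \<noteq> p \<Longrightarrow> k \<noteq> q \<Longrightarrow> f k = 0"
  shows "(\<Sum>k<d. f k) = f p + f q"
proof -
  have "(\<Sum>k<d. f k) = (\<Sum>k\<in>{p,q}. f k)"
    by (rule sum.mono_neutral_right) (use assms in auto)
  then show ?thesis using assms by simp
qed

lemma umap_hadamard:
  assumes "p < d" "q < d" "p \<noteq> q"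
  shows "umap d (hadamard_mat p q) x p = hr * (x p + x q)"
    "umap d (hadamard_mat p q) x q = hr * (x p - x q)"
proof -
  have "mv d (hadamard_mat p q) x p = hadamard_mat p q p p * x p + hadamard_mat p q p q * x q"
    unfolding mv_def by (rule sum_two_points[OF assms]) (simp add: hadamard_mat_def)
  then show "umap d (hadamard_mat p q) x p = hr * (x p + x q)"
    using assms by (simp add: umap_def hadamard_mat_def distrib_left)
  have "mv d (hadamard_mat p q) x q = hadamard_mat p q q p * x p + hadamard_mat p q q q * x q"
    unfolding mv_def by (rule sum_two_points[OF assms]) (use assms in \<open>simp add: hadamard_mat_def\<close>)
  then show "umap d (hadamard_mat p q) x q = hr * (x p - x q)"
    using assms by (simp add: umap_def hadamard_mat_def right_diff_distrib)
qed

lemma hadamard_unitary: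
  assumes pq: "p < d" "q < d" "p \<noteq> q" and ij: "i < d" "j < d"
  shows "(\<Sum>k<d. cnj (hadamard_mat p q k i) * hadamard_mat p q k j) = (if i = j then 1 else 0)"
proof -
  let ?h = "hadamard_mat p q"
  show ?thesis
  proof (cases "i = p \<or> i = q")
    case False
    have "(\<Sum>k<d. cnj (?h k i) * ?h k j) = (\<Sum>k<d. if k = i then ?h i j else 0)"
      by (intro sum.cong) (use False in \<open>auto simp: hadamard_mat_def\<close>)
    also have "\<dots> = ?h i j" using ij by simp
    finally show ?thesis using False by (simp add: hadamard_mat_def)
  next
    case True
    have "(\<Sum>k<d. cnj (?h k i) * ?h k j) = cnj (?h p i) * ?h p j + cnj (?h q i) * ?h q j"
      by (rule sum_two_points[OF pq]) (use True in \<open>auto simp: hadamard_mat_def\<close>)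
    also have "\<dots> = (if i = j then 1 else 0)"
      using True pq by (auto simp: hadamard_mat_def)
    finally show ?thesis .
  qed
qed

context haar begin

lemma integrable_monom4:
  assumes "i < d" "j < d" "k < d" "l < d"
  shows "integrable \<mu> (monom4 i j k l)"
proof (rule integrable_bounded_sphere[where B = 1])
  fix x assume "nsq d x = 1"
  then have le: "cmod (x m) \<le> 1" if "m < d" for m using sphere_coord_le_1 that by blast
  show "norm (monom4 i j k l x) \<le> 1"
    unfolding monom4_def norm_mult complex_mod_cnj using le assms by (intro mult_le_one mult_nonneg_nonneg) auto
qed measurable

text \<open>The quarter turn at \<open>p\<close> multiplies the monomial by a power of
  \<open>\<i>\<close>, the exponent being the number of plain minus the number of conjugated
  occurrences of \<open>p\<close>. This exponent is at most 2 in size, so the factor is 1 only if it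
  vanishes; an imbalance already shows at \<open>p = i\<close> or \<open>p = k\<close>.\<close>

lemma integral_monom4_unbalanced:
  assumes "i < d" "j < d" "k < d" "l < d" "\<not> (i = j \<and> k = l)" "\<not> (i = l \<and> k = j)"
  shows "(\<integral>x. monom4 i j k l x \<partial>\<mu>) = 0"
proof -
  let ?f = "\<lambda>p. (if i = p then \<i> else 1) * (if j = p then - \<i> else 1) * (if k = p then \<i> else 1) * (if l = p then - \<i> else 1)"
  have inv: "(\<integral>x. monom4 i j k l x \<partial>\<mu>) = ?f p * (\<integral>x. monom4 i j k l x \<partial>\<mu>)" for p
  proof -
    have "(\<integral>x. monom4 i j k l x \<partial>\<mu>) = (\<integral>x. monom4 i j k l (umap d (phase_mat p) x) \<partial>\<mu>)"
      by (rule integral_umap[symmetric, OF phase_mat_unitary]) auto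
    also have "(\<lambda>x. monom4 i j k l (umap d (phase_mat p) x)) = (\<lambda>x. ?f p * monom4 i j k l x)"
    proof
      fix x
      have c: "cnj (if j = p then \<i> else 1) = (if j = p then - \<i> else 1)" for j by simp
      have g: "(a * z1) * (b * z2) * (c * z3) * (e * z4) = a * b * c * e * (z1 * z2 * z3 * z4)"
        for a b c e z1 z2 z3 z4 :: complex by (simp only: ac_simps)
      show "monom4 i j k l (umap d (phase_mat p) x) = ?f p * monom4 i j k l x"
        unfolding monom4_def umap_phase[OF assms(1)] umap_phase[OF assms(2)] umap_phase[OF assms(3)]
          umap_phase[OF assms(4)] complex_cnj_mult c
        by (rule g)
    qed
    finally show ?thesis by (rule trans) (rule integral_mult_right_zero)
  qed
  have n: "\<i> \<noteq> 1" "- \<i> \<noteq> 1" by (simp_all add: complex_eq_iff)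
  have "?f i \<noteq> 1 \<or> ?f k \<noteq> 1"
  proof (cases "k = i")
    case True
    then show ?thesis using assms(5,6) n by (cases "j = i"; cases "l = i") simp_all
  next
    case False
    then show ?thesis using assms(5,6) n
      by (cases "j = i"; cases "l = i"; cases "j = k"; cases "l = k") simp_all
  qed
  then show ?thesis
  proof
    assume "?f i \<noteq> 1"
    then show ?thesis using inv[of i] by (simp only: mult_cancel_right1 simp_thms)
  next
    assume "?f k \<noteq> 1"
    then show ?thesis using inv[of k] by (simp only: mult_cancel_right1 simp_thms)
  qed
qed

lemma integral_sum_monom4:
  assumes "finite S" "S \<subseteq> {..<d}"
  shows "(\<integral>x. (\<Sum>i\<in>S. \<Sum>j\<in>S. \<Sum>k\<in>S. \<Sum>l\<in>S. c i j k l * monom4 i j k l x) \<partial>\<mu>)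
     = (\<Sum>i\<in>S. \<Sum>j\<in>S. \<Sum>k\<in>S. \<Sum>l\<in>S. c i j k l * (\<integral>x. monom4 i j k l x \<partial>\<mu>))"
proof -
  have int: "integrable \<mu> (monom4 i j k l)" if "i \<in> S" "j \<in> S" "k \<in> S" "l \<in> S" for i j k l
    by (rule integrable_monom4) (use that assms in auto)
  show ?thesis
    by (simp add: Bochner_Integration.integral_sum Bochner_Integration.integrable_sum int cong: sum.cong)
qed

lemma monom4_swap: "monom4 i j k l = monom4 k j i l" "monom4 i j k l = monom4 i l k j"
  by (auto simp: monom4_def)

text \<open>The Hadamard rotation in the plane of two coordinates relates \<open>E|x\<^sub>p|\<^sup>4\<close> to the mixed moment.\<close>
lemma integral_monom4_pair:
  assumes pq: "p < d" "q < d" "p \<noteq> q"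
  shows "(\<integral>x. monom4 p p p p x \<partial>\<mu>) = 2 * (\<integral>x. monom4 p p q q x \<partial>\<mu>)"
    "(\<integral>x. monom4 q q q q x \<partial>\<mu>) = 2 * (\<integral>x. monom4 p p q q x \<partial>\<mu>)"
proof -
  let ?I = "\<lambda>i j k l. (\<integral>x. monom4 i j k l x \<partial>\<mu>)"
  have h4: "hr * (hr * z) = z / 2" for z by (metis hr_simps(1) mult.assoc mult_1 times_divide_eq_left)
  have expand: "(\<integral>x. (x p + w * x q) * cnj (x p + w * x q) * (x p + w * x q) * cnj (x p + w * x q) \<partial>\<mu>)
     = ?I p p p p + ?I q q q q + 4 * ?I p p q q" if w: "w = 1 \<or> w = -1" for w :: complex
  proof -
    have "(x p + w * x q) * cnj (x p + w * x q) * (x p + w * x q) * cnj (x p + w * x q)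
      = (\<Sum>i\<in>{p,q}. \<Sum>j\<in>{p,q}. \<Sum>k\<in>{p,q}. \<Sum>l\<in>{p,q}.
          (if i = q then w else 1) * (if j = q then w else 1) * (if k = q then w else 1) * (if l = q then w else 1) * monom4 i j k l x)" for x
      using pq w by (auto simp: monom4_def algebra_simps)
    then have "(\<integral>x. (x p + w * x q) * cnj (x p + w * x q) * (x p + w * x q) * cnj (x p + w * x q) \<partial>\<mu>)
      = (\<integral>x. (\<Sum>i\<in>{p,q}. \<Sum>j\<in>{p,q}. \<Sum>k\<in>{p,q}. \<Sum>l\<in>{p,q}.
          (if i = q then w else 1) * (if j = q then w else 1) * (if k = q then w else 1) * (if l = q then w else 1) * monom4 i j k l x) \<partial>\<mu>)"
      by simp
    also have "\<dots> = (\<Sum>i\<in>{p,q}. \<Sum>j\<in>{p,q}. \<Sum>k\<in>{p,q}. \<Sum>l\<in>{p,q}.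
          (if i = q then w else 1) * (if j = q then w else 1) * (if k = q then w else 1) * (if l = q then w else 1) * ?I i j k l)"
      by (rule integral_sum_monom4) (use pq in auto)
    also have "\<dots> = ?I p p p p + ?I q q q q + 4 * ?I p p q q"
    proof -
      have z: "?I i j k l = 0" if "\<not> (i = j \<and> k = l)" "\<not> (i = l \<and> k = j)" "{i,j,k,l} \<subseteq> {p,q}" for i j k l
        by (rule integral_monom4_unbalanced) (use that pq in auto)
      have zs: "?I p p p q = 0" "?I p p q p = 0" "?I p q p p = 0" "?I q p p p = 0" "?I q q q p = 0" "?I q q p q = 0"
        "?I q p q q = 0" "?I p q q q = 0" "?I p q p q = 0" "?I q p q p = 0"
        using pq by (auto intro!: z)
      have "?I q q p p = ?I p p q q" "?I p q q p = ?I p p q q" "?I q p p q = ?I p p q q"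
        using monom4_swap by metis+
      then show ?thesis using pq w zs by auto
    qed
    finally show ?thesis .
  qed
  have h: "?I p p p p = (?I p p p p + ?I q q q q + 4 * ?I p p q q) / 4"
  proof -
    have "?I p p p p = (\<integral>x. monom4 p p p p (umap d (hadamard_mat p q) x) \<partial>\<mu>)"
      by (rule integral_umap[symmetric, OF hadamard_unitary[OF pq]]) auto
    also have "(\<lambda>x. monom4 p p p p (umap d (hadamard_mat p q) x))
        = (\<lambda>x. (x p + 1 * x q) * cnj (x p + 1 * x q) * (x p + 1 * x q) * cnj (x p + 1 * x q) / 4)"
      by (intro ext) (simp add: monom4_def umap_hadamard[OF pq] ac_simps h4)
    also have "(\<integral>x. (x p + 1 * x q) * cnj (x p + 1 * x q) * (x p + 1 * x q) * cnj (x p + 1 * x q) / 4 \<partial>\<mu>)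
        = (?I p p p p + ?I q q q q + 4 * ?I p p q q) / 4"
      using expand[of 1] by simp
    finally show ?thesis .
  qed
  have h2: "?I q q q q = (?I p p p p + ?I q q q q + 4 * ?I p p q q) / 4"
  proof -
    have "?I q q q q = (\<integral>x. monom4 q q q q (umap d (hadamard_mat p q) x) \<partial>\<mu>)"
      by (rule integral_umap[symmetric, OF hadamard_unitary[OF pq]]) auto
    also have "(\<lambda>x. monom4 q q q q (umap d (hadamard_mat p q) x))
        = (\<lambda>x. (x p + (-1) * x q) * cnj (x p + (-1) * x q) * (x p + (-1) * x q) * cnj (x p + (-1) * x q) / 4)"
      by (intro ext) (simp add: monom4_def umap_hadamard[OF pq] ac_simps h4)
    also have "(\<integral>x. (x p + (-1) * x q) * cnj (x p + (-1) * x q) * (x p + (-1) * x q) * cnj (x p + (-1) * x q) / 4 \<partial>\<mu>)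
        = (?I p p p p + ?I q q q q + 4 * ?I p p q q) / 4"
      using expand[of "-1"] by simp
    finally show ?thesis .
  qed
  have e: "?I p p p p = ?I q q q q" using h h2 by simp
  show "?I p p p p = 2 * ?I p p q q" using h unfolding e[symmetric] by (simp add: field_simps)
  then show "?I q q q q = 2 * ?I p p q q" using e by simp
qed

lemma integrable_coord2: "i < d \<Longrightarrow> j < d \<Longrightarrow> integrable \<mu> (\<lambda>x. x i * cnj (x j))"
proof (rule integrable_bounded_sphere[where B = 1])
  fix x assume ij: "i < d" "j < d" and "nsq d x = 1"
  then show "norm (x i * cnj (x j)) \<le> 1"
    unfolding norm_mult complex_mod_cnj by (intro mult_le_one) (auto simp: sphere_coord_le_1)
qed measurable

lemma integral_coord2_offdiag:
  assumes "i < d" "j < d" "i \<noteq> j"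
  shows "(\<integral>x. x i * cnj (x j) \<partial>\<mu>) = 0"
proof -
  have "(\<integral>x. x i * cnj (x j) \<partial>\<mu>) = (\<integral>x. umap d (phase_mat i) x i * cnj (umap d (phase_mat i) x j) \<partial>\<mu>)"
    by (rule integral_umap[symmetric, OF phase_mat_unitary]) auto
  also have "\<dots> = (\<integral>x. \<i> * (x i * cnj (x j)) \<partial>\<mu>)"
    using assms by (simp add: umap_phase mult.assoc)
  finally have "(\<integral>x. x i * cnj (x j) \<partial>\<mu>) = \<i> * (\<integral>x. x i * cnj (x j) \<partial>\<mu>)" by simp
  then have "(1 - \<i>) * (\<integral>x. x i * cnj (x j) \<partial>\<mu>) = 0" by (simp add: algebra_simps)
  moreover have "1 - \<i> \<noteq> 0" by (simp add: complex_eq_iff)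
  ultimately show ?thesis by simp
qed

lemma sum_coord2: "AE x in \<mu>. (\<Sum>i<d. x i * cnj (x i)) = 1"
  using AE_sphere
proof eventually_elim
  case (elim x)
  have "(\<Sum>i<d. x i * cnj (x i)) = of_real (nsq d x)" by (simp add: nsq_def complex_norm_square del: of_real_power)
  then show ?case using elim by simp
qed

lemma integral_coord2_diag_eq:
  assumes pq: "p < d" "q < d"
  shows "(\<integral>x. x p * cnj (x p) \<partial>\<mu>) = (\<integral>x. x q * cnj (x q) \<partial>\<mu>)"
proof (cases "p = q")
  case False
  note pq = pq False
  let ?I = "\<lambda>i j. (\<integral>x. x i * cnj (x j) \<partial>\<mu>)"
  have h4: "hr * (hr * z) = z / 2" for z by (metis hr_simps(1) mult.assoc mult_1 times_divide_eq_left)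
  have "?I p p = (\<integral>x. umap d (hadamard_mat p q) x p * cnj (umap d (hadamard_mat p q) x p) \<partial>\<mu>)"
    by (rule integral_umap[symmetric, OF hadamard_unitary[OF pq]]) auto
  also have "\<dots> = (\<integral>x. (x p * cnj (x p) + x p * cnj (x q) + x q * cnj (x p) + x q * cnj (x q)) / 2 \<partial>\<mu>)"
    by (simp add: umap_hadamard[OF pq] ac_simps h4) (simp add: algebra_simps)
  also have "\<dots> = (?I p p + ?I p q + ?I q p + ?I q q) / 2"
    using pq by (simp add: integrable_coord2)
  finally have "?I p p = (?I p p + ?I q q) / 2" using integral_coord2_offdiag pq by simp
  then show ?thesis by (simp add: field_simps)
qed simp

lemma integral_coord2:
  assumes "i < d" "j < d"
  shows "(\<integral>x. x i * cnj (x j) \<partial>\<mu>) = (if i = j then 1 / of_nat d else 0)"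
proof (cases "i = j")
  case True
  let ?I = "\<lambda>i j. (\<integral>x. x i * cnj (x j) \<partial>\<mu>)"
  have "(\<Sum>k<d. ?I k k) = (\<integral>x. (\<Sum>k<d. x k * cnj (x k)) \<partial>\<mu>)"
    by (rule Bochner_Integration.integral_sum[symmetric]) (simp add: integrable_coord2)
  also have "\<dots> = (\<integral>x. 1 \<partial>\<mu>)"
    by (rule integral_cong_AE) (auto intro: sum_coord2)
  also have "\<dots> = 1" by (simp add: prob_space)
  also have "(\<Sum>k<d. ?I k k) = (\<Sum>k<d. ?I i i)"
    by (intro sum.cong refl integral_coord2_diag_eq) (use assms in auto)
  finally have "of_nat d * ?I i i = 1" by simp
  then show ?thesis using True assms by (simp add: field_simps)
qed (use integral_coord2_offdiag assms in auto)

text \<open>The moment tensor is (identity + swap) / (d (d + 1)). Its normalisation comes from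
  summing over \<open>q\<close>: on the sphere the terms \<open>|x p|\<^sup>2 |x q|\<^sup>2\<close>
  add up to \<open>|x p|\<^sup>2\<close>, of mean \<open>1 / d\<close>, and the term
  \<open>q = p\<close> counts double.\<close>

lemma integral_monom4:
  assumes "i < d" "j < d" "k < d" "l < d"
  shows "(\<integral>x. monom4 i j k l x \<partial>\<mu>)
    = ((if i = j \<and> k = l then 1 else 0) + (if i = l \<and> k = j then 1 else 0)) / (of_nat d * (of_nat d + 1))"
proof -
  let ?I = "\<lambda>i j k l. (\<integral>x. monom4 i j k l x \<partial>\<mu>)"
  have mixed: "?I p p q q = ?I p p p p / 2" if "p < d" "q < d" "p \<noteq> q" for p q
    using integral_monom4_pair(1)[OF that] by simp
  have diag: "?I p p p p = 2 / (of_nat d * (of_nat d + 1))" if p: "p < d" for p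
  proof -
    have "(\<Sum>q<d. ?I p p q q) = (\<integral>x. (\<Sum>q<d. monom4 p p q q x) \<partial>\<mu>)"
      by (rule Bochner_Integration.integral_sum[symmetric]) (simp add: integrable_monom4 p)
    also have "\<dots> = (\<integral>x. x p * cnj (x p) \<partial>\<mu>)"
    proof (rule integral_cong_AE)
      show "AE x in \<mu>. (\<Sum>q<d. monom4 p p q q x) = x p * cnj (x p)"
        using sum_coord2
      proof eventually_elim
        case (elim x)
        have "(\<Sum>q<d. monom4 p p q q x) = x p * cnj (x p) * (\<Sum>q<d. x q * cnj (x q))"
          by (simp add: monom4_def sum_distrib_left mult.assoc)
        then show ?case using elim by simp
      qed
    qed auto
    also have "\<dots> = 1 / of_nat d" using integral_coord2[OF p p] by simp
    also have "(\<Sum>q<d. ?I p p q q) = (\<Sum>q<d. (if q = p then ?I p p p p / 2 else 0) + ?I p p p p / 2)"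
      by (intro sum.cong) (use mixed p in auto)
    also have "\<dots> = ?I p p p p / 2 + of_nat d * (?I p p p p / 2)" using p by (simp add: sum.distrib)
    finally have "?I p p p p * (1 + of_nat d) = 2 / of_nat d" by (simp add: field_simps)
    moreover have "1 + of_nat d \<noteq> (0::complex)" by (metis of_nat_0_eq_iff of_nat_Suc nat.distinct(1))
    moreover have "?I p p p p * (of_nat d * (of_nat d + 1)) = of_nat d * (?I p p p p * (1 + of_nat d))"
      by (simp add: algebra_simps)
    ultimately have "?I p p p p * (of_nat d * (of_nat d + 1)) = 2" using p by simp
    moreover have "of_nat d * (of_nat d + 1) \<noteq> (0::complex)"
      using p \<open>1 + of_nat d \<noteq> (0::complex)\<close> by (simp add: add.commute)
    ultimately show ?thesis by (simp only: nonzero_eq_divide_eq simp_thms)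
  qed
  consider "i = j" "k = l" "i = k" | "i = j" "k = l" "i \<noteq> k" | "i = l" "k = j" "i \<noteq> k"
    | "\<not> (i = j \<and> k = l)" "\<not> (i = l \<and> k = j)" by blast
  then show ?thesis
  proof cases
    case 1 then show ?thesis using diag assms by simp
  next
    case 2 then show ?thesis using mixed diag assms by simp
  next
    case 3
    have "?I i k k i = ?I i i k k" using monom4_swap by metis
    also have "\<dots> = 2 / (of_nat d * (of_nat d + 1)) / 2"
      unfolding mixed[OF assms(1,3) 3(3)] diag[OF assms(1)] ..
    finally show ?thesis using 3 by simp
  next
    case 4
    show ?thesis
      unfolding integral_monom4_unbalanced[OF assms 4] if_not_P[OF 4(1)] if_not_P[OF 4(2)] by simp
  qed
qed

lemma expectation_quadratic_form:
  "(\<integral>x. (\<Sum>a<d. \<Sum>b<d. x a * cnj (x b) * C a b) \<partial>\<mu>) = (\<Sum>a<d. C a a) / of_nat d"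
proof -
  have "(\<integral>x. (\<Sum>a<d. \<Sum>b<d. x a * cnj (x b) * C a b) \<partial>\<mu>) = (\<Sum>a<d. \<Sum>b<d. (\<integral>x. x a * cnj (x b) \<partial>\<mu>) * C a b)"
  proof -
    have i: "integrable \<mu> (\<lambda>x. x a * cnj (x b) * C a b)" if "a < d" "b < d" for a b
      using integrable_coord2[OF that] by simp
    have "(\<integral>x. (\<Sum>a<d. \<Sum>b<d. x a * cnj (x b) * C a b) \<partial>\<mu>) = (\<Sum>a<d. \<integral>x. (\<Sum>b<d. x a * cnj (x b) * C a b) \<partial>\<mu>)"
      by (rule Bochner_Integration.integral_sum) (auto intro!: Bochner_Integration.integrable_sum i)
    also have "\<dots> = (\<Sum>a<d. \<Sum>b<d. \<integral>x. x a * cnj (x b) * C a b \<partial>\<mu>)"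
      by (intro sum.cong refl Bochner_Integration.integral_sum) (auto intro!: i)
    finally show ?thesis by simp
  qed
  also have "\<dots> = (\<Sum>a<d. \<Sum>b<d. if b = a then C a b / of_nat d else 0)"
    by (intro sum.cong refl) (simp add: integral_coord2)
  finally show ?thesis by (simp add: sum_divide_distrib)
qed

lemma integrable_quadratic_form:
  "integrable \<mu> (\<lambda>x. \<Sum>a<d. \<Sum>b<d. x a * cnj (x b) * C a b)"
  by (intro Bochner_Integration.integrable_sum integrable_mult_left integrable_coord2) auto

lemma expectation_quadratic_form_sq:
  shows "integrable \<mu> (\<lambda>x. (cmod (\<Sum>a<d. \<Sum>b<d. x a * cnj (x b) * C a b))\<^sup>2)" (is ?A)
    and "(\<integral>x. (cmod (\<Sum>a<d. \<Sum>b<d. x a * cnj (x b) * C a b))\<^sup>2 \<partial>\<mu>)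
      = ((cmod (\<Sum>a<d. C a a))\<^sup>2 + fro d d C) / (real d * (real d + 1))" (is ?B)
proof -
  have e: "of_real ((cmod (\<Sum>a<d. \<Sum>b<d. x a * cnj (x b) * C a b))\<^sup>2)
     = (\<Sum>i<d. \<Sum>j<d. \<Sum>k<d. \<Sum>l<d. (C i j * cnj (C l k)) * monom4 i j k l x)" for x
  proof -
    have "of_real ((cmod (\<Sum>a<d. \<Sum>b<d. x a * cnj (x b) * C a b))\<^sup>2)
       = (\<Sum>i<d. \<Sum>j<d. x i * cnj (x j) * C i j) * (\<Sum>l<d. \<Sum>k<d. cnj (x l) * x k * cnj (C l k))"
      by (simp add: complex_norm_square cnj_sum del: of_real_power)
    also have "(\<Sum>l<d. \<Sum>k<d. cnj (x l) * x k * cnj (C l k)) = (\<Sum>k<d. \<Sum>l<d. cnj (x l) * x k * cnj (C l k))"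
      by (rule sum.swap)
    also have "(\<Sum>i<d. \<Sum>j<d. x i * cnj (x j) * C i j) * \<dots>
        = (\<Sum>i<d. \<Sum>j<d. \<Sum>k<d. \<Sum>l<d. (x i * cnj (x j) * C i j) * (cnj (x l) * x k * cnj (C l k)))"
      unfolding sum_distrib_right by (intro sum.cong refl) (simp only: sum_distrib_left)
    finally show ?thesis by (simp add: monom4_def ac_simps)
  qed
  have int: "integrable \<mu> (\<lambda>x. \<Sum>i<d. \<Sum>j<d. \<Sum>k<d. \<Sum>l<d. (C i j * cnj (C l k)) * monom4 i j k l x)"
    by (intro Bochner_Integration.integrable_sum integrable_mult_right integrable_monom4) auto
  then have int': "integrable \<mu> (\<lambda>x. complex_of_real ((cmod (\<Sum>a<d. \<Sum>b<d. x a * cnj (x b) * C a b))\<^sup>2))"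
    by (simp only: e)
  from integrable_Re[OF int'] show ?A by (simp only: Re_complex_of_real)
  have "complex_of_real (\<integral>x. (cmod (\<Sum>a<d. \<Sum>b<d. x a * cnj (x b) * C a b))\<^sup>2 \<partial>\<mu>)
    = (\<integral>x. (\<Sum>i<d. \<Sum>j<d. \<Sum>k<d. \<Sum>l<d. (C i j * cnj (C l k)) * monom4 i j k l x) \<partial>\<mu>)"
    unfolding e[symmetric] by (rule integral_complex_of_real[symmetric])
  also have "\<dots> = (\<Sum>i<d. \<Sum>j<d. \<Sum>k<d. \<Sum>l<d. (C i j * cnj (C l k)) * (\<integral>x. monom4 i j k l x \<partial>\<mu>))"
    by (rule integral_sum_monom4) auto
  also have "\<dots> = (\<Sum>i<d. \<Sum>j<d. \<Sum>k<d. \<Sum>l<d. ((if j = i then (if l = k then C i j * cnj (C l k) else 0) else 0)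
      + (if l = i then (if k = j then C i j * cnj (C l k) else 0) else 0)) / (of_nat d * (of_nat d + 1)))"
    by (intro sum.cong refl) (simp add: integral_monom4)
  also have "\<dots> = ((\<Sum>i<d. \<Sum>j<d. \<Sum>k<d. \<Sum>l<d. (if j = i then (if l = k then C i j * cnj (C l k) else 0) else 0))
      + (\<Sum>i<d. \<Sum>j<d. \<Sum>k<d. \<Sum>l<d. (if l = i then (if k = j then C i j * cnj (C l k) else 0) else 0))) / (of_nat d * (of_nat d + 1))"
    by (simp only: sum.distrib sum_divide_distrib[symmetric])
  also have "(\<Sum>i<d. \<Sum>j<d. \<Sum>k<d. \<Sum>l<d. (if j = i then (if l = k then C i j * cnj (C l k) else 0) else 0))
      = (\<Sum>i<d. \<Sum>j<d. if j = i then (\<Sum>k<d. C i j * cnj (C k k)) else 0)"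
    by (intro sum.cong refl) (auto intro!: sum.cong)
  also have "\<dots> = (\<Sum>i<d. C i i) * cnj (\<Sum>k<d. C k k)"
    by (simp add: sum_distrib_left sum_distrib_right cnj_sum) (rule sum.swap)
  also have "\<dots> = of_real ((cmod (\<Sum>a<d. C a a))\<^sup>2)" by (rule complex_norm_square[symmetric])
  also have "(\<Sum>i<d. \<Sum>j<d. \<Sum>k<d. \<Sum>l<d. (if l = i then (if k = j then C i j * cnj (C l k) else 0) else 0))
      = (\<Sum>i<d. \<Sum>j<d. of_real ((cmod (C i j))\<^sup>2))"
    by (intro sum.cong refl) (simp add: complex_norm_square del: of_real_power)
  also have "\<dots> = of_real (fro d d C)" by (simp add: fro_def)
  finally have "complex_of_real (\<integral>x. (cmod (\<Sum>a<d. \<Sum>b<d. x a * cnj (x b) * C a b))\<^sup>2 \<partial>\<mu>)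
     = of_real (((cmod (\<Sum>a<d. C a a))\<^sup>2 + fro d d C) / (real d * (real d + 1)))"
    by simp
  then show ?B by (simp only: of_real_eq_iff)
qed

text \<open>The squared mean \<open>|tr C|\<^sup>2 / d\<^sup>2\<close> is at least the trace term
  \<open>|tr C|\<^sup>2 / (d (d + 1))\<close> of the second moment, so after weakening the
  denominator to \<open>d\<^sup>2\<close> only the Frobenius norm remains.\<close>

lemma variance_quadratic_form:
  assumes "d > 0"
  shows "integrable \<mu> (\<lambda>x. (cmod ((\<Sum>a<d. \<Sum>b<d. x a * cnj (x b) * C a b) - (\<Sum>a<d. C a a) / of_nat d))\<^sup>2)" (is ?A)
    and "(\<integral>x. (cmod ((\<Sum>a<d. \<Sum>b<d. x a * cnj (x b) * C a b) - (\<Sum>a<d. C a a) / of_nat d))\<^sup>2 \<partial>\<mu>) \<le> fro d d C / (real d)\<^sup>2" (is ?B)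
proof -
  let ?z = "\<lambda>x. \<Sum>a<d. \<Sum>b<d. x a * cnj (x b) * C a b"
  let ?t = "\<Sum>a<d. C a a"
  let ?e = "?t / of_nat d"
  have e: "(cmod (?z x - ?e))\<^sup>2 = (cmod (?z x))\<^sup>2 - 2 * Re (?z x * cnj ?e) + (cmod ?e)\<^sup>2" for x
  proof -
    have "(cmod (z - e))\<^sup>2 = (cmod z)\<^sup>2 - 2 * Re (z * cnj e) + (cmod e)\<^sup>2" for z e
      unfolding cmod_power2 by (simp add: power2_eq_square algebra_simps)
    then show ?thesis .
  qed
  have i1: "integrable \<mu> (\<lambda>x. Re (?z x * cnj ?e))"
    by (intro integrable_Re integrable_mult_left integrable_quadratic_form)
  note i2 = expectation_quadratic_form_sq(1)[of C]
  have iall: "integrable \<mu> (\<lambda>x. (cmod (?z x))\<^sup>2 - 2 * Re (?z x * cnj ?e) + (cmod ?e)\<^sup>2)"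
    by (intro Bochner_Integration.integrable_add Bochner_Integration.integrable_diff integrable_mult_right i1 i2) auto
  then show ?A by (simp only: e)
  have "(\<integral>x. Re (?z x * cnj ?e) \<partial>\<mu>) = Re (\<integral>x. ?z x * cnj ?e \<partial>\<mu>)"
    by (rule integral_Re) (intro integrable_mult_left integrable_quadratic_form)
  also have "\<dots> = Re (?e * cnj ?e)" by (simp only: integral_mult_left_zero expectation_quadratic_form)
  also have "\<dots> = (cmod ?e)\<^sup>2" by (simp only: complex_norm_square[symmetric] Re_complex_of_real)
  finally have m: "(\<integral>x. Re (?z x * cnj ?e) \<partial>\<mu>) = (cmod ?e)\<^sup>2" .
  have "(\<integral>x. (cmod (?z x - ?e))\<^sup>2 \<partial>\<mu>) = (\<integral>x. (cmod (?z x))\<^sup>2 \<partial>\<mu>) - 2 * (\<integral>x. Re (?z x * cnj ?e) \<partial>\<mu>) + (cmod ?e)\<^sup>2"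
  proof -
    have gen: "(\<integral>x. f x - 2 * g x + c \<partial>\<mu>) = (\<integral>x. f x \<partial>\<mu>) - 2 * (\<integral>x. g x \<partial>\<mu>) + c"
      if "integrable \<mu> f" "integrable \<mu> g" for f g :: "_ \<Rightarrow> real" and c
      using that by simp
    show ?thesis unfolding e by (rule gen[OF i2 i1])
  qed
  also have "\<dots> = ((cmod ?t)\<^sup>2 + fro d d C) / (real d * (real d + 1)) - (cmod ?e)\<^sup>2"
    unfolding m expectation_quadratic_form_sq(2) by simp
  also have "(cmod ?e)\<^sup>2 = (cmod ?t)\<^sup>2 / (real d)\<^sup>2" by (simp add: norm_divide power_divide)
  also have "((cmod ?t)\<^sup>2 + fro d d C) / (real d * (real d + 1)) - (cmod ?t)\<^sup>2 / (real d)\<^sup>2 \<le> fro d d C / (real d)\<^sup>2"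
  proof -
    have "(real d)\<^sup>2 \<le> real d * (real d + 1)" by (simp add: power2_eq_square algebra_simps)
    then have "((cmod ?t)\<^sup>2 + fro d d C) / (real d * (real d + 1)) \<le> ((cmod ?t)\<^sup>2 + fro d d C) / (real d)\<^sup>2"
      using assms by (intro divide_left_mono) (auto intro!: mult_pos_pos add_nonneg_nonneg)
    then show ?thesis by (simp add: add_divide_distrib)
  qed
  finally show ?B .
qed

text \<open>Transitivity: a phase makes \<open>\<langle>y, z\<rangle>\<close> real, and then a Householder reflection exchanges \<open>y\<close> and \<open>z\<close>.\<close>
lemma nn_integral_ip_radial:
  fixes h :: "complex \<Rightarrow> ennreal"
  assumes h: "h \<in> borel_measurable borel" and yz: "nsq d y = nsq d z"
  shows "(\<integral>\<^sup>+x. h (ip d y x) \<partial>\<mu>) = (\<integral>\<^sup>+x. h (ip d z x) \<partial>\<mu>)"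
proof -
  have meas: "(\<lambda>x. h (ip d y x)) \<in> borel_measurable borel" for y
    by (rule measurable_compose[OF _ h]) (unfold ip_def, measurable)
  have reflect: "(\<integral>\<^sup>+x. h (ip d y x) \<partial>\<mu>) = (\<integral>\<^sup>+x. h (ip d z x) \<partial>\<mu>)"
    if eq: "nsq d y = nsq d z" and re: "Im (ip d y z) = 0" for y z
  proof (cases "nsq d (\<lambda>i. y i - z i) = 0")
    case True
    then have "ip d y x = ip d z x" for x by (intro ip_cong) (auto simp: nsq_eq_0_iff)
    then show ?thesis by simp
  next
    case False
    define w where "w = (\<lambda>i. y i - z i)"
    define N where "N = complex_of_real (nsq d w)"
    have N: "N \<noteq> 0" using False by (simp add: N_def w_def)
    define u where "u i j = (if i = j then 1 else 0) - 2 / N * w i * cnj (w j)" for i j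
    have cN: "cnj N = N" by (simp add: N_def)
    have uni: "(\<Sum>k<d. cnj (u k i) * u k j) = (if i = j then 1 else 0)" if "i < d" "j < d" for i j
    proof -
      have "(\<Sum>k<d. cnj (u k i) * u k j) = (\<Sum>k<d. (if k = i then (if i = j then 1 else 0) else 0)
          - (if k = i then 2 / N * w i * cnj (w j) else 0) - (if k = j then 2 / N * w i * cnj (w j) else 0)
          + (2/N) * (2/N) * w i * cnj (w j) * (cnj (w k) * w k))"
        by (intro sum.cong refl) (auto simp: u_def cN algebra_simps)
      also have "\<dots> = (if i = j then 1 else 0) - 2 / N * w i * cnj (w j) - 2 / N * w i * cnj (w j)
          + (2/N) * (2/N) * w i * cnj (w j) * ip d w w"
        using that by (simp add: sum.distrib sum_subtractf ip_def sum_distrib_left)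
      also have "ip d w w = N" by (simp add: N_def ip_self)
      finally show ?thesis using N by (simp add: field_simps)
    qed
    have herm: "u i j = cnj (u j i)" for i j by (simp add: u_def cN)
    have uy: "mv d u y i = z i" if "i < d" for i
    proof -
      have "mv d u y i = (\<Sum>j<d. (if j = i then y j else 0) - 2 / N * w i * (cnj (w j) * y j))"
        unfolding mv_def by (intro sum.cong refl) (auto simp: u_def algebra_simps)
      also have "\<dots> = y i - 2 / N * w i * ip d w y"
        using that by (simp add: sum_subtractf ip_def sum_distrib_left)
      \<comment> \<open>A real inner product is symmetric; with equal norms this gives
        \<open>2 \<langle>w, y\<rangle> = |w|\<^sup>2\<close>, and the reflection sends
        \<open>y\<close> to \<open>y - w = z\<close>.\<close>
      also have "2 * ip d w y = N"
      proof -
        have "ip d z y = ip d y z" using re cnj_ip[of d y z] by (metis complex_cnj_cancel_iff complex_eq_iff cnj.simps neg_equal_zero minus_zero)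
        then have "ip d w y = ip d y y - ip d y z" unfolding w_def ip_diff_left by simp
        moreover have "N = ip d y y - ip d y z - (ip d z y - ip d z z)"
          unfolding N_def ip_self[symmetric] w_def ip_diff_left ip_diff_right by simp
        moreover have "ip d z z = ip d y y" using eq by (simp add: ip_self)
        ultimately show ?thesis using \<open>ip d z y = ip d y z\<close> by simp
      qed
      then have "2 / N * w i * ip d w y = w i" using N by (simp add: field_simps)
      finally show ?thesis by (simp add: w_def)
    qed
    have "ip d y (umap d u x) = ip d z x" for x
    proof -
      have "ip d y (umap d u x) = ip d y (mv d u x)" by (rule ip_cong) (auto simp: umap_def)
      also have "\<dots> = ip d (mv d u y) x" by (rule ip_mv_hermitian) (rule herm)
      also have "\<dots> = ip d z x" by (rule ip_cong) (auto simp: uy)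
      finally show ?thesis .
    qed
    then show ?thesis using nn_integral_umap[OF uni meas[of y]] by simp
  qed
  define c where "c = (if ip d y z = 0 then 1 else cnj (sgn (ip d y z)))"
  have c1: "cmod c = 1" by (simp add: c_def norm_sgn)
  have "(\<integral>\<^sup>+x. h (ip d y x) \<partial>\<mu>) = (\<integral>\<^sup>+x. h (ip d (\<lambda>i. c * z i) x) \<partial>\<mu>)"
  proof (rule reflect)
    show "nsq d y = nsq d (\<lambda>i. c * z i)" using yz c1 by (simp add: nsq_scale)
    have "ip d y (\<lambda>i. c * z i) = of_real (cmod (ip d y z))"
    proof (cases "ip d y z = 0")
      case False
      have "cnj (sgn (ip d y z)) * ip d y z = of_real (cmod (ip d y z))"
      proof -
        have "cnj (ip d y z) * ip d y z = of_real (cmod (ip d y z)) * of_real (cmod (ip d y z))"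
          by (metis complex_norm_square mult.commute of_real_mult power2_eq_square)
        then show ?thesis using False by (simp add: sgn_eq field_simps)
      qed
      then show ?thesis using False by (simp add: c_def ip_scale_right)
    qed (simp add: ip_scale_right)
    then show "Im (ip d y (\<lambda>i. c * z i)) = 0" by simp
  qed
  also have "\<dots> = (\<integral>\<^sup>+x. h (ip d z x) \<partial>\<mu>)"
  proof -
    define u where "u i j = (if i = j then cnj c else 0)" for i j :: nat
    have cc: "c * cnj c = 1" using c1 complex_norm_square[of c] by simp
    have uni: "(\<Sum>k<d. cnj (u k i) * u k j) = (if i = j then 1 else 0)" if "i < d" "j < d" for i j
    proof -
      have "(\<Sum>k<d. cnj (u k i) * u k j) = (\<Sum>k<d. if k = i then (if i = j then 1 else 0) else 0)"
        by (intro sum.cong refl) (auto simp: u_def cc)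
      then show ?thesis using that by simp
    qed
    have "ip d z (umap d u x) = ip d (\<lambda>i. c * z i) x" for x
    proof -
      have "mv d u x i = cnj c * x i" if "i < d" for i
      proof -
        have "mv d u x i = (\<Sum>j<d. if j = i then cnj c * x j else 0)"
          unfolding mv_def by (intro sum.cong) (auto simp: u_def)
        then show ?thesis using that by simp
      qed
      then have "ip d z (umap d u x) = ip d z (\<lambda>i. cnj c * x i)" by (intro ip_cong) (auto simp: umap_def)
      then show ?thesis by (simp only: ip_scale_right ip_scale_left)
    qed
    then show ?thesis using nn_integral_umap[OF uni meas[of z]] by simp
  qed
  finally show ?thesis .
qed

end

section \<open>Gaussian measures and property (tau)\<close>

text \<open>With \<open>a\<close> the largest point of \<open>A\<close> and \<open>b\<close> the
  smallest of \<open>B\<close>, the sets \<open>(A + b) / 2\<close> and \<open>(a + B) / 2\<close>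
  both lie in \<open>C\<close> and meet at most in \<open>(a + b) / 2\<close>, a null set.\<close>

lemma brunn_minkowski_real:
  fixes A B C :: "real set"
  assumes A: "compact A" "A \<noteq> {}" and B: "compact B" "B \<noteq> {}" and C: "C \<in> sets borel"
    and mid: "\<And>x y. x \<in> A \<Longrightarrow> y \<in> B \<Longrightarrow> (x + y) / 2 \<in> C"
  shows "emeasure lborel A + emeasure lborel B \<le> 2 * emeasure lborel C"
proof -
  obtain a where a: "a \<in> A" "\<And>x. x \<in> A \<Longrightarrow> x \<le> a" using compact_attains_sup[OF A] by blast
  obtain b where b: "b \<in> B" "\<And>x. x \<in> B \<Longrightarrow> b \<le> x" using compact_attains_inf[OF B] by blast
  have [measurable]: "A \<in> sets borel" "B \<in> sets borel" "C \<in> sets borel"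
    using A B C by (auto intro: borel_compact)
  have scale: "emeasure lborel D = 2 * (\<integral>\<^sup>+z. indicator D (- e + 2 * z) \<partial>lborel)"
    if [measurable]: "D \<in> sets borel" for D :: "real set" and e
    using nn_integral_real_affine[of "indicator D" 2 "- e"] by simp
  have "(\<integral>\<^sup>+z. indicator A (- b + 2 * z) \<partial>lborel) + (\<integral>\<^sup>+z. indicator B (- a + 2 * z) \<partial>lborel)
     = (\<integral>\<^sup>+z. indicator A (- b + 2 * z) + indicator B (- a + 2 * z) \<partial>lborel)"
    by (rule nn_integral_add[symmetric]) auto
  also have "\<dots> \<le> (\<integral>\<^sup>+z. indicator C z + indicator {(a + b) / 2} z \<partial>lborel)"
  proof (rule nn_integral_mono)
    fix z :: real
    have "z \<in> C" if "- b + 2 * z \<in> A" using mid[OF that b(1)] by simp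
    moreover have "z \<in> C" if "- a + 2 * z \<in> B" using mid[OF a(1) that] by simp
    moreover have "z = (a + b) / 2" if "- b + 2 * z \<in> A" "- a + 2 * z \<in> B"
      using a(2)[OF that(1)] b(2)[OF that(2)] by simp
    ultimately show "indicator A (- b + 2 * z) + indicator B (- a + 2 * z) \<le> (indicator C z + indicator {(a + b) / 2} z :: ennreal)"
      by (auto simp: indicator_def)
  qed
  also have "\<dots> = emeasure lborel C" by (subst nn_integral_add) auto
  finally have "2 * ((\<integral>\<^sup>+z. indicator A (- b + 2 * z) \<partial>lborel) + (\<integral>\<^sup>+z. indicator B (- a + 2 * z) \<partial>lborel)) \<le> 2 * emeasure lborel C"
    by (rule mult_left_mono) simp
  then show ?thesis using scale[of A b] scale[of B a] by (simp add: distrib_left)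
qed

text \<open>Levels stop at 1 because the two factors will be divided by their maxima; the third
  function is merely cut off at 1, which is harmless in an upper bound.\<close>

lemma layer_cake_unit:
  fixes h :: "real \<Rightarrow> real"
  assumes [measurable]: "h \<in> borel_measurable borel" and h: "\<And>x. h x \<ge> 0"
  shows "(\<integral>\<^sup>+t. indicator {0<..1} t * emeasure lborel {x. t \<le> h x} \<partial>lborel) = (\<integral>\<^sup>+x. ennreal (min 1 (h x)) \<partial>lborel)"
proof -
  have "(\<integral>\<^sup>+t. indicator {0<..1} t * emeasure lborel {x. t \<le> h x} \<partial>lborel)
     = (\<integral>\<^sup>+t. (\<integral>\<^sup>+x. indicator {0<..1} t * indicator {x. t \<le> h x} x \<partial>lborel) \<partial>lborel)"
    by (intro nn_integral_cong) (simp add: nn_integral_cmult)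
  also have "\<dots> = (\<integral>\<^sup>+t. (\<integral>\<^sup>+x. (if 0 < t \<and> t \<le> 1 \<and> t \<le> h x then 1 else 0) \<partial>lborel) \<partial>lborel)"
    by (intro nn_integral_cong) (auto simp: indicator_def)
  also have "\<dots> = (\<integral>\<^sup>+x. (\<integral>\<^sup>+t. (if 0 < t \<and> t \<le> 1 \<and> t \<le> h x then 1 else 0) \<partial>lborel) \<partial>lborel)"
    by (rule lborel_pair.Fubini') measurable
  also have "\<dots> = (\<integral>\<^sup>+x. (\<integral>\<^sup>+t. indicator {0<..min 1 (h x)} t \<partial>lborel) \<partial>lborel)"
    by (intro nn_integral_cong) (auto simp: indicator_def)
  also have "\<dots> = (\<integral>\<^sup>+x. ennreal (min 1 (h x)) \<partial>lborel)"
    by (intro nn_integral_cong) (simp add: h)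
  finally show ?thesis .
qed

text \<open>Exponential growth is beaten by the Gaussian factor. Bounded level sets give the
  compactness required for Brunn-Minkowski and for attaining the maxima.\<close>

lemma level_set_bounded:
  assumes "\<And>x. f x \<le> exp (c * \<bar>x\<bar>) * f (0::real)" "f 0 > 0" "t > 0"
  shows "{x. t \<le> f x * exp (- x\<^sup>2 / 2)} \<subseteq> cball 0 (1 + 4 * (c\<^sup>2 + \<bar>ln (f 0 / t)\<bar>))"
proof
  fix x assume "x \<in> {x. t \<le> f x * exp (- x\<^sup>2 / 2)}"
  then have "t \<le> f x * exp (- x\<^sup>2 / 2)" by simp
  also have "\<dots> \<le> exp (c * \<bar>x\<bar>) * f 0 * exp (- x\<^sup>2 / 2)" using assms(1) by (intro mult_right_mono) auto
  also have "\<dots> = exp (c * \<bar>x\<bar> - x\<^sup>2 / 2) * f 0" by (simp add: exp_add[symmetric] ac_simps exp_diff exp_minus field_simps)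
  finally have "t / f 0 \<le> exp (c * \<bar>x\<bar> - x\<^sup>2 / 2)" using assms by (simp add: field_simps)
  then have "ln (t / f 0) \<le> ln (exp (c * \<bar>x\<bar> - x\<^sup>2 / 2))" using assms by (subst ln_le_cancel_iff) auto
  then have h1: "ln (t / f 0) \<le> c * \<bar>x\<bar> - x\<^sup>2 / 2" by simp
  have h2: "ln (t / f 0) = - ln (f 0 / t)" using assms by (simp add: ln_div)
  have h3: "c * \<bar>x\<bar> \<le> c\<^sup>2 + x\<^sup>2 / 4"
  proof -
    have "0 \<le> (c - \<bar>x\<bar> / 2)\<^sup>2" by simp
    also have "\<dots> = c\<^sup>2 + x\<^sup>2 / 4 - c * \<bar>x\<bar>" by (simp add: power2_eq_square algebra_simps)
    finally show ?thesis by simp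
  qed
  have lin: "z \<le> 4 * (a + \<bar>L\<bar>)" if "l \<le> y - z / 2" "l = - L" "y \<le> a + z / 4" for z a L l y :: real
    using that by argo
  have x2: "x\<^sup>2 \<le> 4 * (c\<^sup>2 + \<bar>ln (f 0 / t)\<bar>)" by (rule lin[OF h1 h2 h3])
  have "\<bar>x\<bar> \<le> 1 + x\<^sup>2"
  proof -
    have "0 \<le> (\<bar>x\<bar> - 1)\<^sup>2" by simp
    then have "2 * \<bar>x\<bar> \<le> 1 + x\<^sup>2" by (simp add: power2_eq_square algebra_simps)
    then show ?thesis by (smt (verit))
  qed
  then show "x \<in> cball 0 (1 + 4 * (c\<^sup>2 + \<bar>ln (f 0 / t)\<bar>))" using x2 by (simp add: dist_norm)
qed

section \<open>Property (tau) for the standard Gaussian measure on the line\<close>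

definition gauss1 :: "real measure" where
  "gauss1 = Nonnegative_Lebesgue_Integration.density lborel (\<lambda>x. ennreal (std_normal_density x))"

lemma prob_space_gauss1: "prob_space gauss1"
  unfolding gauss1_def using prob_space_normal_density[of 1 0] by simp

lemma sets_gauss1 [measurable_cong, simp]: "sets gauss1 = sets borel"
  by (simp add: gauss1_def)

lemma space_gauss1 [simp]: "space gauss1 = UNIV"
  by (simp add: gauss1_def)

lemma nn_integral_gauss1:
  assumes [measurable]: "f \<in> borel_measurable borel"
  shows "(\<integral>\<^sup>+x. f x \<partial>gauss1) = (\<integral>\<^sup>+x. ennreal (std_normal_density x) * f x \<partial>lborel)"
  unfolding gauss1_def by (rule nn_integral_density) auto

text \<open>Maurey's property (tau) of the Gaussian measure: the Prekopa-Leindler inequality with midpoint \<open>(x+y)/2\<close>,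
  because \<open>(x-y)\<^sup>2/4 - x\<^sup>2/2 - y\<^sup>2/2 = -((x+y)/2)\<^sup>2\<close>.\<close>
lemma gauss1_tau_real:
  fixes f g :: "real \<Rightarrow> real"
  assumes f: "\<And>x. f x > 0" and g: "\<And>x. g x > 0"
    and cf: "continuous_on UNIV f" and cg: "continuous_on UNIV g"
    and lf: "\<And>x. f x \<le> exp (c * \<bar>x\<bar>) * f 0" and lg: "\<And>x. g x \<le> exp (c * \<bar>x\<bar>) * g 0"
    and K: "K > 0" and fg: "\<And>x y. f x * g y \<le> K * exp ((x - y)\<^sup>2 / 4)"
  shows "(\<integral>\<^sup>+x. f x \<partial>gauss1) * (\<integral>\<^sup>+x. g x \<partial>gauss1) \<le> ennreal K"
proof -
  define p where "p x = f x * exp (- x\<^sup>2 / 2)" for x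
  define q where "q x = g x * exp (- x\<^sup>2 / 2)" for x
  define m where "m x = sqrt K * exp (- x\<^sup>2 / 2)" for x :: real
  have p0: "p x > 0" and q0: "q x > 0" and m0: "m x > 0" for x using f g K by (auto simp: p_def q_def m_def)
  have cp: "continuous_on UNIV p" and cq: "continuous_on UNIV q" and cm: "continuous_on UNIV m"
    unfolding p_def q_def m_def by (auto intro!: continuous_intros cf cg)
  have [measurable]: "p \<in> borel_measurable borel" "q \<in> borel_measurable borel" "m \<in> borel_measurable borel"
    "f \<in> borel_measurable borel" "g \<in> borel_measurable borel"
    using cp cq cm cf cg by (auto intro: borel_measurable_continuous_onI)
  have comp: "compact {x. t \<le> h x * exp (- x\<^sup>2 / 2)}"
    if "\<And>x. h x \<le> exp (c * \<bar>x\<bar>) * h 0" "h 0 > 0" "t > 0" "continuous_on UNIV h" for h :: "real \<Rightarrow> real" and t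
  proof -
    have "bounded {x. t \<le> h x * exp (- x\<^sup>2 / 2)}"
      using level_set_bounded[of h c t, OF that(1-3)] bounded_cball bounded_subset by blast
    moreover have "closed {x. t \<le> h x * exp (- x\<^sup>2 / 2)}"
      by (intro closed_Collect_le) (auto intro!: continuous_intros that(4))
    ultimately show ?thesis by (simp add: compact_eq_bounded_closed)
  qed
  have comp_p: "compact {x. t \<le> p x}" and comp_q: "compact {x. t \<le> q x}" if "t > 0" for t
    unfolding p_def q_def using comp[OF lf f that cf] comp[OF lg g that cg] by auto
  have attain: "\<exists>x0. \<forall>x. h x \<le> h x0" if "\<And>t. t > 0 \<Longrightarrow> compact {x. t \<le> h x}" "h 0 > 0" "continuous_on UNIV h" for h :: "real \<Rightarrow> real"
  proof -
    have "\<exists>x0\<in>{x. h 0 \<le> h x}. \<forall>x\<in>{x. h 0 \<le> h x}. h x \<le> h x0"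
      by (rule continuous_attains_sup) (use that continuous_on_subset in blast)+
    then obtain x0 where x0: "h 0 \<le> h x0" "\<And>x. h 0 \<le> h x \<Longrightarrow> h x \<le> h x0" by auto
    have "h x \<le> h x0" for x using x0(1) x0(2)[of x] by linarith
    then show ?thesis by blast
  qed
  obtain x0 where x0: "\<And>x. p x \<le> p x0" using attain[OF comp_p p0 cp] by blast
  obtain y0 where y0: "\<And>x. q x \<le> q y0" using attain[OF comp_q q0 cq] by blast
  \<comment> \<open>Dividing by the maxima keeps both level sets nonempty at every level up to 1;
    the additive inequality between level sets would fail for an empty one.\<close>
  define a where "a = p x0"
  define b where "b = q y0"
  have a: "a > 0" and b: "b > 0" using p0 q0 by (auto simp: a_def b_def)
  define s where "s = sqrt (a * b)"
  have s: "s > 0" using a b by (simp add: s_def)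
  have pq: "p x * q y \<le> (m ((x + y) / 2))\<^sup>2" for x y
  proof -
    have "p x * q y = (f x * g y) * exp (- x\<^sup>2 / 2 + - y\<^sup>2 / 2)"
      unfolding p_def q_def exp_add by (simp only: ac_simps)
    also have "\<dots> \<le> K * exp ((x - y)\<^sup>2 / 4) * exp (- x\<^sup>2 / 2 + - y\<^sup>2 / 2)" by (intro mult_right_mono fg) auto
    also have "\<dots> = K * exp ((x - y)\<^sup>2 / 4 + (- x\<^sup>2 / 2 + - y\<^sup>2 / 2))" by (simp add: exp_add)
    also have "(x - y)\<^sup>2 / 4 + (- x\<^sup>2 / 2 + - y\<^sup>2 / 2) = - ((x + y) / 2)\<^sup>2 / 2 + - ((x + y) / 2)\<^sup>2 / 2"
      by (simp add: power2_eq_square field_simps)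
    also have "K * exp \<dots> = (m ((x + y) / 2))\<^sup>2"
      unfolding exp_add m_def power_mult_distrib using K by (simp add: power2_eq_square)
    finally show ?thesis .
  qed
  have level: "emeasure lborel {x. t \<le> p x / a} + emeasure lborel {x. t \<le> q x / b} \<le> 2 * emeasure lborel {x. t \<le> m x / s}"
    if t: "0 < t" "t \<le> 1" for t
  proof (rule brunn_minkowski_real)
    have pa: "{x. t \<le> p x / a} = {x. t * a \<le> p x}" and qb: "{x. t \<le> q x / b} = {x. t * b \<le> q x}"
      using a b by (auto simp: field_simps)
    show "compact {x. t \<le> p x / a}" "compact {x. t \<le> q x / b}"
      unfolding pa qb using comp_p[of "t * a"] comp_q[of "t * b"] t a b by auto
    show "{x. t \<le> p x / a} \<noteq> {}" using t a by (auto simp: a_def intro!: exI[of _ x0])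
    show "{x. t \<le> q x / b} \<noteq> {}" using t b by (auto simp: b_def intro!: exI[of _ y0])
    show "{x. t \<le> m x / s} \<in> sets borel" by measurable
    fix x y assume "x \<in> {x. t \<le> p x / a}" "y \<in> {x. t \<le> q x / b}"
    then have "t * a \<le> p x" "t * b \<le> q y" using pa qb by auto
    then have "(t * a) * (t * b) \<le> p x * q y" using t a b by (intro mult_mono) (auto simp: less_imp_le[OF p0])
    also have "\<dots> \<le> (m ((x + y) / 2))\<^sup>2" by (rule pq)
    finally have "(t * s)\<^sup>2 \<le> (m ((x + y) / 2))\<^sup>2" using a b by (simp add: s_def power_mult_distrib power2_eq_square ac_simps)
    then have "t * s \<le> m ((x + y) / 2)" by (rule power2_le_imp_le) (rule less_imp_le[OF m0])
    then show "(x + y) / 2 \<in> {x. t \<le> m x / s}" using s by (simp add: field_simps)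
  qed
  have mm: "(\<integral>\<^sup>+x. ennreal (p x / a) \<partial>lborel) + (\<integral>\<^sup>+x. ennreal (q x / b) \<partial>lborel) \<le> 2 * (\<integral>\<^sup>+x. ennreal (m x / s) \<partial>lborel)"
  proof -
    have "min 1 (p x / a) = p x / a" "min 1 (q x / b) = q x / b" for x
      using x0[of x] y0[of x] a b by (auto simp: a_def b_def min_def)
    then have "(\<integral>\<^sup>+x. ennreal (p x / a) \<partial>lborel) + (\<integral>\<^sup>+x. ennreal (q x / b) \<partial>lborel)
       = (\<integral>\<^sup>+t. indicator {0<..1} t * emeasure lborel {x. t \<le> p x / a} \<partial>lborel)
        + (\<integral>\<^sup>+t. indicator {0<..1} t * emeasure lborel {x. t \<le> q x / b} \<partial>lborel)"
      using layer_cake_unit[of "\<lambda>x. p x / a"] layer_cake_unit[of "\<lambda>x. q x / b"] p0 q0 a b by (simp add: less_imp_le)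
    also have "\<dots> = (\<integral>\<^sup>+t. indicator {0<..1} t * emeasure lborel {x. t \<le> p x / a}
        + indicator {0<..1} t * emeasure lborel {x. t \<le> q x / b} \<partial>lborel)"
      by (rule nn_integral_add[symmetric]) measurable
    also have "\<dots> \<le> (\<integral>\<^sup>+t. 2 * (indicator {0<..1} t * emeasure lborel {x. t \<le> m x / s}) \<partial>lborel)"
      using level by (intro nn_integral_mono) (auto simp: indicator_def)
    also have "\<dots> = 2 * (\<integral>\<^sup>+t. indicator {0<..1} t * emeasure lborel {x. t \<le> m x / s} \<partial>lborel)"
      by (rule nn_integral_cmult) measurable
    also have "\<dots> = 2 * (\<integral>\<^sup>+x. ennreal (min 1 (m x / s)) \<partial>lborel)"
      using layer_cake_unit[of "\<lambda>x. m x / s"] m0 s by (simp add: less_imp_le)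
    also have "\<dots> \<le> 2 * (\<integral>\<^sup>+x. ennreal (m x / s) \<partial>lborel)"
      by (intro mult_left_mono nn_integral_mono ennreal_leI) auto
    finally show ?thesis .
  qed
  define n where "n = 1 / sqrt (2 * pi)"
  have n: "n > 0" by (simp add: n_def)
  let ?P = "\<integral>\<^sup>+x. f x \<partial>gauss1" and ?Q = "\<integral>\<^sup>+x. g x \<partial>gauss1"
  have P: "?P = ennreal (n * a) * (\<integral>\<^sup>+x. ennreal (p x / a) \<partial>lborel)"
  proof -
    have "?P = (\<integral>\<^sup>+x. ennreal (n * a) * ennreal (p x / a) \<partial>lborel)"
      unfolding nn_integral_gauss1[of "\<lambda>x. ennreal (f x)", simplified]
      using a n f by (intro nn_integral_cong) (simp add: p_def std_normal_density_def n_def ennreal_mult[symmetric] less_imp_le field_simps)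
    then show ?thesis by (simp add: nn_integral_cmult)
  qed
  have Q: "?Q = ennreal (n * b) * (\<integral>\<^sup>+x. ennreal (q x / b) \<partial>lborel)"
  proof -
    have "?Q = (\<integral>\<^sup>+x. ennreal (n * b) * ennreal (q x / b) \<partial>lborel)"
      unfolding nn_integral_gauss1[of "\<lambda>x. ennreal (g x)", simplified]
      using b n g by (intro nn_integral_cong) (simp add: q_def std_normal_density_def n_def ennreal_mult[symmetric] less_imp_le field_simps)
    then show ?thesis by (simp add: nn_integral_cmult)
  qed
  have M: "(\<integral>\<^sup>+x. ennreal (m x / s) \<partial>lborel) = ennreal (sqrt K / (s * n))"
  proof -
    have "(\<integral>\<^sup>+x. ennreal (m x / s) \<partial>lborel) = (\<integral>\<^sup>+x. ennreal (sqrt K / (s * n)) * ennreal (std_normal_density x) \<partial>lborel)"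
      using s K n by (intro nn_integral_cong) (simp add: m_def std_normal_density_def n_def ennreal_mult[symmetric] field_simps)
    also have "\<dots> = ennreal (sqrt K / (s * n)) * (\<integral>\<^sup>+x. ennreal (std_normal_density x) \<partial>lborel)"
      by (rule nn_integral_cmult) measurable
    also have "(\<integral>\<^sup>+x. ennreal (std_normal_density x) \<partial>lborel) = emeasure gauss1 (space gauss1)"
      using nn_integral_gauss1[of "\<lambda>_. 1"] by simp
    also have "\<dots> = 1" using prob_space_gauss1 by (simp add: prob_space.emeasure_space_1 del: space_gauss1)
    finally show ?thesis by simp
  qed
  define X where "X = (\<integral>\<^sup>+x. ennreal (p x / a) \<partial>lborel)"
  define Y where "Y = (\<integral>\<^sup>+x. ennreal (q x / b) \<partial>lborel)"
  have XY: "X + Y \<le> ennreal (2 * sqrt K / (s * n))"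
    using mm unfolding M X_def Y_def using K s n
    by (simp add: ennreal_mult'[symmetric] flip: ennreal_numeral)
  then have "X < \<top>" "Y < \<top>" using le_less_trans ennreal_less_top by (metis add_top_left_ennreal less_top top.not_eq_extremum, metis add_top_right_ennreal less_top top.not_eq_extremum)
  then obtain x y where x: "X = ennreal x" "x \<ge> 0" and y: "Y = ennreal y" "y \<ge> 0"
    by (metis ennreal_cases less_irrefl)
  have xy: "x + y \<le> 2 * sqrt K / (s * n)" using XY x y K s n by (simp flip: ennreal_plus)
  \<comment> \<open>The additive inequality for the normalised functions becomes multiplicative by
    the arithmetic-geometric mean; the maxima return through
    \<open>s\<^sup>2 = a * b\<close>.\<close>
  have "4 * (x * y) \<le> (x + y)\<^sup>2" using zero_le_power2[of "x - y"] by (simp add: power2_eq_square algebra_simps)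
  also have "\<dots> \<le> (2 * sqrt K / (s * n))\<^sup>2" using xy x y by (intro power_mono) auto
  also have "\<dots> = 4 * (K / (s\<^sup>2 * n\<^sup>2))" using K by (simp add: power_divide power_mult_distrib)
  finally have "x * y \<le> K / (a * b * n\<^sup>2)" using a b by (simp add: s_def)
  then have "(n * a * x) * (n * b * y) \<le> K" using a b n by (simp add: field_simps power2_eq_square)
  moreover have "?P * ?Q = ennreal ((n * a * x) * (n * b * y))"
    unfolding P Q X_def[symmetric] Y_def[symmetric] x y using a b n x y by (simp add: ennreal_mult[symmetric])
  ultimately show ?thesis by (simp add: ennreal_leI)
qed

text \<open>The induction over coordinates produces partial integrals known only as extended reals.
  The log-Lipschitz condition makes a function vanish everywhere or nowhere, the product bound then
  excludes infinite values, and continuity follows.\<close>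

lemma gauss1_tau:
  fixes f g :: "real \<Rightarrow> ennreal"
  assumes lf: "\<And>x y. f x \<le> ennreal (exp (c * \<bar>x - y\<bar>)) * f y"
    and lg: "\<And>x y. g x \<le> ennreal (exp (c * \<bar>x - y\<bar>)) * g y"
    and K: "K > 0" and fg: "\<And>x y. f x * g y \<le> ennreal (K * exp ((x - y)\<^sup>2 / 4))"
  shows "(\<integral>\<^sup>+x. f x \<partial>gauss1) * (\<integral>\<^sup>+x. g x \<partial>gauss1) \<le> ennreal K"
proof (cases "(\<forall>x. f x = 0) \<or> (\<forall>x. g x = 0)")
  case True
  then show ?thesis by auto
next
  case False
  have zero: "h x = 0" if "h y = 0" "\<And>x y. h x \<le> ennreal (exp (c * \<bar>x - y\<bar>)) * h y" for h :: "real \<Rightarrow> ennreal" and x y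
    using that(2)[of x y] that(1) by simp
  have f0: "f x \<noteq> 0" for x using False zero[of f, OF _ lf] by blast
  have g0: "g x \<noteq> 0" for x using False zero[of g, OF _ lg] by blast
  have ft: "f x \<noteq> \<top>" for x
  proof
    assume "f x = \<top>"
    then have "f x * g 0 = \<top>" using g0 by (simp add: ennreal_top_mult)
    then show False using fg[of x 0] by (simp add: top_unique)
  qed
  have gt: "g x \<noteq> \<top>" for x
  proof
    assume "g x = \<top>"
    then have "f 0 * g x = \<top>" using f0 by (simp add: ennreal_mult_top)
    then show False using fg[of 0 x] by (simp add: top_unique)
  qed
  define F where "F x = enn2real (f x)" for x
  define G where "G x = enn2real (g x)" for x
  have fF: "f x = ennreal (F x)" and gG: "g x = ennreal (G x)" for x
    using ft gt by (auto simp: F_def G_def less_top)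
  have Fp: "F x > 0" and Gp: "G x > 0" for x
    using f0 g0 ft gt by (auto simp: F_def G_def enn2real_positive_iff less_top zero_less_iff_neq_zero)
  have LF: "F x \<le> exp (c * \<bar>x - y\<bar>) * F y" for x y
    using lf[of x y] Fp[of y] unfolding fF by (simp add: ennreal_mult[symmetric] less_imp_le)
  have LG: "G x \<le> exp (c * \<bar>x - y\<bar>) * G y" for x y
    using lg[of x y] Gp[of y] unfolding gG by (simp add: ennreal_mult[symmetric] less_imp_le)
  have cont: "continuous_on UNIV h" if h: "\<And>x. h x > 0" "\<And>x y. h x \<le> exp (c * \<bar>x - y\<bar>) * h y" for h :: "real \<Rightarrow> real"
  proof -
    have "isCont h x" for x
    proof -
      have t: "((\<lambda>y. exp (c * \<bar>y - x\<bar>) * h x) \<longlongrightarrow> exp (c * \<bar>x - x\<bar>) * h x) (at x)"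
        "((\<lambda>y. exp (- (c * \<bar>y - x\<bar>)) * h x) \<longlongrightarrow> exp (- (c * \<bar>x - x\<bar>)) * h x) (at x)"
        by (intro tendsto_intros)+
      have "(h \<longlongrightarrow> h x) (at x)"
      proof (rule tendsto_sandwich)
        show "\<forall>\<^sub>F y in at x. h y \<le> exp (c * \<bar>y - x\<bar>) * h x" using h(2) by auto
        have "exp (- (c * \<bar>y - x\<bar>)) * h x \<le> h y" for y
          using h(2)[of x y] by (simp add: exp_minus field_simps abs_minus_commute)
        then show "\<forall>\<^sub>F y in at x. exp (- (c * \<bar>y - x\<bar>)) * h x \<le> h y" by simp
      qed (use t in simp_all)
      then show ?thesis by (simp add: isCont_def)
    qed
    then show ?thesis by (simp add: continuous_at_imp_continuous_on)
  qed
  have "(\<integral>\<^sup>+x. F x \<partial>gauss1) * (\<integral>\<^sup>+x. G x \<partial>gauss1) \<le> ennreal K"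
  proof (rule gauss1_tau_real[where c = c])
    show "F x \<le> exp (c * \<bar>x\<bar>) * F 0" "G x \<le> exp (c * \<bar>x\<bar>) * G 0" for x using LF[of x 0] LG[of x 0] by auto
    show "F x * G y \<le> K * exp ((x - y)\<^sup>2 / 4)" for x y
      using fg[of x y] Fp[of x] Gp[of y] K unfolding fF gG by (simp add: ennreal_mult[symmetric] less_imp_le)
  qed (use Fp Gp K cont[OF Fp LF] cont[OF Gp LG] in auto)
  then show ?thesis by (simp add: fF gG)
qed

text \<open>The Cameron-Martin formula in one variable.\<close>

lemma gauss1_shift:
  assumes [measurable]: "G \<in> borel_measurable borel"
  shows "(\<integral>\<^sup>+x. G (x + t) \<partial>gauss1) = (\<integral>\<^sup>+x. ennreal (exp (t * x - t\<^sup>2 / 2)) * G x \<partial>gauss1)"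
proof -
  have "(\<integral>\<^sup>+x. ennreal (exp (t * x - t\<^sup>2 / 2)) * G x \<partial>gauss1)
     = (\<integral>\<^sup>+x. ennreal (std_normal_density x) * (ennreal (exp (t * x - t\<^sup>2 / 2)) * G x) \<partial>lborel)"
    by (rule nn_integral_gauss1) measurable
  also have "\<dots> = (\<integral>\<^sup>+x. ennreal (std_normal_density (t + 1 * x)) * (ennreal (exp (t * (t + 1 * x) - t\<^sup>2 / 2)) * G (t + 1 * x)) \<partial>lborel)"
    by (subst nn_integral_real_affine[where c = 1 and t = t]) auto
  also have "\<dots> = (\<integral>\<^sup>+x. ennreal (std_normal_density x) * G (x + t) \<partial>lborel)"
  proof (intro nn_integral_cong)
    fix x
    have "std_normal_density (t + 1 * x) * exp (t * (t + 1 * x) - t\<^sup>2 / 2) = std_normal_density x"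
    proof -
      have "- (t + x)\<^sup>2 / 2 + (t * (t + x) - t\<^sup>2 / 2) = - x\<^sup>2 / 2" by (simp add: power2_eq_square field_simps)
      then show ?thesis by (simp add: std_normal_density_def flip: exp_add)
    qed
    then show "ennreal (std_normal_density (t + 1 * x)) * (ennreal (exp (t * (t + 1 * x) - t\<^sup>2 / 2)) * G (t + 1 * x))
      = ennreal (std_normal_density x) * G (x + t)"
      by (simp add: mult.assoc[symmetric] ennreal_mult[symmetric] add.commute)
  qed
  also have "\<dots> = (\<integral>\<^sup>+x. G (x + t) \<partial>gauss1)"
    by (rule nn_integral_gauss1[symmetric]) measurable
  finally show ?thesis ..
qed

text \<open>Completing the square by a shift to \<open>b / (1 + 2 * a)\<close>. The factor
  independent of \<open>b\<close> stays an unevaluated integral, since only the dependence on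
  \<open>b\<close> matters.\<close>

lemma gauss1_exp_quadratic:
  assumes a: "a \<ge> 0"
  shows "(\<integral>\<^sup>+x. ennreal (exp (b * x - a * x\<^sup>2)) \<partial>gauss1)
     = (\<integral>\<^sup>+x. ennreal (exp (- a * x\<^sup>2)) \<partial>gauss1) * ennreal (exp (b\<^sup>2 / (2 * (1 + 2 * a))))"
proof -
  define s where "s = b / (1 + 2 * a)"
  have pos: "1 + 2 * a > 0" using a by simp
  have bs: "b = s * (1 + 2 * a)" using pos by (simp add: s_def)
  have bb: "b\<^sup>2 / (2 * (1 + 2 * a)) = s\<^sup>2 * (1 + 2 * a) / 2"
  proof -
    have "(s * D)\<^sup>2 / (2 * D) = s\<^sup>2 * D / 2" if "D > 0" for D :: real
      using that by (simp add: power2_eq_square)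
    then show ?thesis unfolding bs using pos by blast
  qed
  have "(\<integral>\<^sup>+x. ennreal (exp (b * x - a * x\<^sup>2)) \<partial>gauss1)
     = (\<integral>\<^sup>+x. ennreal (std_normal_density x) * ennreal (exp (b * x - a * x\<^sup>2)) \<partial>lborel)"
    by (rule nn_integral_gauss1) measurable
  also have "\<dots> = (\<integral>\<^sup>+x. ennreal (std_normal_density (s + 1 * x)) * ennreal (exp (b * (s + 1 * x) - a * (s + 1 * x)\<^sup>2)) \<partial>lborel)"
    by (subst nn_integral_real_affine[where c = 1 and t = s]) auto
  also have "\<dots> = (\<integral>\<^sup>+x. ennreal (std_normal_density x) * ennreal (exp (- a * x\<^sup>2)) * ennreal (exp (b\<^sup>2 / (2 * (1 + 2 * a)))) \<partial>lborel)"
  proof (intro nn_integral_cong)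
    fix x
    have "- (s + x)\<^sup>2 / 2 + (b * (s + x) - a * (s + x)\<^sup>2) = - x\<^sup>2 / 2 + (- a * x\<^sup>2 + b\<^sup>2 / (2 * (1 + 2 * a)))"
      unfolding bb by (simp add: bs power2_eq_square field_simps)
    then have "std_normal_density (s + 1 * x) * exp (b * (s + 1 * x) - a * (s + 1 * x)\<^sup>2)
       = std_normal_density x * exp (- a * x\<^sup>2) * exp (b\<^sup>2 / (2 * (1 + 2 * a)))"
      by (simp add: std_normal_density_def flip: exp_add)
    then show "ennreal (std_normal_density (s + 1 * x)) * ennreal (exp (b * (s + 1 * x) - a * (s + 1 * x)\<^sup>2))
      = ennreal (std_normal_density x) * ennreal (exp (- a * x\<^sup>2)) * ennreal (exp (b\<^sup>2 / (2 * (1 + 2 * a))))"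
      by (simp add: ennreal_mult[symmetric])
  qed
  also have "\<dots> = (\<integral>\<^sup>+x. ennreal (std_normal_density x) * ennreal (exp (- a * x\<^sup>2)) \<partial>lborel) * ennreal (exp (b\<^sup>2 / (2 * (1 + 2 * a))))"
    by (rule nn_integral_multc) measurable
  also have "(\<integral>\<^sup>+x. ennreal (std_normal_density x) * ennreal (exp (- a * x\<^sup>2)) \<partial>lborel) = (\<integral>\<^sup>+x. ennreal (exp (- a * x\<^sup>2)) \<partial>gauss1)"
    by (rule nn_integral_gauss1[symmetric]) measurable
  finally show ?thesis .
qed

lemma gauss1_moments:
  "(\<integral>\<^sup>+x. ennreal (x\<^sup>2) \<partial>gauss1) = 1" "(\<integral>\<^sup>+x. ennreal (x^4) \<partial>gauss1) = 3"
proof -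
  have e: "(\<integral>\<^sup>+x. ennreal (x ^ (2 * k)) \<partial>gauss1) = ennreal (fact (2 * k) / (2^k * fact k))" for k
  proof -
    have "(\<integral>\<^sup>+x. ennreal (x ^ (2 * k)) \<partial>gauss1) = (\<integral>\<^sup>+x. ennreal (std_normal_density x * x ^ (2 * k)) \<partial>lborel)"
      by (subst nn_integral_gauss1) (auto simp: ennreal_mult[symmetric])
    also have "\<dots> = ennreal (fact (2 * k) / (2^k * fact k))"
      using nn_integral_eq_integral[of lborel "\<lambda>x. std_normal_density x * x ^ (2 * k)"]
        std_normal_moment_even[of k] by (simp add: has_bochner_integral_iff)
    finally show ?thesis .
  qed
  show "(\<integral>\<^sup>+x. ennreal (x\<^sup>2) \<partial>gauss1) = 1" using e[of 1] by (simp add: fact_numeral)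
  show "(\<integral>\<^sup>+x. ennreal (x^4) \<partial>gauss1) = 3" using e[of 2] by (simp add: fact_numeral)
qed

text \<open>Real and imaginary parts are independent standard normals, so the mean of
  \<open>|x|\<^sup>2\<close> is \<open>2 * d\<close>. The measure lives on the same function space
  as the Haar measure, with all coordinates from \<open>d\<close> on equal to 0.\<close>

primrec gauss :: "nat \<Rightarrow> (nat \<Rightarrow> complex) measure" where
  "gauss 0 = return borel (\<lambda>_. 0)"
| "gauss (Suc d) = distr (gauss1 \<Otimes>\<^sub>M (gauss1 \<Otimes>\<^sub>M gauss d)) borel (\<lambda>(p, q, x). x(d := Complex p q))"

lemma borel_measurable_Complex [measurable (raw)]:
  "f \<in> borel_measurable M \<Longrightarrow> g \<in> borel_measurable M \<Longrightarrow> (\<lambda>x. Complex (f x) (g x)) \<in> borel_measurable M"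
  by (simp add: Complex_eq)

lemma borel_measurable_fun_upd [measurable (raw)]:
  fixes f :: "'a \<Rightarrow> nat \<Rightarrow> complex"
  assumes f: "f \<in> borel_measurable M" and g: "g \<in> borel_measurable M"
  shows "(\<lambda>x. (f x)(d := g x)) \<in> borel_measurable M"
proof (rule measurable_coordinatewise_then_product)
  fix i
  have "(\<lambda>x. f x i) \<in> borel_measurable M" using measurable_compose[OF f measurable_borel_coordinate] .
  then show "(\<lambda>x. ((f x)(d := g x)) i) \<in> borel_measurable M" using g by (cases "i = d") auto
qed

lemma sets_gauss [measurable_cong, simp]: "sets (gauss d) = sets borel"
  by (cases d) auto

lemma space_gauss [simp]: "space (gauss d) = UNIV"
  using sets_eq_imp_space_eq[OF sets_gauss, of d] by simp

lemma upd_measurable [measurable]: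
  "(\<lambda>(p, q, x). x(d := Complex p q)) \<in> measurable (gauss1 \<Otimes>\<^sub>M (gauss1 \<Otimes>\<^sub>M gauss d)) borel"
  unfolding split_beta' by measurable

lemma prob_space_gauss: "prob_space (gauss d)"
proof (induction d)
  case 0
  show ?case by (simp add: prob_space_return)
next
  case (Suc d)
  interpret g1: prob_space gauss1 by (rule prob_space_gauss1)
  interpret gd: prob_space "gauss d" by (rule Suc)
  interpret p1: pair_prob_space gauss1 "gauss d" ..
  interpret p2: prob_space "gauss1 \<Otimes>\<^sub>M gauss d" by (rule p1.prob_space_axioms)
  interpret p3: pair_prob_space gauss1 "gauss1 \<Otimes>\<^sub>M gauss d" ..
  show ?case unfolding gauss.simps by (rule p3.prob_space_distr) (rule upd_measurable)
qed

declare gauss.simps [simp del]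

lemma sigma_finite_gauss1: "sigma_finite_measure gauss1"
  using prob_space_gauss1 by (simp add: prob_space_imp_sigma_finite)

lemma sigma_finite_gauss: "sigma_finite_measure (gauss d)"
  using prob_space_gauss by (simp add: prob_space_imp_sigma_finite)

lemma nn_integral_gauss_0:
  assumes [measurable]: "f \<in> borel_measurable borel"
  shows "(\<integral>\<^sup>+x. f x \<partial>gauss 0) = f (\<lambda>_. 0)"
  unfolding gauss.simps by (simp add: nn_integral_return)

lemma borel_measurable_nn_integral_gauss [measurable (raw)]:
  assumes "(\<lambda>(a, x). f a x) \<in> borel_measurable (M \<Otimes>\<^sub>M borel)"
  shows "(\<lambda>a. \<integral>\<^sup>+x. f a x \<partial>gauss d) \<in> borel_measurable M"
proof -
  interpret sigma_finite_measure "gauss d" by (rule sigma_finite_gauss)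
  have "(\<lambda>(a, x). f a x) \<in> borel_measurable (M \<Otimes>\<^sub>M gauss d)"
    using assms by (simp add: measurable_cong_sets[OF sets_pair_measure_cong[OF refl sets_gauss] refl])
  then show ?thesis by (rule borel_measurable_nn_integral)
qed

lemma borel_measurable_nn_integral_gauss1 [measurable (raw)]:
  assumes "(\<lambda>(a, x). f a x) \<in> borel_measurable (M \<Otimes>\<^sub>M borel)"
  shows "(\<lambda>a. \<integral>\<^sup>+x. f a x \<partial>gauss1) \<in> borel_measurable M"
proof -
  interpret sigma_finite_measure gauss1 by (rule sigma_finite_gauss1)
  have "(\<lambda>(a, x). f a x) \<in> borel_measurable (M \<Otimes>\<^sub>M gauss1)"
    using assms by (simp add: measurable_cong_sets[OF sets_pair_measure_cong[OF refl sets_gauss1] refl])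
  then show ?thesis by (rule borel_measurable_nn_integral)
qed

lemma nn_integral_gauss_Suc:
  assumes [measurable]: "f \<in> borel_measurable borel"
  shows "(\<integral>\<^sup>+x. f x \<partial>gauss (Suc d)) = (\<integral>\<^sup>+p. \<integral>\<^sup>+q. \<integral>\<^sup>+x. f (x(d := Complex p q)) \<partial>gauss d \<partial>gauss1 \<partial>gauss1)"
proof -
  interpret gd: prob_space "gauss d" by (rule prob_space_gauss)
  interpret g1: prob_space gauss1 by (rule prob_space_gauss1)
  interpret p1: pair_prob_space gauss1 "gauss d" ..
  interpret p2: prob_space "gauss1 \<Otimes>\<^sub>M gauss d" by (rule p1.prob_space_axioms)
  have m1: "(\<lambda>(p, q, x). f (x(d := Complex p q))) \<in> borel_measurable (gauss1 \<Otimes>\<^sub>M (gauss1 \<Otimes>\<^sub>M gauss d))"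
    unfolding split_beta' by measurable
  have "(\<integral>\<^sup>+x. f x \<partial>gauss (Suc d)) = (\<integral>\<^sup>+z. f ((\<lambda>(p, q, x). x(d := Complex p q)) z) \<partial>(gauss1 \<Otimes>\<^sub>M (gauss1 \<Otimes>\<^sub>M gauss d)))"
    unfolding gauss.simps by (rule nn_integral_distr[OF upd_measurable]) simp
  also have "\<dots> = (\<integral>\<^sup>+z. (\<lambda>(p, q, x). f (x(d := Complex p q))) z \<partial>(gauss1 \<Otimes>\<^sub>M (gauss1 \<Otimes>\<^sub>M gauss d)))"
    by (simp add: split_beta')
  also have "\<dots> = (\<integral>\<^sup>+p. \<integral>\<^sup>+w. (\<lambda>(p, q, x). f (x(d := Complex p q))) (p, w) \<partial>(gauss1 \<Otimes>\<^sub>M gauss d) \<partial>gauss1)"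
    by (rule sigma_finite_measure.nn_integral_fst[OF prob_space_imp_sigma_finite[OF p1.prob_space_axioms] m1, symmetric])
  also have "\<dots> = (\<integral>\<^sup>+p. \<integral>\<^sup>+q. \<integral>\<^sup>+x. f (x(d := Complex p q)) \<partial>gauss d \<partial>gauss1 \<partial>gauss1)"
  proof (intro nn_integral_cong)
    fix p
    have "(\<lambda>(q, x). f (x(d := Complex p q))) \<in> borel_measurable (gauss1 \<Otimes>\<^sub>M gauss d)"
      unfolding split_beta' by measurable
    from gd.nn_integral_fst[OF this]
    show "(\<integral>\<^sup>+w. (\<lambda>(p, q, x). f (x(d := Complex p q))) (p, w) \<partial>(gauss1 \<Otimes>\<^sub>M gauss d)) = (\<integral>\<^sup>+q. \<integral>\<^sup>+x. f (x(d := Complex p q)) \<partial>gauss d \<partial>gauss1)"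
      by simp
  qed
  finally show ?thesis .
qed

lemma nsq_Suc: "nsq (Suc d) x = nsq d x + (cmod (x d))\<^sup>2" by (simp add: nsq_def)
lemma ip_Suc: "ip (Suc d) x y = ip d x y + cnj (x d) * y d" by (simp add: ip_def)
lemma nsq_upd [simp]: "nsq d (x(d := z)) = nsq d x" by (simp add: nsq_def)
lemma ip_upd [simp]: "ip d y (x(d := z)) = ip d y x" "ip d (y(d := z)) x = ip d y x" by (simp_all add: ip_def)

text \<open>The Cameron-Martin formula, one complex coordinate at a time. The shift has to vanish
  from \<open>d\<close> on, where the measure is a point mass.\<close>

lemma gauss_shift:
  assumes "G \<in> borel_measurable borel" "\<And>i. i \<ge> d \<Longrightarrow> b i = 0"
  shows "(\<integral>\<^sup>+x. G (\<lambda>i. x i + b i) \<partial>gauss d) = (\<integral>\<^sup>+x. ennreal (exp (Re (ip d b x) - nsq d b / 2)) * G x \<partial>gauss d)"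
  using assms
proof (induction d arbitrary: G b)
  case 0
  have [measurable]: "G \<in> borel_measurable borel" by fact
  have "b = (\<lambda>_. 0)" using 0 by auto
  have "(\<integral>\<^sup>+x. G (\<lambda>i. x i + b i) \<partial>gauss 0) = G (\<lambda>_. 0)"
    using nn_integral_gauss_0[of G] \<open>b = _\<close> by simp
  moreover have "(\<integral>\<^sup>+x. ennreal (exp (Re (ip 0 b x) - nsq 0 b / 2)) * G x \<partial>gauss 0) = G (\<lambda>_. 0)"
    using nn_integral_gauss_0[of G] by (simp add: ip_def nsq_def)
  ultimately show ?case by simp
next
  case (Suc d)
  have Gm [measurable]: "G \<in> borel_measurable borel" by fact
  define b' where "b' = b(d := 0)"
  have b': "b' i = 0" if "i \<ge> d" for i using Suc.prems(2)[of i] that by (cases "i = d") (auto simp: b'_def)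
  define r where "r = Re (b d)"
  define s where "s = Im (b d)"
  have bd: "b d = Complex r s" by (simp add: r_def s_def)
  have add_meas: "(\<lambda>x::nat\<Rightarrow>complex. (\<lambda>i. x i + b i)) \<in> borel_measurable borel"
    by (rule measurable_coordinatewise_then_product) measurable
  have ipm [measurable]: "(\<lambda>x. ip n y x) \<in> borel_measurable borel" for n y unfolding ip_def by measurable
  have e: "(\<lambda>i. (x(d := Complex p q)) i + b i) = (\<lambda>i. (x i + b' i))(d := Complex (p + r) (q + s))" for x p q
    by (auto simp: b'_def bd fun_eq_iff complex_eq_iff)
  have "(\<integral>\<^sup>+x. G (\<lambda>i. x i + b i) \<partial>gauss (Suc d))
    = (\<integral>\<^sup>+p. \<integral>\<^sup>+q. \<integral>\<^sup>+x. G ((\<lambda>i. (x i + b' i))(d := Complex (p + r) (q + s))) \<partial>gauss d \<partial>gauss1 \<partial>gauss1)"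
    using nn_integral_gauss_Suc[OF measurable_compose[OF add_meas Gm]] by (simp only: e)
  also have "\<dots> = (\<integral>\<^sup>+p. \<integral>\<^sup>+q. \<integral>\<^sup>+x. ennreal (exp (Re (ip d b' x) - nsq d b' / 2)) * G (x(d := Complex (p + r) (q + s))) \<partial>gauss d \<partial>gauss1 \<partial>gauss1)"
    by (intro nn_integral_cong Suc.IH[where G = "\<lambda>x. G (x(d := _))"] b') measurable
  also have "\<dots> = (\<integral>\<^sup>+p. \<integral>\<^sup>+q. ennreal (exp (s * q - s\<^sup>2/2)) * (\<integral>\<^sup>+x. ennreal (exp (Re (ip d b' x) - nsq d b' / 2)) * G (x(d := Complex (p + r) q)) \<partial>gauss d) \<partial>gauss1 \<partial>gauss1)"
    by (intro nn_integral_cong gauss1_shift[where G = "\<lambda>q. \<integral>\<^sup>+x. ennreal (exp (Re (ip d b' x) - nsq d b' / 2)) * G (x(d := Complex _ q)) \<partial>gauss d"]) measurable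
  also have "\<dots> = (\<integral>\<^sup>+p. ennreal (exp (r * p - r\<^sup>2/2)) * (\<integral>\<^sup>+q. ennreal (exp (s * q - s\<^sup>2/2)) * (\<integral>\<^sup>+x. ennreal (exp (Re (ip d b' x) - nsq d b' / 2)) * G (x(d := Complex p q)) \<partial>gauss d) \<partial>gauss1) \<partial>gauss1)"
    by (rule gauss1_shift[where G = "\<lambda>p. (\<integral>\<^sup>+q. ennreal (exp (s * q - s\<^sup>2/2)) * (\<integral>\<^sup>+x. ennreal (exp (Re (ip d b' x) - nsq d b' / 2)) * G (x(d := Complex p q)) \<partial>gauss d) \<partial>gauss1)"]) measurable
  also have "\<dots> = (\<integral>\<^sup>+p. \<integral>\<^sup>+q. \<integral>\<^sup>+x. ennreal (exp (r * p - r\<^sup>2/2)) * (ennreal (exp (s * q - s\<^sup>2/2)) * (ennreal (exp (Re (ip d b' x) - nsq d b' / 2)) * G (x(d := Complex p q)))) \<partial>gauss d \<partial>gauss1 \<partial>gauss1)"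
    by (simp add: nn_integral_cmult)
  also have "\<dots> = (\<integral>\<^sup>+p. \<integral>\<^sup>+q. \<integral>\<^sup>+x. ennreal (exp (Re (ip (Suc d) b (x(d := Complex p q))) - nsq (Suc d) b / 2)) * G (x(d := Complex p q)) \<partial>gauss d \<partial>gauss1 \<partial>gauss1)"
  proof (intro nn_integral_cong)
    fix p q x
    have i: "ip d b' x = ip d b x" "nsq d b' = nsq d b" by (simp_all add: b'_def)
    have "Re (ip (Suc d) b (x(d := Complex p q))) - nsq (Suc d) b / 2
      = (r * p - r\<^sup>2/2) + ((s * q - s\<^sup>2/2) + (Re (ip d b' x) - nsq d b' / 2))"
      unfolding i by (simp add: ip_Suc nsq_Suc bd cmod_power2 field_simps)
    then have "exp (Re (ip (Suc d) b (x(d := Complex p q))) - nsq (Suc d) b / 2)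
      = exp (r * p - r\<^sup>2/2) * (exp (s * q - s\<^sup>2/2) * exp (Re (ip d b' x) - nsq d b' / 2))"
      by (simp only: exp_add)
    then show "ennreal (exp (r * p - r\<^sup>2/2)) * (ennreal (exp (s * q - s\<^sup>2/2)) * (ennreal (exp (Re (ip d b' x) - nsq d b' / 2)) * G (x(d := Complex p q))))
       = ennreal (exp (Re (ip (Suc d) b (x(d := Complex p q))) - nsq (Suc d) b / 2)) * G (x(d := Complex p q))"
      by (simp only: mult.assoc ennreal_mult exp_ge_zero mult_nonneg_nonneg)
  qed
  also have "\<dots> = (\<integral>\<^sup>+x. ennreal (exp (Re (ip (Suc d) b x) - nsq (Suc d) b / 2)) * G x \<partial>gauss (Suc d))"
    by (rule nn_integral_gauss_Suc[symmetric]) measurable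
  finally show ?case .
qed

lemma measurable_nsq [measurable]: "(\<lambda>x. nsq n x) \<in> borel_measurable borel" unfolding nsq_def by measurable
lemma measurable_ip [measurable]: "(\<lambda>x. ip n y x) \<in> borel_measurable borel" unfolding ip_def by measurable

text \<open>The right side sees \<open>b\<close> only through \<open>nsq d b\<close>: the
  exponential transform is radial, a property shared with the unitarily invariant measures.\<close>

lemma gauss_exp_quadratic:
  assumes a: "a \<ge> 0"
  shows "(\<integral>\<^sup>+x. ennreal (exp (Re (ip d b x) - a * nsq d x)) \<partial>gauss d)
     = (\<integral>\<^sup>+x. ennreal (exp (- a * x\<^sup>2)) \<partial>gauss1) ^ (2 * d) * ennreal (exp (nsq d b / (2 * (1 + 2 * a))))"
proof (induction d)
  case 0
  show ?case by (subst nn_integral_gauss_0) (auto simp: ip_def nsq_def)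
next
  case (Suc d)
  let ?C = "\<integral>\<^sup>+x. ennreal (exp (- a * x\<^sup>2)) \<partial>gauss1"
  let ?k = "2 * (1 + 2 * a)"
  have "(\<integral>\<^sup>+x. ennreal (exp (Re (ip (Suc d) b x) - a * nsq (Suc d) x)) \<partial>gauss (Suc d))
    = (\<integral>\<^sup>+p. \<integral>\<^sup>+q. \<integral>\<^sup>+x. ennreal (exp (Re (ip (Suc d) b (x(d := Complex p q))) - a * nsq (Suc d) (x(d := Complex p q)))) \<partial>gauss d \<partial>gauss1 \<partial>gauss1)"
    by (rule nn_integral_gauss_Suc) measurable
  also have "\<dots> = (\<integral>\<^sup>+p. \<integral>\<^sup>+q. \<integral>\<^sup>+x. ennreal (exp (Re (b d) * p - a * p\<^sup>2)) * (ennreal (exp (Im (b d) * q - a * q\<^sup>2)) * ennreal (exp (Re (ip d b x) - a * nsq d x))) \<partial>gauss d \<partial>gauss1 \<partial>gauss1)"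
  proof (intro nn_integral_cong)
    fix p q x
    have "Re (ip (Suc d) b (x(d := Complex p q))) - a * nsq (Suc d) (x(d := Complex p q))
      = (Re (b d) * p - a * p\<^sup>2) + ((Im (b d) * q - a * q\<^sup>2) + (Re (ip d b x) - a * nsq d x))"
      by (simp add: ip_Suc nsq_Suc cmod_power2 algebra_simps)
    then show "ennreal (exp (Re (ip (Suc d) b (x(d := Complex p q))) - a * nsq (Suc d) (x(d := Complex p q))))
      = ennreal (exp (Re (b d) * p - a * p\<^sup>2)) * (ennreal (exp (Im (b d) * q - a * q\<^sup>2)) * ennreal (exp (Re (ip d b x) - a * nsq d x)))"
      by (simp only: exp_add ennreal_mult exp_ge_zero mult_nonneg_nonneg)
  qed
  also have "\<dots> = (\<integral>\<^sup>+p. ennreal (exp (Re (b d) * p - a * p\<^sup>2)) \<partial>gauss1) * ((\<integral>\<^sup>+q. ennreal (exp (Im (b d) * q - a * q\<^sup>2)) \<partial>gauss1) * (\<integral>\<^sup>+x. ennreal (exp (Re (ip d b x) - a * nsq d x)) \<partial>gauss d))"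
    by (simp add: nn_integral_cmult nn_integral_multc)
  also have "\<dots> = (?C * ennreal (exp ((Re (b d))\<^sup>2 / ?k))) * ((?C * ennreal (exp ((Im (b d))\<^sup>2 / ?k))) * (?C ^ (2 * d) * ennreal (exp (nsq d b / ?k))))"
    by (simp only: gauss1_exp_quadratic[OF a] Suc)
  also have "\<dots> = (?C * (?C * ?C ^ (2 * d))) * (ennreal (exp ((Re (b d))\<^sup>2 / ?k)) * (ennreal (exp ((Im (b d))\<^sup>2 / ?k)) * ennreal (exp (nsq d b / ?k))))"
    by (simp only: ac_simps)
  also have "ennreal (exp ((Re (b d))\<^sup>2 / ?k)) * (ennreal (exp ((Im (b d))\<^sup>2 / ?k)) * ennreal (exp (nsq d b / ?k)))
     = ennreal (exp (nsq (Suc d) b / ?k))"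
    by (simp add: ennreal_mult[symmetric] exp_add[symmetric] nsq_Suc cmod_power2 add_divide_distrib ac_simps)
  finally show ?case by simp
qed

text \<open>Log-Lipschitz bounds are stated in this norm because it adds up over the real
  coordinates and so restricts to each of them in the induction.\<close>

definition l1 :: "nat \<Rightarrow> (nat \<Rightarrow> complex) \<Rightarrow> real" where
  "l1 d x = (\<Sum>i<d. \<bar>Re (x i)\<bar> + \<bar>Im (x i)\<bar>)"

lemma l1_Suc: "l1 (Suc d) x = l1 d x + \<bar>Re (x d)\<bar> + \<bar>Im (x d)\<bar>" by (simp add: l1_def)

text \<open>Tensorisation: for fixed last coordinates the induction hypothesis applies with
  \<open>K\<close> enlarged by
  \<open>exp ((p - p')\<^sup>2 / 4) * exp ((q - q')\<^sup>2 / 4)\<close>, and its conclusion is the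
  hypothesis of the one-dimensional inequality, used in \<open>q\<close> and then in
  \<open>p\<close>.\<close>

theorem gauss_tau:
  fixes u v :: "(nat \<Rightarrow> complex) \<Rightarrow> ennreal"
  assumes "u \<in> borel_measurable borel" "v \<in> borel_measurable borel"
    and "\<And>x y. u x \<le> ennreal (exp (c * l1 d (\<lambda>i. x i - y i))) * u y"
    and "\<And>x y. v x \<le> ennreal (exp (c * l1 d (\<lambda>i. x i - y i))) * v y"
    and "K > 0" and "\<And>x y. u x * v y \<le> ennreal (K * exp (nsq d (\<lambda>i. x i - y i) / 4))"
  shows "(\<integral>\<^sup>+x. u x \<partial>gauss d) * (\<integral>\<^sup>+x. v x \<partial>gauss d) \<le> ennreal K"
  using assms
proof (induction d arbitrary: u v K)
  case 0
  show ?case using 0(6)[of "\<lambda>_. 0" "\<lambda>_. 0"] by (simp add: nn_integral_gauss_0[OF 0(1)] nn_integral_gauss_0[OF 0(2)] nsq_def)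
next
  case (Suc d)
  have [measurable]: "u \<in> borel_measurable borel" "v \<in> borel_measurable borel" by fact+
  have lu: "u (x(d := z)) \<le> ennreal (exp (c * (l1 d (\<lambda>i. x i - y i) + \<bar>Re z - Re w\<bar> + \<bar>Im z - Im w\<bar>))) * u (y(d := w))" for x y z w
  proof -
    have e: "l1 (Suc d) (\<lambda>i. (x(d := z)) i - (y(d := w)) i) = l1 d (\<lambda>i. x i - y i) + \<bar>Re z - Re w\<bar> + \<bar>Im z - Im w\<bar>"
      by (simp add: l1_def)
    show ?thesis using Suc.prems(3)[of "x(d := z)" "y(d := w)"] unfolding e .
  qed
  have lv: "v (x(d := z)) \<le> ennreal (exp (c * (l1 d (\<lambda>i. x i - y i) + \<bar>Re z - Re w\<bar> + \<bar>Im z - Im w\<bar>))) * v (y(d := w))" for x y z w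
  proof -
    have e: "l1 (Suc d) (\<lambda>i. (x(d := z)) i - (y(d := w)) i) = l1 d (\<lambda>i. x i - y i) + \<bar>Re z - Re w\<bar> + \<bar>Im z - Im w\<bar>"
      by (simp add: l1_def)
    show ?thesis using Suc.prems(4)[of "x(d := z)" "y(d := w)"] unfolding e .
  qed
  have z0: "l1 d (\<lambda>i. x i - x i) = 0" for x by (simp add: l1_def)
  define U where "U p q = (\<integral>\<^sup>+x. u (x(d := Complex p q)) \<partial>gauss d)" for p q
  define V where "V p q = (\<integral>\<^sup>+x. v (x(d := Complex p q)) \<partial>gauss d)" for p q
  have UV: "U p q * V p' q' \<le> ennreal (K * exp ((p - p')\<^sup>2 / 4) * exp ((q - q')\<^sup>2 / 4))" for p q p' q'
    unfolding U_def V_def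
  proof (rule Suc.IH)
    show "u (x(d := Complex p q)) \<le> ennreal (exp (c * l1 d (\<lambda>i. x i - y i))) * u (y(d := Complex p q))" for x y
      using lu[of x "Complex p q" y "Complex p q"] by simp
    show "v (x(d := Complex p' q')) \<le> ennreal (exp (c * l1 d (\<lambda>i. x i - y i))) * v (y(d := Complex p' q'))" for x y
      using lv[of x "Complex p' q'" y "Complex p' q'"] by simp
    show "0 < K * exp ((p - p')\<^sup>2 / 4) * exp ((q - q')\<^sup>2 / 4)" using Suc.prems(5) by simp
    fix x y
    have "nsq (Suc d) (\<lambda>i. (x(d := Complex p q)) i - (y(d := Complex p' q')) i) = nsq d (\<lambda>i. x i - y i) + ((p - p')\<^sup>2 + (q - q')\<^sup>2)"
      by (simp add: nsq_def cmod_power2)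
    then have e: "K * exp (nsq (Suc d) (\<lambda>i. (x(d := Complex p q)) i - (y(d := Complex p' q')) i) / 4)
      = K * exp ((p - p')\<^sup>2 / 4) * exp ((q - q')\<^sup>2 / 4) * exp (nsq d (\<lambda>i. x i - y i) / 4)"
      by (simp add: exp_add[symmetric] add_divide_distrib ac_simps)
    show "u (x(d := Complex p q)) * v (y(d := Complex p' q')) \<le> ennreal (K * exp ((p - p')\<^sup>2 / 4) * exp ((q - q')\<^sup>2 / 4) * exp (nsq d (\<lambda>i. x i - y i) / 4))"
      using Suc.prems(6)[of "x(d := Complex p q)" "y(d := Complex p' q')"] unfolding e .
  qed measurable
  have lU: "U p q \<le> ennreal (exp (c * (\<bar>p - p'\<bar> + \<bar>q - q'\<bar>))) * U p' q'" for p q p' q'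
  proof -
    have "U p q \<le> (\<integral>\<^sup>+x. ennreal (exp (c * (\<bar>p - p'\<bar> + \<bar>q - q'\<bar>))) * u (x(d := Complex p' q')) \<partial>gauss d)"
      unfolding U_def using lu[of _ "Complex p q" _ "Complex p' q'"] z0 by (intro nn_integral_mono) (metis add.assoc add_0 complex.sel)
    then show ?thesis unfolding U_def by (subst (asm) nn_integral_cmult) measurable
  qed
  have lV: "V p q \<le> ennreal (exp (c * (\<bar>p - p'\<bar> + \<bar>q - q'\<bar>))) * V p' q'" for p q p' q'
  proof -
    have "V p q \<le> (\<integral>\<^sup>+x. ennreal (exp (c * (\<bar>p - p'\<bar> + \<bar>q - q'\<bar>))) * v (x(d := Complex p' q')) \<partial>gauss d)"
      unfolding V_def using lv[of _ "Complex p q" _ "Complex p' q'"] z0 by (intro nn_integral_mono) (metis add.assoc add_0 complex.sel)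
    then show ?thesis unfolding V_def by (subst (asm) nn_integral_cmult) measurable
  qed
  have [measurable]: "(\<lambda>(p, q). U p q) \<in> borel_measurable (borel \<Otimes>\<^sub>M borel)" "(\<lambda>(p, q). V p q) \<in> borel_measurable (borel \<Otimes>\<^sub>M borel)"
    unfolding U_def V_def split_beta' by measurable
  have UVq: "(\<integral>\<^sup>+q. U p q \<partial>gauss1) * (\<integral>\<^sup>+q. V p' q \<partial>gauss1) \<le> ennreal (K * exp ((p - p')\<^sup>2 / 4))" for p p'
    by (rule gauss1_tau[where c = c])
       (use lU[of p _ p] lV[of p' _ p'] UV[of p _ p'] Suc.prems(5) in auto)
  have "(\<integral>\<^sup>+p. \<integral>\<^sup>+q. U p q \<partial>gauss1 \<partial>gauss1) * (\<integral>\<^sup>+p. \<integral>\<^sup>+q. V p q \<partial>gauss1 \<partial>gauss1) \<le> ennreal K"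
  proof (rule gauss1_tau[where c = c, OF _ _ Suc.prems(5) UVq])
    fix p p'
    have "(\<integral>\<^sup>+q. U p q \<partial>gauss1) \<le> (\<integral>\<^sup>+q. ennreal (exp (c * \<bar>p - p'\<bar>)) * U p' q \<partial>gauss1)"
      using lU[of p _ p'] by (intro nn_integral_mono) (metis add.right_neutral abs_zero diff_self)
    then show "(\<integral>\<^sup>+q. U p q \<partial>gauss1) \<le> ennreal (exp (c * \<bar>p - p'\<bar>)) * (\<integral>\<^sup>+q. U p' q \<partial>gauss1)"
      by (subst (asm) nn_integral_cmult) measurable
    have "(\<integral>\<^sup>+q. V p q \<partial>gauss1) \<le> (\<integral>\<^sup>+q. ennreal (exp (c * \<bar>p - p'\<bar>)) * V p' q \<partial>gauss1)"
      using lV[of p _ p'] by (intro nn_integral_mono) (metis add.right_neutral abs_zero diff_self)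
    then show "(\<integral>\<^sup>+q. V p q \<partial>gauss1) \<le> ennreal (exp (c * \<bar>p - p'\<bar>)) * (\<integral>\<^sup>+q. V p' q \<partial>gauss1)"
      by (subst (asm) nn_integral_cmult) measurable
  qed
  then show ?case
    unfolding nn_integral_gauss_Suc[OF Suc.prems(1)] nn_integral_gauss_Suc[OF Suc.prems(2)] U_def V_def .
qed

lemma gauss_moments:
  "(\<integral>\<^sup>+x. ennreal (nsq d x) \<partial>gauss d) = ennreal (2 * d)"
  "(\<integral>\<^sup>+x. ennreal ((nsq d x)\<^sup>2) \<partial>gauss d) = ennreal (2 * d * (2 * d + 2))"
proof (induction d)
  case 0
  { case 1 show ?case by (subst nn_integral_gauss_0) (auto simp: nsq_def) }
  { case 2 show ?case by (subst nn_integral_gauss_0) (auto simp: nsq_def) }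
next
  case (Suc d)
  interpret g1: prob_space gauss1 by (rule prob_space_gauss1)
  interpret gd: prob_space "gauss d" by (rule prob_space_gauss)
  have one: "emeasure gauss1 UNIV = 1" "emeasure (gauss d) UNIV = 1"
    using g1.emeasure_space_1 gd.emeasure_space_1 by simp_all
  have e: "nsq (Suc d) (x(d := Complex p q)) = nsq d x + (p\<^sup>2 + q\<^sup>2)" for x p q
    by (simp add: nsq_Suc cmod_power2)
  { case 1
    have "(\<integral>\<^sup>+x. ennreal (nsq (Suc d) x) \<partial>gauss (Suc d)) = (\<integral>\<^sup>+p. \<integral>\<^sup>+q. \<integral>\<^sup>+x. ennreal (nsq d x) + (ennreal (p\<^sup>2) + ennreal (q\<^sup>2)) \<partial>gauss d \<partial>gauss1 \<partial>gauss1)"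
      by (subst nn_integral_gauss_Suc) (auto simp: e ennreal_plus[symmetric] simp del: ennreal_plus)
    also have "\<dots> = ennreal (2 * d) + (1 + 1)"
      by (simp add: nn_integral_add Suc(1) one gauss1_moments(1))
    also have "\<dots> = ennreal (2 * d) + ennreal 2" by simp
    also have "\<dots> = ennreal (2 * d + 2)" by (subst ennreal_plus[symmetric]) auto
    finally show ?case by (simp add: algebra_simps del: ennreal_plus) }
  { case 2
    have "(\<integral>\<^sup>+x. ennreal ((nsq (Suc d) x)\<^sup>2) \<partial>gauss (Suc d))
      = (\<integral>\<^sup>+p. \<integral>\<^sup>+q. \<integral>\<^sup>+x. ennreal ((nsq d x)\<^sup>2) + (ennreal (2 * p\<^sup>2) * ennreal (nsq d x) + (ennreal (2 * q\<^sup>2) * ennreal (nsq d x)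
         + (ennreal (p^4) + (ennreal (q^4) + ennreal (2 * p\<^sup>2) * ennreal (q\<^sup>2))))) \<partial>gauss d \<partial>gauss1 \<partial>gauss1)"
    proof (subst nn_integral_gauss_Suc, measurable, intro nn_integral_cong)
      fix p q x
      have "(nsq (Suc d) (x(d := Complex p q)))\<^sup>2 = (nsq d x)\<^sup>2 + (2 * p\<^sup>2 * nsq d x + (2 * q\<^sup>2 * nsq d x
         + (p^4 + (q^4 + 2 * p\<^sup>2 * q\<^sup>2))))"
        unfolding e by (simp add: power2_eq_square power4_eq_xxxx algebra_simps)
      then show "ennreal ((nsq (Suc d) (x(d := Complex p q)))\<^sup>2) = ennreal ((nsq d x)\<^sup>2) + (ennreal (2 * p\<^sup>2) * ennreal (nsq d x) + (ennreal (2 * q\<^sup>2) * ennreal (nsq d x)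
         + (ennreal (p^4) + (ennreal (q^4) + ennreal (2 * p\<^sup>2) * ennreal (q\<^sup>2)))))"
        by (simp add: ennreal_mult[symmetric] ennreal_plus[symmetric] del: ennreal_plus)
    qed
    also have "\<dots> = ennreal (2 * d * (2 * d + 2)) + (2 * ennreal (2 * d) + (2 * ennreal (2 * d) + (3 + (3 + 2))))"
      by (simp add: nn_integral_add nn_integral_cmult nn_integral_multc Suc(1,2) one gauss1_moments ennreal_mult del: ennreal_plus)
    also have "\<dots> = ennreal (2 * d * (2 * d + 2) + (2 * (2 * d) + (2 * (2 * d) + 8)))"
      by (simp add: ennreal_plus[symmetric] ennreal_mult[symmetric] flip: ennreal_numeral ennreal_1 del: ennreal_plus)
    finally show ?case by (simp add: algebra_simps) }
qed

lemma measurable_l1 [measurable]: "l1 d \<in> borel_measurable borel" unfolding l1_def by measurable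

lemma l1_nonneg [simp]: "l1 d x \<ge> 0" by (simp add: l1_def sum_nonneg)

lemma nsq_le_l1_sq: "sqrt (nsq d x) \<le> l1 d x"
proof (induction d)
  case 0 show ?case by (simp add: nsq_def l1_def)
next
  case (Suc d)
  have "sqrt (nsq (Suc d) x) \<le> sqrt (nsq d x) + sqrt ((cmod (x d))\<^sup>2)"
    unfolding nsq_Suc by (rule sqrt_add_le_add_sqrt) auto
  also have "\<dots> \<le> l1 d x + (\<bar>Re (x d)\<bar> + \<bar>Im (x d)\<bar>)" using Suc cmod_le by (simp add: add_mono)
  finally show ?case by (simp add: l1_Suc)
qed

lemma l1_triangle: "l1 d x \<le> l1 d (\<lambda>i. x i - y i) + l1 d y"
  unfolding l1_def sum.distrib[symmetric] by (intro sum_mono) auto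

lemma l1_minus_commute: "l1 d (\<lambda>i. x i - y i) = l1 d (\<lambda>i. y i - x i)"
  unfolding l1_def by (intro sum.cong) auto

text \<open>Young's inequality in each of the \<open>2 * d\<close> real coordinates.\<close>

lemma l1_le_nsq: "2 * c * l1 d x \<le> nsq d x / 4 + 8 * c\<^sup>2 * d"
proof -
  have am: "2 * c * \<bar>a\<bar> \<le> a\<^sup>2 / 4 + 4 * c\<^sup>2" for a :: real
  proof -
    have "0 \<le> (\<bar>a\<bar> / 2 - 2 * c)\<^sup>2" by simp
    also have "\<dots> = a\<^sup>2 / 4 + 4 * c\<^sup>2 - 2 * c * \<bar>a\<bar>" by (simp add: power2_eq_square algebra_simps)
    finally show ?thesis by simp
  qed
  have "2 * c * l1 d x = (\<Sum>i<d. 2 * c * \<bar>Re (x i)\<bar> + 2 * c * \<bar>Im (x i)\<bar>)"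
    by (simp add: l1_def sum_distrib_left distrib_left)
  also have "\<dots> \<le> (\<Sum>i<d. ((Re (x i))\<^sup>2 / 4 + 4 * c\<^sup>2) + ((Im (x i))\<^sup>2 / 4 + 4 * c\<^sup>2))"
    by (intro sum_mono add_mono am)
  also have "\<dots> = (\<Sum>i<d. (cmod (x i))\<^sup>2 / 4 + 8 * c\<^sup>2)"
    by (intro sum.cong refl) (simp add: cmod_power2 add_divide_distrib)
  also have "\<dots> = nsq d x / 4 + 8 * c\<^sup>2 * d"
    by (simp add: nsq_def sum.distrib sum_divide_distrib)
  finally show ?thesis .
qed

lemma nn_integral_pos_gauss:
  assumes "\<And>x. v x > (0::ennreal)" "v \<in> borel_measurable borel"
  shows "(\<integral>\<^sup>+x. v x \<partial>gauss d) \<noteq> 0"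
proof
  interpret prob_space "gauss d" by (rule prob_space_gauss)
  assume "(\<integral>\<^sup>+x. v x \<partial>gauss d) = 0"
  then have "AE x in gauss d. v x = 0" using assms(2) by (subst (asm) nn_integral_0_iff_AE) auto
  then have "AE x in gauss d. False" by eventually_elim (use assms(1) in \<open>simp add: less_le\<close>)
  then show False by simp
qed

text \<open>Property (tau) itself gives finiteness: it bounds the product with the integral of the
  reciprocal, which is not 0.\<close>

lemma gauss_exp_l1_finite: "(\<integral>\<^sup>+x. ennreal (exp (2 * c * l1 d x)) \<partial>gauss d) < \<top>"
proof -
  define u where "u x = ennreal (exp (2 * c * l1 d x))" for x
  define v where "v x = ennreal (exp (- (2 * c * l1 d x)))" for x
  have [measurable]: "u \<in> borel_measurable borel" "v \<in> borel_measurable borel" unfolding u_def v_def by measurable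
  have d1: "\<bar>l1 d x - l1 d y\<bar> \<le> l1 d (\<lambda>i. x i - y i)" for x y
    using l1_triangle[of d x y] l1_triangle[of d y x] l1_minus_commute[of d x y] by linarith
  have d2: "s * (l1 d x - l1 d y) \<le> \<bar>s\<bar> * l1 d (\<lambda>i. x i - y i)" for x y s
  proof -
    have "s * (l1 d x - l1 d y) \<le> \<bar>s\<bar> * \<bar>l1 d x - l1 d y\<bar>" by (metis abs_ge_self abs_mult)
    also have "\<dots> \<le> \<bar>s\<bar> * l1 d (\<lambda>i. x i - y i)" by (intro mult_left_mono d1) simp
    finally show ?thesis .
  qed
  have "(\<integral>\<^sup>+x. u x \<partial>gauss d) * (\<integral>\<^sup>+x. v x \<partial>gauss d) \<le> ennreal (exp (8 * c\<^sup>2 * d))"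
  proof (rule gauss_tau[where c = "\<bar>2 * c\<bar>"])
    fix x y
    have "exp (2 * c * l1 d x) \<le> exp (\<bar>2 * c\<bar> * l1 d (\<lambda>i. x i - y i)) * exp (2 * c * l1 d y)"
      using d2[of "2 * c" x y] by (simp add: exp_add[symmetric] algebra_simps)
    then show "u x \<le> ennreal (exp (\<bar>2 * c\<bar> * l1 d (\<lambda>i. x i - y i))) * u y"
      unfolding u_def by (simp add: ennreal_mult[symmetric])
    have "exp (- (2 * c * l1 d x)) \<le> exp (\<bar>2 * c\<bar> * l1 d (\<lambda>i. x i - y i)) * exp (- (2 * c * l1 d y))"
      using d2[of "- (2 * c)" x y] by (simp add: exp_add[symmetric] algebra_simps)
    then show "v x \<le> ennreal (exp (\<bar>2 * c\<bar> * l1 d (\<lambda>i. x i - y i))) * v y"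
      unfolding v_def by (simp add: ennreal_mult[symmetric])
    have "2 * c * l1 d x + - (2 * c * l1 d y) \<le> \<bar>2 * c\<bar> * l1 d (\<lambda>i. x i - y i)"
      using d2[of "2 * c" x y] by (simp add: algebra_simps)
    also have "\<dots> \<le> nsq d (\<lambda>i. x i - y i) / 4 + 8 * c\<^sup>2 * d"
      using l1_le_nsq[of "\<bar>c\<bar>" d "\<lambda>i. x i - y i"] by (simp add: abs_mult)
    finally have "exp (2 * c * l1 d x) * exp (- (2 * c * l1 d y)) \<le> exp (8 * c\<^sup>2 * d) * exp (nsq d (\<lambda>i. x i - y i) / 4)"
      by (simp only: exp_add[symmetric] exp_le_cancel_iff add.commute)
    then show "u x * v y \<le> ennreal (exp (8 * c\<^sup>2 * d) * exp (nsq d (\<lambda>i. x i - y i) / 4))"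
      unfolding u_def v_def by (simp add: ennreal_mult[symmetric])
  qed (auto)
  moreover have "(\<integral>\<^sup>+x. v x \<partial>gauss d) \<noteq> 0" by (rule nn_integral_pos_gauss) (auto simp: v_def)
  ultimately have "(\<integral>\<^sup>+x. u x \<partial>gauss d) \<noteq> \<top>" by (auto simp: ennreal_top_mult top_unique)
  then show ?thesis by (simp add: u_def less_top)
qed

section \<open>Concentration on the sphere\<close>

text \<open>The cut-off at \<open>d\<close> provides the support that \<open>gauss_shift\<close>
  demands, also for arguments outside the sphere.\<close>

definition scal :: "nat \<Rightarrow> real \<Rightarrow> (nat \<Rightarrow> complex) \<Rightarrow> nat \<Rightarrow> complex" where
  "scal d r u = (\<lambda>i. if i < d then of_real r * u i else 0)"

lemma borel_measurable_scal [measurable (raw)]: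
  assumes f: "f \<in> borel_measurable M" and g: "g \<in> borel_measurable M"
  shows "(\<lambda>x. scal d (f x) (g x)) \<in> borel_measurable M"
proof (rule measurable_coordinatewise_then_product)
  fix i
  have [measurable]: "(\<lambda>x. g x i) \<in> borel_measurable M" using measurable_compose[OF g measurable_borel_coordinate] .
  show "(\<lambda>x. scal d (f x) (g x) i) \<in> borel_measurable M" unfolding scal_def using f by (cases "i < d") auto
qed

lemma nsq_scal: "nsq d (scal d r u) = r\<^sup>2 * nsq d u"
  by (simp add: scal_def nsq_def norm_mult power_mult_distrib sum_distrib_left)

lemma ip_scal: "ip d (scal d r u) z = of_real r * ip d u z" "ip d z (scal d r u) = of_real r * ip d z u"
  by (simp_all add: scal_def ip_def sum_distrib_left algebra_simps)

lemma borel_measurable_ip [measurable (raw)]: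
  fixes f g :: "'a \<Rightarrow> nat \<Rightarrow> complex"
  assumes f: "f \<in> borel_measurable M" and g: "g \<in> borel_measurable M"
  shows "(\<lambda>x. ip n (f x) (g x)) \<in> borel_measurable M"
proof -
  have [measurable]: "(\<lambda>x. f x i) \<in> borel_measurable M" "(\<lambda>x. g x i) \<in> borel_measurable M" for i
    using measurable_compose[OF f measurable_borel_coordinate] measurable_compose[OF g measurable_borel_coordinate] by auto
  show ?thesis unfolding ip_def by measurable
qed

lemma Re_ip_commute: "Re (ip d x y) = Re (ip d y x)"
  using cnj_ip[of d x y] by (metis cnj.simps(1))

text \<open>The smoothing of a log-Lipschitz \<open>G\<close> by a small Gaussian, written with a density (Cameron-Martin).\<close>
lemma gauss_smoothing:
  assumes [measurable]: "G \<in> borel_measurable borel" and s: "s > 0" and y: "\<And>i. i \<ge> d \<Longrightarrow> y i = 0"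
  shows "(\<integral>\<^sup>+z. G (\<lambda>i. y i + scal d s z i) \<partial>gauss d)
     = (\<integral>\<^sup>+z. ennreal (exp (Re (ip d (scal d (1/s) z) y) - 1 / (2 * s\<^sup>2) * nsq d y)) * G (scal d s z) \<partial>gauss d)"
proof -
  define b where "b = scal d (1/s) y"
  have b: "b i = 0" if "i \<ge> d" for i using that by (simp add: b_def scal_def)
  have e: "(\<lambda>i. y i + scal d s z i) = scal d s (\<lambda>i. z i + b i)" for z
    using s y by (auto simp: scal_def b_def fun_eq_iff algebra_simps)
  have m: "(\<lambda>z. G (scal d s z)) \<in> borel_measurable borel" by measurable
  have w: "Re (ip d b z) - nsq d b / 2 = Re (ip d (scal d (1/s) z) y) - 1 / (2 * s\<^sup>2) * nsq d y" for z
    using Re_ip_commute[of d y z] by (simp add: b_def ip_scal nsq_scal power_divide)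
  show ?thesis unfolding e using gauss_shift[of "\<lambda>z. G (scal d s z)" d b, OF m b] unfolding w .
qed

text \<open>The relative error of smoothing at scale \<open>s\<close> is at most \<open>s\<close>
  times a majorant independent of \<open>s\<close>, which is integrable by
  \<open>gauss_exp_l1_finite\<close>.\<close>

lemma exp_smoothing_bounds:
  fixes c s t :: real
  assumes "c \<ge> 0" "0 < s" "s \<le> 1" "t \<ge> 0"
  shows "exp (c * (s * t)) \<le> 1 + s * exp (2 * c * t)" "1 \<le> exp (- (c * (s * t))) + s * exp (2 * c * t)"
proof -
  let ?a = "c * (s * t)"
  have a0: "?a \<ge> 0" using assms by simp
  have st: "s * t \<le> t" using assms by (simp add: mult_left_le_one_le)
  have ct: "?a \<le> c * t" using st assms by (intro mult_left_mono) auto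
  have ect: "c * t \<le> exp (c * t)" using exp_ge_add_one_self[of "c * t"] by linarith
  have e2: "exp (c * t) * exp (c * t) = exp (2 * c * t)" by (simp add: exp_add[symmetric])
  have "1 - ?a \<le> exp (- ?a)" using exp_ge_add_one_self[of "- ?a"] by simp
  then have "(1 - ?a) * exp ?a \<le> exp (- ?a) * exp ?a" by (intro mult_right_mono) auto
  then have "exp ?a \<le> 1 + ?a * exp ?a" by (simp add: exp_add[symmetric] algebra_simps)
  also have "?a * exp ?a = s * ((c * t) * exp ?a)" by simp
  also have "\<dots> \<le> s * (exp (c * t) * exp (c * t))"
    using assms ect ct by (intro mult_left_mono mult_mono) auto
  finally show "exp ?a \<le> 1 + s * exp (2 * c * t)" by (simp add: e2)
  have "?a = s * (c * t)" by simp
  also have "\<dots> \<le> s * exp (2 * c * t)"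
    using assms ect e2 by (intro mult_left_mono order_trans[OF ect]) auto
  finally show "1 \<le> exp (- ?a) + s * exp (2 * c * t)" using \<open>1 - ?a \<le> exp (- ?a)\<close> by linarith
qed

section \<open>From Gaussian vectors to an arbitrary unitarily invariant measure\<close>

context haar begin

lemma sigma_finite_mu: "sigma_finite_measure \<mu>" using prob by (rule prob_space_imp_sigma_finite)

lemma nn_integral_swap_gauss_mu:
  assumes "(\<lambda>(x, u). f x u) \<in> borel_measurable (borel \<Otimes>\<^sub>M borel)"
  shows "(\<integral>\<^sup>+x. \<integral>\<^sup>+u. f x u \<partial>\<mu> \<partial>gauss n) = (\<integral>\<^sup>+u. \<integral>\<^sup>+x. f x u \<partial>gauss n \<partial>\<mu>)"
proof -
  interpret pair_sigma_finite "gauss n" \<mu>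
    using sigma_finite_gauss sigma_finite_mu by (simp add: pair_sigma_finite_def)
  have "(\<lambda>(x, u). f x u) \<in> borel_measurable (gauss n \<Otimes>\<^sub>M \<mu>)"
    using assms by (simp add: measurable_cong_sets[OF sets_pair_measure_cong[OF sets_gauss sets_mu] refl])
  then show ?thesis by (rule Fubini'[symmetric])
qed

lemma nn_integral_swap_gauss:
  assumes "(\<lambda>(x, u). f x u) \<in> borel_measurable (borel \<Otimes>\<^sub>M borel)"
  shows "(\<integral>\<^sup>+x. \<integral>\<^sup>+u. f x u \<partial>gauss m \<partial>gauss n) = (\<integral>\<^sup>+u. \<integral>\<^sup>+x. f x u \<partial>gauss n \<partial>gauss m)"
proof -
  interpret pair_sigma_finite "gauss n" "gauss m"
    using sigma_finite_gauss by (simp add: pair_sigma_finite_def)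
  have "(\<lambda>(x, u). f x u) \<in> borel_measurable (gauss n \<Otimes>\<^sub>M gauss m)"
    using assms by (simp add: measurable_cong_sets[OF sets_pair_measure_cong[OF sets_gauss sets_gauss] refl])
  then show ?thesis by (rule Fubini'[symmetric])
qed

text \<open>The Gaussian vector and the vector \<open>|X|u\<close> with \<open>u\<close> Haar distributed have the same exponential
  transforms, since \<open>E\<^sub>u exp (Re \<langle>u, z\<rangle>)\<close> depends on \<open>|z|\<close> only.\<close>
lemma radial_exp_transform:
  assumes a: "a \<ge> 0"
  shows "(\<integral>\<^sup>+x. \<integral>\<^sup>+u. ennreal (exp (Re (ip d z (scal d (sqrt (nsq d x)) u)) - a * nsq d (scal d (sqrt (nsq d x)) u))) \<partial>\<mu> \<partial>gauss d)
     = (\<integral>\<^sup>+x. ennreal (exp (Re (ip d z x) - a * nsq d x)) \<partial>gauss d)"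
proof -
  define t where "t = sqrt (nsq d z)"
  have inner: "(\<integral>\<^sup>+u. ennreal (exp (Re (ip d z (scal d (sqrt (nsq d x)) u)) - a * nsq d (scal d (sqrt (nsq d x)) u))) \<partial>\<mu>)
    = (\<integral>\<^sup>+u. ennreal (exp (Re (ip d (scal d t u) x) - a * nsq d x)) \<partial>\<mu>)" for x
  proof -
    let ?h = "\<lambda>w. ennreal (exp (Re w - a * nsq d x))"
    have "(\<integral>\<^sup>+u. ennreal (exp (Re (ip d z (scal d (sqrt (nsq d x)) u)) - a * nsq d (scal d (sqrt (nsq d x)) u))) \<partial>\<mu>)
      = (\<integral>\<^sup>+u. ?h (ip d (scal d (sqrt (nsq d x)) z) u) \<partial>\<mu>)"
      by (rule nn_integral_cong_AE) (use AE_sphere in \<open>eventually_elim, simp add: nsq_scal ip_scal\<close>)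
    also have "\<dots> = (\<integral>\<^sup>+u. ?h (ip d (scal d t x) u) \<partial>\<mu>)"
      by (rule nn_integral_ip_radial) (auto simp: nsq_scal t_def)
    also have "\<dots> = (\<integral>\<^sup>+u. ennreal (exp (Re (ip d (scal d t u) x) - a * nsq d x)) \<partial>\<mu>)"
      by (intro nn_integral_cong) (simp add: ip_scal Re_ip_commute[of d x])
    finally show ?thesis .
  qed
  have "(\<integral>\<^sup>+x. \<integral>\<^sup>+u. ennreal (exp (Re (ip d (scal d t u) x) - a * nsq d x)) \<partial>\<mu> \<partial>gauss d)
    = (\<integral>\<^sup>+u. \<integral>\<^sup>+x. ennreal (exp (Re (ip d (scal d t u) x) - a * nsq d x)) \<partial>gauss d \<partial>\<mu>)"
    by (rule nn_integral_swap_gauss_mu) (unfold split_beta', measurable)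
  also have "\<dots> = (\<integral>\<^sup>+u. (\<integral>\<^sup>+x. ennreal (exp (- a * x\<^sup>2)) \<partial>gauss1) ^ (2 * d) * ennreal (exp (nsq d z / (2 * (1 + 2 * a)))) \<partial>\<mu>)"
    by (rule nn_integral_cong_AE) (use AE_sphere in \<open>eventually_elim, simp add: gauss_exp_quadratic[OF a] nsq_scal t_def\<close>)
  also have "\<dots> = (\<integral>\<^sup>+x. ennreal (exp (Re (ip d z x) - a * nsq d x)) \<partial>gauss d)"
    unfolding gauss_exp_quadratic[OF a] by (simp add: emeasure_space_1[unfolded space_mu])
  finally show ?thesis unfolding inner .
qed

text \<open>The density of the smoothing at scale \<open>s\<close> around \<open>y\<close> is
  \<open>exp (Re \<langle>z / s, y\<rangle> - |y|\<^sup>2 / (2 * s\<^sup>2))\<close>. After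
  exchanging integrals, the two laws of \<open>y\<close> enter only through their exponential
  transforms at \<open>a = 1 / (2 * s\<^sup>2)\<close>.\<close>

lemma radial_smoothing_eq:
  assumes [measurable]: "G \<in> borel_measurable borel" and s: "s > 0"
  shows "(\<integral>\<^sup>+x. \<integral>\<^sup>+u. \<integral>\<^sup>+z. G (\<lambda>i. scal d (sqrt (nsq d x)) u i + scal d s z i) \<partial>gauss d \<partial>\<mu> \<partial>gauss d)
    = (\<integral>\<^sup>+x. \<integral>\<^sup>+z. G (\<lambda>i. scal d 1 x i + scal d s z i) \<partial>gauss d \<partial>gauss d)"
proof -
  let ?a = "1 / (2 * s\<^sup>2)"
  let ?W = "\<lambda>y z. ennreal (exp (Re (ip d (scal d (1/s) z) y) - ?a * nsq d y))"
  have tr: "scal d r u i = 0" if "i \<ge> d" for r u i using that by (simp add: scal_def)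
  have "(\<integral>\<^sup>+x. \<integral>\<^sup>+u. \<integral>\<^sup>+z. G (\<lambda>i. scal d (sqrt (nsq d x)) u i + scal d s z i) \<partial>gauss d \<partial>\<mu> \<partial>gauss d)
    = (\<integral>\<^sup>+x. \<integral>\<^sup>+u. \<integral>\<^sup>+z. ?W (scal d (sqrt (nsq d x)) u) z * G (scal d s z) \<partial>gauss d \<partial>\<mu> \<partial>gauss d)"
    by (intro nn_integral_cong gauss_smoothing s tr) measurable
  also have "\<dots> = (\<integral>\<^sup>+x. \<integral>\<^sup>+z. \<integral>\<^sup>+u. ?W (scal d (sqrt (nsq d x)) u) z * G (scal d s z) \<partial>\<mu> \<partial>gauss d \<partial>gauss d)"
    by (intro nn_integral_cong nn_integral_swap_gauss_mu[symmetric]) (unfold split_beta', measurable)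
  also have "\<dots> = (\<integral>\<^sup>+z. \<integral>\<^sup>+x. \<integral>\<^sup>+u. ?W (scal d (sqrt (nsq d x)) u) z * G (scal d s z) \<partial>\<mu> \<partial>gauss d \<partial>gauss d)"
    by (rule nn_integral_swap_gauss) (unfold split_beta', measurable)
  also have "\<dots> = (\<integral>\<^sup>+z. (\<integral>\<^sup>+x. \<integral>\<^sup>+u. ?W (scal d (sqrt (nsq d x)) u) z \<partial>\<mu> \<partial>gauss d) * G (scal d s z) \<partial>gauss d)"
    by (simp add: nn_integral_multc)
  also have "\<dots> = (\<integral>\<^sup>+z. (\<integral>\<^sup>+x. ?W x z \<partial>gauss d) * G (scal d s z) \<partial>gauss d)"
    by (subst radial_exp_transform) auto
  also have "\<dots> = (\<integral>\<^sup>+z. \<integral>\<^sup>+x. ?W (scal d 1 x) z * G (scal d s z) \<partial>gauss d \<partial>gauss d)"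
    by (simp add: nn_integral_multc ip_scal nsq_scal)
  also have "\<dots> = (\<integral>\<^sup>+x. \<integral>\<^sup>+z. ?W (scal d 1 x) z * G (scal d s z) \<partial>gauss d \<partial>gauss d)"
    by (rule nn_integral_swap_gauss) (unfold split_beta', measurable)
  also have "\<dots> = (\<integral>\<^sup>+x. \<integral>\<^sup>+z. G (\<lambda>i. scal d 1 x i + scal d s z i) \<partial>gauss d \<partial>gauss d)"
    by (intro nn_integral_cong gauss_smoothing[symmetric] s tr) measurable
  finally show ?thesis .
qed

text \<open>The smoothings of both laws agree exactly, and smoothing a log-Lipschitz
  \<open>G\<close> changes it by a factor between \<open>1 - s * B\<close> and
  \<open>1 + s * B\<close>, where \<open>B\<close> is an exponential moment of the \<open>l1\<close>
  norm. Small \<open>s\<close> removes the factors.\<close>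

lemma radial_le_gauss:
  fixes G :: "(nat \<Rightarrow> complex) \<Rightarrow> real"
  assumes Gm [measurable]: "G \<in> borel_measurable borel" and Gp: "\<And>x. G x > 0" and c: "c \<ge> 0"
    and lG: "\<And>x y. G x \<le> exp (c * l1 d (\<lambda>i. x i - y i)) * G y"
  shows "(\<integral>\<^sup>+x. \<integral>\<^sup>+u. ennreal (G (scal d (sqrt (nsq d x)) u)) \<partial>\<mu> \<partial>gauss d) \<le> (\<integral>\<^sup>+x. ennreal (G x) \<partial>gauss d)"
proof -
  interpret gd: prob_space "gauss d" by (rule prob_space_gauss)
  have one: "emeasure (gauss d) UNIV = 1" using gd.emeasure_space_1 by simp
  obtain B where B: "(\<integral>\<^sup>+x. ennreal (exp (2 * c * l1 d x)) \<partial>gauss d) = ennreal B" "B \<ge> 0"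
    using gauss_exp_l1_finite[where c = c and d = d] by (metis ennreal_cases less_irrefl)
  let ?L = "\<integral>\<^sup>+x. \<integral>\<^sup>+u. ennreal (G (scal d (sqrt (nsq d x)) u)) \<partial>\<mu> \<partial>gauss d"
  let ?R = "\<integral>\<^sup>+x. ennreal (G x) \<partial>gauss d"
  have l1s: "l1 d (\<lambda>i. scal d s z i) = s * l1 d z" if "s > 0" for s z
    using that by (simp add: l1_def scal_def sum_distrib_left abs_mult distrib_left)
  have lower: "ennreal (1 - s * B) * ennreal (G y) \<le> (\<integral>\<^sup>+z. ennreal (G (\<lambda>i. y i + scal d s z i)) \<partial>gauss d)"
    if s: "0 < s" "s \<le> 1" "s * B < 1" for s y
  proof -
    let ?k = "\<integral>\<^sup>+z. ennreal (exp (- (c * (s * l1 d z)))) \<partial>gauss d"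
    have "ennreal 1 \<le> (\<integral>\<^sup>+z. ennreal (exp (- (c * (s * l1 d z)))) + ennreal s * ennreal (exp (2 * c * l1 d z)) \<partial>gauss d)"
    proof -
      have "(\<integral>\<^sup>+z. 1 \<partial>gauss d) \<le> (\<integral>\<^sup>+z. ennreal (exp (- (c * (s * l1 d z)))) + ennreal s * ennreal (exp (2 * c * l1 d z)) \<partial>gauss d)"
        using exp_smoothing_bounds(2)[OF c s(1,2) l1_nonneg] s
        by (intro nn_integral_mono) (simp add: ennreal_mult[symmetric] ennreal_plus[symmetric] del: ennreal_plus flip: ennreal_1)
      then show ?thesis using one by simp
    qed
    also have "\<dots> = ?k + ennreal s * ennreal B"
      using B by (subst nn_integral_add) (auto simp: nn_integral_cmult)
    finally have "ennreal (1 - s * B) \<le> ?k"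
      using s B by (simp add: ennreal_mult[symmetric] ennreal_minus[symmetric] ennreal_minus_le_iff add.commute flip: ennreal_1)
    then have "ennreal (1 - s * B) * ennreal (G y) \<le> ?k * ennreal (G y)" by (rule mult_right_mono) simp
    also have "\<dots> = (\<integral>\<^sup>+z. ennreal (exp (- (c * (s * l1 d z)))) * ennreal (G y) \<partial>gauss d)"
      by (rule nn_integral_multc[symmetric]) measurable
    also have "\<dots> \<le> (\<integral>\<^sup>+z. ennreal (G (\<lambda>i. y i + scal d s z i)) \<partial>gauss d)"
    proof (rule nn_integral_mono)
      fix z
      have "l1 d (\<lambda>i. y i - (y i + scal d s z i)) = s * l1 d z"
        using l1s[OF s(1), of z] by (simp add: l1_def)
      then have "G y \<le> exp (c * (s * l1 d z)) * G (\<lambda>i. y i + scal d s z i)" using lG[of y "\<lambda>i. y i + scal d s z i"] by simp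
      then have "exp (- (c * (s * l1 d z))) * G y \<le> G (\<lambda>i. y i + scal d s z i)" by (simp add: exp_minus field_simps)
      then show "ennreal (exp (- (c * (s * l1 d z)))) * ennreal (G y) \<le> ennreal (G (\<lambda>i. y i + scal d s z i))"
        using Gp[of y] by (simp add: ennreal_mult[symmetric] less_imp_le ennreal_leI)
    qed
    finally show ?thesis .
  qed
  have upper: "(\<integral>\<^sup>+z. ennreal (G (\<lambda>i. scal d 1 y i + scal d s z i)) \<partial>gauss d) \<le> ennreal (1 + s * B) * ennreal (G y)"
    if s: "0 < s" "s \<le> 1" for s y
  proof -
    have "(\<integral>\<^sup>+z. ennreal (G (\<lambda>i. scal d 1 y i + scal d s z i)) \<partial>gauss d)
      \<le> (\<integral>\<^sup>+z. (1 + ennreal s * ennreal (exp (2 * c * l1 d z))) * ennreal (G y) \<partial>gauss d)"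
    proof (rule nn_integral_mono)
      fix z
      have "l1 d (\<lambda>i. (scal d 1 y i + scal d s z i) - y i) = s * l1 d z"
        using l1s[OF s(1), of z] by (simp add: l1_def scal_def)
      then have "G (\<lambda>i. scal d 1 y i + scal d s z i) \<le> exp (c * (s * l1 d z)) * G y" using lG[of "\<lambda>i. scal d 1 y i + scal d s z i" y] by simp
      also have "\<dots> \<le> (1 + s * exp (2 * c * l1 d z)) * G y"
        using exp_smoothing_bounds(1)[OF c s l1_nonneg] Gp[of y] by (intro mult_right_mono) auto
      finally have "ennreal (G (\<lambda>i. scal d 1 y i + scal d s z i)) \<le> ennreal ((1 + s * exp (2 * c * l1 d z)) * G y)" by (rule ennreal_leI)
      also have "\<dots> = (1 + ennreal s * ennreal (exp (2 * c * l1 d z))) * ennreal (G y)"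
        using s Gp[of y] by (simp add: ennreal_mult less_imp_le)
      finally show "ennreal (G (\<lambda>i. scal d 1 y i + scal d s z i)) \<le> (1 + ennreal s * ennreal (exp (2 * c * l1 d z))) * ennreal (G y)" .
    qed
    also have "\<dots> = (1 + ennreal s * ennreal B) * ennreal (G y)"
      using B one by (simp add: nn_integral_multc nn_integral_add nn_integral_cmult)
    also have "\<dots> = ennreal (1 + s * B) * ennreal (G y)" using s B by (simp add: ennreal_mult)
    finally show ?thesis .
  qed
  have main: "ennreal (1 - s * B) * ?L \<le> ennreal (1 + s * B) * ?R" if s: "0 < s" "s \<le> 1" "s * B < 1" for s
  proof -
    have "ennreal (1 - s * B) * ?L = (\<integral>\<^sup>+x. \<integral>\<^sup>+u. ennreal (1 - s * B) * ennreal (G (scal d (sqrt (nsq d x)) u)) \<partial>\<mu> \<partial>gauss d)"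
      by (simp add: nn_integral_cmult)
    also have "\<dots> \<le> (\<integral>\<^sup>+x. \<integral>\<^sup>+u. \<integral>\<^sup>+z. ennreal (G (\<lambda>i. scal d (sqrt (nsq d x)) u i + scal d s z i)) \<partial>gauss d \<partial>\<mu> \<partial>gauss d)"
      by (intro nn_integral_mono lower s)
    also have "\<dots> = (\<integral>\<^sup>+x. \<integral>\<^sup>+z. ennreal (G (\<lambda>i. scal d 1 x i + scal d s z i)) \<partial>gauss d \<partial>gauss d)"
      by (rule radial_smoothing_eq[where G = "\<lambda>x. ennreal (G x)"]) (use s in auto)
    also have "\<dots> \<le> (\<integral>\<^sup>+x. ennreal (1 + s * B) * ennreal (G x) \<partial>gauss d)"
      by (intro nn_integral_mono upper s)
    also have "\<dots> = ennreal (1 + s * B) * ?R" by (rule nn_integral_cmult) measurable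
    finally show ?thesis .
  qed
  show "?L \<le> ?R"
  proof (cases "?R = \<top>")
    case False
    then obtain r where r: "?R = ennreal r" "r \<ge> 0" by (metis ennreal_cases)
    \<comment> \<open>Some scale with \<open>s0 * B < 1\<close>, used to see that \<open>?L\<close>
      is finite before passing to real arithmetic.\<close>
    define s0 where "s0 = 1 / (2 * (B + 1))"
    have s0: "0 < s0" "s0 \<le> 1" "s0 * B < 1" using B by (auto simp: s0_def field_simps)
    have "ennreal (1 - s0 * B) * ?L \<le> ennreal ((1 + s0 * B) * r)"
      using main[OF s0] r s0 B by (simp add: ennreal_mult)
    moreover have "ennreal (1 - s0 * B) * ?L = \<top>" if "?L = \<top>"
      unfolding that using s0 by (simp add: ennreal_mult_top)
    ultimately have "?L \<noteq> \<top>" by (metis ennreal_less_top leD)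
    then obtain l where l: "?L = ennreal l" "l \<ge> 0" by (cases ?L) blast+
    have real: "(1 - s * B) * l \<le> (1 + s * B) * r" if s: "0 < s" "s \<le> 1" "s * B < 1" for s
    proof -
      have nn: "1 - s * B \<ge> 0" "1 + s * B \<ge> 0" using s B(2) by (auto intro: add_nonneg_nonneg)
      have "ennreal ((1 - s * B) * l) \<le> ennreal ((1 + s * B) * r)"
        using main[OF s] unfolding l(1) r(1) ennreal_mult[OF nn(1) l(2)] ennreal_mult[OF nn(2) r(2)] .
      then show ?thesis using nn(2) r(2) by (subst (asm) ennreal_le_iff) auto
    qed
    have "l \<le> r"
    proof (rule ccontr)
      assume "\<not> l \<le> r"
      then have lr: "l - r > 0" by simp
      \<comment> \<open>\<open>D\<close> is positive and exceeds \<open>B * (l + r)\<close>, so the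
        chosen \<open>s\<close> leaves an error of at most half the gap
        \<open>l - r\<close>.\<close>
      define D where "D = B * (l + r) + (l - r) + B + 1"
      have "B * (l + r) \<ge> 0" using B l r by simp
      then have D: "D > 0" "B * (l + r) < D" using B(2) lr unfolding D_def by linarith+
      define s where "s = min s0 ((l - r) / (2 * D))"
      have s: "0 < s" "s \<le> 1" "s * B < 1"
      proof -
        show "0 < s" using s0 lr D by (simp add: s_def)
        show "s \<le> 1" using s0 by (simp add: s_def)
        have "s * B \<le> s0 * B" using B by (intro mult_right_mono) (auto simp: s_def)
        then show "s * B < 1" using s0 by simp
      qed
      have "l - r \<le> s * (B * (l + r))" using real[OF s] by (simp add: algebra_simps)
      also have "\<dots> \<le> (l - r) / (2 * D) * (B * (l + r))" using B l r by (intro mult_right_mono) (auto simp: s_def)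
      also have "\<dots> \<le> (l - r) / (2 * D) * D" using D lr by (intro mult_left_mono) auto
      also have "\<dots> = (l - r) / 2" using D by simp
      finally show False using lr by simp
    qed
    then show ?thesis using l r by (simp add: ennreal_leI)
  qed simp
qed

end

lemma integral_le_nn_integral_ennreal:
  fixes h :: "'a \<Rightarrow> real"
  assumes "integrable M h"
  shows "ennreal (\<integral>x. h x \<partial>M) \<le> (\<integral>\<^sup>+x. ennreal (h x) \<partial>M)"
proof -
  have i: "integrable M (\<lambda>x. max 0 (h x))" using assms by (intro integrable_max) auto
  have "(\<integral>x. h x \<partial>M) \<le> (\<integral>x. max 0 (h x) \<partial>M)" using assms i by (intro integral_mono) auto
  then have "ennreal (\<integral>x. h x \<partial>M) \<le> ennreal (\<integral>x. max 0 (h x) \<partial>M)" by (rule ennreal_leI)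
  also have "\<dots> = (\<integral>\<^sup>+x. ennreal (max 0 (h x)) \<partial>M)" using i by (intro nn_integral_eq_integral[symmetric]) auto
  also have "\<dots> = (\<integral>\<^sup>+x. ennreal (h x) \<partial>M)" by (intro nn_integral_cong) (auto simp: max_def ennreal_neg)
  finally show ?thesis .
qed

lemma integrable_gauss_nsq:
  "integrable (gauss d) (nsq d)" "(\<integral>x. nsq d x \<partial>gauss d) = 2 * d"
  "integrable (gauss d) (\<lambda>x. (nsq d x)\<^sup>2)" "(\<integral>x. (nsq d x)\<^sup>2 \<partial>gauss d) = 2 * d * (2 * d + 2)"
proof -
  have 1: "has_bochner_integral (gauss d) (nsq d) (2 * d)"
    by (rule has_bochner_integral_nn_integral) (use gauss_moments(1)[of d] in auto)
  have 2: "has_bochner_integral (gauss d) (\<lambda>x. (nsq d x)\<^sup>2) (2 * d * (2 * d + 2))"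
    by (rule has_bochner_integral_nn_integral) (use gauss_moments(2)[of d] in auto)
  show "integrable (gauss d) (nsq d)" "(\<integral>x. nsq d x \<partial>gauss d) = 2 * d"
    "integrable (gauss d) (\<lambda>x. (nsq d x)\<^sup>2)" "(\<integral>x. (nsq d x)\<^sup>2 \<partial>gauss d) = 2 * d * (2 * d + 2)"
    using 1 2 by (auto simp: has_bochner_integral_iff)
qed

lemma integrable_gauss_norm: "integrable (gauss d) (\<lambda>x. sqrt (nsq d x))"
proof (rule Bochner_Integration.integrable_bound)
  interpret prob_space "gauss d" by (rule prob_space_gauss)
  show "integrable (gauss d) (\<lambda>x. 1 + nsq d x)" using integrable_gauss_nsq(1) by simp
  have "sqrt t \<le> 1 + t" if "t \<ge> 0" for t :: real
    using that by (intro real_le_lsqrt) (auto simp: power2_eq_square algebra_simps)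
  then show "AE x in gauss d. norm (sqrt (nsq d x)) \<le> norm (1 + nsq d x)" by simp
qed measurable

section \<open>The mean radius of the Gaussian vector\<close>

definition gauss_radius :: "nat \<Rightarrow> real" where "gauss_radius d = (\<integral>x. sqrt (nsq d x) \<partial>gauss d)"

text \<open>Pointwise, \<open>r \<ge> 3r\<^sup>2/(2c) - r\<^sup>4/(2c\<^sup>3)\<close> with equality at \<open>r = c\<close>; take \<open>c\<^sup>2 = E r\<^sup>4 / E r\<^sup>2\<close>.\<close>
lemma gauss_radius_sq_ge:
  assumes "d \<ge> 2"
  shows "(gauss_radius d)\<^sup>2 \<ge> 5 / 4 * d" "gauss_radius d > 0"
proof -
  define c where "c = sqrt (2 * d + 2)"
  have c: "c > 0" "c\<^sup>2 = 2 * d + 2" by (auto simp: c_def)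
  have pt: "3 / (2 * c) * t - 1 / (2 * c ^ 3) * t\<^sup>2 \<le> sqrt t" if "t \<ge> 0" for t
  proof -
    define r where "r = sqrt t / c"
    have r: "r \<ge> 0" "sqrt t = c * r" "t = c\<^sup>2 * r\<^sup>2"
      using c that by (auto simp: r_def power_divide)
    have "0 \<le> r * ((r - 1)\<^sup>2 * (r + 2))" using r by simp
    also have "\<dots> = r ^ 4 - 3 * r\<^sup>2 + 2 * r" by (simp add: power2_eq_square power4_eq_xxxx algebra_simps)
    finally have "3 / 2 * r\<^sup>2 - 1 / 2 * r ^ 4 \<le> r" by argo
    then have "c * (3 / 2 * r\<^sup>2 - 1 / 2 * r ^ 4) \<le> c * r" using c by (intro mult_left_mono) auto
    moreover have "3 / (2 * c) * t - 1 / (2 * c ^ 3) * t\<^sup>2 = c * (3 / 2 * r\<^sup>2 - 1 / 2 * r ^ 4)"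
      unfolding r(3) using c(1) by (simp add: field_simps power2_eq_square power3_eq_cube power4_eq_xxxx)
    ultimately show ?thesis using r(2) by simp
  qed
  have "3 / (2 * c) * (2 * d) - 1 / (2 * c ^ 3) * (2 * d * (2 * d + 2)) = (\<integral>x. 3 / (2 * c) * nsq d x - 1 / (2 * c ^ 3) * (nsq d x)\<^sup>2 \<partial>gauss d)"
    using integrable_gauss_nsq[of d] by simp
  also have "\<dots> \<le> gauss_radius d"
    unfolding gauss_radius_def using integrable_gauss_nsq[of d] integrable_gauss_norm[of d] pt
    by (intro integral_mono) auto
  also have "3 / (2 * c) * (2 * d) - 1 / (2 * c ^ 3) * (2 * d * (2 * d + 2)) = 2 * d / c"
  proof -
    have "real (2 * d * (2 * d + 2)) = 2 * d * c\<^sup>2" unfolding c(2) by (simp add: distrib_left)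
    then show ?thesis using c(1) by (simp add: field_simps power2_eq_square power3_eq_cube)
  qed
  finally have le: "2 * d / c \<le> gauss_radius d" .
  have "2 * d / c > 0" using c assms by (intro divide_pos_pos) auto
  then show "gauss_radius d > 0" using le by linarith
  have "5 / 4 * d \<le> (2 * d / c)\<^sup>2"
  proof -
    \<comment> \<open>Here \<open>d \<ge> 2\<close> enters, through
      \<open>10 * d + 10 \<le> 16 * d\<close>; dimension 1 is treated apart.\<close>
    have "real d * (10 * d + 10) \<le> real d * (16 * d)" using assms by (intro mult_left_mono) auto
    then have "5 / 4 * real d * (2 * d + 2) \<le> (2 * real d)\<^sup>2" by (simp add: power2_eq_square algebra_simps)
    then have "5 / 4 * real d \<le> (2 * real d)\<^sup>2 / (2 * d + 2)" by (subst pos_le_divide_eq) auto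
    then show ?thesis unfolding power_divide c(2) by simp
  qed
  also have "\<dots> \<le> (gauss_radius d)\<^sup>2" using le c by (intro power_mono) auto
  finally show "(gauss_radius d)\<^sup>2 \<ge> 5 / 4 * d" .
qed

lemma nsq_diff: "nsq d (\<lambda>i. x i - y i) = nsq d x + nsq d y - 2 * Re (ip d x y)"
proof -
  have "ip d (\<lambda>i. x i - y i) (\<lambda>i. x i - y i) = ip d x x - ip d x y - (ip d y x - ip d y y)"
    by (simp only: ip_diff_left ip_diff_right)
  then show ?thesis using Re_ip_commute[of d x y] by (simp add: nsq_eq_Re_ip)
qed

lemma unit_sphere_nsq: "u \<in> unit_sphere_c d \<longleftrightarrow> (\<forall>i\<ge>d. u i = 0) \<and> nsq d u = 1"
  by (simp add: unit_sphere_c_def nsq_def)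

text \<open>The extension homogeneous of degree 1. At the origin the radius makes the value 0,
  whatever \<open>g\<close> is there.\<close>

definition cone_ext :: "nat \<Rightarrow> ((nat \<Rightarrow> complex) \<Rightarrow> real) \<Rightarrow> (nat \<Rightarrow> complex) \<Rightarrow> real" where
  "cone_ext d g x = sqrt (nsq d x) * g (scal d (1 / sqrt (nsq d x)) x)"

lemma scal_normalized: "nsq d x \<noteq> 0 \<Longrightarrow> scal d (1 / sqrt (nsq d x)) x \<in> unit_sphere_c d"
  by (simp add: unit_sphere_nsq nsq_scal power_divide) (simp add: scal_def)

lemma cone_ext_scal:
  assumes "u \<in> unit_sphere_c d" "r \<ge> 0"
  shows "cone_ext d g (scal d r u) = r * g u"
proof (cases "r = 0")
  case False
  have "nsq d (scal d r u) = r\<^sup>2" using assms by (simp add: unit_sphere_nsq nsq_scal)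
  then have s: "sqrt (nsq d (scal d r u)) = r" using assms by simp
  have "scal d (1 / r) (scal d r u) = u"
    using assms False by (auto simp: scal_def fun_eq_iff unit_sphere_nsq)
  then show ?thesis by (simp add: cone_ext_def s)
qed (simp add: cone_ext_def nsq_scal)

text \<open>For \<open>x = r u\<close> and \<open>y = s v\<close> one has
  \<open>|x - y|\<^sup>2 = (r - s)\<^sup>2 + r s |u - v|\<^sup>2\<close>. The radial part costs at
  most \<open>|r - s|\<close> and the angular part \<open>2 s |u - v|\<close>; Cauchy-Schwarz
  combines the constants 1 and 2 into \<open>sqrt 5\<close>. Taking \<open>s \<le> r\<close> makes
  \<open>s\<^sup>2 \<le> r s\<close>.\<close>

lemma cone_ext_lipschitz:
  assumes b: "\<And>u. u \<in> unit_sphere_c d \<Longrightarrow> \<bar>g u\<bar> \<le> 1"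
    and l: "\<And>u v. u \<in> unit_sphere_c d \<Longrightarrow> v \<in> unit_sphere_c d \<Longrightarrow> \<bar>g u - g v\<bar> \<le> 2 * sqrt (nsq d (\<lambda>i. u i - v i))"
  shows "\<bar>cone_ext d g x - cone_ext d g y\<bar> \<le> sqrt 5 * sqrt (nsq d (\<lambda>i. x i - y i))"
proof -
  have cs: "a + 2 * b \<le> sqrt 5 * sqrt (a\<^sup>2 + b\<^sup>2)" for a b :: real
  proof -
    have "(a + 2 * b)\<^sup>2 \<le> 5 * (a\<^sup>2 + b\<^sup>2)" using zero_le_power2[of "2 * a - b"] by (simp add: power2_eq_square algebra_simps)
    then have "a + 2 * b \<le> sqrt (5 * (a\<^sup>2 + b\<^sup>2))" by (rule real_le_rsqrt)
    then show ?thesis by (simp only: real_sqrt_mult)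
  qed
  have wlog: "\<bar>cone_ext d g x - cone_ext d g y\<bar> \<le> sqrt 5 * sqrt (nsq d (\<lambda>i. x i - y i))"
    if le: "nsq d y \<le> nsq d x" for x y
  proof -
    let ?r = "sqrt (nsq d x)" and ?s = "sqrt (nsq d y)"
    have sr: "?s \<le> ?r" "?s \<ge> 0" using le by auto
    consider "nsq d x = 0" | "nsq d x \<noteq> 0" "nsq d y = 0" | "nsq d x \<noteq> 0" "nsq d y \<noteq> 0" by blast
    then show ?thesis
    proof cases
      case 1
      then have "nsq d y = 0" using le nsq_nonneg[of d y] by linarith
      with 1 show ?thesis by (simp add: cone_ext_def)
    next
      case 2
      have "\<bar>cone_ext d g x - cone_ext d g y\<bar> = ?r * \<bar>g (scal d (1 / ?r) x)\<bar>"
        using 2 by (simp add: cone_ext_def abs_mult)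
      also have "\<dots> \<le> ?r * 1" using b[OF scal_normalized[OF 2(1)]] by (intro mult_left_mono) auto
      also have "?r = sqrt (nsq d (\<lambda>i. x i - y i))"
        using 2 by (simp add: nsq_eq_0_iff nsq_def cong: sum.cong) (simp add: sum_nonneg_eq_0_iff)
      also have "\<dots> * 1 \<le> sqrt 5 * sqrt (nsq d (\<lambda>i. x i - y i))"
        using mult_right_mono[of 1 "sqrt 5" "sqrt (nsq d (\<lambda>i. x i - y i))"] by simp
      finally show ?thesis .
    next
      case 3
      define u where "u = scal d (1 / ?r) x"
      define v where "v = scal d (1 / ?s) y"
      have u: "u \<in> unit_sphere_c d" and v: "v \<in> unit_sphere_c d" using 3 scal_normalized by (auto simp: u_def v_def)
      have r0: "?r > 0" "?s > 0" using 3 nsq_nonneg[of d x] nsq_nonneg[of d y] by (auto simp: less_le)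
      have ipuv: "Re (ip d u v) = Re (ip d x y) / (?r * ?s)"
        by (simp add: u_def v_def ip_scal)
      have uv: "nsq d (\<lambda>i. u i - v i) = 2 - 2 * Re (ip d u v)"
        using u v by (simp add: nsq_diff unit_sphere_nsq)
      have xy: "nsq d (\<lambda>i. x i - y i) = (?r - ?s)\<^sup>2 + ?r * ?s * nsq d (\<lambda>i. u i - v i)"
      proof -
        have "?r * ?s * (2 - 2 * (Re (ip d x y) / (?r * ?s))) = 2 * ?r * ?s - 2 * Re (ip d x y)"
          using r0 by (simp add: field_simps)
        moreover have "(?r - ?s)\<^sup>2 = nsq d x + nsq d y - 2 * ?r * ?s" by (simp add: power2_diff)
        ultimately show ?thesis unfolding uv ipuv nsq_diff[of d x y] by simp
      qed
      have "cone_ext d g x - cone_ext d g y = (?r - ?s) * g u + ?s * (g u - g v)"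
        by (simp add: cone_ext_def u_def v_def algebra_simps)
      then have "\<bar>cone_ext d g x - cone_ext d g y\<bar> \<le> \<bar>?r - ?s\<bar> * \<bar>g u\<bar> + ?s * \<bar>g u - g v\<bar>"
        by (metis abs_mult abs_triangle_ineq abs_of_nonneg sr(2))
      also have "\<dots> \<le> \<bar>?r - ?s\<bar> * 1 + ?s * (2 * sqrt (nsq d (\<lambda>i. u i - v i)))"
        using b[OF u] l[OF u v] sr by (intro add_mono mult_left_mono) auto
      also have "\<dots> = (?r - ?s) + 2 * (?s * sqrt (nsq d (\<lambda>i. u i - v i)))" using sr by simp
      also have "\<dots> \<le> sqrt 5 * sqrt ((?r - ?s)\<^sup>2 + (?s * sqrt (nsq d (\<lambda>i. u i - v i)))\<^sup>2)" by (rule cs)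
      also have "\<dots> \<le> sqrt 5 * sqrt (nsq d (\<lambda>i. x i - y i))"
      proof -
        have "(?s * sqrt (nsq d (\<lambda>i. u i - v i)))\<^sup>2 = ?s * ?s * nsq d (\<lambda>i. u i - v i)"
          by (simp add: power_mult_distrib)
        also have "\<dots> \<le> ?r * ?s * nsq d (\<lambda>i. u i - v i)" using sr by (intro mult_right_mono) auto
        finally show ?thesis unfolding xy by (intro mult_left_mono real_sqrt_le_mono) auto
      qed
      finally show ?thesis .
    qed
  qed
  show ?thesis
  proof (cases "nsq d y \<le> nsq d x")
    case False
    have "nsq d (\<lambda>i. y i - x i) = nsq d (\<lambda>i. x i - y i)" by (simp add: nsq_def norm_minus_commute)
    then show ?thesis using wlog[of x y] False by (simp add: abs_minus_commute)
  qed (rule wlog)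
qed

text \<open>The tangent of \<open>exp\<close> at \<open>t0\<close>. Integrated with
  \<open>t0\<close> the mean of the exponent, it yields Jensen's inequality also where the integral
  of the exponential may be infinite.\<close>

lemma exp_tangent: "exp t0 * (1 + (t - t0)) \<le> exp t" for t t0 :: real
proof -
  have "exp t0 * (1 + (t - t0)) \<le> exp t0 * exp (t - t0)" by (intro mult_left_mono exp_ge_add_one_self) auto
  then show ?thesis by (simp add: exp_add[symmetric])
qed

context haar begin

text \<open>Property (tau) bounds the product of the exponential moments of the homogeneous
  extension at \<open>t\<close> and \<open>- t\<close>. The second factor is bounded below through
  the mean of \<open>g\<close>, which leaves a bound for the first one centred at that mean.\<close>

lemma levy_exp_moment:
  assumes gm [measurable]: "g \<in> borel_measurable borel"
    and b: "\<And>u. u \<in> unit_sphere_c d \<Longrightarrow> \<bar>g u\<bar> \<le> 1"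
    and l: "\<And>u v. u \<in> unit_sphere_c d \<Longrightarrow> v \<in> unit_sphere_c d \<Longrightarrow> \<bar>g u - g v\<bar> \<le> 2 * sqrt (nsq d (\<lambda>i. u i - v i))"
    and t: "t \<ge> 0"
  shows "(\<integral>\<^sup>+u. ennreal (exp (t * gauss_radius d * g u)) \<partial>\<mu>) \<le> ennreal (exp (5 * t\<^sup>2 + t * gauss_radius d * (\<integral>u. g u \<partial>\<mu>)))"
proof -
  let ?F = "cone_ext d g" and ?\<rho> = "gauss_radius d" and ?m = "\<integral>u. g u \<partial>\<mu>"
  have Fm [measurable]: "?F \<in> borel_measurable borel" unfolding cone_ext_def by measurable
  have ig: "integrable \<mu> g"
    by (rule integrable_const_bound[where B = 1]) (use AE_unit_sphere b in \<open>auto elim!: eventually_mono\<close>)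
  have Fl: "\<bar>?F x - ?F y\<bar> \<le> sqrt 5 * sqrt (nsq d (\<lambda>i. x i - y i))" for x y
    by (rule cone_ext_lipschitz[OF b l])
  have lip: "k * ?F x \<le> t * sqrt 5 * l1 d (\<lambda>i. x i - y i) + k * ?F y" if "\<bar>k\<bar> = t" for k x y
  proof -
    have "k * (?F x - ?F y) \<le> \<bar>k\<bar> * \<bar>?F x - ?F y\<bar>" by (metis abs_ge_self abs_mult)
    also have "\<dots> \<le> t * (sqrt 5 * l1 d (\<lambda>i. x i - y i))"
      unfolding that using t Fl[of x y] nsq_le_l1_sq[of d "\<lambda>i. x i - y i"]
      by (intro mult_left_mono) (auto intro: order_trans mult_left_mono)
    finally show ?thesis by (simp add: algebra_simps)
  qed
  have tau: "(\<integral>\<^sup>+x. ennreal (exp (t * ?F x)) \<partial>gauss d) * (\<integral>\<^sup>+x. ennreal (exp (- t * ?F x)) \<partial>gauss d) \<le> ennreal (exp (5 * t\<^sup>2))"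
  proof (rule gauss_tau[where c = "t * sqrt 5"])
    show "ennreal (exp (t * ?F x)) \<le> ennreal (exp (t * sqrt 5 * l1 d (\<lambda>i. x i - y i))) * ennreal (exp (t * ?F y))" for x y
      using lip[of t x y] t by (simp add: ennreal_mult[symmetric] exp_add[symmetric])
    show "ennreal (exp (- t * ?F x)) \<le> ennreal (exp (t * sqrt 5 * l1 d (\<lambda>i. x i - y i))) * ennreal (exp (- t * ?F y))" for x y
      using lip[of "- t" x y] t by (simp add: ennreal_mult[symmetric] exp_add[symmetric])
    fix x y
    let ?D = "sqrt (nsq d (\<lambda>i. x i - y i))"
    have "t * ?F x + - t * ?F y = t * (?F x - ?F y)" by (simp add: algebra_simps)
    also have "\<dots> \<le> t * (sqrt 5 * ?D)" using t Fl[of x y] by (intro mult_left_mono) auto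
    \<comment> \<open>Young's inequality leaves the quarter of the squared distance that property
      (tau) tolerates; 5 is the square of the Lipschitz constant.\<close>
    also have "\<dots> \<le> 5 * t\<^sup>2 + nsq d (\<lambda>i. x i - y i) / 4"
    proof -
      have "0 \<le> (sqrt 5 * t - ?D / 2)\<^sup>2" by simp
      also have "\<dots> = 5 * t\<^sup>2 + ?D\<^sup>2 / 4 - t * (sqrt 5 * ?D)" by (simp add: power2_diff power_mult_distrib power_divide)
      finally show ?thesis by simp
    qed
    finally have "exp (t * ?F x) * exp (- t * ?F y) \<le> exp (5 * t\<^sup>2) * exp (nsq d (\<lambda>i. x i - y i) / 4)"
      by (simp only: exp_add[symmetric] exp_le_cancel_iff)
    then show "ennreal (exp (t * ?F x)) * ennreal (exp (- t * ?F y)) \<le> ennreal (exp (5 * t\<^sup>2) * exp (nsq d (\<lambda>i. x i - y i) / 4))"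
      by (simp add: ennreal_mult[symmetric])
  qed auto
  have radial: "(\<integral>\<^sup>+x. \<integral>\<^sup>+u. ennreal (exp (k * (sqrt (nsq d x) * g u))) \<partial>\<mu> \<partial>gauss d) \<le> (\<integral>\<^sup>+x. ennreal (exp (k * ?F x)) \<partial>gauss d)"
    if k: "\<bar>k\<bar> = t" for k
  proof -
    have "(\<integral>\<^sup>+x. \<integral>\<^sup>+u. ennreal (exp (k * (sqrt (nsq d x) * g u))) \<partial>\<mu> \<partial>gauss d)
      = (\<integral>\<^sup>+x. \<integral>\<^sup>+u. ennreal (exp (k * ?F (scal d (sqrt (nsq d x)) u))) \<partial>\<mu> \<partial>gauss d)"
      by (rule nn_integral_cong, rule nn_integral_cong_AE) (use AE_unit_sphere in \<open>eventually_elim, simp add: cone_ext_scal\<close>)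
    also have "\<dots> \<le> (\<integral>\<^sup>+x. ennreal (exp (k * ?F x)) \<partial>gauss d)"
      by (rule radial_le_gauss[where c = "t * sqrt 5" and G = "\<lambda>x. exp (k * ?F x)"])
         (use t lip[OF k] in \<open>auto simp: exp_add[symmetric]\<close>)
    finally show ?thesis .
  qed
  interpret gd: prob_space "gauss d" by (rule prob_space_gauss)
  have one: "gd.prob UNIV = 1" using gd.prob_space by simp
  note ir = integrable_gauss_norm[of d]
  \<comment> \<open>Jensen over the Gaussian radius only, at fixed \<open>u\<close>.\<close>
  have upper: "(\<integral>\<^sup>+u. ennreal (exp (t * ?\<rho> * g u)) \<partial>\<mu>) \<le> (\<integral>\<^sup>+x. \<integral>\<^sup>+u. ennreal (exp (t * (sqrt (nsq d x) * g u))) \<partial>\<mu> \<partial>gauss d)"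
  proof -
    have "(\<integral>\<^sup>+u. ennreal (exp (t * ?\<rho> * g u)) \<partial>\<mu>) \<le> (\<integral>\<^sup>+u. \<integral>\<^sup>+x. ennreal (exp (t * (sqrt (nsq d x) * g u))) \<partial>gauss d \<partial>\<mu>)"
    proof (rule nn_integral_mono)
      fix u
      let ?t0 = "t * ?\<rho> * g u"
      have "exp ?t0 = (\<integral>x. exp ?t0 * (1 + (t * (sqrt (nsq d x) * g u) - ?t0)) \<partial>gauss d)"
        using ir one by (simp add: gauss_radius_def)
      then have "ennreal (exp ?t0) \<le> (\<integral>\<^sup>+x. ennreal (exp ?t0 * (1 + (t * (sqrt (nsq d x) * g u) - ?t0))) \<partial>gauss d)"
        using integral_le_nn_integral_ennreal[of "gauss d" "\<lambda>x. exp ?t0 * (1 + (t * (sqrt (nsq d x) * g u) - ?t0))"] ir by simp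
      also have "\<dots> \<le> (\<integral>\<^sup>+x. ennreal (exp (t * (sqrt (nsq d x) * g u))) \<partial>gauss d)"
        by (intro nn_integral_mono ennreal_leI exp_tangent)
      finally show "ennreal (exp ?t0) \<le> (\<integral>\<^sup>+x. ennreal (exp (t * (sqrt (nsq d x) * g u))) \<partial>gauss d)" .
    qed
    also have "\<dots> = (\<integral>\<^sup>+x. \<integral>\<^sup>+u. ennreal (exp (t * (sqrt (nsq d x) * g u))) \<partial>\<mu> \<partial>gauss d)"
      by (rule nn_integral_swap_gauss_mu[symmetric]) (unfold split_beta', measurable)
    finally show ?thesis .
  qed
  \<comment> \<open>Jensen twice: over the sphere at fixed radius, then over the radius.\<close>
  have lower: "ennreal (exp (- t * ?\<rho> * ?m)) \<le> (\<integral>\<^sup>+x. \<integral>\<^sup>+u. ennreal (exp (- t * (sqrt (nsq d x) * g u))) \<partial>\<mu> \<partial>gauss d)"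
  proof -
    let ?t0 = "- t * ?\<rho> * ?m"
    have in1: "ennreal (exp ?t0 * (1 + (- t * (sqrt (nsq d x) * ?m) - ?t0))) \<le> (\<integral>\<^sup>+u. ennreal (exp (- t * (sqrt (nsq d x) * g u))) \<partial>\<mu>)" for x
    proof -
      have "exp ?t0 * (1 + (- t * (sqrt (nsq d x) * ?m) - ?t0)) = (\<integral>u. exp ?t0 * (1 + (- t * (sqrt (nsq d x) * g u) - ?t0)) \<partial>\<mu>)"
        using ig by simp
      then have "ennreal (exp ?t0 * (1 + (- t * (sqrt (nsq d x) * ?m) - ?t0))) \<le> (\<integral>\<^sup>+u. ennreal (exp ?t0 * (1 + (- t * (sqrt (nsq d x) * g u) - ?t0))) \<partial>\<mu>)"
        using integral_le_nn_integral_ennreal[of \<mu> "\<lambda>u. exp ?t0 * (1 + (- t * (sqrt (nsq d x) * g u) - ?t0))"] ig by simp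
      also have "\<dots> \<le> (\<integral>\<^sup>+u. ennreal (exp (- t * (sqrt (nsq d x) * g u))) \<partial>\<mu>)"
        by (intro nn_integral_mono ennreal_leI exp_tangent)
      finally show ?thesis .
    qed
    have "exp ?t0 = (\<integral>x. exp ?t0 * (1 + (- t * (sqrt (nsq d x) * ?m) - ?t0)) \<partial>gauss d)"
      using ir one by (simp add: gauss_radius_def)
    then have "ennreal (exp ?t0) \<le> (\<integral>\<^sup>+x. ennreal (exp ?t0 * (1 + (- t * (sqrt (nsq d x) * ?m) - ?t0))) \<partial>gauss d)"
      using integral_le_nn_integral_ennreal[of "gauss d" "\<lambda>x. exp ?t0 * (1 + (- t * (sqrt (nsq d x) * ?m) - ?t0))"] ir by simp
    also have "\<dots> \<le> (\<integral>\<^sup>+x. \<integral>\<^sup>+u. ennreal (exp (- t * (sqrt (nsq d x) * g u))) \<partial>\<mu> \<partial>gauss d)"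
      by (intro nn_integral_mono in1)
    finally show ?thesis .
  qed
  let ?I = "\<integral>\<^sup>+u. ennreal (exp (t * ?\<rho> * g u)) \<partial>\<mu>"
  have "?I * ennreal (exp (- t * ?\<rho> * ?m)) \<le> (\<integral>\<^sup>+x. ennreal (exp (t * ?F x)) \<partial>gauss d) * (\<integral>\<^sup>+x. ennreal (exp (- t * ?F x)) \<partial>gauss d)"
    using t by (intro mult_mono order_trans[OF upper radial] order_trans[OF lower radial]) auto
  also note tau
  finally have "?I * ennreal (exp (- t * ?\<rho> * ?m)) * ennreal (exp (t * ?\<rho> * ?m)) \<le> ennreal (exp (5 * t\<^sup>2)) * ennreal (exp (t * ?\<rho> * ?m))"
    by (intro mult_right_mono) auto
  then show ?thesis
    by (simp add: mult.assoc ennreal_mult[symmetric] exp_add[symmetric])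
qed

theorem levy:
  assumes gm [measurable]: "g \<in> borel_measurable borel"
    and b: "\<And>u. u \<in> unit_sphere_c d \<Longrightarrow> \<bar>g u\<bar> \<le> 1"
    and l: "\<And>u v. u \<in> unit_sphere_c d \<Longrightarrow> v \<in> unit_sphere_c d \<Longrightarrow> \<bar>g u - g v\<bar> \<le> 2 * sqrt (nsq d (\<lambda>i. u i - v i))"
    and d: "d \<ge> 2" and \<delta>: "\<delta> > 0"
  shows "measure \<mu> {u. g u \<ge> (\<integral>u. g u \<partial>\<mu>) + \<delta>} \<le> exp (- (real d * \<delta>\<^sup>2 / 16))"
proof -
  let ?\<rho> = "gauss_radius d" and ?m = "\<integral>u. g u \<partial>\<mu>"
  \<comment> \<open>The minimiser of \<open>5 * t\<^sup>2 - t * ?\<rho> * \<delta>\<close>. The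
    minimum is \<open>- (?\<rho>\<^sup>2 * \<delta>\<^sup>2 / 20)\<close>, and
    \<open>?\<rho>\<^sup>2 \<ge> 5 / 4 * d\<close> turns the 20 into 16.\<close>
  define t where "t = ?\<rho> * \<delta> / 10"
  have \<rho>: "?\<rho> > 0" "?\<rho>\<^sup>2 \<ge> 5 / 4 * d" using gauss_radius_sq_ge[OF d] by auto
  have t: "t > 0" using \<rho> \<delta> by (simp add: t_def)
  let ?A = "{u. g u \<ge> ?m + \<delta>}"
  have A [measurable]: "?A \<in> sets \<mu>" by (simp add: sets_mu)
  have "ennreal (exp (t * ?\<rho> * (?m + \<delta>))) * emeasure \<mu> ?A = (\<integral>\<^sup>+u. ennreal (exp (t * ?\<rho> * (?m + \<delta>))) * indicator ?A u \<partial>\<mu>)"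
    by (simp add: nn_integral_cmult_indicator)
  also have "\<dots> \<le> (\<integral>\<^sup>+u. ennreal (exp (t * ?\<rho> * g u)) \<partial>\<mu>)"
    using t \<rho> by (intro nn_integral_mono) (auto simp: indicator_def intro!: ennreal_leI)
  also have "\<dots> \<le> ennreal (exp (5 * t\<^sup>2 + t * ?\<rho> * ?m))"
    using t by (intro levy_exp_moment[OF gm b l]) auto
  finally have "ennreal (exp (t * ?\<rho> * (?m + \<delta>)) * measure \<mu> ?A) \<le> ennreal (exp (5 * t\<^sup>2 + t * ?\<rho> * ?m))"
    by (simp add: emeasure_eq_measure ennreal_mult)
  then have "exp (t * ?\<rho> * (?m + \<delta>)) * measure \<mu> ?A \<le> exp (5 * t\<^sup>2 + t * ?\<rho> * ?m)" by simp
  then have "measure \<mu> ?A \<le> exp (5 * t\<^sup>2 + t * ?\<rho> * ?m) / exp (t * ?\<rho> * (?m + \<delta>))" by (simp add: field_simps)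
  also have "\<dots> = exp (5 * t\<^sup>2 - t * ?\<rho> * \<delta>)" by (simp add: exp_diff[symmetric] algebra_simps)
  also have "5 * t\<^sup>2 - t * ?\<rho> * \<delta> = - (?\<rho>\<^sup>2 * \<delta>\<^sup>2 / 20)" by (simp add: t_def power2_eq_square field_simps)
  also have "exp \<dots> \<le> exp (- (real d * \<delta>\<^sup>2 / 16))"
  proof -
    have "5 / 4 * d * \<delta>\<^sup>2 \<le> ?\<rho>\<^sup>2 * \<delta>\<^sup>2" using \<rho>(2) by (intro mult_right_mono) auto
    then show ?thesis by simp
  qed
  finally show ?thesis .
qed

end

section \<open>Channels and their Choi states\<close>

lemma sum_product_index:
  fixes f :: "nat \<Rightarrow> 'a::comm_monoid_add"
  shows "(\<Sum>p<a*b. f p) = (\<Sum>i<a. \<Sum>k<b. f (i*b + k))"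
proof -
  have "(\<Sum>p<a*b. f p) = (\<Sum>i<a. sum f {i*b..<i*b + b})" by (rule sum.nat_group[symmetric])
  also have "\<dots> = (\<Sum>i<a. \<Sum>k<b. f (i*b + k))"
  proof (rule sum.cong[OF refl])
    fix i
    show "sum f {i*b..<i*b + b} = (\<Sum>k<b. f (i*b + k))"
      using sum.shift_bounds_nat_ivl[of f 0 "i*b" b] by (simp add: add.commute atLeast0LessThan)
  qed
  finally show ?thesis .
qed

lemma pair_index_less: "a < n \<Longrightarrow> k < m \<Longrightarrow> a * m + k < n * (m::nat)"
proof -
  assume "a < n" "k < m"
  then have "a * m + k < Suc a * m" by simp
  also have "\<dots> \<le> n * m" using \<open>a < n\<close> by (intro mult_right_mono) auto
  finally show ?thesis .
qed

text \<open>The output for the pure input \<open>x\<close> of the map with Choi matrix \<open>t\<close>, the basis vector \<open>(a, k)\<close> of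
  \<open>A' \<otimes> B\<close> having the index \<open>a * dB + k\<close>.\<close>
definition chan :: "nat \<Rightarrow> nat \<Rightarrow> (nat \<Rightarrow> nat \<Rightarrow> complex) \<Rightarrow> (nat \<Rightarrow> complex) \<Rightarrow> complex mat" where
  "chan dA dB t x = Matrix.mat dB dB (\<lambda>(k,l). of_nat dA * (\<Sum>a<dA. \<Sum>b<dA. x a * cnj (x b) * t (a*dB + k) (b*dB + l)))"

text \<open>The output for the maximally mixed input and, at the same time, the partial trace over
  \<open>A'\<close>.\<close>

definition chan_mix :: "nat \<Rightarrow> nat \<Rightarrow> (nat \<Rightarrow> nat \<Rightarrow> complex) \<Rightarrow> complex mat" where
  "chan_mix dA dB t = Matrix.mat dB dB (\<lambda>(k,l). \<Sum>a<dA. t (a*dB + k) (a*dB + l))"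

text \<open>Column \<open>m\<close> is the image of \<open>x\<close> under the \<open>m\<close>-th
  Kraus operator read off from a factor \<open>A\<close> of the Choi matrix.\<close>

definition kmap :: "nat \<Rightarrow> nat \<Rightarrow> (nat \<Rightarrow> nat \<Rightarrow> complex) \<Rightarrow> (nat \<Rightarrow> complex) \<Rightarrow> nat \<Rightarrow> nat \<Rightarrow> complex" where
  "kmap dA dB A x k m = of_real (sqrt dA) * (\<Sum>a<dA. x a * A (a*dB + k) m)"

lemma chan_carrier [simp]: "chan dA dB t x \<in> carrier_mat dB dB" "chan_mix dA dB t \<in> carrier_mat dB dB"
  by (simp_all add: chan_def chan_mix_def)

lemma chan_entry: "k < dB \<Longrightarrow> l < dB \<Longrightarrow> chan dA dB t x $$ (k,l) = of_nat dA * (\<Sum>a<dA. \<Sum>b<dA. x a * cnj (x b) * t (a*dB + k) (b*dB + l))"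
  by (simp add: chan_def)

lemma chan_mix_entry: "k < dB \<Longrightarrow> l < dB \<Longrightarrow> chan_mix dA dB t $$ (k,l) = (\<Sum>a<dA. t (a*dB + k) (a*dB + l))"
  by (simp add: chan_mix_def)

lemma chan_gram:
  assumes t: "\<And>p q. p < dA*dB \<Longrightarrow> q < dA*dB \<Longrightarrow> t p q = (\<Sum>m<N. A p m * cnj (A q m))" and kl: "k < dB" "l < dB"
  shows "chan dA dB t x $$ (k,l) = (\<Sum>m<N. kmap dA dB A x k m * cnj (kmap dA dB A x l m))"
proof -
  have s: "complex_of_real (sqrt dA) * complex_of_real (sqrt dA) = of_nat dA" by (simp flip: of_real_mult)
  have "kmap dA dB A x k m * cnj (kmap dA dB A x l m)
     = of_nat dA * (\<Sum>a<dA. \<Sum>b<dA. x a * cnj (x b) * (A (a*dB + k) m * cnj (A (b*dB + l) m)))" for m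
  proof -
    have "kmap dA dB A x k m * cnj (kmap dA dB A x l m)
      = (complex_of_real (sqrt dA) * complex_of_real (sqrt dA)) * ((\<Sum>a<dA. x a * A (a*dB + k) m) * (\<Sum>b<dA. cnj (x b) * cnj (A (b*dB + l) m)))"
      by (simp add: kmap_def cnj_sum)
    also have "(\<Sum>a<dA. x a * A (a*dB + k) m) * (\<Sum>b<dA. cnj (x b) * cnj (A (b*dB + l) m))
      = (\<Sum>a<dA. \<Sum>b<dA. (x a * A (a*dB + k) m) * (cnj (x b) * cnj (A (b*dB + l) m)))"
      by (rule sum_product)
    finally show ?thesis unfolding s by (simp add: ac_simps)
  qed
  then have "(\<Sum>m<N. kmap dA dB A x k m * cnj (kmap dA dB A x l m))
     = of_nat dA * (\<Sum>m<N. \<Sum>a<dA. \<Sum>b<dA. x a * cnj (x b) * (A (a*dB + k) m * cnj (A (b*dB + l) m)))"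
    by (simp add: sum_distrib_left)
  also have "(\<Sum>m<N. \<Sum>a<dA. \<Sum>b<dA. x a * cnj (x b) * (A (a*dB + k) m * cnj (A (b*dB + l) m)))
     = (\<Sum>a<dA. \<Sum>m<N. \<Sum>b<dA. x a * cnj (x b) * (A (a*dB + k) m * cnj (A (b*dB + l) m)))" by (rule sum.swap)
  also have "\<dots> = (\<Sum>a<dA. \<Sum>b<dA. \<Sum>m<N. x a * cnj (x b) * (A (a*dB + k) m * cnj (A (b*dB + l) m)))"
    by (rule sum.cong[OF refl]) (rule sum.swap)
  also have "\<dots> = (\<Sum>a<dA. \<Sum>b<dA. x a * cnj (x b) * t (a*dB + k) (b*dB + l))"
    by (intro sum.cong refl) (use kl t in \<open>simp add: pair_index_less sum_distrib_left\<close>)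
  finally show ?thesis using kl by (simp add: chan_entry)
qed

lemma kmap_diff: "kmap dA dB (\<lambda>p m. A p m - B p m) x = (\<lambda>k m. kmap dA dB A x k m - kmap dA dB B x k m)"
  by (intro ext) (simp add: kmap_def algebra_simps sum_subtractf)

lemma kmap_add: "kmap dA dB (\<lambda>p m. A p m + B p m) x = (\<lambda>k m. kmap dA dB A x k m + kmap dA dB B x k m)"
  by (intro ext) (simp add: kmap_def algebra_simps sum.distrib)

lemma kmap_diff_vec: "kmap dA dB A (\<lambda>i. x i - y i) = (\<lambda>k m. kmap dA dB A x k m - kmap dA dB A y k m)"
  by (intro ext) (simp add: kmap_def algebra_simps sum_subtractf)

lemma kmap_add_vec: "kmap dA dB A (\<lambda>i. x i + y i) = (\<lambda>k m. kmap dA dB A x k m + kmap dA dB A y k m)"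
  by (intro ext) (simp add: kmap_def algebra_simps sum.distrib)

lemma chan_diff: "chan dA dB t x - chan dA dB t' x = chan dA dB (\<lambda>p q. t p q - t' p q) x"
  by (rule eq_matI) (auto simp: chan_def algebra_simps sum_subtractf)

lemma chan_mix_diff: "chan_mix dA dB t - chan_mix dA dB t' = chan_mix dA dB (\<lambda>p q. t p q - t' p q)"
  by (rule eq_matI) (auto simp: chan_mix_def sum_subtractf)

text \<open>\<open>tnorm\<close> is defined through a square root, but it is Lipschitz for itself
  and dominated by the entries, so continuity of the entries suffices.\<close>

lemma continuous_on_tnorm:
  fixes F :: "'a::topological_space \<Rightarrow> complex mat"
  assumes F: "\<And>x. F x \<in> carrier_mat n n" and c: "\<And>i j. i < n \<Longrightarrow> j < n \<Longrightarrow> continuous_on UNIV (\<lambda>x. F x $$ (i,j))"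
  shows "continuous_on UNIV (\<lambda>x. tnorm (F x))"
proof -
  have "((\<lambda>y. tnorm (F y)) \<longlongrightarrow> tnorm (F x)) (at x)" for x
  proof (rule LIM_zero_cancel, rule Lim_null_comparison)
    show "\<forall>\<^sub>F y in at x. norm (tnorm (F y) - tnorm (F x)) \<le> (\<Sum>i<n. \<Sum>j<n. cmod (F y $$ (i,j) - F x $$ (i,j)))"
    proof (rule always_eventually, rule allI)
      fix y
      have "\<bar>tnorm (F y) - tnorm (F x)\<bar> \<le> tnorm (F y - F x)" by (rule tnorm_lipschitz[OF F F])
      also have "\<dots> \<le> (\<Sum>i<n. \<Sum>j<n. cmod ((F y - F x) $$ (i,j)))"
        by (rule tnorm_le_sum_entries) (rule minus_carrier_mat[OF F])
      also have "\<dots> = (\<Sum>i<n. \<Sum>j<n. cmod (F y $$ (i,j) - F x $$ (i,j)))"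
        using F[of x] F[of y] by (intro sum.cong refl) auto
      finally show "norm (tnorm (F y) - tnorm (F x)) \<le> (\<Sum>i<n. \<Sum>j<n. cmod (F y $$ (i,j) - F x $$ (i,j)))" by simp
    qed
    have "((\<lambda>y. \<Sum>i<n. \<Sum>j<n. cmod (F y $$ (i,j) - F x $$ (i,j))) \<longlongrightarrow> (\<Sum>i<n. \<Sum>j<n. cmod (F x $$ (i,j) - F x $$ (i,j)))) (at x)"
      using c by (intro tendsto_intros) (auto simp: continuous_on_def)
    then show "((\<lambda>y. \<Sum>i<n. \<Sum>j<n. cmod (F y $$ (i,j) - F x $$ (i,j))) \<longlongrightarrow> 0) (at x)" by simp
  qed
  then show ?thesis by (simp add: continuous_on_def)
qed

lemma continuous_on_chan_entry:
  assumes "k < dB" "l < dB" shows "continuous_on UNIV (\<lambda>x. chan dA dB t x $$ (k,l))"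
proof -
  have [continuous_intros]: "continuous_on UNIV (\<lambda>x::nat\<Rightarrow>complex. x i)" for i by (rule continuous_on_product_coordinates)
  show ?thesis unfolding chan_entry[OF assms] by (intro continuous_intros)
qed

lemma measurable_tnorm_chan:
  assumes Y: "Y \<in> carrier_mat dB dB"
  shows "(\<lambda>x. tnorm (chan dA dB t x - Y)) \<in> borel_measurable borel"
proof (rule borel_measurable_continuous_onI, rule continuous_on_tnorm[where n = dB])
  show "chan dA dB t x - Y \<in> carrier_mat dB dB" for x using Y by (rule minus_carrier_mat)
  fix k l assume kl: "k < dB" "l < dB"
  have e: "(\<lambda>x. (chan dA dB t x - Y) $$ (k,l)) = (\<lambda>x. chan dA dB t x $$ (k,l) - Y $$ (k,l))"
    using Y kl by (intro ext) (auto simp: chan_def)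
  show "continuous_on UNIV (\<lambda>x. (chan dA dB t x - Y) $$ (k,l))"
    unfolding e by (intro continuous_on_diff continuous_on_chan_entry[OF kl] continuous_on_const)
qed

context haar begin

lemma integrable_tnorm_chan:
  assumes Y: "Y \<in> carrier_mat dB dB"
  shows "integrable \<mu> (\<lambda>x. tnorm (chan d dB t x - Y))"
proof (rule integrable_bounded_sphere[OF measurable_tnorm_chan[OF Y]])
  fix x assume x: "nsq d x = 1"
  have c: "chan d dB t x - Y \<in> carrier_mat dB dB" using Y by (rule minus_carrier_mat)
  have "norm (tnorm (chan d dB t x - Y)) = tnorm (chan d dB t x - Y)" using tnorm_nonneg[OF c] by simp
  also have "\<dots> \<le> (\<Sum>k<dB. \<Sum>l<dB. cmod ((chan d dB t x - Y) $$ (k,l)))" by (rule tnorm_le_sum_entries[OF c])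
  also have "\<dots> \<le> (\<Sum>k<dB. \<Sum>l<dB. real d * (\<Sum>a<d. \<Sum>b<d. cmod (t (a*dB + k) (b*dB + l))) + cmod (Y $$ (k,l)))"
  proof (intro sum_mono)
    fix k l assume "k \<in> {..<dB}" "l \<in> {..<dB}"
    then have kl: "k < dB" "l < dB" by auto
    have "cmod ((chan d dB t x - Y) $$ (k,l)) \<le> cmod (chan d dB t x $$ (k,l)) + cmod (Y $$ (k,l))"
      using Y kl by (auto simp: norm_triangle_ineq4)
    also have "cmod (chan d dB t x $$ (k,l)) \<le> real d * (\<Sum>a<d. \<Sum>b<d. cmod (t (a*dB + k) (b*dB + l)))"
    proof -
      have "cmod (\<Sum>a<d. \<Sum>b<d. x a * cnj (x b) * t (a*dB + k) (b*dB + l)) \<le> (\<Sum>a<d. \<Sum>b<d. cmod (x a * cnj (x b) * t (a*dB + k) (b*dB + l)))"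
        by (intro order_trans[OF norm_sum] sum_mono norm_sum)
      also have "\<dots> \<le> (\<Sum>a<d. \<Sum>b<d. 1 * cmod (t (a*dB + k) (b*dB + l)))"
        unfolding norm_mult complex_mod_cnj
        by (intro sum_mono mult_right_mono mult_le_one) (auto simp: sphere_coord_le_1[OF x])
      finally show ?thesis unfolding chan_entry[OF kl] norm_mult norm_of_nat by (intro mult_left_mono) auto
    qed
    finally show "cmod ((chan d dB t x - Y) $$ (k,l)) \<le> real d * (\<Sum>a<d. \<Sum>b<d. cmod (t (a*dB + k) (b*dB + l))) + cmod (Y $$ (k,l))"
      by simp
  qed
  finally show "norm (tnorm (chan d dB t x - Y)) \<le> (\<Sum>k<dB. \<Sum>l<dB. real d * (\<Sum>a<d. \<Sum>b<d. cmod (t (a*dB + k) (b*dB + l))) + cmod (Y $$ (k,l)))" .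
qed

lemma expectation_chan_entry:
  assumes "d > 0" "k < dB" "l < dB"
  shows "integrable \<mu> (\<lambda>x. chan d dB t x $$ (k,l))"
    "(\<integral>x. chan d dB t x $$ (k,l) \<partial>\<mu>) = chan_mix d dB t $$ (k,l)"
  unfolding chan_entry[OF assms(2,3)] chan_mix_entry[OF assms(2,3)]
  using integrable_quadratic_form[of "\<lambda>a b. t (a*dB + k) (b*dB + l)"]
    expectation_quadratic_form[of "\<lambda>a b. t (a*dB + k) (b*dB + l)"] assms(1) by simp_all

text \<open>Jensen's inequality by duality: a contraction that is optimal for the mean is admissible
  for every single output.\<close>

lemma tnorm_expectation_le:
  assumes d: "d > 0" and Y: "Y \<in> carrier_mat dB dB"
  shows "tnorm (chan_mix d dB t - Y) \<le> (\<integral>x. tnorm (chan d dB t x - Y) \<partial>\<mu>)"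
proof -
  have c: "chan_mix d dB t - Y \<in> carrier_mat dB dB" using Y by (rule minus_carrier_mat)
  have c': "chan d dB t x - Y \<in> carrier_mat dB dB" for x using Y by (rule minus_carrier_mat)
  obtain W where W: "contraction dB W" "(\<Sum>i<dB. \<Sum>j<dB. (chan_mix d dB t - Y) $$ (i,j) * W j i) = of_real (tnorm (chan_mix d dB t - Y))"
    using tnorm_attained[OF c] by blast
  let ?f = "\<lambda>x. \<Sum>i<dB. \<Sum>j<dB. (chan d dB t x - Y) $$ (i,j) * W j i"
  have i: "integrable \<mu> (\<lambda>x. (chan d dB t x - Y) $$ (i,j) * W j i)"
    "(\<integral>x. (chan d dB t x - Y) $$ (i,j) * W j i \<partial>\<mu>) = (chan_mix d dB t - Y) $$ (i,j) * W j i" if ij: "i < dB" "j < dB" for i j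
  proof -
    have e: "(chan d dB t x - Y) $$ (i,j) = chan d dB t x $$ (i,j) - Y $$ (i,j)" for x using Y ij by (auto simp: chan_def)
    have e': "(chan_mix d dB t - Y) $$ (i,j) = chan_mix d dB t $$ (i,j) - Y $$ (i,j)" using Y ij by (auto simp: chan_mix_def)
    show "integrable \<mu> (\<lambda>x. (chan d dB t x - Y) $$ (i,j) * W j i)"
      "(\<integral>x. (chan d dB t x - Y) $$ (i,j) * W j i \<partial>\<mu>) = (chan_mix d dB t - Y) $$ (i,j) * W j i"
      unfolding e e' using expectation_chan_entry[OF d ij, of t] by simp_all
  qed
  have int: "integrable \<mu> ?f" by (intro Bochner_Integration.integrable_sum i) auto
  have "(\<integral>x. ?f x \<partial>\<mu>) = (\<Sum>i<dB. \<integral>x. (\<Sum>j<dB. (chan d dB t x - Y) $$ (i,j) * W j i) \<partial>\<mu>)"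
    by (rule Bochner_Integration.integral_sum) (intro Bochner_Integration.integrable_sum i, auto)
  also have "\<dots> = (\<Sum>i<dB. \<Sum>j<dB. \<integral>x. (chan d dB t x - Y) $$ (i,j) * W j i \<partial>\<mu>)"
    by (rule sum.cong[OF refl], rule Bochner_Integration.integral_sum) (intro i, auto)
  also have "\<dots> = (\<Sum>i<dB. \<Sum>j<dB. (chan_mix d dB t - Y) $$ (i,j) * W j i)"
    by (intro sum.cong refl i) auto
  also note W(2)
  finally have "tnorm (chan_mix d dB t - Y) = Re (\<integral>x. ?f x \<partial>\<mu>)" by simp
  also have "\<dots> = (\<integral>x. Re (?f x) \<partial>\<mu>)" by (rule integral_Re[OF int, symmetric])
  also have "\<dots> \<le> (\<integral>x. tnorm (chan d dB t x - Y) \<partial>\<mu>)"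
  proof (rule integral_mono)
    show "integrable \<mu> (\<lambda>x. Re (?f x))" using int by (rule integrable_Re)
    show "integrable \<mu> (\<lambda>x. tnorm (chan d dB t x - Y))" by (rule integrable_tnorm_chan[OF Y])
    show "Re (?f x) \<le> tnorm (chan d dB t x - Y)" for x
      using tnorm_ge[OF c' W(1), of x] complex_Re_le_cmod[of "?f x"] by linarith
  qed
  finally show ?thesis .
qed

text \<open>The squared Frobenius norm of the Kraus images is the trace of the output, whose mean is
  known exactly. Distances between factors of Choi matrices thus pass to the outputs without loss on
  average.\<close>

lemma expectation_fro_kmap:
  assumes d: "d > 0"
  shows "integrable \<mu> (\<lambda>x. fro dB N (kmap d dB A x))" "(\<integral>x. fro dB N (kmap d dB A x) \<partial>\<mu>) = fro (d*dB) N A"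
proof -
  let ?t = "\<lambda>p q. \<Sum>m<N. A p m * cnj (A q m)"
  have e: "fro dB N (kmap d dB A x) = (\<Sum>k<dB. Re (chan d dB ?t x $$ (k,k)))" for x
    unfolding fro_def by (intro sum.cong refl) (simp add: chan_gram[where t = ?t and N = N and A = A] cmod_power2 flip: power2_eq_square)
  have i: "integrable \<mu> (\<lambda>x. Re (chan d dB ?t x $$ (k,k)))"
    "(\<integral>x. Re (chan d dB ?t x $$ (k,k)) \<partial>\<mu>) = Re (chan_mix d dB ?t $$ (k,k))" if "k < dB" for k
    using expectation_chan_entry[OF d that that, of ?t] by (auto simp: integral_Re)
  show "integrable \<mu> (\<lambda>x. fro dB N (kmap d dB A x))"
    unfolding e by (intro Bochner_Integration.integrable_sum i) auto
  have "(\<integral>x. fro dB N (kmap d dB A x) \<partial>\<mu>) = (\<Sum>k<dB. \<integral>x. Re (chan d dB ?t x $$ (k,k)) \<partial>\<mu>)"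
    unfolding e by (rule Bochner_Integration.integral_sum) (intro i, auto)
  also have "\<dots> = (\<Sum>k<dB. \<Sum>a<d. \<Sum>m<N. (cmod (A (a*dB + k) m))\<^sup>2)"
    by (intro sum.cong refl) (simp add: i chan_mix_entry cmod_power2 flip: power2_eq_square)
  also have "\<dots> = (\<Sum>a<d. \<Sum>k<dB. \<Sum>m<N. (cmod (A (a*dB + k) m))\<^sup>2)" by (rule sum.swap)
  also have "\<dots> = fro (d*dB) N A" by (simp add: fro_def sum_product_index)
  finally show "(\<integral>x. fro dB N (kmap d dB A x) \<partial>\<mu>) = fro (d*dB) N A" .
qed

lemma expectation_chan_gram_diff:
  assumes d: "d > 0" and c: "c > 0"
    and t: "\<And>p q. p < d*dB \<Longrightarrow> q < d*dB \<Longrightarrow> t p q = (\<Sum>m<N. A p m * cnj (A q m))"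
    and t': "\<And>p q. p < d*dB \<Longrightarrow> q < d*dB \<Longrightarrow> t' p q = (\<Sum>m<N. B p m * cnj (B q m))"
  shows "(\<integral>x. tnorm (chan d dB t x - chan d dB t' x) \<partial>\<mu>)
      \<le> (c * fro (d*dB) N (\<lambda>p m. A p m - B p m) + fro (d*dB) N (\<lambda>p m. A p m + B p m) / c) / 2"
proof -
  let ?D = "\<lambda>p m. A p m - B p m" and ?S = "\<lambda>p m. A p m + B p m"
  have z: "X - 0\<^sub>m dB dB = X" if "X \<in> carrier_mat dB dB" for X :: "complex mat" using that by (auto intro!: eq_matI)
  have "integrable \<mu> (\<lambda>x. tnorm (chan d dB (\<lambda>p q. t p q - t' p q) x - 0\<^sub>m dB dB))"
    by (rule integrable_tnorm_chan) simp
  then have i: "integrable \<mu> (\<lambda>x. tnorm (chan d dB t x - chan d dB t' x))" by (simp add: chan_diff z)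
  have "(\<integral>x. tnorm (chan d dB t x - chan d dB t' x) \<partial>\<mu>)
     \<le> (\<integral>x. (c * fro dB N (kmap d dB ?D x) + fro dB N (kmap d dB ?S x) / c) / 2 \<partial>\<mu>)"
  proof (rule integral_mono[OF i])
    show "integrable \<mu> (\<lambda>x. (c * fro dB N (kmap d dB ?D x) + fro dB N (kmap d dB ?S x) / c) / 2)"
      using expectation_fro_kmap(1)[OF d] by simp
    show "tnorm (chan d dB t x - chan d dB t' x) \<le> (c * fro dB N (kmap d dB ?D x) + fro dB N (kmap d dB ?S x) / c) / 2" for x
      unfolding kmap_diff kmap_add
      by (rule tnorm_gram_diff_le[OF _ c])
         (auto simp: chan_gram[OF t] chan_gram[OF t'] chan_carrier carrier_matD[OF chan_carrier(1)] intro!: minus_carrier_mat)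
  qed
  also have "\<dots> = (c * fro (d*dB) N ?D + fro (d*dB) N ?S / c) / 2"
    using expectation_fro_kmap[OF d] by simp
  finally show ?thesis .
qed

end

section \<open>The Choi representation of a channel\<close>

definition mat_unit :: "nat \<Rightarrow> nat \<Rightarrow> nat \<Rightarrow> complex mat" where
  "mat_unit d a b = Matrix.mat d d (\<lambda>(i,j). if i = a \<and> j = b then 1 else 0)"

lemma mat_unit_carrier [simp]: "mat_unit d a b \<in> carrier_mat d d" by (simp add: mat_unit_def)

locale channel =
  fixes dA dB :: nat and T :: "complex mat \<Rightarrow> complex mat"
  assumes dA: "dA > 0" and dB: "dB > 0" and cptp: "cptp dA dB T"
begin

definition tau :: "nat \<Rightarrow> nat \<Rightarrow> complex" where "tau p q = choi dA dB T $$ (p,q)"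

lemma T_carrier: "X \<in> carrier_mat dA dA \<Longrightarrow> T X \<in> carrier_mat dB dB"
  and T_lin: "X \<in> carrier_mat dA dA \<Longrightarrow> Y \<in> carrier_mat dA dA \<Longrightarrow> T (a \<cdot>\<^sub>m X + b \<cdot>\<^sub>m Y) = a \<cdot>\<^sub>m T X + b \<cdot>\<^sub>m T Y"
  and T_tr: "X \<in> carrier_mat dA dA \<Longrightarrow> tr (T X) = tr X"
  and T_cp: "psd (n*dA) M \<Longrightarrow> psd (n*dB) (id_tensor n dA dB T M)"
  using cptp unfolding cptp_def by blast+

lemma T_add_scaled_entry:
  assumes "X \<in> carrier_mat dA dA" "Y \<in> carrier_mat dA dA" "k < dB" "l < dB"
  shows "T (X + c \<cdot>\<^sub>m Y) $$ (k,l) = T X $$ (k,l) + c * T Y $$ (k,l)"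
proof -
  have "X + c \<cdot>\<^sub>m Y = 1 \<cdot>\<^sub>m X + c \<cdot>\<^sub>m Y" using assms by (intro eq_matI) auto
  then have "T (X + c \<cdot>\<^sub>m Y) = 1 \<cdot>\<^sub>m T X + c \<cdot>\<^sub>m T Y" using T_lin[OF assms(1,2)] by simp
  then show ?thesis using T_carrier[OF assms(1)] T_carrier[OF assms(2)] assms by auto
qed

lemma T_zero_entry:
  assumes "k < dB" "l < dB" shows "T (0\<^sub>m dA dA) $$ (k,l) = 0"
proof -
  have z: "0\<^sub>m dA dA \<in> carrier_mat dA dA" by simp
  have "0\<^sub>m dA dA + 1 \<cdot>\<^sub>m 0\<^sub>m dA dA = (0\<^sub>m dA dA :: complex mat)" by (intro eq_matI) auto
  then show ?thesis using T_add_scaled_entry[OF z z assms, of 1] by simp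
qed

text \<open>\<open>cptp\<close> gives linearity for two terms, so the matrix is built up through the
  partial sums \<open>P n\<close>, one matrix unit at a time in the order of the index
  \<open>i * dA + j\<close>.\<close>

lemma T_expand:
  assumes M: "M \<in> carrier_mat dA dA" and kl: "k < dB" "l < dB"
  shows "T M $$ (k,l) = (\<Sum>a<dA. \<Sum>b<dA. M $$ (a,b) * T (mat_unit dA a b) $$ (k,l))"
proof -
  define P where "P n = Matrix.mat dA dA (\<lambda>(i,j). if i*dA + j < n then M $$ (i,j) else 0)" for n
  have Pc: "P n \<in> carrier_mat dA dA" for n by (simp add: P_def)
  have "T (P n) $$ (k,l) = (\<Sum>p<n. M $$ (p div dA, p mod dA) * T (mat_unit dA (p div dA) (p mod dA)) $$ (k,l))" for n
  proof (induction n)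
    case 0
    have "P 0 = 0\<^sub>m dA dA" by (intro eq_matI) (auto simp: P_def)
    then show ?case using T_zero_entry[OF kl] by simp
  next
    case (Suc n)
    have "P (Suc n) = P n + M $$ (n div dA, n mod dA) \<cdot>\<^sub>m mat_unit dA (n div dA) (n mod dA)"
    proof (rule eq_matI)
      fix i j assume "i < dim_row (P n + M $$ (n div dA, n mod dA) \<cdot>\<^sub>m mat_unit dA (n div dA) (n mod dA))"
        "j < dim_col (P n + M $$ (n div dA, n mod dA) \<cdot>\<^sub>m mat_unit dA (n div dA) (n mod dA))"
      then have ij: "i < dA" "j < dA" by (auto simp: mat_unit_def)
      have "i*dA + j = n \<longleftrightarrow> i = n div dA \<and> j = n mod dA" using ij by auto
      then show "P (Suc n) $$ (i,j) = (P n + M $$ (n div dA, n mod dA) \<cdot>\<^sub>m mat_unit dA (n div dA) (n mod dA)) $$ (i,j)"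
        using ij by (auto simp: P_def mat_unit_def less_Suc_eq)
    qed (auto simp: P_def mat_unit_def)
    then show ?case using T_add_scaled_entry[OF Pc mat_unit_carrier kl] Suc by simp
  qed
  note this[of "dA*dA"]
  also have "(\<Sum>p<dA*dA. M $$ (p div dA, p mod dA) * T (mat_unit dA (p div dA) (p mod dA)) $$ (k,l))
      = (\<Sum>a<dA. \<Sum>b<dA. M $$ (a,b) * T (mat_unit dA a b) $$ (k,l))"
    unfolding sum_product_index by (intro sum.cong refl) (use dA in simp)
  finally have "T (P (dA*dA)) $$ (k,l) = (\<Sum>a<dA. \<Sum>b<dA. M $$ (a,b) * T (mat_unit dA a b) $$ (k,l))" .
  moreover have "P (dA*dA) = M" using M by (intro eq_matI) (auto simp: P_def pair_index_less)
  ultimately show ?thesis by simp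
qed

lemma tau_entry:
  assumes "a < dA" "b < dA" "k < dB" "l < dB"
  shows "tau (a*dB + k) (b*dB + l) = T (mat_unit dA a b) $$ (k,l) / of_nat dA"
proof -
  let ?c = "complex_of_real (1 / real dA)"
  have bl: "block dA (max_ent dA) a b = 0\<^sub>m dA dA + ?c \<cdot>\<^sub>m mat_unit dA a b"
    using assms by (intro eq_matI) (auto simp: block_def max_ent_def mat_unit_def pair_index_less)
  have "tau (a*dB + k) (b*dB + l) = T (block dA (max_ent dA) a b) $$ (k,l)"
    using assms by (simp add: tau_def choi_def id_tensor_def pair_index_less)
  also have "\<dots> = T (0\<^sub>m dA dA) $$ (k,l) + ?c * T (mat_unit dA a b) $$ (k,l)"
    unfolding bl by (rule T_add_scaled_entry) (use assms in auto)
  finally show ?thesis using T_zero_entry[OF assms(3,4)] by simp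
qed

lemma T_entry:
  assumes M: "M \<in> carrier_mat dA dA" and kl: "k < dB" "l < dB"
  shows "T M $$ (k,l) = of_nat dA * (\<Sum>a<dA. \<Sum>b<dA. M $$ (a,b) * tau (a*dB + k) (b*dB + l))"
  unfolding T_expand[OF M kl] sum_distrib_left
  by (intro sum.cong refl) (use kl dA in \<open>simp add: tau_entry\<close>)

lemma T_proj: "T (proj dA x) = chan dA dB tau x"
proof (rule eq_matI)
  have c: "proj dA x \<in> carrier_mat dA dA" by (simp add: proj_def)
  show "dim_row (T (proj dA x)) = dim_row (chan dA dB tau x)" "dim_col (T (proj dA x)) = dim_col (chan dA dB tau x)"
    using T_carrier[OF c] by (auto simp: chan_def)
  fix k l assume "k < dim_row (chan dA dB tau x)" "l < dim_col (chan dA dB tau x)"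
  then have kl: "k < dB" "l < dB" by (auto simp: chan_def)
  show "T (proj dA x) $$ (k,l) = chan dA dB tau x $$ (k,l)"
    unfolding T_entry[OF c kl] chan_entry[OF kl]
    by (intro arg_cong2[where f="(*)"] refl sum.cong) (auto simp: proj_def)
qed

lemma T_mixed: "T (max_mixed dA) = chan_mix dA dB tau"
proof (rule eq_matI)
  have c: "max_mixed dA \<in> carrier_mat dA dA" by (simp add: max_mixed_def)
  show "dim_row (T (max_mixed dA)) = dim_row (chan_mix dA dB tau)" "dim_col (T (max_mixed dA)) = dim_col (chan_mix dA dB tau)"
    using T_carrier[OF c] by (auto simp: chan_mix_def)
  fix k l assume "k < dim_row (chan_mix dA dB tau)" "l < dim_col (chan_mix dA dB tau)"
  then have kl: "k < dB" "l < dB" by (auto simp: chan_mix_def)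
  have "T (max_mixed dA) $$ (k,l) = of_nat dA * (\<Sum>a<dA. \<Sum>b<dA. if b = a then tau (a*dB + k) (b*dB + l) / of_nat dA else 0)"
    unfolding T_entry[OF c kl] by (intro arg_cong2[where f="(*)"] refl sum.cong) (auto simp: max_mixed_def)
  also have "\<dots> = chan_mix dA dB tau $$ (k,l)"
    using dA kl by (simp add: chan_mix_entry sum_distrib_left)
  finally show "T (max_mixed dA) $$ (k,l) = chan_mix dA dB tau $$ (k,l)" .
qed

lemma psd_max_ent: "psd (dA*dA) (max_ent dA)"
proof (rule psdI)
  let ?w = "\<lambda>p. if p div dA = p mod dA then 1 else (0::complex)"
  show "max_ent dA \<in> carrier_mat (dA*dA) (dA*dA)" by (simp add: max_ent_def)
  fix x
  have "ip (dA*dA) x (mv (dA*dA) (\<lambda>i j. max_ent dA $$ (i,j)) x)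
     = (\<Sum>p<dA*dA. \<Sum>q<dA*dA. of_real (1 / real dA) * ((cnj (x p) * ?w p) * (?w q * x q)))"
    unfolding ip_def mv_def sum_distrib_left by (intro sum.cong refl) (auto simp: max_ent_def)
  also have "\<dots> = of_real (1 / real dA) * ((\<Sum>p<dA*dA. cnj (x p) * ?w p) * (\<Sum>q<dA*dA. ?w q * x q))"
    unfolding sum_product by (simp only: sum_distrib_left)
  also have "(\<Sum>p<dA*dA. cnj (x p) * ?w p) = cnj (\<Sum>q<dA*dA. ?w q * x q)"
    unfolding cnj_sum by (intro sum.cong) auto
  finally show "ip (dA*dA) x (mv (dA*dA) (\<lambda>i j. max_ent dA $$ (i,j)) x)
      = of_real ((cmod (\<Sum>q<dA*dA. ?w q * x q))\<^sup>2 / real dA)"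
    by (simp add: complex_norm_square mult.commute del: of_real_power)
qed simp

lemma psd_choi: "psd (dA*dB) (choi dA dB T)"
  unfolding choi_def by (rule T_cp[OF psd_max_ent])

lemma ptr1_choi: "ptr1 dA dB (choi dA dB T) = chan_mix dA dB tau"
  by (auto simp: ptr1_def chan_mix_def tau_def)

lemma tr_chan_mix: "tr (chan_mix dA dB tau) = 1"
proof -
  have "tr (T (max_mixed dA)) = tr (max_mixed dA)" by (rule T_tr) (simp add: max_mixed_def)
  also have "\<dots> = 1" using dA by (simp add: tr_def max_mixed_def)
  finally show ?thesis by (simp add: T_mixed)
qed

lemma tr_choi: "tr (choi dA dB T) = 1"
proof -
  have "tr (choi dA dB T) = (\<Sum>a<dA. \<Sum>k<dB. tau (a*dB + k) (a*dB + k))"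
    using psd_carrier[OF psd_choi] by (simp add: tr_def sum_product_index tau_def)
  also have "\<dots> = (\<Sum>k<dB. \<Sum>a<dA. tau (a*dB + k) (a*dB + k))" by (rule sum.swap)
  also have "\<dots> = tr (chan_mix dA dB tau)"
    by (simp add: tr_def chan_mix_def)
  finally show ?thesis using tr_chan_mix by simp
qed

text \<open>The positive root is chosen as Gram factor because \<open>fid\<close> is expressed
  through positive roots, so that Uhlmann's theorem compares other states with it directly.\<close>

definition amp :: "nat \<Rightarrow> nat \<Rightarrow> complex" where "amp p m = msqrt (dA*dB) (choi dA dB T) $$ (p,m)"

lemma tau_gram: "p < dA*dB \<Longrightarrow> q < dA*dB \<Longrightarrow> tau p q = (\<Sum>m<dA*dB. amp p m * cnj (amp q m))"
  unfolding tau_def amp_def by (rule msqrt_gram[OF psd_choi])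

text \<open>Trace preservation read through the Kraus form: \<open>x\<close> is mapped isometrically
  into the Frobenius space. The Lipschitz constant of the deviation rests on this.\<close>

lemma fro_kmap_amp: "fro dB (dA*dB) (kmap dA dB amp x) = nsq dA x"
proof -
  have "fro dB (dA*dB) (kmap dA dB amp x) = (\<Sum>k<dB. Re (chan dA dB tau x $$ (k,k)))"
    unfolding fro_def by (intro sum.cong refl) (simp add: chan_gram[OF tau_gram] cmod_power2 flip: power2_eq_square)
  also have "\<dots> = Re (tr (T (proj dA x)))"
    unfolding T_proj tr_def by (simp add: chan_def)
  also have "tr (T (proj dA x)) = tr (proj dA x)" by (rule T_tr) (simp add: proj_def)
  also have "tr (proj dA x) = of_real (nsq dA x)"
    by (simp add: tr_def proj_def nsq_def complex_norm_square del: of_real_power)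
  finally show ?thesis by simp
qed

lemma tnorm_chan_le: "tnorm (chan dA dB tau x) \<le> nsq dA x"
proof -
  have "tnorm (chan dA dB tau x) \<le> (1 * fro dB (dA*dB) (kmap dA dB amp x) + fro dB (dA*dB) (kmap dA dB amp x) / 1) / 2"
    by (rule tnorm_gram_le[OF chan_carrier(1)]) (auto simp: chan_gram[OF tau_gram])
  then show ?thesis by (simp add: fro_kmap_amp)
qed

lemma psd_chan_mix: "psd dB (chan_mix dA dB tau)"
proof (rule psdI[OF chan_carrier(2)])
  fix x
  let ?N = "dA*dB"
  \<comment> \<open>The sum over \<open>a\<close> and \<open>m\<close> is flattened to the index
    \<open>p = a * ?N + m\<close>, which makes the partial trace a single Gram matrix.\<close>
  let ?S = "\<lambda>k p. amp ((p div ?N)*dB + k) (p mod ?N)"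
  have "chan_mix dA dB tau $$ (k,l) = (\<Sum>p<dA*?N. ?S k p * cnj (?S l p))" if "k < dB" "l < dB" for k l
    unfolding chan_mix_entry[OF that] sum_product_index[of _ dA ?N]
  proof (rule sum.cong[OF refl])
    fix a assume "a \<in> {..<dA}"
    then have "tau (a*dB + k) (a*dB + l) = (\<Sum>m<?N. amp (a*dB + k) m * cnj (amp (a*dB + l) m))"
      using that by (intro tau_gram) (auto simp: pair_index_less)
    also have "\<dots> = (\<Sum>m<?N. ?S k (a*?N + m) * cnj (?S l (a*?N + m)))"
    proof (rule sum.cong[OF refl])
      fix m assume "m \<in> {..<?N}"
      then have "(a*?N + m) div ?N = a" "(a*?N + m) mod ?N = m" by (auto simp: div_add1_eq)
      then show "amp (a*dB + k) m * cnj (amp (a*dB + l) m) = ?S k (a*?N + m) * cnj (?S l (a*?N + m))" by (simp only:)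
    qed
    finally show "tau (a*dB + k) (a*dB + l) = (\<Sum>m<?N. ?S k (a*?N + m) * cnj (?S l (a*?N + m)))" .
  qed
  from gram_form[where M = "\<lambda>i j. chan_mix dA dB tau $$ (i,j)" and S = ?S, OF this]
  show "ip dB x (mv dB (\<lambda>i j. chan_mix dA dB tau $$ (i,j)) x)
    = of_real (\<Sum>p<dA*?N. (cmod (\<Sum>k<dB. cnj (?S k p) * x k))\<^sup>2)" .
qed (auto intro: sum_nonneg)

lemma tnorm_chan_mix_le: "tnorm (chan_mix dA dB tau) \<le> 1"
  using tnorm_gram_le[OF chan_carrier(2) _ msqrt_gram[OF psd_chan_mix], of 1] fro_msqrt[OF psd_chan_mix] tr_chan_mix
  by simp

end

section \<open>Decoupling\<close>

lemma kron_id_entry: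
  assumes "\<sigma> \<in> carrier_mat dB dB" "a < d" "b < d" "k < dB" "l < dB"
  shows "kron (1\<^sub>m d) \<sigma> $$ (a*dB + k, b*dB + l) = (if a = b then \<sigma> $$ (k,l) else 0)"
  using assms by (simp add: kron_def pair_index_less)

lemma kron_carrier: "\<sigma> \<in> carrier_mat dB dB \<Longrightarrow> kron (1\<^sub>m d) \<sigma> \<in> carrier_mat (d*dB) (d*dB)"
  by (auto simp: kron_def)

lemma kron_id_form:
  assumes \<sigma>: "\<sigma> = specmat dB s v"
  shows "ip (d*dB) x (mv (d*dB) (\<lambda>i j. kron (1\<^sub>m d) \<sigma> $$ (i,j)) x)
    = of_real (\<Sum>a<d. \<Sum>m<dB. s m * (cmod (ip dB (v m) (\<lambda>k. x (a*dB + k))))\<^sup>2)"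
proof -
  have c: "\<sigma> \<in> carrier_mat dB dB" using \<sigma> by simp
  have "ip (d*dB) x (mv (d*dB) (\<lambda>i j. kron (1\<^sub>m d) \<sigma> $$ (i,j)) x)
    = (\<Sum>a<d. \<Sum>k<dB. cnj (x (a*dB + k)) * (\<Sum>b<d. \<Sum>l<dB. kron (1\<^sub>m d) \<sigma> $$ (a*dB + k, b*dB + l) * x (b*dB + l)))"
    by (simp add: ip_def mv_def sum_product_index)
  also have "\<dots> = (\<Sum>a<d. \<Sum>k<dB. cnj (x (a*dB + k)) * (\<Sum>b<d. if b = a then (\<Sum>l<dB. \<sigma> $$ (k,l) * x (b*dB + l)) else 0))"
    by (intro sum.cong refl arg_cong2[where f="(*)"]) (auto simp: kron_id_entry[OF c])
  also have "\<dots> = (\<Sum>a<d. ip dB (\<lambda>k. x (a*dB + k)) (mv dB (\<lambda>i j. specmat dB s v $$ (i,j)) (\<lambda>k. x (a*dB + k))))"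
    by (simp add: ip_def mv_def \<sigma>)
  finally show ?thesis by (simp add: ip_specmat)
qed

lemma gram_ip:
  "(\<Sum>p<n. cnj (z p) * (\<Sum>m<N. B p m * cnj (B q m))) = cnj (\<Sum>m<N. (\<Sum>p<n. cnj (B p m) * z p) * B q m)"
proof -
  have "(\<Sum>p<n. cnj (z p) * (\<Sum>m<N. B p m * cnj (B q m))) = (\<Sum>m<N. \<Sum>p<n. cnj (z p) * (B p m * cnj (B q m)))"
    unfolding sum_distrib_left by (rule sum.swap)
  then show ?thesis by (simp add: cnj_sum sum_distrib_left sum_distrib_right ac_simps)
qed

text \<open>For \<open>0 \<le> t \<le> \<kappa> K\<close> with \<open>K = I \<otimes> \<sigma>\<close>, this is the diagonal of \<open>t K\<^sup>-\<^sup>1 t \<le> \<kappa> t\<close>, which also holds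
  for singular \<open>\<sigma>\<close> with \<open>x / 0 = 0\<close>.\<close>
lemma column_bound:
  fixes B :: "nat \<Rightarrow> nat \<Rightarrow> complex"
  assumes s: "\<And>m. m < dB \<Longrightarrow> s m \<ge> 0" and on: "orthonormal dB dB v" and \<kappa>: "\<kappa> > 0"
    and t: "\<And>p q. p < d*dB \<Longrightarrow> q < d*dB \<Longrightarrow> t p q = (\<Sum>m<N. B p m * cnj (B q m))"
    and form: "\<And>x. (\<Sum>m<N. (cmod (\<Sum>p<d*dB. cnj (B p m) * x p))\<^sup>2) \<le> \<kappa> * (\<Sum>a<d. \<Sum>m<dB. s m * (cmod (ip dB (v m) (\<lambda>k. x (a*dB + k))))\<^sup>2)"
    and q: "q < d*dB"
  defines "R \<equiv> \<lambda>a m q. ip dB (v m) (\<lambda>k. t (a*dB + k) q)"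
  shows "(\<Sum>a<d. \<Sum>m<dB. (cmod (R a m q))\<^sup>2 / s m) \<le> \<kappa> * (\<Sum>m<N. (cmod (B q m))\<^sup>2)"
    "\<And>a m. a < d \<Longrightarrow> m < dB \<Longrightarrow> s m = 0 \<Longrightarrow> R a m q = 0"
proof -
  have pair: "(\<Sum>p<d*dB. cnj (z p) * t p q) = (\<Sum>a<d. ip dB (\<lambda>k. z (a*dB + k)) (\<lambda>k. t (a*dB + k) q))" for z
    by (simp add: sum_product_index ip_def)
  have cs: "(cmod (\<Sum>p<d*dB. cnj (z p) * t p q))\<^sup>2 \<le> (\<Sum>m<N. (cmod (\<Sum>p<d*dB. cnj (B p m) * z p))\<^sup>2) * (\<Sum>m<N. (cmod (B q m))\<^sup>2)" for z
  proof -
    let ?b = "\<lambda>m. \<Sum>p<d*dB. cnj (B p m) * z p"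
    have "(\<Sum>p<d*dB. cnj (z p) * t p q) = (\<Sum>p<d*dB. cnj (z p) * (\<Sum>m<N. B p m * cnj (B q m)))"
      by (intro sum.cong refl) (use t q in auto)
    also have "\<dots> = cnj (\<Sum>m<N. ?b m * B q m)" by (rule gram_ip)
    finally have "cmod (\<Sum>p<d*dB. cnj (z p) * t p q) = cmod (ip N (\<lambda>m. cnj (?b m)) (\<lambda>m. B q m))"
      by (simp only: complex_mod_cnj ip_def complex_cnj_cnj)
    also have "\<dots> \<le> sqrt (nsq N (\<lambda>m. cnj (?b m))) * sqrt (nsq N (B q))" by (rule cauchy_schwarz_ip)
    finally have "(cmod (\<Sum>p<d*dB. cnj (z p) * t p q))\<^sup>2 \<le> (sqrt (nsq N (\<lambda>m. cnj (?b m))) * sqrt (nsq N (B q)))\<^sup>2"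
      by (intro power_mono) auto
    also have "\<dots> = nsq N (\<lambda>m. cnj (?b m)) * nsq N (B q)" by (simp add: power_mult_distrib)
    finally show ?thesis by (simp only: nsq_def complex_mod_cnj)
  qed
  show "R a m q = 0" if am: "a < d" "m < dB" "s m = 0" for a m
  proof -
    \<comment> \<open>The basis vector \<open>a\<close> tensored with \<open>v m\<close>. The form
      of \<open>I \<otimes> \<sigma>\<close> vanishes on it when \<open>s m = 0\<close>, and with it
      the form of \<open>t\<close>.\<close>
    define z where "z p = (if p div dB = a then v m (p mod dB) else 0)" for p
    have za: "(\<lambda>k. z (a'*dB + k)) k = (if a' = a then v m k else 0)" if "k < dB" for a' k
      using that by (auto simp: z_def)
    have ipz: "ip dB y (\<lambda>k. z (a'*dB + k)) = (if a' = a then ip dB y (v m) else 0)" for y a'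
      unfolding ip_def using za by (auto intro!: sum.cong)
    have "(\<Sum>m<N. (cmod (\<Sum>p<d*dB. cnj (B p m) * z p))\<^sup>2) \<le> \<kappa> * (\<Sum>a'<d. \<Sum>m'<dB. s m' * (cmod (ip dB (v m') (\<lambda>k. z (a'*dB + k))))\<^sup>2)"
      by (rule form)
    also have "(\<Sum>a'<d. \<Sum>m'<dB. s m' * (cmod (ip dB (v m') (\<lambda>k. z (a'*dB + k))))\<^sup>2) = 0"
      unfolding ipz using on am by (intro sum.neutral ballI) (auto simp: orthonormal_def)
    finally have "(\<Sum>m<N. (cmod (\<Sum>p<d*dB. cnj (B p m) * z p))\<^sup>2) * (\<Sum>m<N. (cmod (B q m))\<^sup>2) \<le> 0"
      by (intro mult_nonpos_nonneg) (auto intro: sum_nonneg)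
    then have "(cmod (\<Sum>p<d*dB. cnj (z p) * t p q))\<^sup>2 \<le> 0" using cs[of z] by linarith
    then have "(\<Sum>p<d*dB. cnj (z p) * t p q) = 0" by simp
    moreover have "(\<Sum>p<d*dB. cnj (z p) * t p q) = (\<Sum>a'<d. if a' = a then R a' m q else 0)"
      unfolding pair R_def ip_def using za by (intro sum.cong refl) auto
    ultimately show ?thesis using am by simp
  qed
  \<comment> \<open>\<open>K\<close> inverted on column \<open>q\<close> of \<open>t\<close>, with
    value 0 on the kernel. Pairing \<open>z\<close> with the column gives \<open>Q\<close>, and its
    form under \<open>K\<close> is again \<open>Q\<close>, so Cauchy-Schwarz bounds
    \<open>Q\<^sup>2\<close> by \<open>\<kappa> * Q\<close> times a diagonal entry of
    \<open>t\<close>.\<close>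
  define z where "z p = (\<Sum>m<dB. (R (p div dB) m q / of_real (s m)) * v m (p mod dB))" for p
  have za: "z (a*dB + k) = (\<Sum>m<dB. (R a m q / of_real (s m)) * v m k)" if "k < dB" for a k
    using that by (simp add: z_def)
  define Q where "Q = (\<Sum>a<d. \<Sum>m<dB. (cmod (R a m q))\<^sup>2 / s m)"
  have Q0: "Q \<ge> 0" unfolding Q_def by (intro sum_nonneg divide_nonneg_nonneg) (auto simp: s)
  have ipz: "ip dB (v m) (\<lambda>k. z (a*dB + k)) = R a m q / of_real (s m)" if m: "m < dB" for a m
  proof -
    have "ip dB (v m) (\<lambda>k. z (a*dB + k)) = ip dB (v m) (\<lambda>k. \<Sum>m'<dB. (R a m' q / of_real (s m')) * v m' k)"
      by (intro ip_cong refl) (simp add: za)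
    also have "\<dots> = (\<Sum>m'<dB. if m' = m then R a m' q / of_real (s m') else 0)"
      unfolding ip_sum_right ip_scale_right using on m by (intro sum.cong) (auto simp: orthonormal_def)
    finally show ?thesis using m by simp
  qed
  have "(\<Sum>p<d*dB. cnj (z p) * t p q) = of_real Q"
  proof -
    have "ip dB (\<lambda>k. z (a*dB + k)) (\<lambda>k. t (a*dB + k) q) = (\<Sum>m<dB. of_real ((cmod (R a m q))\<^sup>2 / s m))" for a
    proof -
      have "ip dB (\<lambda>k. z (a*dB + k)) (\<lambda>k. t (a*dB + k) q) = ip dB (\<lambda>k. \<Sum>m<dB. (R a m q / of_real (s m)) * v m k) (\<lambda>k. t (a*dB + k) q)"
        by (intro ip_cong refl) (simp add: za)
      also have "\<dots> = (\<Sum>m<dB. cnj (R a m q / of_real (s m)) * R a m q)"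
        by (simp only: ip_sum_left ip_scale_left R_def)
      also have "\<dots> = (\<Sum>m<dB. of_real ((cmod (R a m q))\<^sup>2 / s m))"
        by (intro sum.cong refl) (simp add: complex_norm_square mult.commute del: of_real_power)
      finally show ?thesis .
    qed
    then show ?thesis unfolding pair Q_def by simp
  qed
  then have "Q\<^sup>2 \<le> (\<Sum>m<N. (cmod (\<Sum>p<d*dB. cnj (B p m) * z p))\<^sup>2) * (\<Sum>m<N. (cmod (B q m))\<^sup>2)"
    using cs[of z] by (simp only: norm_of_real power2_abs)
  also have "\<dots> \<le> \<kappa> * Q * (\<Sum>m<N. (cmod (B q m))\<^sup>2)"
  proof (rule mult_right_mono)
    have "(\<Sum>m<N. (cmod (\<Sum>p<d*dB. cnj (B p m) * z p))\<^sup>2) \<le> \<kappa> * (\<Sum>a<d. \<Sum>m<dB. s m * (cmod (ip dB (v m) (\<lambda>k. z (a*dB + k))))\<^sup>2)"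
      by (rule form)
    also have "(\<Sum>a<d. \<Sum>m<dB. s m * (cmod (ip dB (v m) (\<lambda>k. z (a*dB + k))))\<^sup>2) = Q"
      unfolding Q_def by (intro sum.cong refl) (simp add: ipz norm_divide power_divide power2_eq_square)
    finally show "(\<Sum>m<N. (cmod (\<Sum>p<d*dB. cnj (B p m) * z p))\<^sup>2) \<le> \<kappa> * Q" .
  qed (auto intro: sum_nonneg)
  finally have le: "Q * Q \<le> \<kappa> * (\<Sum>m<N. (cmod (B q m))\<^sup>2) * Q" by (simp add: power2_eq_square ac_simps)
  show "(\<Sum>a<d. \<Sum>m<dB. (cmod (R a m q))\<^sup>2 / s m) \<le> \<kappa> * (\<Sum>m<N. (cmod (B q m))\<^sup>2)"
  proof (cases "Q = 0")
    case True
    then show ?thesis using \<kappa> unfolding Q_def[symmetric] by (simp add: sum_nonneg)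
  next
    case False
    then have "Q > 0" using Q0 by simp
    then show ?thesis using le unfolding Q_def[symmetric] by simp
  qed
qed

text \<open>Cauchy-Schwarz with the root of the weight on one side only: rows are taken in its
  eigenbasis \<open>v\<close>, and the Young parameter of row \<open>m\<close> is
  \<open>c * s m\<close>. A row with \<open>s m = 0\<close> has to vanish, since its quotient is
  read as 0.\<close>

lemma tnorm_weighted_le:
  assumes X: "X \<in> carrier_mat n n" and on: "orthonormal n n v" and s: "\<And>m. m < n \<Longrightarrow> s m \<ge> 0" and c: "c > 0"
    and z: "\<And>m l. m < n \<Longrightarrow> s m = 0 \<Longrightarrow> l < n \<Longrightarrow> ip n (v m) (\<lambda>k. X $$ (k,l)) = 0"
  shows "tnorm X \<le> (c * (\<Sum>m<n. s m) + (\<Sum>m<n. \<Sum>l<n. (cmod (ip n (v m) (\<lambda>k. X $$ (k,l))))\<^sup>2 / s m) / c) / 2"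
proof -
  obtain W where W: "contraction n W" "(\<Sum>i<n. \<Sum>j<n. X $$ (i,j) * W j i) = of_real (tnorm X)"
    using tnorm_attained[OF X] by blast
  let ?Y = "\<lambda>m l. ip n (v m) (\<lambda>k. X $$ (k,l))"
  have e: "X $$ (k,l) = (\<Sum>m<n. v m k * ?Y m l)" if "k < n" for k l
  proof -
    have "(\<Sum>m<n. v m k * ?Y m l) = (\<Sum>m<n. \<Sum>j<n. X $$ (j,l) * (v m k * cnj (v m j)))"
      by (simp add: ip_def sum_distrib_left ac_simps)
    also have "\<dots> = (\<Sum>j<n. X $$ (j,l) * (\<Sum>m<n. v m k * cnj (v m j)))"
      by (subst sum.swap) (simp add: sum_distrib_left)
    also have "\<dots> = (\<Sum>j<n. if j = k then X $$ (j,l) else 0)"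
      using orthonormal_complete[OF on that] by (intro sum.cong) auto
    finally show ?thesis using that by simp
  qed
  have "(\<Sum>i<n. \<Sum>j<n. X $$ (i,j) * W j i) = (\<Sum>i<n. \<Sum>j<n. (\<Sum>m<n. v m i * cnj (cnj (?Y m j))) * W j i)"
    by (intro sum.cong refl) (simp add: e)
  also have "\<dots> = (\<Sum>m<n. ip n (\<lambda>i. cnj (?Y m i)) (mv n W (\<lambda>i. v m i)))"
    by (rule gram_trace)
  finally have tw: "complex_of_real (tnorm X) = (\<Sum>m<n. ip n (\<lambda>i. cnj (?Y m i)) (mv n W (\<lambda>i. v m i)))" unfolding W(2) .
  have "tnorm X \<le> cmod (of_real (tnorm X))" by simp
  also have "\<dots> = cmod (\<Sum>m<n. ip n (\<lambda>i. cnj (?Y m i)) (mv n W (\<lambda>i. v m i)))" by (simp only: tw)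
  also have "\<dots> \<le> (\<Sum>m<n. cmod (ip n (\<lambda>i. cnj (?Y m i)) (mv n W (\<lambda>i. v m i))))" by (rule norm_sum)
  also have "\<dots> \<le> (\<Sum>m<n. (c * s m + (\<Sum>l<n. (cmod (?Y m l))\<^sup>2 / s m) / c) / 2)"
  proof (rule sum_mono)
    fix m assume "m \<in> {..<n}" then have m: "m < n" by simp
    have nY: "nsq n (\<lambda>i. cnj (?Y m i)) = (\<Sum>l<n. (cmod (?Y m l))\<^sup>2)" by (simp only: nsq_def complex_mod_cnj)
    show "cmod (ip n (\<lambda>i. cnj (?Y m i)) (mv n W (\<lambda>i. v m i))) \<le> (c * s m + (\<Sum>l<n. (cmod (?Y m l))\<^sup>2 / s m) / c) / 2"
    proof (cases "s m = 0")
      case True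
      have "ip n (\<lambda>i. cnj (?Y m i)) (mv n W (\<lambda>i. v m i)) = 0"
        unfolding ip_def[of n "\<lambda>i. cnj (?Y m i)"] using z[OF m True] by (intro sum.neutral ballI) auto
      then show ?thesis using True by simp
    next
      case False
      then have sm: "c * s m > 0" using s[OF m] c by simp
      have "nsq n (mv n W (v m)) \<le> nsq n (v m)" using W(1) by (simp add: contraction_def)
      also have "\<dots> = 1" using on m by (simp add: orthonormal_def nsq_eq_Re_ip)
      finally have n1: "nsq n (mv n W (v m)) \<le> 1" .
      have "cmod (ip n (\<lambda>i. cnj (?Y m i)) (mv n W (\<lambda>i. v m i)))
        \<le> (c * s m * nsq n (mv n W (v m)) + nsq n (\<lambda>i. cnj (?Y m i)) / (c * s m)) / 2"
        using cmod_ip_le_am_gm[OF sm, of n "\<lambda>i. cnj (?Y m i)" "mv n W (v m)"] .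
      also have "\<dots> \<le> (c * s m * 1 + nsq n (\<lambda>i. cnj (?Y m i)) / (c * s m)) / 2"
        using sm n1 by (intro divide_right_mono add_right_mono mult_left_mono) auto
      also have "nsq n (\<lambda>i. cnj (?Y m i)) / (c * s m) = (\<Sum>l<n. (cmod (?Y m l))\<^sup>2 / s m) / c"
        unfolding nY by (simp add: sum_divide_distrib mult.commute)
      finally show ?thesis by simp
    qed
  qed
  also have "\<dots> = (c * (\<Sum>m<n. s m) + (\<Sum>m<n. \<Sum>l<n. (cmod (?Y m l))\<^sup>2 / s m) / c) / 2"
    by (simp add: sum_divide_distrib sum.distrib sum_distrib_left add_divide_distrib)
  finally show ?thesis .
qed

context haar begin

text \<open>In the eigenbasis of \<sigma> the deviation has entries that are centred quadratic forms
  in \<open>x\<close> with coefficients from \<open>R\<close>. The factor \<open>d\<close> of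
  \<open>chan\<close> cancels the \<open>1 / d\<^sup>2\<close> of their variances, and by
  \<open>column_bound\<close> the weighted coefficients sum to at most \<kappa> times the trace of
  \<open>t\<close>.\<close>

theorem decoupling:
  assumes d: "d > 0" and \<sigma>: "Defs.density dB \<sigma>" and \<kappa>: "\<kappa> > 0"
    and t: "\<And>p q. p < d*dB \<Longrightarrow> q < d*dB \<Longrightarrow> t p q = (\<Sum>m<N. B p m * cnj (B q m))"
    and form: "\<And>x. (\<Sum>m<N. (cmod (\<Sum>p<d*dB. cnj (B p m) * x p))\<^sup>2)
        \<le> \<kappa> * Re (ip (d*dB) x (mv (d*dB) (\<lambda>i j. kron (1\<^sub>m d) \<sigma> $$ (i,j)) x))"
    and B1: "fro (d*dB) N B \<le> 1"
  shows "(\<integral>x. tnorm (chan d dB t x - chan_mix d dB t) \<partial>\<mu>) \<le> sqrt \<kappa>"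
proof -
  have "psd dB \<sigma>" "tr \<sigma> = 1" using \<sigma> by (auto simp: density_def)
  obtain s v where sv: "\<And>k. k < dB \<Longrightarrow> s k \<ge> 0" "orthonormal dB dB v" "\<sigma> = specmat dB s v"
    using psd_eq_specmat[OF \<open>psd dB \<sigma>\<close>] by blast
  have s1: "(\<Sum>m<dB. s m) = 1"
  proof -
    have "complex_of_real (\<Sum>m<dB. s m) = 1" using \<open>tr \<sigma> = 1\<close> unfolding sv(3) tr_specmat[OF sv(2)] .
    then show ?thesis by (simp only: of_real_eq_1_iff)
  qed
  have form': "(\<Sum>m<N. (cmod (\<Sum>p<d*dB. cnj (B p m) * x p))\<^sup>2) \<le> \<kappa> * (\<Sum>a<d. \<Sum>m<dB. s m * (cmod (ip dB (v m) (\<lambda>k. x (a*dB + k))))\<^sup>2)" for x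
    using form[of x] unfolding kron_id_form[OF sv(3)] by simp
  define R where "R a m q = ip dB (v m) (\<lambda>k. t (a*dB + k) q)" for a m q
  have col: "(\<Sum>a<d. \<Sum>m<dB. (cmod (R a m q))\<^sup>2 / s m) \<le> \<kappa> * (\<Sum>m<N. (cmod (B q m))\<^sup>2)" if "q < d*dB" for q
    using column_bound(1)[OF sv(1,2) \<kappa> t form' that] unfolding R_def .
  have R0: "R a m q = 0" if "q < d*dB" "a < d" "m < dB" "s m = 0" for a m q
    using column_bound(2)[OF sv(1,2) \<kappa> t form' that] unfolding R_def .
  define X where "X x = chan d dB t x - chan_mix d dB t" for x
  have Xc: "X x \<in> carrier_mat dB dB" for x unfolding X_def by (rule minus_carrier_mat) simp
  let ?Y = "\<lambda>x m l. ip dB (v m) (\<lambda>k. X x $$ (k,l))"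
  let ?C = "\<lambda>m l a b. R a m (b*dB + l)"
  let ?V = "\<lambda>m l x. (\<Sum>a<d. \<Sum>b<d. x a * cnj (x b) * ?C m l a b) - (\<Sum>a<d. ?C m l a a) / of_nat d"
  have Y: "?Y x m l = of_nat d * ?V m l x" if l: "l < dB" for x m l
  proof -
    have "?Y x m l = ip dB (v m) (\<lambda>k. of_nat d * (\<Sum>a<d. \<Sum>b<d. x a * cnj (x b) * t (a*dB + k) (b*dB + l)) - (\<Sum>a<d. t (a*dB + k) (a*dB + l)))"
      by (intro ip_cong refl) (use l in \<open>simp add: X_def chan_entry chan_mix_entry carrier_matD[OF chan_carrier(2)]\<close>)
    also have "\<dots> = of_nat d * (\<Sum>a<d. \<Sum>b<d. x a * cnj (x b) * ?C m l a b) - (\<Sum>a<d. ?C m l a a)"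
      unfolding ip_diff_right ip_scale_right ip_sum_right R_def ..
    finally show ?thesis using d by (simp add: algebra_simps)
  qed
  \<comment> \<open>The Young parameter that balances \<open>k\<close> against
    \<open>\<kappa> / k\<close>.\<close>
  define k where "k = sqrt \<kappa>"
  have k: "k > 0" "k * k = \<kappa>" using \<kappa> by (auto simp: k_def)
  let ?Z = "\<lambda>x. \<Sum>m<dB. \<Sum>l<dB. (real d)\<^sup>2 * (cmod (?V m l x))\<^sup>2 / s m"
  have pt: "tnorm (X x) \<le> (k + ?Z x / k) / 2" for x
  proof -
    have "tnorm (X x) \<le> (k * (\<Sum>m<dB. s m) + (\<Sum>m<dB. \<Sum>l<dB. (cmod (?Y x m l))\<^sup>2 / s m) / k) / 2"
    proof (rule tnorm_weighted_le[OF Xc sv(2,1) k(1)])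
      fix m l assume ml: "m < dB" "s m = 0" "l < dB"
      have "?C m l a b = 0" if "a < d" "b < d" for a b
        by (rule R0) (use ml that in \<open>auto simp: pair_index_less\<close>)
      then show "?Y x m l = 0" unfolding Y[OF ml(3)] by simp
    qed
    also have "(\<Sum>m<dB. \<Sum>l<dB. (cmod (?Y x m l))\<^sup>2 / s m) = ?Z x"
      by (intro sum.cong refl) (simp add: Y norm_mult power_mult_distrib)
    finally show ?thesis by (simp add: s1)
  qed
  have iV: "integrable \<mu> (\<lambda>x. (real d)\<^sup>2 * (cmod (?V m l x))\<^sup>2 / s m)" for m l
    using variance_quadratic_form(1)[OF d, of "?C m l"] by simp
  have iZ: "integrable \<mu> ?Z" by (intro Bochner_Integration.integrable_sum iV)
  have EZ: "(\<integral>x. ?Z x \<partial>\<mu>) \<le> \<kappa>"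
  proof -
    have "(\<integral>x. ?Z x \<partial>\<mu>) = (\<Sum>m<dB. \<integral>x. (\<Sum>l<dB. (real d)\<^sup>2 * (cmod (?V m l x))\<^sup>2 / s m) \<partial>\<mu>)"
      by (rule Bochner_Integration.integral_sum) (intro Bochner_Integration.integrable_sum iV)
    also have "\<dots> = (\<Sum>m<dB. \<Sum>l<dB. \<integral>x. (real d)\<^sup>2 * (cmod (?V m l x))\<^sup>2 / s m \<partial>\<mu>)"
      by (rule sum.cong[OF refl], rule Bochner_Integration.integral_sum) (rule iV)
    also have "\<dots> \<le> (\<Sum>m<dB. \<Sum>l<dB. \<Sum>a<d. \<Sum>b<d. (cmod (?C m l a b))\<^sup>2 / s m)"
    proof (intro sum_mono)
      fix m l assume "m \<in> {..<dB}"
      then have sm: "s m \<ge> 0" using sv(1) by simp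
      have "(\<integral>x. (real d)\<^sup>2 * (cmod (?V m l x))\<^sup>2 / s m \<partial>\<mu>) = (real d)\<^sup>2 * (\<integral>x. (cmod (?V m l x))\<^sup>2 \<partial>\<mu>) / s m" by simp
      also have "\<dots> \<le> (real d)\<^sup>2 * (fro d d (?C m l) / (real d)\<^sup>2) / s m"
        using variance_quadratic_form(2)[OF d, of "?C m l"] sm by (intro divide_right_mono mult_left_mono) auto
      also have "\<dots> = fro d d (?C m l) / s m" using d by simp
      finally show "(\<integral>x. (real d)\<^sup>2 * (cmod (?V m l x))\<^sup>2 / s m \<partial>\<mu>) \<le> (\<Sum>a<d. \<Sum>b<d. (cmod (?C m l a b))\<^sup>2 / s m)"
        by (simp add: fro_def sum_divide_distrib)
    qed
    \<comment> \<open>Reordering groups the coefficients by the column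
      \<open>q = b * dB + l\<close>, the form in which \<open>col\<close> bounds them.\<close>
    also have "\<dots> = (\<Sum>b<d. \<Sum>l<dB. \<Sum>a<d. \<Sum>m<dB. (cmod (R a m (b*dB + l)))\<^sup>2 / s m)"
    proof -
      let ?f = "\<lambda>m l a b. (cmod (R a m (b*dB + l)))\<^sup>2 / s m"
      have "(\<Sum>m<dB. \<Sum>l<dB. \<Sum>a<d. \<Sum>b<d. ?f m l a b) = (\<Sum>m<dB. \<Sum>l<dB. \<Sum>b<d. \<Sum>a<d. ?f m l a b)"
        by (rule sum.cong[OF refl], rule sum.cong[OF refl], rule sum.swap)
      also have "\<dots> = (\<Sum>m<dB. \<Sum>b<d. \<Sum>l<dB. \<Sum>a<d. ?f m l a b)" by (rule sum.cong[OF refl], rule sum.swap)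
      also have "\<dots> = (\<Sum>b<d. \<Sum>m<dB. \<Sum>l<dB. \<Sum>a<d. ?f m l a b)" by (rule sum.swap)
      also have "\<dots> = (\<Sum>b<d. \<Sum>l<dB. \<Sum>m<dB. \<Sum>a<d. ?f m l a b)" by (rule sum.cong[OF refl], rule sum.swap)
      also have "\<dots> = (\<Sum>b<d. \<Sum>l<dB. \<Sum>a<d. \<Sum>m<dB. ?f m l a b)"
        by (rule sum.cong[OF refl], rule sum.cong[OF refl], rule sum.swap)
      finally show ?thesis .
    qed
    also have "\<dots> \<le> (\<Sum>b<d. \<Sum>l<dB. \<kappa> * (\<Sum>m<N. (cmod (B (b*dB + l) m))\<^sup>2))"
      by (intro sum_mono col) (auto simp: pair_index_less)
    also have "\<dots> = \<kappa> * fro (d*dB) N B" by (simp add: fro_def sum_product_index sum_distrib_left)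
    also have "\<dots> \<le> \<kappa>" using B1 \<kappa> by (simp add: mult_left_le)
    finally show ?thesis .
  qed
  have iX: "integrable \<mu> (\<lambda>x. tnorm (X x))" unfolding X_def by (rule integrable_tnorm_chan) simp
  have "(\<integral>x. tnorm (X x) \<partial>\<mu>) \<le> (\<integral>x. (k + ?Z x / k) / 2 \<partial>\<mu>)"
    by (rule integral_mono[OF iX _ pt]) (use iZ in simp)
  also have "\<dots> = (k + (\<integral>x. ?Z x \<partial>\<mu>) / k) / 2"
    by (subst integral_divide_zero, subst Bochner_Integration.integral_add) (use iZ in auto)
  also have "\<dots> \<le> (k + \<kappa> / k) / 2" using EZ k by (intro divide_right_mono add_left_mono) auto
  also have "\<dots> = sqrt \<kappa>" using k by (simp add: k_def[symmetric] flip: k(2))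
  finally show ?thesis unfolding X_def .
qed

end

section \<open>From purified distance to Frobenius distance\<close>

lemma fro_add_diff:
  shows "fro n N (\<lambda>i m. A i m - B i m) = fro n N A + fro n N B - 2 * Re (\<Sum>i<n. \<Sum>m<N. cnj (A i m) * B i m)"
    "fro n N (\<lambda>i m. A i m + B i m) = fro n N A + fro n N B + 2 * Re (\<Sum>i<n. \<Sum>m<N. cnj (A i m) * B i m)"
proof -
  have "(cmod (a - b))\<^sup>2 = (cmod a)\<^sup>2 + (cmod b)\<^sup>2 - 2 * Re (cnj a * b)"
    "(cmod (a + b))\<^sup>2 = (cmod a)\<^sup>2 + (cmod b)\<^sup>2 + 2 * Re (cnj a * b)" for a b
    unfolding cmod_power2 by (simp_all add: power2_eq_square algebra_simps)
  then show "fro n N (\<lambda>i m. A i m - B i m) = fro n N A + fro n N B - 2 * Re (\<Sum>i<n. \<Sum>m<N. cnj (A i m) * B i m)"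
    "fro n N (\<lambda>i m. A i m + B i m) = fro n N A + fro n N B + 2 * Re (\<Sum>i<n. \<Sum>m<N. cnj (A i m) * B i m)"
    by (simp_all only: fro_def sum.distrib sum_subtractf sum_distrib_left Re_sum)
qed

text \<open>Uhlmann-type representation: \<open>B = \<surd>\<sigma> W\<close> is close to \<open>\<surd>\<rho>\<close>, and \<open>BB* \<le> \<sigma>\<close> since \<open>W\<close> is a contraction.\<close>
lemma uhlmann:
  assumes \<rho>: "psd n \<rho>" and \<sigma>: "psd n \<sigma>"
  obtains W where "contraction n W"
    "fro n n (\<lambda>i m. msqrt n \<rho> $$ (i,m) - (\<Sum>k<n. msqrt n \<sigma> $$ (i,k) * W k m)) \<le> Re (tr \<rho>) + Re (tr \<sigma>) - 2 * fid \<rho> \<sigma>"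
    "fro n n (\<lambda>i m. msqrt n \<rho> $$ (i,m) + (\<Sum>k<n. msqrt n \<sigma> $$ (i,k) * W k m)) \<le> Re (tr \<rho>) + Re (tr \<sigma>) + 2 * fid \<rho> \<sigma>"
    "fro n n (\<lambda>i m. \<Sum>k<n. msqrt n \<sigma> $$ (i,k) * W k m) \<le> Re (tr \<sigma>)"
    "\<And>x. (\<Sum>m<n. (cmod (\<Sum>p<n. cnj (\<Sum>k<n. msqrt n \<sigma> $$ (p,k) * W k m) * x p))\<^sup>2) \<le> Re (ip n x (mv n (\<lambda>i j. \<sigma> $$ (i,j)) x))"
proof -
  obtain W where W: "contraction n W"
    "(\<Sum>i<n. \<Sum>m<n. cnj (msqrt n \<rho> $$ (i,m)) * (\<Sum>k<n. msqrt n \<sigma> $$ (i,k) * W k m)) = of_real (fid \<rho> \<sigma>)"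
    using fid_attained[OF \<rho> \<sigma>] by blast
  let ?A = "\<lambda>i m. msqrt n \<rho> $$ (i,m)" and ?S = "\<lambda>i m. msqrt n \<sigma> $$ (i,m)"
  let ?B = "\<lambda>i m. \<Sum>k<n. ?S i k * W k m"
  have B: "fro n n ?B \<le> Re (tr \<sigma>)" using fro_contraction_right[OF W(1), of n ?S] fro_msqrt[OF \<sigma>] by simp
  have d: "(\<Sum>m<n. (cmod (\<Sum>p<n. cnj (?B p m) * x p))\<^sup>2) \<le> Re (ip n x (mv n (\<lambda>i j. \<sigma> $$ (i,j)) x))" for x
  proof -
    let ?y = "\<lambda>k. \<Sum>p<n. cnj (?S p k) * x p"
    have "(\<Sum>p<n. cnj (?B p m) * x p) = mv n (\<lambda>i j. cnj (W j i)) ?y m" for m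
    proof -
      have "(\<Sum>p<n. cnj (?B p m) * x p) = (\<Sum>p<n. \<Sum>k<n. cnj (W k m) * (cnj (?S p k) * x p))"
        by (simp add: cnj_sum sum_distrib_right sum_distrib_left ac_simps)
      also have "\<dots> = (\<Sum>k<n. \<Sum>p<n. cnj (W k m) * (cnj (?S p k) * x p))" by (rule sum.swap)
      finally show ?thesis by (simp add: mv_def sum_distrib_left)
    qed
    then have "(\<Sum>m<n. (cmod (\<Sum>p<n. cnj (?B p m) * x p))\<^sup>2) = nsq n (mv n (\<lambda>i j. cnj (W j i)) ?y)" by (simp add: nsq_def)
    also have "\<dots> \<le> nsq n ?y" using contraction_adj[OF W(1)] by (simp add: contraction_def)
    also have "\<dots> = Re (ip n x (mv n (\<lambda>i j. \<sigma> $$ (i,j)) x))"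
      using gram_form[where M = "\<lambda>i j. \<sigma> $$ (i,j)" and N = n and S = ?S and n = n and x = x] msqrt_gram[OF \<sigma>] by (simp add: nsq_def)
    finally show ?thesis .
  qed
  show ?thesis
  proof (rule that[OF W(1) _ _ B d])
    show "fro n n (\<lambda>i m. ?A i m - ?B i m) \<le> Re (tr \<rho>) + Re (tr \<sigma>) - 2 * fid \<rho> \<sigma>"
      unfolding fro_add_diff(1) W(2) fro_msqrt[OF \<rho>] using B by simp
    show "fro n n (\<lambda>i m. ?A i m + ?B i m) \<le> Re (tr \<rho>) + Re (tr \<sigma>) + 2 * fid \<rho> \<sigma>"
      unfolding fro_add_diff(2) W(2) fro_msqrt[OF \<rho>] using B by simp
  qed
qed

lemma fid_nonneg:
  assumes "psd n \<rho>" "psd n \<sigma>" shows "fid \<rho> \<sigma> \<ge> 0"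
proof -
  have "msqrt n \<rho> * msqrt n \<sigma> \<in> carrier_mat n n"
    using psd_carrier[OF msqrt_psd[OF assms(1)]] psd_carrier[OF msqrt_psd[OF assms(2)]] by (rule mult_carrier_mat)
  then show ?thesis unfolding fid_def using tnorm_nonneg psd_carrier assms by (metis carrier_matD(1))
qed

lemma fid_le_1:
  assumes "psd n \<rho>" "psd n \<sigma>" "Re (tr \<rho>) \<le> 1" "Re (tr \<sigma>) \<le> 1" shows "fid \<rho> \<sigma> \<le> 1"
proof -
  obtain W where "fro n n (\<lambda>i m. msqrt n \<rho> $$ (i,m) - (\<Sum>k<n. msqrt n \<sigma> $$ (i,k) * W k m)) \<le> Re (tr \<rho>) + Re (tr \<sigma>) - 2 * fid \<rho> \<sigma>"
    using uhlmann[OF assms(1,2)] by blast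
  then have "0 \<le> Re (tr \<rho>) + Re (tr \<sigma>) - 2 * fid \<rho> \<sigma>"
    using fro_nonneg[of n n "\<lambda>i m. msqrt n \<rho> $$ (i,m) - (\<Sum>k<n. msqrt n \<sigma> $$ (i,k) * W k m)"] by linarith
  then show ?thesis using assms by linarith
qed

lemma fid_ge_of_pdist:
  assumes "psd n \<rho>" "psd n \<sigma>" "tr \<rho> = 1" "Re (tr \<sigma>) \<le> 1" "pdist \<rho> \<sigma> \<le> \<epsilon>" "\<epsilon> > 0"
  shows "1 - fid \<rho> \<sigma> \<le> \<epsilon>\<^sup>2"
proof -
  let ?F = "fid \<rho> \<sigma>"
  have F: "0 \<le> ?F" "?F \<le> 1" using fid_nonneg fid_le_1 assms by auto
  \<comment> \<open>A normalised \<rho> removes the second summand of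
    \<open>gen_fid\<close>.\<close>
  have "sqrt (1 - ?F\<^sup>2) \<le> \<epsilon>" using assms(3,5) by (simp add: pdist_def gen_fid_def)
  then have "1 - ?F\<^sup>2 \<le> \<epsilon>\<^sup>2" by (rule sqrt_le_D)
  moreover have "?F\<^sup>2 \<le> ?F" using F by (simp add: power2_eq_square mult_left_le)
  ultimately show ?thesis by linarith
qed

lemma loewner_geD:
  assumes "loewner_ge n X Y"
  shows "Re (ip n x (mv n (\<lambda>i j. Y $$ (i,j)) x)) \<le> Re (ip n x (mv n (\<lambda>i j. X $$ (i,j)) x))"
proof -
  have c: "X \<in> carrier_mat n n" "Y \<in> carrier_mat n n" and p: "psd n (X - Y)" using assms by (auto simp: loewner_ge_def)
  have "ip n x (mv n (\<lambda>i j. (X - Y) $$ (i,j)) x) = ip n x (\<lambda>i. mv n (\<lambda>i j. X $$ (i,j)) x i - mv n (\<lambda>i j. Y $$ (i,j)) x i)"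
    by (intro ip_cong refl) (use c in \<open>simp add: mv_def algebra_simps sum_subtractf\<close>)
  also have "\<dots> = ip n x (mv n (\<lambda>i j. X $$ (i,j)) x) - ip n x (mv n (\<lambda>i j. Y $$ (i,j)) x)" by (rule ip_diff_right)
  finally show ?thesis using psd_form(2)[OF p, of x] by simp
qed

lemma ip_mv_smult:
  assumes "M \<in> carrier_mat n n"
  shows "ip n x (mv n (\<lambda>i j. (c \<cdot>\<^sub>m M) $$ (i,j)) x) = c * ip n x (mv n (\<lambda>i j. M $$ (i,j)) x)"
proof -
  have "ip n x (mv n (\<lambda>i j. (c \<cdot>\<^sub>m M) $$ (i,j)) x) = ip n x (\<lambda>i. c * mv n (\<lambda>i j. M $$ (i,j)) x i)"
    by (intro ip_cong refl) (use assms in \<open>simp add: mv_def sum_distrib_left mult.assoc\<close>)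
  then show ?thesis by (simp only: ip_scale_right)
qed

locale haar_channel = channel dA dB T + haar dA \<mu> for dA dB T \<mu>
begin

abbreviation dev :: "(nat \<Rightarrow> complex) \<Rightarrow> real" where
  "dev x \<equiv> tnorm (T (proj dA x) - T (max_mixed dA))"

lemma dev_chan: "dev x = tnorm (chan dA dB tau x - chan_mix dA dB tau)"
  by (simp add: T_proj T_mixed)

lemma integrable_dev: "integrable \<mu> dev"
  unfolding dev_chan by (rule integrable_tnorm_chan) simp

theorem decoupling_bound:
  assumes \<epsilon>: "\<epsilon> > 0" and \<rho>: "subnormalized (dA*dB) \<rho>" and pd: "pdist (choi dA dB T) \<rho> \<le> \<epsilon>"
    and \<sigma>: "Defs.density dB \<sigma>"
    and ge: "loewner_ge (dA*dB) (complex_of_real (2 powr (-l)) \<cdot>\<^sub>m kron (1\<^sub>m dA) \<sigma>) \<rho>"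
  shows "(\<integral>x. dev x \<partial>\<mu>) \<le> 2 powr (- l / 2) + 6 * \<epsilon>"
proof -
  let ?n = "dA*dB"
  have p: "psd ?n \<rho>" "Re (tr \<rho>) \<le> 1" using \<rho> by (auto simp: subnormalized_def)
  have tr1: "Re (tr (choi dA dB T)) = 1" using tr_choi by simp
  let ?F = "fid (choi dA dB T) \<rho>"
  have F: "1 - ?F \<le> \<epsilon>\<^sup>2" by (rule fid_ge_of_pdist[OF psd_choi p(1) tr_choi p(2) pd \<epsilon>])
  have F1: "?F \<le> 1" by (rule fid_le_1[OF psd_choi p(1)]) (use tr1 p in auto)
  obtain W where W: "contraction ?n W"
    "fro ?n ?n (\<lambda>i m. msqrt ?n (choi dA dB T) $$ (i,m) - (\<Sum>k<?n. msqrt ?n \<rho> $$ (i,k) * W k m)) \<le> Re (tr (choi dA dB T)) + Re (tr \<rho>) - 2 * ?F"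
    "fro ?n ?n (\<lambda>i m. msqrt ?n (choi dA dB T) $$ (i,m) + (\<Sum>k<?n. msqrt ?n \<rho> $$ (i,k) * W k m)) \<le> Re (tr (choi dA dB T)) + Re (tr \<rho>) + 2 * ?F"
    "fro ?n ?n (\<lambda>i m. \<Sum>k<?n. msqrt ?n \<rho> $$ (i,k) * W k m) \<le> Re (tr \<rho>)"
    "\<And>x. (\<Sum>m<?n. (cmod (\<Sum>p<?n. cnj (\<Sum>k<?n. msqrt ?n \<rho> $$ (p,k) * W k m) * x p))\<^sup>2) \<le> Re (ip ?n x (mv ?n (\<lambda>i j. \<rho> $$ (i,j)) x))"
    using uhlmann[OF psd_choi p(1)] by blast
  define B where "B i m = (\<Sum>k<?n. msqrt ?n \<rho> $$ (i,k) * W k m)" for i m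
  define t where "t p q = (\<Sum>m<?n. B p m * cnj (B q m))" for p q
  \<comment> \<open>Both traces are at most 1, so the defect is at most
    \<open>2 - 2 * ?F\<close>.\<close>
  have D: "fro ?n ?n (\<lambda>i m. amp i m - B i m) \<le> 2 * \<epsilon>\<^sup>2"
    using W(2) F p(2) tr1 unfolding amp_def B_def by linarith
  have S: "fro ?n ?n (\<lambda>i m. amp i m + B i m) \<le> 4"
    using W(3) F1 p(2) tr1 unfolding amp_def B_def by linarith
  have main: "(\<integral>x. tnorm (chan dA dB t x - chan_mix dA dB t) \<partial>\<mu>) \<le> sqrt (2 powr (-l))"
  proof (rule decoupling[OF dA \<sigma>, where B = B and N = ?n])
    have \<sigma>c: "\<sigma> \<in> carrier_mat dB dB" using \<sigma> psd_carrier by (auto simp: density_def)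
    fix x
    have "(\<Sum>m<?n. (cmod (\<Sum>p<?n. cnj (B p m) * x p))\<^sup>2) \<le> Re (ip ?n x (mv ?n (\<lambda>i j. \<rho> $$ (i,j)) x))"
      using W(5) unfolding B_def .
    also have "\<dots> \<le> Re (ip ?n x (mv ?n (\<lambda>i j. (complex_of_real (2 powr (-l)) \<cdot>\<^sub>m kron (1\<^sub>m dA) \<sigma>) $$ (i,j)) x))"
      by (rule loewner_geD[OF ge])
    also have "\<dots> = 2 powr (-l) * Re (ip ?n x (mv ?n (\<lambda>i j. kron (1\<^sub>m dA) \<sigma> $$ (i,j)) x))"
      unfolding ip_mv_smult[OF kron_carrier[OF \<sigma>c]] by simp
    finally show "(\<Sum>m<?n. (cmod (\<Sum>p<?n. cnj (B p m) * x p))\<^sup>2) \<le> 2 powr (-l) * Re (ip ?n x (mv ?n (\<lambda>i j. kron (1\<^sub>m dA) \<sigma> $$ (i,j)) x))" .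
  next
    show "fro ?n ?n B \<le> 1" using W(4) p(2) unfolding B_def by linarith
  qed (auto simp: t_def)
  \<comment> \<open>The parameter \<open>1 / \<epsilon>\<close> weighs the squared distance
    \<open>2 * \<epsilon>\<^sup>2\<close> against the 4 bounding the sum, giving half of
    \<open>2 * \<epsilon> + 4 * \<epsilon>\<close>.\<close>
  have err: "(\<integral>x. tnorm (chan dA dB tau x - chan dA dB t x) \<partial>\<mu>) \<le> 3 * \<epsilon>"
  proof -
    have "(\<integral>x. tnorm (chan dA dB tau x - chan dA dB t x) \<partial>\<mu>)
      \<le> (1/\<epsilon> * fro ?n ?n (\<lambda>p m. amp p m - B p m) + fro ?n ?n (\<lambda>p m. amp p m + B p m) / (1/\<epsilon>)) / 2"
      by (rule expectation_chan_gram_diff[OF dA]) (use \<epsilon> tau_gram in \<open>auto simp: t_def\<close>)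
    also have "\<dots> \<le> (1/\<epsilon> * (2 * \<epsilon>\<^sup>2) + 4 / (1/\<epsilon>)) / 2"
      using D S \<epsilon> by (intro divide_right_mono add_mono mult_left_mono) auto
    also have "\<dots> = 3 * \<epsilon>" using \<epsilon> by (simp add: power2_eq_square)
    finally show ?thesis .
  qed
  have z: "X - 0\<^sub>m dB dB = X" if "X \<in> carrier_mat dB dB" for X :: "complex mat" using that by (auto intro!: eq_matI)
  \<comment> \<open>By convexity the mean outputs differ by no more than the outputs do on average;
    this second error raises the constant to 6.\<close>
  have err_mix: "tnorm (chan_mix dA dB t - chan_mix dA dB tau) \<le> 3 * \<epsilon>"
  proof -
    have "tnorm (chan_mix dA dB t - chan_mix dA dB tau) = tnorm (chan_mix dA dB tau - chan_mix dA dB t)"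
      by (rule tnorm_diff_commute[where n = dB]) simp_all
    also have "\<dots> = tnorm (chan_mix dA dB (\<lambda>p q. tau p q - t p q) - 0\<^sub>m dB dB)" by (simp add: chan_mix_diff z)
    also have "\<dots> \<le> (\<integral>x. tnorm (chan dA dB (\<lambda>p q. tau p q - t p q) x - 0\<^sub>m dB dB) \<partial>\<mu>)"
      by (rule tnorm_expectation_le[OF dA]) simp
    also have "\<dots> = (\<integral>x. tnorm (chan dA dB tau x - chan dA dB t x) \<partial>\<mu>)" by (simp add: chan_diff z)
    finally show ?thesis using err by linarith
  qed
  have pt: "dev x \<le> tnorm (chan dA dB tau x - chan dA dB t x) + tnorm (chan dA dB t x - chan_mix dA dB t) + 3 * \<epsilon>" for x
    using tnorm_diff_triangle[of "chan dA dB tau x" dB "chan dA dB t x" "chan_mix dA dB tau"]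
      tnorm_diff_triangle[of "chan dA dB t x" dB "chan_mix dA dB t" "chan_mix dA dB tau"] err_mix
    unfolding dev_chan by simp
  have i1: "integrable \<mu> (\<lambda>x. tnorm (chan dA dB tau x - chan dA dB t x))"
    using integrable_tnorm_chan[of "0\<^sub>m dB dB" dB "\<lambda>p q. tau p q - t p q"] by (simp add: chan_diff z)
  have i2: "integrable \<mu> (\<lambda>x. tnorm (chan dA dB t x - chan_mix dA dB t))"
    by (rule integrable_tnorm_chan) simp
  have "(\<integral>x. dev x \<partial>\<mu>) \<le> (\<integral>x. tnorm (chan dA dB tau x - chan dA dB t x) + tnorm (chan dA dB t x - chan_mix dA dB t) + 3 * \<epsilon> \<partial>\<mu>)"
    by (rule integral_mono[OF integrable_dev _ pt]) (use i1 i2 in simp)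
  also have "\<dots> = (\<integral>x. tnorm (chan dA dB tau x - chan dA dB t x) \<partial>\<mu>) + (\<integral>x. tnorm (chan dA dB t x - chan_mix dA dB t) \<partial>\<mu>) + 3 * \<epsilon>"
    using i1 i2 by simp
  also have "\<dots> \<le> 3 * \<epsilon> + sqrt (2 powr (-l)) + 3 * \<epsilon>" using err main by linarith
  also have "sqrt (2 powr (-l)) = 2 powr (- l / 2)" by (simp add: powr_half_sqrt[symmetric] powr_powr)
  finally show ?thesis by simp
qed

theorem expectation_bound:
  assumes \<epsilon>: "\<epsilon> > 0"
  shows "ereal (\<integral>x. dev x \<partial>\<mu>) \<le> pow2_neg_half (Hmin_s \<epsilon> dA dB (choi dA dB T)) + ereal (6 * \<epsilon>)"
proof -
  let ?m = "\<integral>x. dev x \<partial>\<mu>" and ?H = "Hmin_s \<epsilon> dA dB (choi dA dB T)"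
  have pos: "pow2_neg_half h \<ge> 0" for h by (simp add: pow2_neg_half_def)
  show ?thesis
  proof (cases "?m \<le> 6 * \<epsilon>")
    case True
    have "ereal ?m \<le> 0 + ereal (6 * \<epsilon>)" using True by simp
    also have "\<dots> \<le> pow2_neg_half ?H + ereal (6 * \<epsilon>)" by (intro add_right_mono pos)
    finally show ?thesis .
  next
    case False
    \<comment> \<open>The \<open>l\<close> at which the bound for the mean becomes an equality; its
      logarithm makes sense because the mean exceeds \<open>6 * \<epsilon>\<close> here. Every
      admissible \<open>l\<close> is at most \<open>b\<close>, hence so is the supremum.\<close>
    define b where "b = - 2 * log 2 (?m - 6 * \<epsilon>)"
    have "?H \<le> ereal b"
      unfolding Hmin_s_def Hmin_c_def
    proof (intro SUP_least Sup_least, clarify)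
      fix \<rho> \<sigma> l
      assume "subnormalized (dA*dB) \<rho>" "pdist (choi dA dB T) \<rho> \<le> \<epsilon>" "Defs.density dB \<sigma>"
        "loewner_ge (dA*dB) (complex_of_real (2 powr (-l)) \<cdot>\<^sub>m kron (1\<^sub>m dA) \<sigma>) \<rho>"
      from decoupling_bound[OF \<epsilon> this] have le: "?m - 6 * \<epsilon> \<le> 2 powr (- l / 2)" by simp
      then have "log 2 (?m - 6 * \<epsilon>) \<le> log 2 (2 powr (- l / 2))" using False by (subst log_le_cancel_iff) auto
      then show "ereal l \<le> ereal b" by (simp add: b_def)
    qed
    \<comment> \<open>The value \<infinity> of \<open>?H\<close> is excluded by \<open>b\<close>,
      and at -\<infinity> the right side is \<infinity>.\<close>
    then have "ereal (?m - 6 * \<epsilon>) \<le> pow2_neg_half ?H"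
    proof (cases ?H)
      case (real h)
      have "?m - 6 * \<epsilon> = 2 powr (- b / 2)" using False by (simp add: b_def)
      also have "\<dots> \<le> 2 powr (- h / 2)" using \<open>?H \<le> ereal b\<close> real by (intro powr_mono) auto
      finally show ?thesis using real by (simp add: pow2_neg_half_def)
    qed (auto simp: pow2_neg_half_def)
    then have "ereal (?m - 6 * \<epsilon>) + ereal (6 * \<epsilon>) \<le> pow2_neg_half ?H + ereal (6 * \<epsilon>)" by (rule add_right_mono)
    then show ?thesis by simp
  qed
qed

lemma dev_bounds:
  assumes "nsq dA u = 1" shows "0 \<le> dev u" "dev u \<le> 2"
proof -
  have c: "chan dA dB tau u - chan_mix dA dB tau \<in> carrier_mat dB dB" by (rule minus_carrier_mat) simp
  show "0 \<le> dev u" unfolding dev_chan by (rule tnorm_nonneg[OF c])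
  show "dev u \<le> 2"
    using tnorm_triangle2[OF chan_carrier, of dA dB tau u dA tau] tnorm_chan_le[of u] tnorm_chan_mix_le assms
    unfolding dev_chan by linarith
qed

lemma dev_lipschitz:
  assumes u: "u \<in> unit_sphere_c dA" and v: "v \<in> unit_sphere_c dA"
  shows "\<bar>dev u - dev v\<bar> \<le> 2 * sqrt (nsq dA (\<lambda>i. u i - v i))"
proof (cases "nsq dA (\<lambda>i. u i - v i) = 0")
  case True
  then have "u i = v i" for i using u v by (cases "i < dA") (auto simp: nsq_eq_0_iff unit_sphere_nsq)
  then have "u = v" by auto
  then show ?thesis using True by simp
next
  case False
  define r where "r = sqrt (nsq dA (\<lambda>i. u i - v i))"
  have r: "r > 0" "r * r = nsq dA (\<lambda>i. u i - v i)" using False nsq_nonneg[of dA "\<lambda>i. u i - v i"] by (auto simp: r_def less_le)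
  have c: "chan dA dB tau x - chan_mix dA dB tau \<in> carrier_mat dB dB" for x by (rule minus_carrier_mat) simp
  have "\<bar>dev u - dev v\<bar> \<le> tnorm ((chan dA dB tau u - chan_mix dA dB tau) - (chan dA dB tau v - chan_mix dA dB tau))"
    unfolding dev_chan by (rule tnorm_lipschitz[OF c c])
  also have "(chan dA dB tau u - chan_mix dA dB tau) - (chan dA dB tau v - chan_mix dA dB tau) = chan dA dB tau u - chan dA dB tau v"
    by (rule eq_matI) (auto simp: chan_def chan_mix_def)
  \<comment> \<open>The parameter \<open>2 / r\<close> balances
    \<open>|u - v|\<^sup>2 = r\<^sup>2\<close> against
    \<open>|u + v|\<^sup>2 \<le> 4\<close>.\<close>
  also have "tnorm \<dots> \<le> (2 / r * fro dB (dA*dB) (\<lambda>k m. kmap dA dB amp u k m - kmap dA dB amp v k m)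
      + fro dB (dA*dB) (\<lambda>k m. kmap dA dB amp u k m + kmap dA dB amp v k m) / (2 / r)) / 2"
    by (rule tnorm_gram_diff_le) (use r in \<open>auto simp: chan_gram[OF tau_gram] carrier_matD[OF chan_carrier(1)] intro!: minus_carrier_mat\<close>)
  also have "\<dots> = (2 / r * nsq dA (\<lambda>i. u i - v i) + nsq dA (\<lambda>i. u i + v i) / (2 / r)) / 2"
    unfolding kmap_diff_vec[symmetric] kmap_add_vec[symmetric] fro_kmap_amp ..
  also have "\<dots> \<le> (2 / r * nsq dA (\<lambda>i. u i - v i) + 4 / (2 / r)) / 2"
  proof -
    have "ip dA (\<lambda>i. u i + v i) (\<lambda>i. u i + v i) = ip dA u u + ip dA u v + (ip dA v u + ip dA v v)"
      by (simp only: ip_add_left ip_add_right)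
    then have "nsq dA (\<lambda>i. u i + v i) = 2 + 2 * Re (ip dA u v)"
      using u v Re_ip_commute[of dA u v] by (simp add: nsq_eq_Re_ip unit_sphere_nsq)
    also have "Re (ip dA u v) \<le> 1"
      using cauchy_schwarz_ip[of dA u v] complex_Re_le_cmod[of "ip dA u v"] u v by (simp add: unit_sphere_nsq)
    finally have "nsq dA (\<lambda>i. u i + v i) \<le> 4" by simp
    then show ?thesis using r by (intro divide_right_mono add_left_mono) auto
  qed
  also have "\<dots> = 2 * r" unfolding r(2)[symmetric] using r(1) by (simp add: field_simps)
  finally show ?thesis by (simp add: r_def)
qed

theorem dev_concentration:
  assumes \<delta>: "\<delta> > 0"
  shows "measure \<mu> {u. dev u \<ge> (\<integral>u. dev u \<partial>\<mu>) + \<delta>} \<le> exp (- (real dA * \<delta>\<^sup>2 / 16))"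
proof (cases "dA \<ge> 2")
  case True
  have [measurable]: "dev \<in> borel_measurable borel" unfolding dev_chan by (rule measurable_tnorm_chan) simp
  \<comment> \<open>Centring moves the range from between 0 and 2 to between -1 and 1, which gives
    the radial constant 1 in \<open>cone_ext_lipschitz\<close>.\<close>
  define g where "g u = dev u - 1" for u
  have gm: "g \<in> borel_measurable borel" unfolding g_def by measurable
  have "(\<integral>u. g u \<partial>\<mu>) = (\<integral>u. dev u \<partial>\<mu>) - 1"
    unfolding g_def using integrable_dev by simp
  then have "{u. dev u \<ge> (\<integral>u. dev u \<partial>\<mu>) + \<delta>} = {u. g u \<ge> (\<integral>u. g u \<partial>\<mu>) + \<delta>}" by (auto simp: g_def)
  moreover have "measure \<mu> {u. g u \<ge> (\<integral>u. g u \<partial>\<mu>) + \<delta>} \<le> exp (- (real dA * \<delta>\<^sup>2 / 16))"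
  proof (rule levy[OF gm _ _ True \<delta>])
    show "\<bar>g u\<bar> \<le> 1" if "u \<in> unit_sphere_c dA" for u
      using dev_bounds[of u] that by (simp add: g_def unit_sphere_nsq abs_le_iff)
    show "\<bar>g u - g v\<bar> \<le> 2 * sqrt (nsq dA (\<lambda>i. u i - v i))" if "u \<in> unit_sphere_c dA" "v \<in> unit_sphere_c dA" for u v
      using dev_lipschitz[OF that] by (simp add: g_def)
  qed
  ultimately show ?thesis by simp
next
  case False
  then have d1: "dA = 1" using dA by simp
  have [measurable]: "dev \<in> borel_measurable borel" unfolding dev_chan by (rule measurable_tnorm_chan) simp
  \<comment> \<open>In dimension 1 all unit vectors differ by a phase only, so they have the same
    output as the maximally mixed state.\<close>
  have z: "AE u in \<mu>. dev u = 0"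
    using AE_sphere
  proof eventually_elim
    case (elim u)
    then have "u 0 * cnj (u 0) = 1" by (simp add: d1 nsq_def complex_norm_square[symmetric] del: of_real_power)
    then have "chan dA dB tau u = chan_mix dA dB tau" by (auto simp: chan_def chan_mix_def d1)
    then have e: "dev u = tnorm (chan_mix dA dB tau - chan_mix dA dB tau)" by (simp add: dev_chan)
    have c: "chan_mix dA dB tau - chan_mix dA dB tau \<in> carrier_mat dB dB" by (rule minus_carrier_mat) simp
    have "(\<Sum>i<dB. \<Sum>j<dB. cmod ((chan_mix dA dB tau - chan_mix dA dB tau) $$ (i,j))) = 0"
      by (intro sum.neutral ballI) (auto simp: chan_mix_def)
    then show ?case using tnorm_le_sum_entries[OF c] tnorm_nonneg[OF c] e by simp
  qed
  then have "(\<integral>u. dev u \<partial>\<mu>) = 0" by (intro integral_eq_zero_AE)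
  moreover have "measure \<mu> {u. dev u \<ge> 0 + \<delta>} = 0"
  proof -
    have "AE u in \<mu>. \<not> dev u \<ge> 0 + \<delta>" using z by eventually_elim (use \<delta> in simp)
    then have "emeasure \<mu> {u \<in> space \<mu>. \<not> \<not> dev u \<ge> 0 + \<delta>} = 0"
      by (intro emeasure_eq_0_AE) auto
    then show ?thesis by (simp add: measure_def)
  qed
  ultimately show ?thesis by simp
qed

end

section \<open>The converse\<close>

text \<open>Gram-Schmidt that skips dependent vectors: a zero residual adds no new basis vector,
  hence \<open>s \<le> card I\<close> rather than equality.\<close>

lemma gram_schmidt_span:
  assumes "finite I"
  shows "\<exists>s e. s \<le> card I \<and> orthonormal n s e \<and> (\<forall>i\<in>I. \<forall>k<n. a i k = (\<Sum>j<s. ip n (e j) (a i) * e j k))"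
  using assms
proof (induction I rule: finite_induct)
  case empty
  show ?case by (rule exI[of _ 0]) (simp add: orthonormal_def)
next
  case (insert i0 I)
  then obtain s e where se: "s \<le> card I" "orthonormal n s e" "\<forall>i\<in>I. \<forall>k<n. a i k = (\<Sum>j<s. ip n (e j) (a i) * e j k)" by blast
  define r where "r = (\<lambda>k. a i0 k - (\<Sum>j<s. ip n (e j) (a i0) * e j k))"
  have ro: "ip n (e j) r = 0" if "j < s" for j unfolding r_def by (rule ip_sub_proj[OF se(2) that])
  show ?case
  proof (cases "nsq n r = 0")
    case True
    then have "\<forall>k<n. a i0 k = (\<Sum>j<s. ip n (e j) (a i0) * e j k)" by (simp add: nsq_eq_0_iff r_def)
    then show ?thesis using se insert.hyps by (intro exI[of _ s] exI[of _ e]) auto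
  next
    case False
    then have pos: "nsq n r > 0" using nsq_nonneg[of n r] by linarith
    define c where "c = complex_of_real (1 / sqrt (nsq n r))"
    have cc: "c * c = of_real (1 / nsq n r)" "cnj c = c"
      unfolding c_def using pos by (simp_all flip: of_real_mult)
    define f where "f = (\<lambda>k. c * r k)"
    have ff: "ip n f f = 1"
    proof -
      have "ip n f f = (c * c) * ip n r r" unfolding f_def ip_scale_left ip_scale_right cc(2) by (simp only: mult.assoc)
      then show ?thesis using pos unfolding cc(1) ip_self[of n r] by (simp flip: of_real_mult)
    qed
    have ef: "ip n (e j) f = 0" "ip n f (e j) = 0" if "j < s" for j
    proof -
      show "ip n (e j) f = 0" unfolding f_def ip_scale_right ro[OF that] by simp
      then show "ip n f (e j) = 0" using cnj_ip[of n "e j" f] by simp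
    qed
    have on: "orthonormal n (Suc s) (e(s := f))"
      using se(2) ff ef unfolding orthonormal_def by (auto simp: less_Suc_eq)
    have sum_e: "(\<Sum>j<Suc s. ip n ((e(s := f)) j) x * (e(s := f)) j k) = (\<Sum>j<s. ip n (e j) x * e j k) + ip n f x * f k" for x k
      by simp
    have I: "a i k = (\<Sum>j<Suc s. ip n ((e(s := f)) j) (a i) * (e(s := f)) j k)" if "i \<in> I" "k < n" for i k
    proof -
      have "ip n f (a i) = ip n f (\<lambda>k. \<Sum>j<s. ip n (e j) (a i) * e j k)" using se(3) that(1) by (intro ip_cong) auto
      also have "\<dots> = 0" unfolding ip_sum_right ip_scale_right using ef by simp
      finally show ?thesis unfolding sum_e using se(3) that by simp
    qed
    have i0: "a i0 k = (\<Sum>j<Suc s. ip n ((e(s := f)) j) (a i0) * (e(s := f)) j k)" if "k < n" for k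
    proof -
      have "ip n r (a i0) = ip n r (\<lambda>k. r k + (\<Sum>j<s. ip n (e j) (a i0) * e j k))" by (intro ip_cong) (auto simp: r_def)
      also have "\<dots> = ip n r r + (\<Sum>j<s. ip n (e j) (a i0) * ip n r (e j))"
        unfolding ip_add_right ip_sum_right ip_scale_right ..
      also have "(\<Sum>j<s. ip n (e j) (a i0) * ip n r (e j)) = 0"
        using ro cnj_ip[of n _ r] by (intro sum.neutral ballI) (metis complex_cnj_zero lessThan_iff mult_zero_right)
      finally have "ip n r (a i0) = of_real (nsq n r)" by (simp add: ip_self)
      then have "ip n f (a i0) * f k = (c * c) * of_real (nsq n r) * r k" unfolding f_def ip_scale_left cc(2) by simp
      also have "\<dots> = r k" using pos unfolding cc(1) by (simp flip: of_real_mult)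
      finally show ?thesis unfolding sum_e by (simp add: r_def)
    qed
    show ?thesis
    proof (intro exI[of _ "Suc s"] exI[of _ "e(s := f)"] conjI ballI allI impI)
      show "Suc s \<le> card (insert i0 I)" using se(1) insert.hyps by simp
      show "a i k = (\<Sum>j<Suc s. ip n ((e(s := f)) j) (a i) * (e(s := f)) j k)" if "i \<in> insert i0 I" "k < n" for i k
        using I[of i k] i0[of k] that by blast
    qed (rule on)
  qed
qed

definition perp :: "nat \<Rightarrow> nat \<Rightarrow> (nat \<Rightarrow> nat \<Rightarrow> complex) \<Rightarrow> (nat \<Rightarrow> complex) \<Rightarrow> nat \<Rightarrow> complex" where
  "perp n s e x k = x k - (\<Sum>j<s. ip n (e j) x * e j k)"

lemma nsq_perp: "orthonormal n s e \<Longrightarrow> nsq n (perp n s e x) = nsq n x - (\<Sum>j<s. (cmod (ip n (e j) x))\<^sup>2)"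
  using nsq_sub_proj[of n s e x] by (simp add: perp_def[abs_def])

lemma nsq_perp_le: "orthonormal n s e \<Longrightarrow> nsq n (perp n s e x) \<le> nsq n x"
  by (simp add: nsq_perp sum_nonneg)

lemma perp_sum: "perp n s e (\<lambda>k. \<Sum>m\<in>M. c m * f m k) k = (\<Sum>m\<in>M. c m * perp n s e (f m) k)"
proof -
  have "(\<Sum>j<s. ip n (e j) (\<lambda>k. \<Sum>m\<in>M. c m * f m k) * e j k) = (\<Sum>j<s. \<Sum>m\<in>M. c m * (ip n (e j) (f m) * e j k))"
    unfolding ip_sum_right ip_scale_right sum_distrib_right by (simp add: mult.assoc)
  also have "\<dots> = (\<Sum>m\<in>M. c m * (\<Sum>j<s. ip n (e j) (f m) * e j k))"
    by (subst sum.swap) (simp add: sum_distrib_left)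
  finally show ?thesis by (simp add: perp_def right_diff_distrib sum_subtractf)
qed

lemma perp_diff: "perp n s e (\<lambda>k. x k - y k) k = perp n s e x k - perp n s e y k"
  by (simp add: perp_def ip_diff_right algebra_simps sum_subtractf)

lemma ip_perp: "orthonormal n s e \<Longrightarrow> ip n x (perp n s e x) = of_real (nsq n (perp n s e x))"
proof -
  assume on: "orthonormal n s e"
  have "ip n x (perp n s e x) = ip n x x - (\<Sum>j<s. ip n (e j) x * ip n x (e j))"
    unfolding perp_def[abs_def] ip_diff_right ip_sum_right ip_scale_right ..
  also have "(\<Sum>j<s. ip n (e j) x * ip n x (e j)) = of_real (\<Sum>j<s. (cmod (ip n (e j) x))\<^sup>2)"
    using cnj_ip[of n _ x] by (simp add: complex_norm_square del: of_real_power)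
  finally show ?thesis unfolding nsq_perp[OF on] ip_self by simp
qed

text \<open>The projection of \<open>perp\<close> as a kernel, so that it can serve as test
  contraction in \<open>tnorm_ge\<close>.\<close>

definition perp_mat :: "nat \<Rightarrow> (nat \<Rightarrow> nat \<Rightarrow> complex) \<Rightarrow> nat \<Rightarrow> nat \<Rightarrow> complex" where
  "perp_mat s e i j = (if i = j then 1 else 0) - (\<Sum>r<s. e r i * cnj (e r j))"

lemma mv_perp_mat: "i < n \<Longrightarrow> mv n (perp_mat s e) x i = perp n s e x i"
proof -
  assume i: "i < n"
  have "mv n (perp_mat s e) x i = (\<Sum>j<n. (if j = i then x j else 0) - (\<Sum>r<s. e r i * cnj (e r j) * x j))"
    unfolding mv_def perp_mat_def by (intro sum.cong refl) (auto simp: algebra_simps sum_distrib_right sum_distrib_left)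
  also have "\<dots> = x i - (\<Sum>j<n. \<Sum>r<s. e r i * cnj (e r j) * x j)" using i by (simp add: sum_subtractf)
  also have "(\<Sum>j<n. \<Sum>r<s. e r i * cnj (e r j) * x j) = (\<Sum>r<s. \<Sum>j<n. e r i * cnj (e r j) * x j)" by (rule sum.swap)
  finally show ?thesis by (simp add: perp_def ip_def sum_distrib_left sum_distrib_right ac_simps)
qed

lemma contraction_perp_mat: "orthonormal n s e \<Longrightarrow> contraction n (perp_mat s e)"
  unfolding contraction_def
proof
  fix x assume on: "orthonormal n s e"
  have "nsq n (mv n (perp_mat s e) x) = nsq n (perp n s e x)" by (simp add: nsq_def mv_perp_mat)
  then show "nsq n (mv n (perp_mat s e) x) \<le> nsq n x" using nsq_perp_le[OF on] by simp
qed

text \<open>The weight outside the span is linear in the matrix, as a trace against the projection;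
  \<open>tnorm_ge\<close> can then compare the weights of two states.\<close>

lemma gram_trace_perp:
  assumes on: "orthonormal n s e"
    and X: "\<And>i j. i < n \<Longrightarrow> j < n \<Longrightarrow> X $$ (i,j) = (\<Sum>m<N. K i m * cnj (K j m))"
  shows "(\<Sum>i<n. \<Sum>j<n. X $$ (i,j) * perp_mat s e j i) = of_real (\<Sum>m<N. nsq n (perp n s e (\<lambda>i. K i m)))"
proof -
  have "(\<Sum>i<n. \<Sum>j<n. X $$ (i,j) * perp_mat s e j i) = (\<Sum>i<n. \<Sum>j<n. (\<Sum>m<N. K i m * cnj (K j m)) * perp_mat s e j i)"
    by (intro sum.cong refl) (simp add: X)
  also have "\<dots> = (\<Sum>m<N. ip n (\<lambda>i. K i m) (mv n (perp_mat s e) (\<lambda>i. K i m)))" by (rule gram_trace)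
  also have "\<dots> = (\<Sum>m<N. ip n (\<lambda>i. K i m) (perp n s e (\<lambda>i. K i m)))"
    by (intro sum.cong refl ip_cong) (auto simp: mv_perp_mat)
  finally show ?thesis by (simp add: ip_perp[OF on])
qed

lemma nsq_add_le: "nsq n (\<lambda>i. x i + y i) \<le> 2 * nsq n x + 2 * nsq n y"
proof -
  have "(cmod (a + b))\<^sup>2 \<le> 2 * (cmod a)\<^sup>2 + 2 * (cmod b)\<^sup>2" for a b
  proof -
    have "(cmod (a + b))\<^sup>2 \<le> (cmod a + cmod b)\<^sup>2" by (intro power_mono norm_triangle_ineq) auto
    also have "\<dots> \<le> 2 * (cmod a)\<^sup>2 + 2 * (cmod b)\<^sup>2"
      using zero_le_power2[of "cmod a - cmod b"] by (simp add: power2_eq_square algebra_simps)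
    finally show ?thesis .
  qed
  then have "nsq n (\<lambda>i. x i + y i) \<le> (\<Sum>i<n. 2 * (cmod (x i))\<^sup>2 + 2 * (cmod (y i))\<^sup>2)"
    unfolding nsq_def by (intro sum_mono)
  then show ?thesis by (simp add: nsq_def sum.distrib sum_distrib_left)
qed

lemma fro_add_le: "fro n N (\<lambda>i m. x i m + y i m) \<le> 2 * fro n N x + 2 * fro n N y"
proof -
  have "(\<Sum>i<n. nsq N (\<lambda>m. x i m + y i m)) \<le> (\<Sum>i<n. 2 * nsq N (x i) + 2 * nsq N (y i))"
    by (intro sum_mono nsq_add_le)
  then show ?thesis by (simp add: fro_rows sum.distrib sum_distrib_left)
qed

lemma fro_specmat:
  assumes "orthonormal n n v"
  shows "fro n n (\<lambda>i j. specmat n s v $$ (i,j)) = (\<Sum>k<n. (s k)\<^sup>2)"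
proof -
  have h: "specmat n s v $$ (j,i) = cnj (specmat n s v $$ (i,j))" if "i < n" "j < n" for i j
    using that by (simp add: specmat_entry cnj_sum ac_simps)
  have "complex_of_real (\<Sum>k<n. s k * s k) = tr (specmat n s v * specmat n s v)"
    unfolding specmat_mult[OF assms] tr_specmat[OF assms] ..
  also have "\<dots> = (\<Sum>i<n. \<Sum>j<n. specmat n s v $$ (i,j) * specmat n s v $$ (j,i))"
  proof -
    have dr: "dim_row (specmat n s v * specmat n s v) = n" by (simp add: specmat_def)
    show ?thesis unfolding tr_def dr
      by (rule sum.cong[OF refl], rule mat_mult_entry[OF specmat_carrier specmat_carrier]) auto
  qed
  also have "\<dots> = (\<Sum>i<n. \<Sum>j<n. of_real ((cmod (specmat n s v $$ (i,j)))\<^sup>2))"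
  proof (intro sum.cong refl)
    fix i j assume "i \<in> {..<n}" "j \<in> {..<n}"
    then have e: "specmat n s v $$ (j,i) = cnj (specmat n s v $$ (i,j))" by (intro h) auto
    show "specmat n s v $$ (i,j) * specmat n s v $$ (j,i) = of_real ((cmod (specmat n s v $$ (i,j)))\<^sup>2)"
      unfolding complex_norm_square by (rule arg_cong[OF e])
  qed
  also have "\<dots> = of_real (fro n n (\<lambda>i j. specmat n s v $$ (i,j)))" by (simp add: fro_def)
  finally have "(\<Sum>k<n. s k * s k) = fro n n (\<lambda>i j. specmat n s v $$ (i,j))" by (simp only: of_real_eq_iff)
  then show ?thesis by (simp add: power2_eq_square)
qed

lemma (in prob_space) exists_le_expectation:
  fixes h :: "'a \<Rightarrow> real"
  assumes i: "integrable M h" and le: "(\<integral>x. h x \<partial>M) \<le> c" and P: "AE x in M. P x"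
  shows "\<exists>x. P x \<and> h x \<le> c"
proof (rule ccontr)
  assume "\<not> (\<exists>x. P x \<and> h x \<le> c)"
  then have gt: "AE x in M. h x - c > 0" using P by (auto elim!: eventually_mono simp: not_le)
  have ih: "integrable M (\<lambda>x. h x - c)" using i by simp
  have "(\<integral>x. h x - c \<partial>M) \<le> 0" using i le by (simp add: prob_space)
  moreover have nn: "AE x in M. 0 \<le> h x - c" using gt by eventually_elim simp
  then have "(\<integral>x. h x - c \<partial>M) \<ge> 0" by (rule integral_nonneg_AE)
  ultimately have "(\<integral>x. h x - c \<partial>M) = 0" by simp
  then have "AE x in M. h x - c = 0" using integral_nonneg_eq_0_iff_AE[OF ih nn] by simp
  then have "AE x in M. False" using gt by eventually_elim simp
  then show False by simp
qed

text \<open>Truncating the eigenvalues \<open>r k\<close> of \<open>\<surd>\<sigma>\<close> at \<open>\<theta> = \<epsilon>\<^sup>2 / (2Q)\<close>, where \<open>Q = \<Sum> r k\<close>; for \<open>Q = 0\<close> nothing is kept.\<close>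
lemma truncation:
  fixes r :: "nat \<Rightarrow> real"
  assumes r: "\<And>k. k < n \<Longrightarrow> r k \<ge> 0" and Q: "Q = (\<Sum>k<n. r k)" and \<epsilon>: "\<epsilon> > 0"
  defines "I \<equiv> {k. k < n \<and> r k > \<epsilon>\<^sup>2 / (2 * Q)}"
  shows "real (card I) \<le> Q\<^sup>2 * (2 / \<epsilon>\<^sup>2)" "(\<Sum>k<n. (if k \<in> I then 0 else r k)\<^sup>2) \<le> \<epsilon>\<^sup>2 / 2"
proof -
  have Q0: "Q \<ge> 0" unfolding Q by (intro sum_nonneg) (auto simp: r)
  have I: "I \<subseteq> {..<n}" "finite I" by (auto simp: I_def)
  have "card I \<le> Q\<^sup>2 * (2 / \<epsilon>\<^sup>2) \<and> (\<Sum>k<n. (if k \<in> I then 0 else r k)\<^sup>2) \<le> \<epsilon>\<^sup>2 / 2"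
  proof (cases "Q = 0")
    case True
    then have "(\<Sum>k<n. r k) = 0" using Q by simp
    then have "r k = 0" if "k < n" for k using that r by (subst (asm) sum_nonneg_eq_0_iff) auto
    then have "I = {}" "(\<Sum>k<n. (if k \<in> I then 0 else r k)\<^sup>2) = 0" by (auto simp: I_def True)
    then show ?thesis using True by simp
  next
    case False
    then have Qp: "Q > 0" using Q0 by simp
    define \<theta> where "\<theta> = \<epsilon>\<^sup>2 / (2 * Q)"
    have \<theta>: "\<theta> > 0" "\<theta> * Q = \<epsilon>\<^sup>2 / 2" using Qp \<epsilon> by (auto simp: \<theta>_def)
    have "card I * \<theta> = (\<Sum>k\<in>I. \<theta>)" by simp
    also have "\<dots> \<le> (\<Sum>k\<in>I. r k)" by (intro sum_mono) (auto simp: I_def \<theta>_def)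
    also have "\<dots> \<le> Q" unfolding Q by (intro sum_mono2) (use I r in auto)
    finally have "card I \<le> Q / \<theta>" using \<theta> by (simp add: field_simps)
    also have "Q / \<theta> = Q\<^sup>2 * (2 / \<epsilon>\<^sup>2)" by (simp add: \<theta>_def power2_eq_square)
    finally have 1: "card I \<le> Q\<^sup>2 * (2 / \<epsilon>\<^sup>2)" .
    have "(\<Sum>k<n. (if k \<in> I then 0 else r k)\<^sup>2) \<le> (\<Sum>k<n. \<theta> * r k)"
    proof (rule sum_mono)
      fix k assume k: "k \<in> {..<n}"
      show "(if k \<in> I then 0 else r k)\<^sup>2 \<le> \<theta> * r k"
      proof (cases "k \<in> I")
        case True then show ?thesis using r k \<theta> by simp
      next
        case False
        then have "r k \<le> \<theta>" using k by (auto simp: I_def \<theta>_def not_less)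
        then show ?thesis using False r k by (simp add: power2_eq_square mult_right_mono)
      qed
    qed
    also have "\<dots> = \<theta> * Q" by (simp add: Q sum_distrib_left)
    finally show ?thesis using 1 \<theta> by simp
  qed
  then show "real (card I) \<le> Q\<^sup>2 * (2 / \<epsilon>\<^sup>2)" "(\<Sum>k<n. (if k \<in> I then 0 else r k)\<^sup>2) \<le> \<epsilon>\<^sup>2 / 2" by auto
qed

context haar_channel begin

text \<open>The weight of \<rho> outside the low-dimensional span is at most
  \<open>14 * \<epsilon>\<^sup>2 + 2 * \<delta>\<close> and its trace at least
  \<open>1 - 2 * \<epsilon>\<^sup>2\<close>, so the span carries at least
  \<open>1 - 16 * \<epsilon>\<^sup>2 - 2 * \<delta>\<close>. The min-entropy allows less than
  \<open>1 - \<eta>\<^sup>2\<close>, while \<open>\<eta>\<^sup>2\<close> exceeds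
  \<open>16 * \<epsilon>\<^sup>2 + 2 * \<delta>\<close> by its cross term.\<close>

theorem converse_core:
  assumes \<epsilon>: "\<epsilon> > 0" and \<delta>: "\<delta> > 0"
    and \<sigma>: "subnormalized (dA*dB) \<sigma>" "pdist (choi dA dB T) \<sigma> \<le> \<epsilon>"
    and \<rho>: "subnormalized dB \<rho>" "pdist (chan_mix dA dB tau) \<rho> \<le> \<epsilon>"
    and \<rho>_le: "\<And>x. Re (ip dB x (mv dB (\<lambda>i j. \<rho> $$ (i,j)) x)) \<le> lm * nsq dB x" and lm: "lm > 0"
    and Q: "(Re (tr (msqrt (dA*dB) \<sigma>)))\<^sup>2 * (2 / \<epsilon>\<^sup>2) * lm < 1 - \<eta>\<^sup>2" and \<eta>: "\<eta> = sqrt (2 * \<delta>) + 4 * \<epsilon>"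
    and \<omega>: "\<omega> \<in> carrier_mat dB dB" "(\<integral>x. tnorm (T (proj dA x) - \<omega>) \<partial>\<mu>) \<le> \<delta> / 2"
  shows False
proof -
  let ?n = "dA*dB"
  have p\<sigma>: "psd ?n \<sigma>" "Re (tr \<sigma>) \<le> 1" and p\<rho>: "psd dB \<rho>" "Re (tr \<rho>) \<le> 1"
    using \<sigma>(1) \<rho>(1) by (auto simp: subnormalized_def)
  have tr1: "Re (tr (choi dA dB T)) = 1" using tr_choi by simp
  have F1: "1 - fid (choi dA dB T) \<sigma> \<le> \<epsilon>\<^sup>2" by (rule fid_ge_of_pdist[OF psd_choi p\<sigma>(1) tr_choi p\<sigma>(2) \<sigma>(2) \<epsilon>])
  have F2: "1 - fid (chan_mix dA dB tau) \<rho> \<le> \<epsilon>\<^sup>2"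
    by (rule fid_ge_of_pdist[OF psd_chan_mix p\<rho>(1) tr_chan_mix p\<rho>(2) \<rho>(2) \<epsilon>])
  obtain W where W: "contraction ?n W"
    "fro ?n ?n (\<lambda>i m. msqrt ?n (choi dA dB T) $$ (i,m) - (\<Sum>k<?n. msqrt ?n \<sigma> $$ (i,k) * W k m)) \<le> Re (tr (choi dA dB T)) + Re (tr \<sigma>) - 2 * fid (choi dA dB T) \<sigma>"
    using uhlmann[OF psd_choi p\<sigma>(1)] by blast
  obtain t v where tv: "\<And>k. k < ?n \<Longrightarrow> t k \<ge> 0" "orthonormal ?n ?n v" "\<sigma> = specmat ?n t v"
    using psd_eq_specmat[OF p\<sigma>(1)] by blast
  define r where "r k = sqrt (t k)" for k
  have sq: "msqrt ?n \<sigma> = specmat ?n r v" unfolding tv(3) r_def[abs_def] by (rule msqrt_specmat[OF tv(1,2)])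
  define Qv where "Qv = (\<Sum>k<?n. r k)"
  have trQ: "Re (tr (msqrt ?n \<sigma>)) = Qv" unfolding sq tr_specmat[OF tv(2)] by (simp add: Qv_def)
  define I where "I = {k. k < ?n \<and> r k > \<epsilon>\<^sup>2 / (2 * Qv)}"
  have I: "real (card I) \<le> Qv\<^sup>2 * (2 / \<epsilon>\<^sup>2)" "(\<Sum>k<?n. (if k \<in> I then 0 else r k)\<^sup>2) \<le> \<epsilon>\<^sup>2 / 2"
    unfolding I_def by (rule truncation; (simp add: r_def tv(1) \<epsilon> Qv_def)?)+
  have finI: "finite I" "I \<subseteq> {..<?n}" by (auto simp: I_def)
  define r1 where "r1 k = (if k \<in> I then r k else 0)" for k
  define S1 where "S1 p j = specmat ?n r1 v $$ (p,j)" for p j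
  define S2 where "S2 p j = specmat ?n (\<lambda>k. if k \<in> I then 0 else r k) v $$ (p,j)" for p j
  have split: "msqrt ?n \<sigma> $$ (p,j) = S1 p j + S2 p j" if "p < ?n" "j < ?n" for p j
    unfolding sq S1_def S2_def specmat_entry[OF that] sum.distrib[symmetric]
    by (intro sum.cong refl) (simp add: r1_def)
  \<comment> \<open>The Uhlmann factor of \<sigma> splits into a low-rank part \<open>B\<close> and
    a remainder \<open>B2\<close> of squared Frobenius norm at most
    \<open>\<epsilon>\<^sup>2 / 2\<close>.\<close>
  define B where "B p m = (\<Sum>k<?n. S1 p k * W k m)" for p m
  define B2 where "B2 p m = (\<Sum>k<?n. S2 p k * W k m)" for p m
  have fB2: "fro ?n ?n B2 \<le> \<epsilon>\<^sup>2 / 2"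
    using fro_contraction_right[OF W(1), of ?n S2] fro_specmat[OF tv(2), of "\<lambda>k. if k \<in> I then 0 else r k"] I(2)
    unfolding B2_def[abs_def] S2_def[abs_def] by linarith
  have e1: "fro ?n ?n (\<lambda>p m. amp p m - B p m) \<le> 5 * \<epsilon>\<^sup>2"
  proof -
    let ?D = "\<lambda>i m. msqrt ?n (choi dA dB T) $$ (i,m) - (\<Sum>k<?n. msqrt ?n \<sigma> $$ (i,k) * W k m)"
    have "fro ?n ?n (\<lambda>p m. amp p m - B p m) = fro ?n ?n (\<lambda>p m. ?D p m + B2 p m)"
      unfolding fro_def
    proof (intro sum.cong refl)
      fix p m assume "p \<in> {..<?n}" "m \<in> {..<?n}"
      then have "(\<Sum>k<?n. msqrt ?n \<sigma> $$ (p,k) * W k m) = B p m + B2 p m"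
        by (simp add: split B_def B2_def algebra_simps sum.distrib)
      then show "(cmod (amp p m - B p m))\<^sup>2 = (cmod (?D p m + B2 p m))\<^sup>2" by (simp add: amp_def)
    qed
    also have "\<dots> \<le> 2 * fro ?n ?n ?D + 2 * fro ?n ?n B2" by (rule fro_add_le)
    also have "\<dots> \<le> 2 * (2 * \<epsilon>\<^sup>2) + 2 * (\<epsilon>\<^sup>2 / 2)" using W(2) F1 p\<sigma>(2) tr1 fB2 by (intro add_mono mult_left_mono) linarith+
    finally show ?thesis by simp
  qed
  \<comment> \<open>By convexity \<omega> is within \<open>\<delta> / 2\<close> of the mean output
    too, so the mean output may replace it at total distance \<delta>.\<close>
  have cm: "tnorm (chan_mix dA dB tau - \<omega>) \<le> \<delta> / 2"
    using tnorm_expectation_le[OF dA \<omega>(1), of tau] \<omega>(2) unfolding T_proj by linarith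
  have i_om: "integrable \<mu> (\<lambda>x. tnorm (chan dA dB tau x - \<omega>))" by (rule integrable_tnorm_chan[OF \<omega>(1)])
  \<comment> \<open>Both errors are averaged as one sum, so that a single input \<open>x\<close>
    controls them together.\<close>
  let ?h = "\<lambda>x. fro dB ?n (kmap dA dB (\<lambda>p m. amp p m - B p m) x) + tnorm (chan dA dB tau x - chan_mix dA dB tau)"
  have ih: "integrable \<mu> ?h"
    by (intro Bochner_Integration.integrable_add expectation_fro_kmap(1)[OF dA] integrable_tnorm_chan) simp
  have "(\<integral>x. tnorm (chan dA dB tau x - chan_mix dA dB tau) \<partial>\<mu>) \<le> (\<integral>x. tnorm (chan dA dB tau x - \<omega>) + \<delta> / 2 \<partial>\<mu>)"
  proof (rule integral_mono)
    show "tnorm (chan dA dB tau x - chan_mix dA dB tau) \<le> tnorm (chan dA dB tau x - \<omega>) + \<delta> / 2" for x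
      using tnorm_diff_triangle[OF chan_carrier(1) \<omega>(1) chan_carrier(2), of dA tau x dA tau]
        tnorm_diff_commute[OF \<omega>(1) chan_carrier(2), of dA tau] cm by linarith
  qed (use i_om in \<open>auto intro!: integrable_tnorm_chan\<close>)
  also have "\<dots> \<le> \<delta>" using i_om \<omega>(2) unfolding T_proj by simp
  finally have Et: "(\<integral>x. tnorm (chan dA dB tau x - chan_mix dA dB tau) \<partial>\<mu>) \<le> \<delta>" .
  have "(\<integral>x. ?h x \<partial>\<mu>) = fro ?n ?n (\<lambda>p m. amp p m - B p m) + (\<integral>x. tnorm (chan dA dB tau x - chan_mix dA dB tau) \<partial>\<mu>)"
    using expectation_fro_kmap[OF dA, of dB ?n "\<lambda>p m. amp p m - B p m"]
    by (subst Bochner_Integration.integral_add) (auto intro!: integrable_tnorm_chan)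
  also have "\<dots> \<le> 5 * \<epsilon>\<^sup>2 + \<delta>" using e1 Et by linarith
  finally have "\<exists>x. True \<and> ?h x \<le> 5 * \<epsilon>\<^sup>2 + \<delta>" by (intro exists_le_expectation[OF ih]) auto
  then obtain x where x: "?h x \<le> 5 * \<epsilon>\<^sup>2 + \<delta>" by auto
  define K where "K = kmap dA dB amp x"
  define L where "L = kmap dA dB B x"
  \<comment> \<open>Up to the factor \<open>r1 i\<close>, the image of \<open>x\<close> under the
    Kraus operator belonging to the eigenvector \<open>v i\<close> of \<sigma>; it vanishes for
    \<open>i\<close> outside \<open>I\<close>.\<close>
  define a where "a i k = of_real (r1 i) * (of_real (sqrt dA) * (\<Sum>c<dA. x c * v i (c*dB + k)))" for i k
  have L_span: "L k m = (\<Sum>i\<in>I. (\<Sum>j<?n. cnj (v i j) * W j m) * a i k)" if "k < dB" for k m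
  proof -
    have Bp: "B p m = (\<Sum>i<?n. of_real (r1 i) * v i p * (\<Sum>j<?n. cnj (v i j) * W j m))" if "p < ?n" for p
    proof -
      have "B p m = (\<Sum>j<?n. \<Sum>i<?n. of_real (r1 i) * v i p * (cnj (v i j) * W j m))"
        using that by (simp add: B_def S1_def specmat_entry sum_distrib_right mult.assoc)
      also have "\<dots> = (\<Sum>i<?n. \<Sum>j<?n. of_real (r1 i) * v i p * (cnj (v i j) * W j m))" by (rule sum.swap)
      finally show ?thesis by (simp add: sum_distrib_left)
    qed
    have "L k m = of_real (sqrt dA) * (\<Sum>c<dA. x c * (\<Sum>i<?n. of_real (r1 i) * v i (c*dB + k) * (\<Sum>j<?n. cnj (v i j) * W j m)))"
      unfolding L_def kmap_def using that by (intro arg_cong2[where f="(*)"] sum.cong refl) (simp add: Bp pair_index_less)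
    also have "\<dots> = (\<Sum>c<dA. \<Sum>i<?n. (\<Sum>j<?n. cnj (v i j) * W j m) * (of_real (r1 i) * (of_real (sqrt dA) * (x c * v i (c*dB + k)))))"
      unfolding sum_distrib_left[of _ _ "{..<?n}"] sum_distrib_left[of _ _ "{..<dA}"] by (simp add: sum_distrib_left sum_distrib_right ac_simps)
    also have "\<dots> = (\<Sum>i<?n. \<Sum>c<dA. (\<Sum>j<?n. cnj (v i j) * W j m) * (of_real (r1 i) * (of_real (sqrt dA) * (x c * v i (c*dB + k)))))"
      by (rule sum.swap)
    also have "\<dots> = (\<Sum>i<?n. (\<Sum>j<?n. cnj (v i j) * W j m) * a i k)" by (simp only: a_def sum_distrib_left)
    also have "\<dots> = (\<Sum>i\<in>I. (\<Sum>j<?n. cnj (v i j) * W j m) * a i k)"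
      by (rule sum.mono_neutral_right) (use finI in \<open>auto simp: a_def r1_def\<close>)
    finally show ?thesis .
  qed
  obtain s e where se: "s \<le> card I" "orthonormal dB s e" "\<And>i k. i \<in> I \<Longrightarrow> k < dB \<Longrightarrow> a i k = (\<Sum>j<s. ip dB (e j) (a i) * e j k)"
    using gram_schmidt_span[OF finI(1), of dB a] by blast
  let ?P = "perp dB s e"
  have PL: "?P (\<lambda>k. L k m) k = 0" if "k < dB" for k m
  proof -
    have pc: "perp dB s e y k = perp dB s e y' k" if "\<And>k. k < dB \<Longrightarrow> y k = y' k" "k < dB" for y y' k
      using that ip_cong[of dB "e _" "e _" y y'] by (simp add: perp_def)
    have "?P (\<lambda>k. L k m) k = ?P (\<lambda>k. \<Sum>i\<in>I. (\<Sum>j<?n. cnj (v i j) * W j m) * a i k) k"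
      by (rule pc) (use L_span that in auto)
    also have "\<dots> = (\<Sum>i\<in>I. (\<Sum>j<?n. cnj (v i j) * W j m) * ?P (a i) k)" by (rule perp_sum)
    also have "\<dots> = 0" using se(3) that by (intro sum.neutral ballI) (simp add: perp_def)
    finally show ?thesis .
  qed
  \<comment> \<open>The projection kills the low-rank part \<open>L\<close>, so the weight of the
    output outside the span is only the Frobenius error.\<close>
  define PK where "PK = (\<Sum>m<?n. nsq dB (?P (\<lambda>k. K k m)))"
  have PK: "PK \<le> fro dB ?n (kmap dA dB (\<lambda>p m. amp p m - B p m) x)"
    unfolding PK_def fro_columns
  proof (rule sum_mono)
    fix m
    have "nsq dB (?P (\<lambda>k. K k m)) = nsq dB (?P (\<lambda>k. K k m - L k m))"
      unfolding nsq_def by (intro sum.cong refl) (simp add: perp_diff PL)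
    also have "\<dots> \<le> nsq dB (\<lambda>k. K k m - L k m)" by (rule nsq_perp_le[OF se(2)])
    finally show "nsq dB (?P (\<lambda>k. K k m)) \<le> nsq dB (\<lambda>i. kmap dA dB (\<lambda>p m. amp p m - B p m) x i m)"
      by (simp add: kmap_diff K_def L_def)
  qed
  let ?\<tau> = "chan_mix dA dB tau"
  let ?S = "\<lambda>i m. msqrt dB ?\<tau> $$ (i,m)"
  define PS where "PS = (\<Sum>m<dB. nsq dB (?P (\<lambda>k. ?S k m)))"
  have PS: "PS \<le> 5 * \<epsilon>\<^sup>2 + \<delta>"
  proof -
    have c: "?\<tau> - chan dA dB tau x \<in> carrier_mat dB dB" by (rule minus_carrier_mat) simp
    have 1: "(\<Sum>i<dB. \<Sum>j<dB. chan dA dB tau x $$ (i,j) * perp_mat s e j i) = of_real PK"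
      unfolding PK_def K_def by (rule gram_trace_perp[OF se(2)]) (rule chan_gram[OF tau_gram])
    have 2: "(\<Sum>i<dB. \<Sum>j<dB. ?\<tau> $$ (i,j) * perp_mat s e j i) = of_real PS"
      unfolding PS_def by (rule gram_trace_perp[OF se(2)]) (rule msqrt_gram[OF psd_chan_mix])
    have "(\<Sum>i<dB. \<Sum>j<dB. (?\<tau> - chan dA dB tau x) $$ (i,j) * perp_mat s e j i) = of_real (PS - PK)"
    proof -
      have "(\<Sum>i<dB. \<Sum>j<dB. (?\<tau> - chan dA dB tau x) $$ (i,j) * perp_mat s e j i)
        = (\<Sum>i<dB. \<Sum>j<dB. ?\<tau> $$ (i,j) * perp_mat s e j i - chan dA dB tau x $$ (i,j) * perp_mat s e j i)"
        by (intro sum.cong refl) (simp add: carrier_matD[OF chan_carrier(1)] left_diff_distrib)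
      then show ?thesis unfolding sum_subtractf 1 2 by simp
    qed
    then have "\<bar>PS - PK\<bar> \<le> tnorm (?\<tau> - chan dA dB tau x)"
      using tnorm_ge[OF c contraction_perp_mat[OF se(2)]] by (simp only: norm_of_real)
    also have "\<dots> = tnorm (chan dA dB tau x - ?\<tau>)" by (rule tnorm_diff_commute[where n = dB]) simp_all
    finally show ?thesis using PK x by linarith
  qed
  \<comment> \<open>Uhlmann duality between the mean output and \<rho>. Moving the contraction, as
    its adjoint, to the mean output keeps the root of \<rho> intact, whose Frobenius norm and form
    are the known quantities.\<close>
  obtain V where V: "contraction dB V"
    "(\<Sum>i<dB. \<Sum>m<dB. cnj (?S i m) * (\<Sum>k<dB. msqrt dB \<rho> $$ (i,k) * V k m)) = of_real (fid ?\<tau> \<rho>)"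
    using fid_attained[OF psd_chan_mix p\<rho>(1)] by blast
  let ?R = "\<lambda>i m. msqrt dB \<rho> $$ (i,m)"
  define SV where "SV i m = (\<Sum>j<dB. ?S i j * cnj (V m j))" for i m
  have fSV: "fro dB dB SV \<le> 1"
    using fro_contraction_right[OF contraction_adj[OF V(1)], of dB ?S] fro_msqrt[OF psd_chan_mix] tr_chan_mix
    unfolding SV_def[abs_def] by simp
  have "(\<Sum>i<dB. \<Sum>m<dB. cnj (?R i m) * SV i m) = cnj (of_real (fid ?\<tau> \<rho>))"
  proof -
    have "cnj (of_real (fid ?\<tau> \<rho>)) = (\<Sum>i<dB. \<Sum>m<dB. \<Sum>k<dB. cnj (?R i k) * (?S i m * cnj (V k m)))"
      unfolding V(2)[symmetric] by (simp add: cnj_sum sum_distrib_left ac_simps)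
    also have "\<dots> = (\<Sum>i<dB. \<Sum>k<dB. \<Sum>m<dB. cnj (?R i k) * (?S i m * cnj (V k m)))"
      by (rule sum.cong[OF refl], rule sum.swap)
    finally show ?thesis by (simp only: SV_def sum_distrib_left)
  qed
  then have "fro dB dB (\<lambda>i m. ?R i m - SV i m) = Re (tr \<rho>) + fro dB dB SV - 2 * fid ?\<tau> \<rho>"
    unfolding fro_add_diff(1) fro_msqrt[OF p\<rho>(1)] by simp
  then have e2: "fro dB dB (\<lambda>i m. ?R i m - SV i m) \<le> 2 * \<epsilon>\<^sup>2" and trR: "Re (tr \<rho>) \<ge> 1 - 2 * \<epsilon>\<^sup>2"
    using F2 p\<rho>(2) fSV fro_nonneg[of dB dB "\<lambda>i m. ?R i m - SV i m"] by linarith+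
  have PSV: "(\<Sum>m<dB. nsq dB (?P (\<lambda>k. SV k m))) \<le> PS"
  proof -
    have "?P (\<lambda>k. SV k m) k = (\<Sum>j<dB. ?P (\<lambda>k. ?S k j) k * cnj (V m j))" for m k
    proof -
      have "(\<lambda>k. SV k m) = (\<lambda>k. \<Sum>j<dB. cnj (V m j) * ?S k j)" by (simp add: SV_def mult.commute)
      then show ?thesis using perp_sum[of dB s e "\<lambda>j. cnj (V m j)" "\<lambda>j k. ?S k j" "{..<dB}" k] by (simp add: mult.commute)
    qed
    then have "(\<Sum>m<dB. nsq dB (?P (\<lambda>k. SV k m))) = fro dB dB (\<lambda>k m. \<Sum>j<dB. ?P (\<lambda>k. ?S k j) k * cnj (V m j))"
      unfolding fro_columns nsq_def by simp
    also have "\<dots> \<le> fro dB dB (\<lambda>k j. ?P (\<lambda>k. ?S k j) k)" by (rule fro_contraction_right[OF contraction_adj[OF V(1)]])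
    also have "\<dots> = PS" unfolding fro_columns PS_def ..
    finally show ?thesis .
  qed
  have PR: "(\<Sum>m<dB. nsq dB (?P (\<lambda>k. ?R k m))) \<le> 2 * (5 * \<epsilon>\<^sup>2 + \<delta>) + 2 * (2 * \<epsilon>\<^sup>2)"
  proof -
    have "(\<Sum>m<dB. nsq dB (?P (\<lambda>k. ?R k m))) \<le> (\<Sum>m<dB. 2 * nsq dB (?P (\<lambda>k. SV k m)) + 2 * nsq dB (\<lambda>k. ?R k m - SV k m))"
    proof (rule sum_mono)
      fix m
      have "nsq dB (?P (\<lambda>k. ?R k m)) = nsq dB (\<lambda>k. ?P (\<lambda>k. SV k m) k + ?P (\<lambda>k. ?R k m - SV k m) k)"
        unfolding nsq_def by (intro sum.cong refl) (simp add: perp_diff)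
      also have "\<dots> \<le> 2 * nsq dB (?P (\<lambda>k. SV k m)) + 2 * nsq dB (?P (\<lambda>k. ?R k m - SV k m))" by (rule nsq_add_le)
      also have "\<dots> \<le> 2 * nsq dB (?P (\<lambda>k. SV k m)) + 2 * nsq dB (\<lambda>k. ?R k m - SV k m)"
        using nsq_perp_le[OF se(2)] by (intro add_left_mono mult_left_mono) auto
      finally show "nsq dB (?P (\<lambda>k. ?R k m)) \<le> 2 * nsq dB (?P (\<lambda>k. SV k m)) + 2 * nsq dB (\<lambda>k. ?R k m - SV k m)" .
    qed
    also have "\<dots> = 2 * (\<Sum>m<dB. nsq dB (?P (\<lambda>k. SV k m))) + 2 * fro dB dB (\<lambda>i m. ?R i m - SV i m)"
      by (simp add: sum.distrib sum_distrib_left fro_columns)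
    finally show ?thesis using PSV PS e2 by argo
  qed
  have "(\<Sum>m<dB. nsq dB (?P (\<lambda>k. ?R k m))) = Re (tr \<rho>) - (\<Sum>j<s. \<Sum>m<dB. (cmod (ip dB (e j) (\<lambda>k. ?R k m)))\<^sup>2)"
    unfolding nsq_perp[OF se(2)] sum_subtractf fro_columns[symmetric] fro_msqrt[OF p\<rho>(1)]
    by (simp only: sum.swap[of _ "{..<dB}" "{..<s}"])
  \<comment> \<open>Each direction of the span carries at most \<open>lm\<close>, and there are at
    most \<open>card I\<close> of them.\<close>
  moreover have "(\<Sum>j<s. \<Sum>m<dB. (cmod (ip dB (e j) (\<lambda>k. ?R k m)))\<^sup>2) < 1 - \<eta>\<^sup>2"
  proof -
    have "(\<Sum>m<dB. (cmod (ip dB (e j) (\<lambda>k. ?R k m)))\<^sup>2) \<le> lm" if "j < s" for j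
    proof -
      have "(\<Sum>m<dB. (cmod (ip dB (e j) (\<lambda>k. ?R k m)))\<^sup>2) = (\<Sum>m<dB. (cmod (\<Sum>p<dB. cnj (?R p m) * e j p))\<^sup>2)"
      proof (intro sum.cong refl arg_cong[where f = "\<lambda>z. z\<^sup>2"])
        fix m
        have "(\<Sum>p<dB. cnj (?R p m) * e j p) = cnj (ip dB (e j) (\<lambda>k. ?R k m))"
          unfolding cnj_ip by (simp add: ip_def)
        then show "cmod (ip dB (e j) (\<lambda>k. ?R k m)) = cmod (\<Sum>p<dB. cnj (?R p m) * e j p)" by (simp only: complex_mod_cnj)
      qed
      also have "\<dots> = Re (ip dB (e j) (mv dB (\<lambda>i j. \<rho> $$ (i,j)) (e j)))"
        using gram_form[where M = "\<lambda>i j. \<rho> $$ (i,j)" and S = ?R and N = dB and n = dB and x = "e j"] msqrt_gram[OF p\<rho>(1)] by simp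
      also have "\<dots> \<le> lm * nsq dB (e j)" by (rule \<rho>_le)
      also have "nsq dB (e j) = 1" using se(2) that by (simp add: orthonormal_def nsq_eq_Re_ip)
      finally show ?thesis by simp
    qed
    then have "(\<Sum>j<s. \<Sum>m<dB. (cmod (ip dB (e j) (\<lambda>k. ?R k m)))\<^sup>2) \<le> (\<Sum>j<s. lm)" by (intro sum_mono) simp
    also have "\<dots> = real s * lm" by simp
    also have "\<dots> \<le> Qv\<^sup>2 * (2 / \<epsilon>\<^sup>2) * lm" using se(1) I(1) lm by (intro mult_right_mono) auto
    also have "\<dots> < 1 - \<eta>\<^sup>2" using Q unfolding trQ .
    finally show ?thesis .
  qed
  ultimately have lt: "\<eta>\<^sup>2 < 16 * \<epsilon>\<^sup>2 + 2 * \<delta>" using PR trR by argo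
  have "\<eta>\<^sup>2 = 2 * \<delta> + 16 * \<epsilon>\<^sup>2 + 8 * sqrt (2 * \<delta>) * \<epsilon>"
    using \<delta> unfolding \<eta> by (simp add: power2_eq_square algebra_simps)
  moreover have "8 * sqrt (2 * \<delta>) * \<epsilon> > 0" using \<delta> \<epsilon> by simp
  ultimately show False using lt by linarith
qed

end

section \<open>Unconditional entropies and conclusion of the converse\<close>

lemma density_one:
  assumes "Defs.density 1 s" shows "kron (1\<^sub>m n) s = 1\<^sub>m n"
proof -
  have c: "s \<in> carrier_mat 1 1" using assms psd_carrier by (auto simp: density_def)
  then have "s $$ (0,0) = 1" using assms by (simp add: density_def tr_def)
  then show ?thesis using c by (intro eq_matI) (auto simp: kron_def)
qed

lemma psd_one: "psd n (1\<^sub>m n)"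
proof (rule psdI)
  show "ip n x (mv n (\<lambda>i j. 1\<^sub>m n $$ (i,j)) x) = of_real (nsq n x)" for x
  proof -
    have "mv n (\<lambda>i j. 1\<^sub>m n $$ (i,j)) x i = x i" if "i < n" for i
    proof -
      have "mv n (\<lambda>i j. 1\<^sub>m n $$ (i,j)) x i = (\<Sum>j<n. if j = i then x j else 0)"
        unfolding mv_def by (intro sum.cong) (use that in auto)
      then show ?thesis using that by simp
    qed
    then have "ip n x (mv n (\<lambda>i j. 1\<^sub>m n $$ (i,j)) x) = ip n x x" by (intro ip_cong) auto
    then show ?thesis by (simp add: ip_self)
  qed
qed auto

lemma msqrt_unique: "psd n S \<Longrightarrow> msqrt n (S * S) = S"
  unfolding msqrt_def by (rule the_equality) (auto intro: psd_sqrt_unique)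

lemma fid_one:
  assumes "psd n \<sigma>"
  shows "fid \<sigma> (1\<^sub>m n) = Re (tr (msqrt n \<sigma>))"
proof -
  let ?S = "msqrt n \<sigma>"
  have p: "psd n ?S" by (rule msqrt_psd[OF assms])
  have c: "?S \<in> carrier_mat n n" by (rule psd_carrier[OF p])
  have one: "msqrt n (1\<^sub>m n) = (1\<^sub>m n :: complex mat)" using msqrt_unique[OF psd_one, of n] by simp
  have "adj ?S = ?S"
  proof (rule eq_matI)
    fix i j assume "i < dim_row ?S" "j < dim_col ?S"
    then have ij: "i < n" "j < n" using c by auto
    show "adj ?S $$ (i,j) = ?S $$ (i,j)"
      unfolding adj_entry[OF c ij] by (rule psd_hermitian[OF p ij(2,1), symmetric])
  qed (use c in \<open>auto simp: adj_def\<close>)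
  then have "tnorm ?S = Re (tr ?S)" using c msqrt_unique[OF p] by (simp add: tnorm_def)
  then show ?thesis using psd_carrier[OF assms] c by (simp add: fid_def one)
qed

text \<open>The trivial system has a single density operator, so the supremum collapses; what
  remains is the Renyi entropy of order 1/2.\<close>

lemma Hmax_c_one:
  assumes "psd n \<sigma>"
  shows "Hmax_c n 1 \<sigma> = (let F = Re (tr (msqrt n \<sigma>)) in if F = 0 then -\<infinity> else ereal (log 2 (F\<^sup>2)))"
proof -
  have ne: "Defs.density 1 (1\<^sub>m 1)" using psd_one[of 1] by (simp add: density_def tr_def)
  have "(SUP s \<in> {s. Defs.density 1 s}. (let F = fid \<sigma> (kron (1\<^sub>m n) s) in if F = 0 then -\<infinity> else ereal (log 2 (F\<^sup>2))))
    = (SUP s \<in> {s. Defs.density 1 s}. (let F = Re (tr (msqrt n \<sigma>)) in if F = 0 then -\<infinity> else ereal (log 2 (F\<^sup>2))))"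
    by (intro SUP_cong refl) (auto simp: density_one fid_one[OF assms])
  then show ?thesis unfolding Hmax_c_def using ne by (subst (asm) SUP_const) auto
qed

text \<open>All logarithms are undone at once here; \<open>F = 0\<close> encodes the entropy
  \<open>-\<infinity>\<close>, for which the conclusion is immediate.\<close>

lemma entropy_gap:
  fixes F :: real
  assumes "(if F = 0 then -\<infinity> else ereal (log 2 (F\<^sup>2))) + ereal (log 2 (1 / a)) + ereal (log 2 (2 / \<epsilon>\<^sup>2)) < ereal l"
    and a: "a > 0" and \<epsilon>: "\<epsilon> > 0"
  shows "F\<^sup>2 * (2 / \<epsilon>\<^sup>2) * 2 powr (- l) < a"
proof (cases "F = 0")
  case False
  have pos: "F\<^sup>2 > 0" "1 / a > 0" "2 / \<epsilon>\<^sup>2 > 0" using False a \<epsilon> by auto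
  have "log 2 (F\<^sup>2) + log 2 (1 / a) + log 2 (2 / \<epsilon>\<^sup>2) < l" using assms(1) False by simp
  then have "log 2 (F\<^sup>2 * (1 / a) * (2 / \<epsilon>\<^sup>2)) < l"
    by (simp only: log_mult_pos pos mult_pos_pos)
  then have "F\<^sup>2 * (1 / a) * (2 / \<epsilon>\<^sup>2) < 2 powr l"
    using log_less_iff[of 2 "F\<^sup>2 * (1 / a) * (2 / \<epsilon>\<^sup>2)" l] pos by (simp only: mult_pos_pos)
  moreover have "F\<^sup>2 * (1 / a) * (2 / \<epsilon>\<^sup>2) = (F\<^sup>2 * (2 / \<epsilon>\<^sup>2)) / a" by simp
  ultimately have "F\<^sup>2 * (2 / \<epsilon>\<^sup>2) / a < 2 powr l" by (simp only:)
  then have "F\<^sup>2 * (2 / \<epsilon>\<^sup>2) < a * 2 powr l"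
    unfolding pos_divide_less_eq[OF a] by (simp only: mult.commute)
  then have "F\<^sup>2 * (2 / \<epsilon>\<^sup>2) / 2 powr l < a" by (subst pos_divide_less_eq) simp_all
  then show ?thesis unfolding powr_minus divide_inverse[of _ "2 powr l"] .
qed (use a in simp)

context haar_channel begin

theorem converse:
  assumes \<epsilon>: "\<epsilon> > 0" and \<delta>: "\<delta> > 0" and lt1: "sqrt (2 * \<delta>) + 4 * \<epsilon> < 1"
    and H: "Hmax_s1 \<epsilon> (dA * dB) (choi dA dB T)
        + ereal (log 2 (1 / (1 - (sqrt (2 * \<delta>) + 4 * \<epsilon>)\<^sup>2)))
        + ereal (log 2 (2 / \<epsilon>\<^sup>2))
        < Hmin_s1 \<epsilon> dB (ptr1 dA dB (choi dA dB T))"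
    and \<omega>: "Defs.density dB \<omega>" "(\<integral>\<phi>. tnorm (T (proj dA \<phi>) - \<omega>) \<partial>\<mu>) \<le> \<delta> / 2"
  shows False
proof -
  define \<eta> where "\<eta> = sqrt (2 * \<delta>) + 4 * \<epsilon>"
  define a where "a = 1 - \<eta>\<^sup>2"
  have \<eta>: "0 \<le> \<eta>" "\<eta> < 1" using \<delta> \<epsilon> lt1 by (auto simp: \<eta>_def)
  then have a: "a > 0" unfolding a_def using power_strict_mono[of \<eta> 1 2] by simp
  let ?c1 = "log 2 (1 / a)" and ?c2 = "log 2 (2 / \<epsilon>\<^sup>2)"
  let ?\<tau> = "choi dA dB T"
  have H': "Hmax_s1 \<epsilon> (dA*dB) ?\<tau> + ereal ?c1 + ereal ?c2 < Hmin_s1 \<epsilon> dB (ptr1 dA dB ?\<tau>)"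
    using H unfolding a_def \<eta>_def .
  \<comment> \<open>Strictness of the gap yields witnesses in turn: a state \<rho>, an admissible
    \<open>l\<close> for it, and a state \<sigma>.\<close>
  obtain \<rho> where \<rho>: "subnormalized dB \<rho>" "pdist (chan_mix dA dB tau) \<rho> \<le> \<epsilon>"
    and l\<rho>: "Hmax_s1 \<epsilon> (dA*dB) ?\<tau> + ereal ?c1 + ereal ?c2 < Hmin_c dB 1 \<rho>"
    using H' unfolding Hmin_s1_def Hmin_s_def less_SUP_iff ptr1_choi by auto
  obtain s l where s: "Defs.density 1 s"
      "loewner_ge (dB*1) (complex_of_real (2 powr (-l)) \<cdot>\<^sub>m kron (1\<^sub>m dB) s) \<rho>"
    and l: "Hmax_s1 \<epsilon> (dA*dB) ?\<tau> + ereal ?c1 + ereal ?c2 < ereal l"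
    using l\<rho> unfolding Hmin_c_def less_SUP_iff less_Sup_iff by (elim bexE) (auto simp: less_SUP_iff less_Sup_iff)
  \<comment> \<open>The two finite constants are moved to the other side so that the infimum stands
    alone.\<close>
  have "Hmax_s1 \<epsilon> (dA*dB) ?\<tau> < ereal (l - ?c1 - ?c2)"
    using l by (cases "Hmax_s1 \<epsilon> (dA*dB) ?\<tau>") auto
  then obtain \<sigma> where \<sigma>: "subnormalized (dA*dB) \<sigma>" "pdist ?\<tau> \<sigma> \<le> \<epsilon>" "Hmax_c (dA*dB) 1 \<sigma> < ereal (l - ?c1 - ?c2)"
    unfolding Hmax_s1_def Hmax_s_def INF_less_iff by auto
  have p: "psd (dA*dB) \<sigma>" using \<sigma>(1) by (simp add: subnormalized_def)
  let ?F = "Re (tr (msqrt (dA*dB) \<sigma>))"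
  have "(if ?F = 0 then -\<infinity> else ereal (log 2 (?F\<^sup>2))) + ereal ?c1 + ereal ?c2 < ereal l"
    using \<sigma>(3) unfolding Hmax_c_one[OF p] by (auto simp: Let_def split: if_splits)
  from entropy_gap[OF this a \<epsilon>] have gap: "?F\<^sup>2 * (2 / \<epsilon>\<^sup>2) * 2 powr (- l) < 1 - \<eta>\<^sup>2" by (simp add: a_def)
  have le: "Re (ip dB x (mv dB (\<lambda>i j. \<rho> $$ (i,j)) x)) \<le> 2 powr (-l) * nsq dB x" for x
  proof -
    have "Re (ip dB x (mv dB (\<lambda>i j. \<rho> $$ (i,j)) x)) \<le> Re (ip dB x (mv dB (\<lambda>i j. (complex_of_real (2 powr (-l)) \<cdot>\<^sub>m 1\<^sub>m dB) $$ (i,j)) x))"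
      using loewner_geD[OF s(2), of x] unfolding density_one[OF s(1)] by simp
    also have "\<dots> = 2 powr (-l) * Re (ip dB x (mv dB (\<lambda>i j. 1\<^sub>m dB $$ (i,j)) x))"
      by (subst ip_mv_smult) auto
    also have "ip dB x (mv dB (\<lambda>i j. 1\<^sub>m dB $$ (i,j)) x) = ip dB x x"
    proof (rule ip_cong)
      fix i assume "i < dB"
      then have "mv dB (\<lambda>i j. 1\<^sub>m dB $$ (i,j)) x i = (\<Sum>j<dB. if j = i then x j else 0)"
        unfolding mv_def by (intro sum.cong) auto
      then show "mv dB (\<lambda>i j. 1\<^sub>m dB $$ (i,j)) x i = x i" using \<open>i < dB\<close> by simp
    qed simp
    finally show ?thesis by (simp add: ip_self)
  qed
  have "\<omega> \<in> carrier_mat dB dB" using \<omega>(1) psd_carrier by (auto simp: density_def)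
  from converse_core[OF \<epsilon> \<delta> \<sigma>(1,2) \<rho>(1,2) le _ gap \<eta>_def this \<omega>(2)] show False by simp
qed

theorem tail_bound:
  assumes \<epsilon>: "\<epsilon> > 0" and \<delta>: "\<delta> > 0"
  shows "measure \<mu> {\<phi> \<in> space \<mu>. ereal (dev \<phi>)
      \<ge> pow2_neg_half (Hmin_s \<epsilon> dA dB (choi dA dB T)) + ereal (6 * \<epsilon>) + ereal \<delta>} \<le> 2 * exp (- (real dA * \<delta>\<^sup>2 / 16))"
proof -
  let ?H = "pow2_neg_half (Hmin_s \<epsilon> dA dB (choi dA dB T)) + ereal (6 * \<epsilon>)"
  have [measurable]: "dev \<in> borel_measurable borel" unfolding dev_chan by (rule measurable_tnorm_chan) simp
  \<comment> \<open>The mean lies below the entropic bound, so the event is contained in an upper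
    deviation from the mean.\<close>
  have "measure \<mu> {\<phi> \<in> space \<mu>. ereal (dev \<phi>) \<ge> ?H + ereal \<delta>} \<le> measure \<mu> {u. dev u \<ge> (\<integral>u. dev u \<partial>\<mu>) + \<delta>}"
  proof (rule finite_measure_mono)
    show "{\<phi> \<in> space \<mu>. ereal (dev \<phi>) \<ge> ?H + ereal \<delta>} \<subseteq> {u. dev u \<ge> (\<integral>u. dev u \<partial>\<mu>) + \<delta>}"
    proof clarify
      fix u assume "?H + ereal \<delta> \<le> ereal (dev u)"
      moreover have "ereal (\<integral>u. dev u \<partial>\<mu>) + ereal \<delta> \<le> ?H + ereal \<delta>"
        by (rule add_right_mono) (rule expectation_bound[OF \<epsilon>])
      ultimately have "ereal (\<integral>u. dev u \<partial>\<mu>) + ereal \<delta> \<le> ereal (dev u)" by (rule order_trans[rotated])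
      then show "(\<integral>u. dev u \<partial>\<mu>) + \<delta> \<le> dev u" by simp
    qed
    show "{u. dev u \<ge> (\<integral>u. dev u \<partial>\<mu>) + \<delta>} \<in> sets \<mu>" by (simp add: sets_mu)
  qed
  also have "\<dots> \<le> exp (- (real dA * \<delta>\<^sup>2 / 16))" by (rule dev_concentration[OF \<delta>])
  also have "\<dots> \<le> 2 * exp (- (real dA * \<delta>\<^sup>2 / 16))" by simp
  finally show ?thesis .
qed

end

lemma haar_channelI: "0 < dA \<Longrightarrow> 0 < dB \<Longrightarrow> cptp dA dB T \<Longrightarrow> haar_sphere dA \<mu> \<Longrightarrow> haar_channel dA dB T \<mu>"
  by (simp add: haar_channel_def channel_def haar_def)

theorem theorem1:
  shows
  "(\<exists>C :: real. \<forall>(dA::nat) (dB::nat) T \<mu> (\<epsilon>::real).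
      0 < dA \<longrightarrow> 0 < dB \<longrightarrow> cptp dA dB T \<longrightarrow> haar_sphere dA \<mu> \<longrightarrow> 0 < \<epsilon> \<longrightarrow>
      ereal (\<integral>\<phi>. tnorm (T (proj dA \<phi>) - T (max_mixed dA)) \<partial>\<mu>)
          \<le> pow2_neg_half (Hmin_s \<epsilon> dA dB (choi dA dB T)) + ereal (C * \<epsilon>)
      \<and> (\<forall>\<delta>::real. 0 < \<delta> \<longrightarrow>
           measure \<mu> {\<phi> \<in> space \<mu>.
              ereal (tnorm (T (proj dA \<phi>) - T (max_mixed dA)))
                \<ge> pow2_neg_half (Hmin_s \<epsilon> dA dB (choi dA dB T)) + ereal (C * \<epsilon>) + ereal \<delta>}
             \<le> 2 * exp (- (real dA * \<delta>\<^sup>2 / 16))))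
   \<and>
   (\<forall>(dA::nat) (dB::nat) T \<mu> (\<epsilon>::real) (\<delta>::real).
      0 < dA \<longrightarrow> 0 < dB \<longrightarrow> cptp dA dB T \<longrightarrow> haar_sphere dA \<mu> \<longrightarrow>
      0 < \<epsilon> \<longrightarrow> 0 < \<delta> \<longrightarrow> sqrt (2 * \<delta>) + 4 * \<epsilon> < 1 \<longrightarrow>
      Hmax_s1 \<epsilon> (dA * dB) (choi dA dB T)
        + ereal (log 2 (1 / (1 - (sqrt (2 * \<delta>) + 4 * \<epsilon>)\<^sup>2)))
        + ereal (log 2 (2 / \<epsilon>\<^sup>2))
        < Hmin_s1 \<epsilon> dB (ptr1 dA dB (choi dA dB T)) \<longrightarrow>
      \<not> (\<exists>\<omega>. density dB \<omega> \<and>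
            (\<integral>\<phi>. tnorm (T (proj dA \<phi>) - \<omega>) \<partial>\<mu>) \<le> \<delta> / 2))"
proof (intro conjI exI[of _ 6] allI impI notI)
  fix dA dB :: nat and T \<mu> and \<epsilon> :: real
  assume "0 < dA" "0 < dB" "cptp dA dB T" "haar_sphere dA \<mu>" and \<epsilon>: "0 < \<epsilon>"
  then interpret haar_channel dA dB T \<mu> by (intro haar_channelI)
  show "ereal (\<integral>\<phi>. tnorm (T (proj dA \<phi>) - T (max_mixed dA)) \<partial>\<mu>)
      \<le> pow2_neg_half (Hmin_s \<epsilon> dA dB (choi dA dB T)) + ereal (6 * \<epsilon>)"
    by (rule expectation_bound[OF \<epsilon>])
  fix \<delta> :: real assume "0 < \<delta>"
  then show "measure \<mu> {\<phi> \<in> space \<mu>. ereal (tnorm (T (proj dA \<phi>) - T (max_mixed dA)))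
      \<ge> pow2_neg_half (Hmin_s \<epsilon> dA dB (choi dA dB T)) + ereal (6 * \<epsilon>) + ereal \<delta>}
      \<le> 2 * exp (- (real dA * \<delta>\<^sup>2 / 16))"
    by (rule tail_bound[OF \<epsilon>])
next
  fix dA dB :: nat and T \<mu> and \<epsilon> \<delta> :: real
  assume "0 < dA" "0 < dB" "cptp dA dB T" "haar_sphere dA \<mu>" and *: "0 < \<epsilon>" "0 < \<delta>" "sqrt (2 * \<delta>) + 4 * \<epsilon> < 1"
    "Hmax_s1 \<epsilon> (dA * dB) (choi dA dB T)
        + ereal (log 2 (1 / (1 - (sqrt (2 * \<delta>) + 4 * \<epsilon>)\<^sup>2)))
        + ereal (log 2 (2 / \<epsilon>\<^sup>2))
        < Hmin_s1 \<epsilon> dB (ptr1 dA dB (choi dA dB T))"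
    and "\<exists>\<omega>. density dB \<omega> \<and> (\<integral>\<phi>. tnorm (T (proj dA \<phi>) - \<omega>) \<partial>\<mu>) \<le> \<delta> / 2"
  then interpret haar_channel dA dB T \<mu> by (intro haar_channelI)
  show False using converse[OF *] \<open>\<exists>\<omega>. _\<close> by blast
qed

end
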